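(* Let $\alpha,\theta,\sigma>0$, $\gamma\in(0,1/4)$, and let $X$ be the mild solution of $\partial_tX_t(x)=-\theta(-\Delta)^{\alpha/2}X_t(x)+\sigma\dot W^\gamma(t,x)$, $t>0$, $x\in\mathbb{R}$, $X_0=0$. Let $m\in\mathbb{N}_0$ and $0<H<1$ be such that $m+H=s^*=2\gamma+\alpha/2-1/2$. Let $M,q\in\mathbb{N}$ and assume that either $M=m+1$ with $H<1/2$, or $M\ge m+2$. Fix $t>0$ and $a<b$, and let $V_{q,M,s^*,N}(X_t)$ be computed from the function $x\mapsto X_t(x)$ on $[a,b]$. Then, as $N\to\infty$, $$\sqrt N\left(V_{q,M,s^*,N}(X_t)-c_{\alpha,\gamma,m}^q\tau_q\mu_{M,s^*}^{q/2}\left(\frac{\sigma}{\sqrt\theta}\right)^q\right)\xrightarrow{d}\mathcal{N}\left(0,\,c_{\alpha,\gamma,m}^{2q}\,\sigma_{q,M,s^*}^2\,\mu_{M,s^*}^q\left(\frac{\sigma}{\sqrt\theta}\right)^{2q}\right).$$ Moreover: (i) if $\theta$ is known, then $\widetilde\sigma_N^{q,M}:=c_{\alpha,\gamma,m}^{-1}\tau_q^{-1/q}\mu_{M,s^*}^{-1/2}\sqrt\theta\,V_{q,M,s^*,N}(X_t)^{1/q}$ is an asymptotically normal estimator for $\sigma$; (ii) if $\sigma$ is known, then $\widetilde\theta_N^{q,M}:=c_{\alpha,\gamma,m}^2\tau_q^{2/q}\mu_{M,s^*}\sigma^2\,V_{q,M,s^*,N}(X_t)^{-2/q}$ is an asymptotically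 normal estimator for $\theta$.
   Context: $W^\gamma(t,A)$, $t\ge0$, $A\in\mathcal{B}(\mathbb{R})$, is a centered Gaussian field with covariance $\mathbb{E}[W^\gamma(t,A)W^\gamma(s,B)]=(t\wedge s)\int_A\int_BK_\gamma(x-y)\,dx\,dy$, where $K_\gamma$ is the Riesz kernel with Fourier transform $\int_{\mathbb{R}}e^{-ix\xi}K_\gamma(x)dx=|\xi|^{-4\gamma}$, i.e. $K_\gamma(x)=\frac{\Gamma(1/2-2\gamma)}{2^{4\gamma}\sqrt\pi\,\Gamma(2\gamma)}|x|^{4\gamma-1}$. $G_\alpha(t,x)=\frac1{2\pi}\int_{\mathbb{R}}e^{ix\xi-t|\xi|^\alpha}d\xi$ is the fundamental solution of $\partial_tG_\alpha=-(-\Delta)^{\alpha/2}G_\alpha$. The mild solution is the Wiener integral $$X_t(x)=\sigma\int_0^t\int_{\mathbb{R}}G_\alpha(\theta(t-s),x-z)\,W^\gamma(ds,dz).$$ Difference operator: $\Delta_hf(x)=f(x+h)-f(x)$, $\Delta_h^M$ its $M$-fold iterate (not to be confused with the Laplacian $\Delta$). With $h=(b-a)/N$, $x_k=a+kh$, $N>M$: $V_{q,M,s,N}(f)=\frac1{b-a}\sum_{k=0}^{N-M}h\left|\frac{\Delta_h^Mf(x_k)}{h^s}\right|^q$. Constants: $\tau_q=\mathbb{E}|Z|^q$, $Z\sim\mathcal{N}(0,1)$; $c_{\alpha,\gamma,m}>0$ with $c_{\alpha,\gamma,m}^2=(2\pi)^{-1}\int_{\mathbb{R}}(1-\cos\xi)|\xi|^{2m-4\gamma-\alpha}d\xi$.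 Let $B^H$ be a fractional Brownian motion on $\mathbb{R}$ with Hurst index $H$, $\mathbb{E}(B^H_tB^H_r)=\frac12(|t|^{2H}+|r|^{2H}-|t-r|^{2H})$, and let $J$ be the integral operator $Jf(t)=\int_0^tf(r)dr$, $J^m$ its $m$-fold iterate. For $s=m+H$, $M>m$, $\mu_{M,s}>0$ is defined by $\mathbb{E}|\Delta_h^MJ^mB^H_t|^2=\mu_{M,s}h^{2s}$ (for all $t\in\mathbb R$, $h>0$), and $\sigma_{q,M,s}>0$ is the constant for which $\sqrt N\bigl(V_{q,M,s,N}(J^mB^H)-\tau_q\mu_{M,s}^{q/2}\bigr)\xrightarrow{d}\mathcal{N}(0,\sigma_{q,M,s}^2\mu_{M,s}^q)$ as $N\to\infty$ (such a constant exists whenever $M=m+1$, $H<3/4$, or $M\ge m+2$). An estimator $\vartheta_N$ of $\vartheta$ is asymptotically normal if $\sqrt N(\vartheta_N-\vartheta)$ converges in distribution to a centered Gaussian variable. *)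

theory Defs
  imports "HOL-Probability.Probability"
begin

section \<open>Gaussian laws and Gaussian families\<close>

text \<open>The centered normal law with variance \<open>v \<ge> 0\<close>, the case \<open>v = 0\<close> being the point mass at 0.\<close>

definition normal_law :: "real \<Rightarrow> real measure" where
  "normal_law v =
     (if v = 0 then return borel 0 else density lborel (normal_density 0 (sqrt v)))"

definition centered_gaussian_family :: "'a measure \<Rightarrow> 'i set \<Rightarrow> ('i \<Rightarrow> 'a \<Rightarrow> real) \<Rightarrow> bool" where
  "centered_gaussian_family P I Y \<longleftrightarrow>
     (\<forall>S c. finite S \<and> S \<subseteq> I \<longrightarrow>
        (\<lambda>\<omega>. \<Sum>i\<in>S. c i * Y i \<omega>) \<in> borel_measurable P \<and>
        (\<exists>v\<ge>0. distr P borel (\<lambda>\<omega>. \<Sum>i\<in>S. c i * Y i \<omega>) = normal_law v))"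

definition abs_normal_moment :: "nat \<Rightarrow> real" where
  "abs_normal_moment q = (LINT z|normal_law 1. \<bar>z\<bar> ^ q)"

definition asymptotically_normal :: "'a measure \<Rightarrow> (nat \<Rightarrow> 'a \<Rightarrow> real) \<Rightarrow> real \<Rightarrow> bool" where
  "asymptotically_normal P est p \<longleftrightarrow>
     (\<exists>v>0. weak_conv_m (\<lambda>N. distr P borel (\<lambda>\<omega>. sqrt (real N) * (est N \<omega> - p))) (normal_law v))"

section \<open>The noise, the Wiener integral and the mild solution\<close>

definition riesz_kernel :: "real \<Rightarrow> real \<Rightarrow> real" where
  "riesz_kernel \<gamma> x =
     Gamma (1/2 - 2*\<gamma>) / (2 powr (4*\<gamma>) * sqrt pi * Gamma (2*\<gamma>)) * \<bar>x\<bar> powr (4*\<gamma> - 1)"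

text \<open>The field is indexed by bounded Borel sets: on unbounded sets the double integral of the
  Riesz kernel may be infinite.\<close>

definition bounded_borel :: "real set set" where
  "bounded_borel = {A. A \<in> sets borel \<and> bounded A}"

definition riesz_noise :: "'a measure \<Rightarrow> real \<Rightarrow> (real \<Rightarrow> real set \<Rightarrow> 'a \<Rightarrow> real) \<Rightarrow> bool" where
  "riesz_noise P \<gamma> W \<longleftrightarrow>
     centered_gaussian_family P ({0..} \<times> bounded_borel) (\<lambda>(t, A). W t A) \<and>
     (\<forall>t\<ge>0. \<forall>s\<ge>0. \<forall>A\<in>bounded_borel. \<forall>B\<in>bounded_borel.
        (LINT \<omega>|P. W t A \<omega> * W s B \<omega>) =
          min t s * (LINT x:A|lborel. (LINT y:B|lborel. riesz_kernel \<gamma> (x - y))))"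

text \<open>An entry \<open>(c, s, u, A)\<close> of a list stands for the function
  \<open>c \<cdot> 1\<close> on \<open>(s, u] \<times> A\<close>, and the list for the sum of its entries.\<close>

type_synonym simple_fn = "(real \<times> real \<times> real \<times> real set) list"

definition is_simple :: "simple_fn \<Rightarrow> bool" where
  "is_simple \<phi> \<longleftrightarrow> (\<forall>(c, s, u, A)\<in>set \<phi>. 0 \<le> s \<and> s \<le> u \<and> A \<in> bounded_borel)"

definition simple_eval :: "simple_fn \<Rightarrow> real \<Rightarrow> real \<Rightarrow> real" where
  "simple_eval \<phi> r z = (\<Sum>(c, s, u, A)\<leftarrow>\<phi>. c * indicator {s<..u} r * indicator A z)"

definition simple_integral :: "(real \<Rightarrow> real set \<Rightarrow> 'a \<Rightarrow> real) \<Rightarrow> simple_fn \<Rightarrow> 'a \<Rightarrow> real" where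
  "simple_integral W \<phi> \<omega> = (\<Sum>(c, s, u, A)\<leftarrow>\<phi>. c * (W u A \<omega> - W s A \<omega>))"

text \<open>The squared norm \<open>\<integral>\<^sub>0\<^sup>\<infinity> \<integral> \<integral> f(s,x) f(s,y) K(x - y) dx dy ds\<close>
  of the Hilbert space attached to the noise; for a simple function it is the second moment of
  its integral. It is used for functions with absolutely convergent triple integral.\<close>

definition noise_admissible :: "real \<Rightarrow> (real \<Rightarrow> real \<Rightarrow> real) \<Rightarrow> bool" where
  "noise_admissible \<gamma> f \<longleftrightarrow>
     (\<lambda>(s, x). f s x) \<in> borel_measurable borel \<and>
     integrable lborel
       (\<lambda>(s, x, y). indicator {0..} s * (\<bar>f s x\<bar> * \<bar>f s y\<bar> * riesz_kernel \<gamma> (x - y)))"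

definition noise_norm2 :: "real \<Rightarrow> (real \<Rightarrow> real \<Rightarrow> real) \<Rightarrow> real" where
  "noise_norm2 \<gamma> f =
     (LINT (s, x, y)|lborel. indicator {0..} s * (f s x * f s y * riesz_kernel \<gamma> (x - y)))"

text \<open>\<open>I\<close> is a version of the Wiener integral of the deterministic \<open>f\<close>: the mean-square limit
  of the integrals of simple functions converging to \<open>f\<close> in the above norm.\<close>

definition is_wiener_integral ::
  "'a measure \<Rightarrow> real \<Rightarrow> (real \<Rightarrow> real set \<Rightarrow> 'a \<Rightarrow> real) \<Rightarrow> (real \<Rightarrow> real \<Rightarrow> real) \<Rightarrow> ('a \<Rightarrow> real) \<Rightarrow> bool"
where
  "is_wiener_integral P \<gamma> W f I \<longleftrightarrow>
     noise_admissible \<gamma> f \<and>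
     I \<in> borel_measurable P \<and> integrable P (\<lambda>\<omega>. (I \<omega>)\<^sup>2) \<and>
     (\<exists>\<phi>. (\<forall>n. is_simple (\<phi> n)) \<and>
        (\<lambda>n. noise_norm2 \<gamma> (\<lambda>s z. f s z - simple_eval (\<phi> n) s z)) \<longlonglongrightarrow> 0 \<and>
        (\<lambda>n. LINT \<omega>|P. (I \<omega> - simple_integral W (\<phi> n) \<omega>)\<^sup>2) \<longlonglongrightarrow> 0)"

text \<open>The integral is real-valued, hence the real part is only a change of type.\<close>

definition fund_sol :: "real \<Rightarrow> real \<Rightarrow> real \<Rightarrow> real" where
  "fund_sol \<alpha> t x =
     1 / (2*pi) * Re (LINT \<xi>|lborel. exp (\<i> * of_real (x * \<xi>) - of_real (t * \<bar>\<xi>\<bar> powr \<alpha>)))"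

definition mild_solution ::
  "'a measure \<Rightarrow> real \<Rightarrow> real \<Rightarrow> real \<Rightarrow> real \<Rightarrow> (real \<Rightarrow> real set \<Rightarrow> 'a \<Rightarrow> real) \<Rightarrow>
   (real \<Rightarrow> real \<Rightarrow> 'a \<Rightarrow> real) \<Rightarrow> bool"
where
  "mild_solution P \<alpha> \<theta> \<sigma> \<gamma> W X \<longleftrightarrow>
     (\<forall>t\<ge>0. \<forall>x. \<exists>I.
        is_wiener_integral P \<gamma> W
          (\<lambda>s z. indicator {0..t} s * fund_sol \<alpha> (\<theta> * (t - s)) (x - z)) I \<and>
        (\<forall>\<omega>\<in>space P. X t x \<omega> = \<sigma> * I \<omega>))"

section \<open>Power variations\<close>

definition fwd_diff :: "real \<Rightarrow> (real \<Rightarrow> real) \<Rightarrow> real \<Rightarrow> real" where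
  "fwd_diff h f x = f (x + h) - f x"

definition power_variation ::
  "real \<Rightarrow> real \<Rightarrow> nat \<Rightarrow> nat \<Rightarrow> real \<Rightarrow> nat \<Rightarrow> (real \<Rightarrow> real) \<Rightarrow> real" where
  "power_variation a b q M s N f =
     (let h = (b - a) / real N in
      1 / (b - a) * (\<Sum>k=0..N - M. h * \<bar>(fwd_diff h ^^ M) f (a + real k * h) / h powr s\<bar> ^ q))"

section \<open>Fractional Brownian motion and the constants\<close>

text \<open>All paths are continuous, so that they can be integrated.\<close>

definition fractional_bm :: "'b measure \<Rightarrow> real \<Rightarrow> (real \<Rightarrow> 'b \<Rightarrow> real) \<Rightarrow> bool" where
  "fractional_bm Q H B \<longleftrightarrow>
     centered_gaussian_family Q UNIV B \<and>
     (\<forall>t r. (LINT \<omega>|Q. B t \<omega> * B r \<omega>) =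
        1/2 * (\<bar>t\<bar> powr (2*H) + \<bar>r\<bar> powr (2*H) - \<bar>t - r\<bar> powr (2*H))) \<and>
     (\<forall>\<omega>\<in>space Q. continuous_on UNIV (\<lambda>t. B t \<omega>))"

text \<open>The interval integral is oriented, so this is also the right operator for \<open>t < 0\<close>.\<close>

definition int_op :: "(real \<Rightarrow> real) \<Rightarrow> real \<Rightarrow> real" where
  "int_op f t = (LBINT r=ereal 0..ereal t. f r)"

definition int_fbm :: "nat \<Rightarrow> (real \<Rightarrow> 'b \<Rightarrow> real) \<Rightarrow> 'b \<Rightarrow> real \<Rightarrow> real" where
  "int_fbm m B \<omega> = (int_op ^^ m) (\<lambda>t. B t \<omega>)"

definition c_const :: "real \<Rightarrow> real \<Rightarrow> nat \<Rightarrow> real" where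
  "c_const \<alpha> \<gamma> m =
     sqrt (1 / (2*pi) * (LINT \<xi>|lborel. (1 - cos \<xi>) * \<bar>\<xi>\<bar> powr (2 * real m - 4*\<gamma> - \<alpha>)))"

text \<open>The next two predicates are the defining properties of the constants
  \<open>\<mu>\<close> and \<open>\<sigma>\<close> indexed by \<open>M\<close>, \<open>s\<close> and by \<open>q\<close>, \<open>M\<close>, \<open>s\<close>, where \<open>s = m + H\<close> and \<open>H\<close> is the Hurst
  index of \<open>B\<close>. Each determines its constant uniquely. The law of the power variation
  of the \<open>m\<close>-fold integral of \<open>B\<close> does not depend on the interval, hence neither does
  the second constant.\<close>

definition is_mu_const ::
  "'b measure \<Rightarrow> (real \<Rightarrow> 'b \<Rightarrow> real) \<Rightarrow> nat \<Rightarrow> nat \<Rightarrow> real \<Rightarrow> real \<Rightarrow> bool" where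
  "is_mu_const Q B m M s \<mu> \<longleftrightarrow>
     \<mu> > 0 \<and>
     (\<forall>t h. h > 0 \<longrightarrow>
        (LINT \<omega>|Q. \<bar>(fwd_diff h ^^ M) (int_fbm m B \<omega>) t\<bar>\<^sup>2) = \<mu> * h powr (2 * s))"

definition is_sigma_const ::
  "'b measure \<Rightarrow> (real \<Rightarrow> 'b \<Rightarrow> real) \<Rightarrow> real \<Rightarrow> real \<Rightarrow> nat \<Rightarrow> nat \<Rightarrow> nat \<Rightarrow> real \<Rightarrow> real \<Rightarrow> real \<Rightarrow> bool"
where
  "is_sigma_const Q B a b m q M s \<mu> \<kappa> \<longleftrightarrow>
     \<kappa> > 0 \<and>
     weak_conv_m
       (\<lambda>N. distr Q borel (\<lambda>\<omega>. sqrt (real N) *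
          (power_variation a b q M s N (int_fbm m B \<omega>)
             - abs_normal_moment q * \<mu> powr (real q / 2))))
       (normal_law (\<kappa>\<^sup>2 * \<mu> ^ q))"

end

theory Submission
  imports Defs
begin

text \<open>
  Both processes are studied through the quadratic forms of their \<open>M\<close>-th differences. By Plancherel,
  the increments of \<open>X t\<close> have spectral density
  \<open>\<sigma>\<^sup>2 / (4 \<pi> \<theta>) \<bar>\<xi>\<bar> powr (- 2 s - 1) (1 - exp (- 2 \<theta> t \<bar>\<xi>\<bar> powr \<alpha>))\<close>, while those of
  \<open>c \<sigma> / sqrt \<theta>\<close> times the \<open>m\<close>-fold integral of the fractional Brownian motion have the same density
  without the last factor. Hence the latter differences have the law of the former plus independent
  Gaussian variables whose variances are of order \<open>h ^ (2 * M)\<close>, the missing factor making the density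
  of the remainder integrable against every power of \<open>\<xi>\<close>. After division by \<open>h powr s\<close> the
  remainder changes the power variation by \<open>O(h powr (M - s))\<close> in mean, which is \<open>o(1 / sqrt N)\<close>
  exactly because \<open>M - s > 1/2\<close>, so the limit theorem defining \<open>\<kappa>\<close> carries over to \<open>X\<close>. The two
  estimators follow by the delta method.
\<close>

section \<open>Centered normal laws\<close>

text \<open>The covariance of the noise is given in real space by a singular kernel, while
  \<open>fund_sol\<close> is a Fourier integral with no spatial decay at hand. The bridge is to
  write the Riesz kernel as a positive mixture over \<open>(u, p)\<close> of products
  \<open>gk u p x * gk u p y\<close>. The squared seminorm of the noise becomes an integral of
  squares of Gaussian averages. Each average of \<open>fund_sol\<close> is the Fourier transform of
  a continuous integrable function, so Plancherel is needed for such functions only, and the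
  integral over \<open>u\<close> produces the factor
  \<open>\<bar>\<xi>\<bar> powr (- 4 * \<gamma>)\<close>. The same mixture gives positivity of the
  seminorm and absolute convergence of mixed terms.

  The remainder is a covariance because the factor missing from the second density is at most 1, so
  the difference of the two densities is nonnegative. A Gaussian vector with that covariance is
  built on a third space. Since a power variation depends on finitely many differences, equality of
  finite-dimensional laws and a bound between characteristic functions are enough.\<close>

lemma normal_law_eq_distr:
  assumes "v \<ge> 0"
  shows "normal_law v = distr std_normal_distribution borel (\<lambda>x. sqrt v * x)"
proof -
  interpret real_distribution std_normal_distribution by (rule real_dist_normal_dist)
  show ?thesis
  proof (cases "v = 0")
    case True
    then show ?thesis by (simp add: normal_law_def distr_const)
  next
    case False
    have "distributed std_normal_distribution lborel (\<lambda>x. x) std_normal_density"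
      unfolding distributed_def
      by (auto simp: distr_id2 intro!: distr_id2)
    then have "distributed std_normal_distribution lborel (\<lambda>x. 0 + sqrt v * x)
        (normal_density (0 + sqrt v * 0) (\<bar>sqrt v\<bar> * 1))"
      by (rule normal_density_affine) (use False in auto)
    then have "distr std_normal_distribution lborel (\<lambda>x. sqrt v * x) = density lborel (normal_density 0 (sqrt v))"
      unfolding distributed_def using assms by simp
    moreover have "distr std_normal_distribution lborel (\<lambda>x. sqrt v * x) = distr std_normal_distribution borel (\<lambda>x. sqrt v * x)"
      by (rule distr_cong) auto
    ultimately show ?thesis using False by (simp add: normal_law_def)
  qed
qed

lemma normal_law_1: "normal_law 1 = std_normal_distribution"
  by (simp add: normal_law_def)

lemma real_distribution_normal_law: "v \<ge> 0 \<Longrightarrow> real_distribution (normal_law v)"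
proof -
  assume v: "v \<ge> 0"
  interpret real_distribution std_normal_distribution by (rule real_dist_normal_dist)
  show ?thesis unfolding normal_law_eq_distr[OF v] by (rule real_distribution_distr) simp
qed

lemma char_normal_law:
  assumes "v \<ge> 0"
  shows "char (normal_law v) u = of_real (exp (- (u\<^sup>2 * v) / 2))"
proof -
  have "char (normal_law v) u = char std_normal_distribution (u * sqrt v)"
    unfolding normal_law_eq_distr[OF assms] char_def
    by (subst integral_distr) (auto simp: mult_ac)
  also have "\<dots> = of_real (exp (- (u\<^sup>2 * v) / 2))"
    using assms by (simp add: char_std_normal_distribution power_mult_distrib)
  finally show ?thesis .
qed

text \<open>The degenerate case \<open>v = 0\<close> is included, so that limits, zero combinations
  and coinciding points need no separate treatment.\<close>

definition gauss_rv :: "'a measure \<Rightarrow> ('a \<Rightarrow> real) \<Rightarrow> real \<Rightarrow> bool" where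
  "gauss_rv P Y v \<longleftrightarrow> Y \<in> borel_measurable P \<and> v \<ge> 0 \<and> distr P borel Y = normal_law v"

lemma gauss_rvD:
  assumes "gauss_rv P Y v"
  shows "Y \<in> borel_measurable P" "v \<ge> 0" "distr P borel Y = normal_law v"
  using assms by (auto simp: gauss_rv_def)

lemma gauss_rv_char:
  assumes "gauss_rv P Y v"
  shows "(LINT \<omega>|P. iexp (u * Y \<omega>)) = of_real (exp (- (u\<^sup>2 * v) / 2))"
proof -
  have "(LINT \<omega>|P. iexp (u * Y \<omega>)) = char (distr P borel Y) u"
    unfolding char_def using gauss_rvD(1)[OF assms] by (subst integral_distr) auto
  then show ?thesis using char_normal_law gauss_rvD[OF assms] by simp
qed

lemma (in prob_space) gauss_rv_charI:
  assumes [measurable]: "Y \<in> borel_measurable M" and "v \<ge> 0"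
    and char: "\<And>u. (LINT \<omega>|M. iexp (u * Y \<omega>)) = of_real (exp (- (u\<^sup>2 * v) / 2))"
  shows "gauss_rv M Y v"
proof -
  interpret D: real_distribution "distr M borel Y" by (rule real_distribution_distr) simp
  interpret N: real_distribution "normal_law v" by (rule real_distribution_normal_law) fact
  have "char (distr M borel Y) = char (normal_law v)"
  proof
    fix u
    have "char (distr M borel Y) u = (LINT \<omega>|M. iexp (u * Y \<omega>))"
      unfolding char_def by (subst integral_distr) auto
    then show "char (distr M borel Y) u = char (normal_law v) u"
      using char char_normal_law[OF \<open>v \<ge> 0\<close>] by simp
  qed
  then have "distr M borel Y = normal_law v"
    by (intro Levy_uniqueness) unfold_locales
  then show ?thesis using assms by (simp add: gauss_rv_def)
qed

lemma integrable_abs_power_normal_law: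
  assumes "v \<ge> 0"
  shows "integrable (normal_law v) (\<lambda>x. \<bar>x\<bar> ^ k)"
    and "(LINT x|normal_law v. \<bar>x\<bar> ^ k) = sqrt v ^ k * abs_normal_moment k"
proof -
  have "integrable std_normal_distribution (\<lambda>x. \<bar>x\<bar> ^ k)"
    using integrable_abs[OF integrable_std_normal_distribution_moment[of k]] by (simp add: power_abs)
  then have i: "integrable std_normal_distribution (\<lambda>x. \<bar>sqrt v * x\<bar> ^ k)"
    using assms by (simp add: abs_mult power_mult_distrib del: real_sqrt_abs)
  show "integrable (normal_law v) (\<lambda>x. \<bar>x\<bar> ^ k)"
    unfolding normal_law_eq_distr[OF assms] by (subst integrable_distr_eq) (use i in auto)
  show "(LINT x|normal_law v. \<bar>x\<bar> ^ k) = sqrt v ^ k * abs_normal_moment k"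
    unfolding normal_law_eq_distr[OF assms] abs_normal_moment_def normal_law_1
    by (subst integral_distr) (use assms in \<open>auto simp: abs_mult power_mult_distrib\<close>)
qed

lemma gauss_rv_abs_power:
  assumes "gauss_rv P Y v"
  shows "integrable P (\<lambda>\<omega>. \<bar>Y \<omega>\<bar> ^ k)"
    and "(LINT \<omega>|P. \<bar>Y \<omega>\<bar> ^ k) = sqrt v ^ k * abs_normal_moment k"
  using integrable_abs_power_normal_law[OF gauss_rvD(2)[OF assms], of k]
  unfolding gauss_rvD(3)[OF assms, symmetric]
  by (simp_all add: integrable_distr_eq integral_distr gauss_rvD(1)[OF assms])

lemma abs_normal_moment_2: "abs_normal_moment 2 = 1"
  using std_normal_distribution_even_moments(1)[of 1]
  by (simp add: abs_normal_moment_def normal_law_1 fact_2)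

lemma gauss_rv_square:
  assumes "gauss_rv P Y v"
  shows "integrable P (\<lambda>\<omega>. (Y \<omega>)\<^sup>2)" "(LINT \<omega>|P. (Y \<omega>)\<^sup>2) = v"
  using gauss_rv_abs_power[OF assms, of 2] gauss_rvD(2)[OF assms] by (simp_all add: abs_normal_moment_2)

text \<open>A vanishing moment would force \<open>x = 0\<close> for Lebesgue-almost every
  \<open>x\<close>. Positivity makes the centering constant of the limit theorem positive, so that
  the powers defining the estimators are differentiable there.\<close>

lemma abs_normal_moment_pos: "abs_normal_moment k > 0"
proof (rule ccontr)
  interpret real_distribution std_normal_distribution by (rule real_dist_normal_dist)
  assume "\<not> ?thesis"
  moreover have i: "integrable std_normal_distribution (\<lambda>x. \<bar>x\<bar> ^ k)"
    using integrable_abs_power_normal_law(1)[of 1] by (simp add: normal_law_1)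
  moreover have "abs_normal_moment k \<ge> 0" by (simp add: abs_normal_moment_def)
  ultimately have "abs_normal_moment k = 0" by simp
  then have "(LINT x|std_normal_distribution. \<bar>x\<bar> ^ k) = 0"
    by (simp add: abs_normal_moment_def normal_law_1)
  then have "AE x in std_normal_distribution. \<bar>x\<bar> ^ k = 0"
    using integral_nonneg_eq_0_iff_AE[OF i] by simp
  then have "AE x in lborel. \<bar>x\<bar> ^ k = (0::real)"
    by (subst (asm) AE_density) (auto simp: normal_density_pos)
  moreover have "AE x in lborel. x \<noteq> (0::real)" by (rule AE_lborel_singleton)
  ultimately have "AE x in (lborel :: real measure). False" by eventually_elim simp
  then show False
    using AE_iff_measurable[of UNIV "lborel :: real measure" "\<lambda>_. False"] by auto
qed

lemma gauss_rv_scale: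
  assumes "gauss_rv P Y v" "prob_space P"
  shows "gauss_rv P (\<lambda>\<omega>. c * Y \<omega>) (c\<^sup>2 * v)"
proof -
  interpret prob_space P by fact
  note [measurable] = gauss_rvD(1)[OF assms(1)]
  show ?thesis
    by (rule gauss_rv_charI)
      (use gauss_rv_char[OF assms(1), of "u * c" for u] gauss_rvD(2)[OF assms(1)]
        in \<open>auto simp: mult_ac power_mult_distrib\<close>)
qed

section \<open>Limits of Gaussian variables through characteristic functions\<close>

lemma norm_iexp_diff_le: "norm (iexp x - iexp y) \<le> \<bar>x - y\<bar>"
proof -
  have "iexp x - iexp y = iexp y * (iexp (x - y) - 1)"
    by (simp add: algebra_simps exp_diff)
  then have "norm (iexp x - iexp y) = norm (iexp (x - y) - 1)"
    by (simp add: norm_mult)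
  also have "\<dots> \<le> \<bar>x - y\<bar>" using iexp_approx1[of "x - y" 0] by simp
  finally show ?thesis .
qed

text \<open>Turns an \<open>L^1\<close> distance into closeness of characteristic functions, both
  for mean-square limits and for the comparison of the power variations.\<close>

lemma (in prob_space) integral_iexp_diff_le:
  assumes [measurable]: "X \<in> borel_measurable M" "Y \<in> borel_measurable M"
    and "integrable M (\<lambda>\<omega>. X \<omega> - Y \<omega>)"
  shows "norm ((LINT \<omega>|M. iexp (u * X \<omega>)) - (LINT \<omega>|M. iexp (u * Y \<omega>))) \<le> \<bar>u\<bar> * (LINT \<omega>|M. \<bar>X \<omega> - Y \<omega>\<bar>)"
proof -
  have "(LINT \<omega>|M. iexp (u * X \<omega>)) - (LINT \<omega>|M. iexp (u * Y \<omega>))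
      = (LINT \<omega>|M. iexp (u * X \<omega>) - iexp (u * Y \<omega>))"
    by (rule Bochner_Integration.integral_diff[symmetric]) (auto intro!: integrable_iexp)
  also have "norm \<dots> \<le> (LINT \<omega>|M. norm (iexp (u * X \<omega>) - iexp (u * Y \<omega>)))"
    by (rule integral_norm_bound)
  also have "\<dots> \<le> (LINT \<omega>|M. \<bar>u\<bar> * \<bar>X \<omega> - Y \<omega>\<bar>)"
  proof (rule integral_mono)
    show "integrable M (\<lambda>\<omega>. cmod (iexp (u * X \<omega>) - iexp (u * Y \<omega>)))"
      by (intro integrable_norm Bochner_Integration.integrable_diff integrable_iexp) auto
    show "integrable M (\<lambda>\<omega>. \<bar>u\<bar> * \<bar>X \<omega> - Y \<omega>\<bar>)" using assms(3) by simp
    show "norm (iexp (u * X \<omega>) - iexp (u * Y \<omega>)) \<le> \<bar>u\<bar> * \<bar>X \<omega> - Y \<omega>\<bar>" for \<omega>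
      using norm_iexp_diff_le[of "u * X \<omega>" "u * Y \<omega>"]
      by (simp add: abs_mult right_diff_distrib[symmetric])
  qed
  finally show ?thesis by simp
qed

lemma (in prob_space) integral_abs_le_sqrt:
  assumes [measurable]: "X \<in> borel_measurable M" and i: "integrable M (\<lambda>\<omega>. (X \<omega>)\<^sup>2)"
  shows "integrable M X" "(LINT \<omega>|M. \<bar>X \<omega>\<bar>) \<le> sqrt (LINT \<omega>|M. (X \<omega>)\<^sup>2)"
proof -
  show iX: "integrable M X" by (rule square_integrable_imp_integrable) fact+
  have "(LINT \<omega>|M. \<bar>X \<omega>\<bar>)\<^sup>2 \<le> (LINT \<omega>|M. \<bar>X \<omega>\<bar>\<^sup>2)"
    using variance_positive[of "\<lambda>\<omega>. \<bar>X \<omega>\<bar>"] variance_eq[of "\<lambda>\<omega>. \<bar>X \<omega>\<bar>"] iX i by simp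
  then show "(LINT \<omega>|M. \<bar>X \<omega>\<bar>) \<le> sqrt (LINT \<omega>|M. (X \<omega>)\<^sup>2)"
    by (simp add: real_le_rsqrt)
qed

text \<open>The characteristic functions of the \<open>Y n\<close> are explicit in the variances, so
  their limit is again of Gaussian form. The mode of convergence of \<open>Y n\<close> to
  \<open>Z\<close> is left open here; the next two lemmas supply it pointwise and in mean
  square.\<close>

lemma (in prob_space) gauss_rv_limit:
  assumes "\<And>n. gauss_rv M (Y n) (v n)" and [measurable]: "Z \<in> borel_measurable M"
    and v: "v \<longlonglongrightarrow> w"
    and lim: "\<And>u. (\<lambda>n. LINT \<omega>|M. iexp (u * Y n \<omega>)) \<longlonglongrightarrow> (LINT \<omega>|M. iexp (u * Z \<omega>))"
  shows "gauss_rv M Z w"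
proof (rule gauss_rv_charI)
  show "w \<ge> 0" using gauss_rvD(2)[OF assms(1)] by (intro LIMSEQ_le_const[OF v]) auto
  fix u
  have "(\<lambda>n. of_real (exp (- (u\<^sup>2 * v n) / 2))) \<longlonglongrightarrow> (of_real (exp (- (u\<^sup>2 * w) / 2)) :: complex)"
    by (intro tendsto_intros v) simp
  then show "(LINT \<omega>|M. iexp (u * Z \<omega>)) = of_real (exp (- (u\<^sup>2 * w) / 2))"
    using lim[of u] unfolding gauss_rv_char[OF assms(1)] by (rule LIMSEQ_unique[rotated])
qed fact

lemma (in prob_space) gauss_rv_limit_pointwise:
  assumes "\<And>n. gauss_rv M (Y n) (v n)" and v: "v \<longlonglongrightarrow> w"
    and lim: "\<And>\<omega>. \<omega> \<in> space M \<Longrightarrow> (\<lambda>n. Y n \<omega>) \<longlonglongrightarrow> Z \<omega>"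
  shows "gauss_rv M Z w"
proof (rule gauss_rv_limit[OF assms(1) _ v])
  note [measurable] = gauss_rvD(1)[OF assms(1)]
  show [measurable]: "Z \<in> borel_measurable M"
    by (rule borel_measurable_LIMSEQ_real[OF lim]) auto
  show "(\<lambda>n. LINT \<omega>|M. iexp (u * Y n \<omega>)) \<longlonglongrightarrow> (LINT \<omega>|M. iexp (u * Z \<omega>))" for u
    by (rule integral_dominated_convergence[where w="\<lambda>_. 1"])
      (auto intro!: AE_I2 tendsto_intros lim)
qed

lemma (in prob_space) gauss_rv_limit_L2:
  assumes "\<And>n. gauss_rv M (Y n) (v n)" and v: "v \<longlonglongrightarrow> w"
    and [measurable]: "Z \<in> borel_measurable M" and Z2: "integrable M (\<lambda>\<omega>. (Z \<omega>)\<^sup>2)"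
    and lim: "(\<lambda>n. LINT \<omega>|M. (Z \<omega> - Y n \<omega>)\<^sup>2) \<longlonglongrightarrow> 0"
  shows "gauss_rv M Z w"
proof (rule gauss_rv_limit[OF assms(1) _ v])
  note [measurable] = gauss_rvD(1)[OF assms(1)]
  fix u
  have i: "integrable M (\<lambda>\<omega>. (Z \<omega> - Y n \<omega>)\<^sup>2)" for n
  proof (rule Bochner_Integration.integrable_bound)
    show "integrable M (\<lambda>\<omega>. 2 * (Z \<omega>)\<^sup>2 + 2 * (Y n \<omega>)\<^sup>2)"
      using Z2 gauss_rv_square(1)[OF assms(1)] by simp
    have "(a - b)\<^sup>2 \<le> 2 * a\<^sup>2 + 2 * b\<^sup>2" for a b :: real
      using zero_le_power2[of "a + b"] by (simp add: power2_eq_square algebra_simps)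
    then show "AE \<omega> in M. norm ((Z \<omega> - Y n \<omega>)\<^sup>2) \<le> norm (2 * (Z \<omega>)\<^sup>2 + 2 * (Y n \<omega>)\<^sup>2)" by simp
  qed simp
  have "(\<lambda>n. (LINT \<omega>|M. iexp (u * Y n \<omega>)) - (LINT \<omega>|M. iexp (u * Z \<omega>))) \<longlonglongrightarrow> 0"
  proof (rule Lim_null_comparison)
    show "(\<lambda>n. \<bar>u\<bar> * sqrt (LINT \<omega>|M. (Z \<omega> - Y n \<omega>)\<^sup>2)) \<longlonglongrightarrow> 0"
      using tendsto_mult_left[OF tendsto_real_sqrt[OF lim], of "\<bar>u\<bar>"] by simp
    show "\<forall>\<^sub>F n in sequentially. norm ((LINT \<omega>|M. iexp (u * Y n \<omega>)) - (LINT \<omega>|M. iexp (u * Z \<omega>)))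
        \<le> \<bar>u\<bar> * sqrt (LINT \<omega>|M. (Z \<omega> - Y n \<omega>)\<^sup>2)"
    proof (intro always_eventually allI)
      fix n
      have "norm ((LINT \<omega>|M. iexp (u * Z \<omega>)) - (LINT \<omega>|M. iexp (u * Y n \<omega>)))
        \<le> \<bar>u\<bar> * (LINT \<omega>|M. \<bar>Z \<omega> - Y n \<omega>\<bar>)"
        by (rule integral_iexp_diff_le) (use integral_abs_le_sqrt(1)[OF _ i[of n]] in auto)
      also have "\<dots> \<le> \<bar>u\<bar> * sqrt (LINT \<omega>|M. (Z \<omega> - Y n \<omega>)\<^sup>2)"
        using integral_abs_le_sqrt(2)[OF _ i[of n]] by (simp add: mult_left_mono)
      finally show "norm ((LINT \<omega>|M. iexp (u * Y n \<omega>)) - (LINT \<omega>|M. iexp (u * Z \<omega>))) \<le> \<dots>"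
        by (simp add: norm_minus_commute)
    qed
  qed
  then show "(\<lambda>n. LINT \<omega>|M. iexp (u * Y n \<omega>)) \<longlonglongrightarrow> (LINT \<omega>|M. iexp (u * Z \<omega>))"
    by (simp add: LIM_zero_iff)
qed fact

section \<open>Laws of finite random vectors\<close>

text \<open>Evaluation at 0 shows that the total masses agree, and division by the common mass leads
  back to Levy's uniqueness theorem for probability laws; mass 0 is treated apart. Needed because
  the weighted laws below do not have mass 1 in general.\<close>

lemma finite_measure_eq_if_char_eq:
  assumes "finite_measure M1" "finite_measure M2"
    and s: "sets M1 = sets borel" "sets M2 = sets borel"
    and char: "\<And>u. char M1 u = char M2 u"
  shows "M1 = M2"
proof -
  interpret M1: finite_measure M1 by fact
  interpret M2: finite_measure M2 by fact
  have sp: "space M1 = UNIV" "space M2 = UNIV" using sets_eq_imp_space_eq[OF s(1)] sets_eq_imp_space_eq[OF s(2)] by auto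
  define r where "r = measure M1 UNIV"
  have r1: "emeasure M1 UNIV = ennreal r" using M1.emeasure_eq_measure r_def by simp
  have "measure M1 UNIV = measure M2 UNIV"
    using char[of 0] sp by (simp add: char_def)
  then have r2: "emeasure M2 UNIV = ennreal r" using M2.emeasure_eq_measure r_def by simp
  show ?thesis
  proof (cases "r = 0")
    case True
    show ?thesis
    proof (rule measure_eqI)
      fix A assume "A \<in> sets M1"
      then show "emeasure M1 A = emeasure M2 A"
        using emeasure_space[of M1 A] emeasure_space[of M2 A] r1 r2 True sp by simp
    qed (use s in simp)
  next
    case False
    then have r: "r > 0" by (simp add: r_def less_le)
    have *: "real_distribution (density N (\<lambda>_. ennreal (1 / r))) \<and>
        (\<forall>u. char (density N (\<lambda>_. ennreal (1 / r))) u = char N u / r)"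
      if N: "sets N = sets borel" "emeasure N UNIV = ennreal r" "space N = UNIV" for N :: "real measure"
    proof safe
      have "emeasure (density N (\<lambda>_. ennreal (1 / r))) UNIV = ennreal (1 / r) * ennreal r"
        using N by (subst emeasure_density) (auto simp: nn_integral_cmult)
      also have "\<dots> = 1" using r by (simp add: ennreal_mult[symmetric])
      finally show "real_distribution (density N (\<lambda>_. ennreal (1 / r)))"
        using N by (intro real_distribution.intro prob_spaceI real_distribution_axioms.intro) auto
      show "char (density N (\<lambda>_. ennreal (1 / r))) u = char N u / r" for u
        unfolding char_def using r N(1)
        by (subst integral_density) (auto simp: measurable_cong_sets[OF N(1) refl] scaleR_conv_of_real)
    qed
    have "density M1 (\<lambda>_. ennreal (1 / r)) = density M2 (\<lambda>_. ennreal (1 / r))"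
      using *[OF s(1) r1 sp(1)] *[OF s(2) r2 sp(2)] char
      by (intro Levy_uniqueness) (auto intro!: ext)
    then have "density (density M1 (\<lambda>_. ennreal (1 / r))) (\<lambda>_. ennreal r)
        = density (density M2 (\<lambda>_. ennreal (1 / r))) (\<lambda>_. ennreal r)" by simp
    moreover have "density (density N (\<lambda>_. ennreal (1 / r))) (\<lambda>_. ennreal r) = N" for N :: "real measure"
      using r by (simp add: density_density_eq ennreal_mult[symmetric] density_1)
    ultimately show ?thesis by simp
  qed
qed

lemma (in prob_space) weighted_law:
  fixes g :: "'a \<Rightarrow> real"
  assumes [measurable]: "g \<in> borel_measurable M" "Y \<in> borel_measurable M" and g: "\<And>\<omega>. \<bar>g \<omega>\<bar> \<le> 1"
  defines "N \<equiv> distr (density M (\<lambda>\<omega>. ennreal (1 + g \<omega>))) borel Y"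
  shows "sets N = sets borel" and "finite_measure N"
    and "\<And>B. B \<in> sets borel \<Longrightarrow> emeasure N B = ennreal (LINT \<omega>|M. (1 + g \<omega>) * indicator B (Y \<omega>))"
    and "\<And>u. char N u = (LINT \<omega>|M. iexp (u * Y \<omega>)) + (LINT \<omega>|M. of_real (g \<omega>) * iexp (u * Y \<omega>))"
proof -
  have nn: "0 \<le> 1 + g \<omega>" for \<omega> using g[of \<omega>] by (auto simp: abs_le_iff)
  show sN: "sets N = sets borel" by (simp add: N_def)
  show em: "emeasure N B = ennreal (LINT \<omega>|M. (1 + g \<omega>) * indicator B (Y \<omega>))" if [measurable]: "B \<in> sets borel" for B
  proof -
    have "emeasure N B = (\<integral>\<^sup>+\<omega>. ennreal ((1 + g \<omega>) * indicator B (Y \<omega>)) \<partial>M)"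
      unfolding N_def by (subst emeasure_distr) (auto simp: emeasure_density measurable_sets_borel intro!: nn_integral_cong split: split_indicator)
    also have "\<dots> = ennreal (LINT \<omega>|M. (1 + g \<omega>) * indicator B (Y \<omega>))"
      using g nn abs_le_D1[OF g] by (intro nn_integral_eq_integral integrable_const_bound[where B=2])
        (auto simp: abs_mult intro!: AE_I2 split: split_indicator)
    finally show ?thesis .
  qed
  show "finite_measure N"
    using em[of UNIV] sets_eq_imp_space_eq[OF sN] by (auto intro!: finite_measureI)
  show "char N u = (LINT \<omega>|M. iexp (u * Y \<omega>)) + (LINT \<omega>|M. of_real (g \<omega>) * iexp (u * Y \<omega>))" for u
  proof -
    have "char N u = (LINT \<omega>|M. (1 + g \<omega>) *\<^sub>R iexp (u * Y \<omega>))"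
      unfolding char_def N_def using nn by (subst integral_distr, simp, simp, subst integral_density) auto
    also have "\<dots> = (LINT \<omega>|M. iexp (u * Y \<omega>) + of_real (g \<omega>) * iexp (u * Y \<omega>))"
      by (simp add: scaleR_conv_of_real algebra_simps)
    also have "\<dots> = (LINT \<omega>|M. iexp (u * Y \<omega>)) + (LINT \<omega>|M. of_real (g \<omega>) * iexp (u * Y \<omega>))"
      using g by (intro Bochner_Integration.integral_add integrable_const_bound[where B=1]) (auto simp: norm_mult)
    finally show ?thesis .
  qed
qed

text \<open>The weights \<open>1 + g1\<close> and \<open>1 + g2\<close> are nonnegative, so the one-dimensional uniqueness theorem
  for characteristic functions applies to the weighted laws.\<close>

lemma weighted_law_eq_real:
  fixes g1 :: "'a \<Rightarrow> real" and g2 :: "'b \<Rightarrow> real"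
  assumes "prob_space P1" "prob_space P2"
    and [measurable]: "g1 \<in> borel_measurable P1" "g2 \<in> borel_measurable P2"
      "Y1 \<in> borel_measurable P1" "Y2 \<in> borel_measurable P2" "A \<in> sets borel"
    and g: "\<And>\<omega>. \<bar>g1 \<omega>\<bar> \<le> 1" "\<And>\<omega>. \<bar>g2 \<omega>\<bar> \<le> 1"
    and eq0: "\<And>u. (LINT \<omega>|P1. iexp (u * Y1 \<omega>)) = (LINT \<omega>|P2. iexp (u * Y2 \<omega>))"
    and eq: "\<And>u. (LINT \<omega>|P1. of_real (g1 \<omega>) * iexp (u * Y1 \<omega>)) = (LINT \<omega>|P2. of_real (g2 \<omega>) * iexp (u * Y2 \<omega>))"
  shows "(LINT \<omega>|P1. g1 \<omega> * indicator A (Y1 \<omega>)) = (LINT \<omega>|P2. g2 \<omega> * indicator A (Y2 \<omega>))"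
proof -
  interpret P1: prob_space P1 by fact
  interpret P2: prob_space P2 by fact
  have bI: "integrable P1 (\<lambda>\<omega>. g1 \<omega> * indicator A (Y1 \<omega>))" "integrable P2 (\<lambda>\<omega>. g2 \<omega> * indicator A (Y2 \<omega>))"
    using g by (auto intro!: P1.integrable_const_bound[where B=1] P2.integrable_const_bound[where B=1] split: split_indicator)
  have nn: "0 \<le> 1 + g1 \<omega>" "0 \<le> 1 + g2 \<omega>'" for \<omega> \<omega>'
    using g(1)[of \<omega>] g(2)[of \<omega>'] by (auto simp: abs_le_iff)
  note N1 = P1.weighted_law[OF assms(3,5) g(1)] and N2 = P2.weighted_law[OF assms(4,6) g(2)]
  have "distr (density P1 (\<lambda>\<omega>. ennreal (1 + g1 \<omega>))) borel Y1 = distr (density P2 (\<lambda>\<omega>. ennreal (1 + g2 \<omega>))) borel Y2"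
    by (rule finite_measure_eq_if_char_eq[OF N1(2) N2(2) N1(1) N2(1)]) (simp only: N1(4) N2(4) eq0 eq)
  then have "ennreal (LINT \<omega>|P1. (1 + g1 \<omega>) * indicator A (Y1 \<omega>)) = ennreal (LINT \<omega>|P2. (1 + g2 \<omega>) * indicator A (Y2 \<omega>))"
    using N1(3)[of A] N2(3)[of A] by simp
  then have a: "(LINT \<omega>|P1. (1 + g1 \<omega>) * indicator A (Y1 \<omega>)) = (LINT \<omega>|P2. (1 + g2 \<omega>) * indicator A (Y2 \<omega>))"
    using nn by (subst (asm) ennreal_inj) (auto intro!: integral_nonneg)
  have "distr P1 borel Y1 = distr P2 borel Y2"
    by (rule finite_measure_eq_if_char_eq)
      (use eq0 in \<open>auto simp: char_def integral_distr intro!: P1.finite_measure_distr P2.finite_measure_distr\<close>)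
  then have "(LINT x|distr P1 borel Y1. indicator A x :: real) = (LINT x|distr P2 borel Y2. indicator A x)" by simp
  then have b: "(LINT \<omega>|P1. indicator A (Y1 \<omega>) :: real) = (LINT \<omega>|P2. indicator A (Y2 \<omega>))"
    by (subst (asm) (1 2) integral_distr) auto
  have iA: "integrable P1 (\<lambda>\<omega>. indicator A (Y1 \<omega>) :: real)" "integrable P2 (\<lambda>\<omega>. indicator A (Y2 \<omega>) :: real)"
    by (auto intro!: P1.integrable_const_bound[where B=1] P2.integrable_const_bound[where B=1])
  show ?thesis using a b bI iA by (simp add: distrib_right)
qed

text \<open>The conjugate weights satisfy the same hypothesis, since the transform of
  \<open>cnj g\<close> at \<open>u\<close> is the conjugate of the transform of \<open>g\<close> at
  \<open>- u\<close>. Hence the transforms of the real and of the imaginary parts agree, and the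
  real case applies to each.\<close>

lemma weighted_law_eq:
  fixes g1 :: "'a \<Rightarrow> complex" and g2 :: "'b \<Rightarrow> complex"
  assumes "prob_space P1" "prob_space P2"
    and [measurable]: "g1 \<in> borel_measurable P1" "g2 \<in> borel_measurable P2"
      "Y1 \<in> borel_measurable P1" "Y2 \<in> borel_measurable P2" "A \<in> sets borel"
    and g: "\<And>\<omega>. norm (g1 \<omega>) \<le> 1" "\<And>\<omega>. norm (g2 \<omega>) \<le> 1"
    and eq0: "\<And>u. (LINT \<omega>|P1. iexp (u * Y1 \<omega>)) = (LINT \<omega>|P2. iexp (u * Y2 \<omega>))"
    and eq: "\<And>u. (LINT \<omega>|P1. g1 \<omega> * iexp (u * Y1 \<omega>)) = (LINT \<omega>|P2. g2 \<omega> * iexp (u * Y2 \<omega>))"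
  shows "(LINT \<omega>|P1. g1 \<omega> * indicator A (Y1 \<omega>)) = (LINT \<omega>|P2. g2 \<omega> * indicator A (Y2 \<omega>))"
proof -
  interpret P1: prob_space P1 by fact
  interpret P2: prob_space P2 by fact
  have i1: "integrable P1 (\<lambda>\<omega>. g1 \<omega> * iexp (u * Y1 \<omega>))" for u
    using g by (intro P1.integrable_const_bound[where B=1]) (auto simp: norm_mult)
  have i2: "integrable P2 (\<lambda>\<omega>. g2 \<omega> * iexp (u * Y2 \<omega>))" for u
    using g by (intro P2.integrable_const_bound[where B=1]) (auto simp: norm_mult)
  have cnj1: "(LINT \<omega>|P1. cnj (g1 \<omega>) * iexp (u * Y1 \<omega>)) = cnj (LINT \<omega>|P1. g1 \<omega> * iexp ((- u) * Y1 \<omega>))" for u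
    unfolding Bochner_Integration.integral_cnj[where M=P1 and f="\<lambda>\<omega>. g1 \<omega> * iexp ((- u) * Y1 \<omega>)", symmetric]
    by (simp add: exp_cnj del: Bochner_Integration.integral_cnj)
  have cnj2: "(LINT \<omega>|P2. cnj (g2 \<omega>) * iexp (u * Y2 \<omega>)) = cnj (LINT \<omega>|P2. g2 \<omega> * iexp ((- u) * Y2 \<omega>))" for u
    unfolding Bochner_Integration.integral_cnj[where M=P2 and f="\<lambda>\<omega>. g2 \<omega> * iexp ((- u) * Y2 \<omega>)", symmetric]
    by (simp add: exp_cnj del: Bochner_Integration.integral_cnj)
  have [measurable]: "cnj \<in> borel_measurable borel"
    by (intro borel_measurable_continuous_onI continuous_intros)
  have i1': "integrable P1 (\<lambda>\<omega>. cnj (g1 \<omega>) * iexp (u * Y1 \<omega>))" for u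
    using g by (intro P1.integrable_const_bound[where B=1]) (auto simp: norm_mult)
  have i2': "integrable P2 (\<lambda>\<omega>. cnj (g2 \<omega>) * iexp (u * Y2 \<omega>))" for u
    using g by (intro P2.integrable_const_bound[where B=1]) (auto simp: norm_mult)
  have Re: "of_real (Re z) * w = (z * w + cnj z * w) * inverse 2"
for z w :: complex
    by (auto simp: complex_eq_iff field_simps)
  have Im: "of_real (Im z) * w = (z * w - cnj z * w) * inverse (2 * \<i>)" for z w :: complex
  proof -
    have "z * w - cnj z * w = of_real (Im z) * w * (2 * \<i>)"
      by (auto simp: complex_eq_iff algebra_simps)
    then show ?thesis by simp
  qed
  have "(LINT \<omega>|P1. of_real (Re (g1 \<omega>)) * iexp (u * Y1 \<omega>)) = (LINT \<omega>|P2. of_real (Re (g2 \<omega>)) * iexp (u * Y2 \<omega>))" for u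
    unfolding Re integral_mult_left_zero Bochner_Integration.integral_add[OF i1 i1'] Bochner_Integration.integral_add[OF i2 i2']
      cnj1 cnj2 eq ..
  then have R: "(LINT \<omega>|P1. Re (g1 \<omega>) * indicator A (Y1 \<omega>)) = (LINT \<omega>|P2. Re (g2 \<omega>) * indicator A (Y2 \<omega>))"
    using order.trans[OF abs_Re_le_cmod g(1)] order.trans[OF abs_Re_le_cmod g(2)] eq0
    by (intro weighted_law_eq_real[OF assms(1,2)]) simp_all
  have "(LINT \<omega>|P1. of_real (Im (g1 \<omega>)) * iexp (u * Y1 \<omega>)) = (LINT \<omega>|P2. of_real (Im (g2 \<omega>)) * iexp (u * Y2 \<omega>))" for u
    unfolding Im integral_mult_left_zero Bochner_Integration.integral_diff[OF i1 i1'] Bochner_Integration.integral_diff[OF i2 i2']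
      cnj1 cnj2 eq ..
  then have I: "(LINT \<omega>|P1. Im (g1 \<omega>) * indicator A (Y1 \<omega>)) = (LINT \<omega>|P2. Im (g2 \<omega>) * indicator A (Y2 \<omega>))"
    using order.trans[OF abs_Im_le_cmod g(1)] order.trans[OF abs_Im_le_cmod g(2)] eq0
    by (intro weighted_law_eq_real[OF assms(1,2)]) simp_all
  have iA1: "integrable P1 (\<lambda>\<omega>. g1 \<omega> * indicator A (Y1 \<omega>))"
    using g by (intro P1.integrable_const_bound[where B=1]) (auto simp: norm_mult split: split_indicator)
  have iA2: "integrable P2 (\<lambda>\<omega>. g2 \<omega> * indicator A (Y2 \<omega>))"
    using g by (intro P2.integrable_const_bound[where B=1]) (auto simp: norm_mult split: split_indicator)
  have ri: "Re (indicator A y) = indicator A y" "Im (indicator A y) = 0" for y :: real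
    by (auto split: split_indicator)
  show ?thesis
    using R I integral_Re[OF iA1] integral_Re[OF iA2] integral_Im[OF iA1] integral_Im[OF iA2]
    by (simp add: complex_eq_iff ri)
qed

text \<open>The factors \<open>iexp (c k * Y k)\<close> are replaced by indicators of \<open>Y k\<close> one index at a time, with the
  remaining product as the weight.\<close>

lemma joint_law_eq:
  fixes Y1 :: "'i \<Rightarrow> 'a \<Rightarrow> real" and Y2 :: "'i \<Rightarrow> 'b \<Rightarrow> real"
  assumes "prob_space P1" "prob_space P2" "finite K"
    and [measurable]: "\<And>k. k \<in> K \<Longrightarrow> Y1 k \<in> borel_measurable P1" "\<And>k. k \<in> K \<Longrightarrow> Y2 k \<in> borel_measurable P2"
    and char: "\<And>c. (LINT \<omega>|P1. iexp (\<Sum>k\<in>K. c k * Y1 k \<omega>)) = (LINT \<omega>|P2. iexp (\<Sum>k\<in>K. c k * Y2 k \<omega>))"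
  shows "distr P1 (PiM K (\<lambda>_. borel)) (\<lambda>\<omega>. \<lambda>k\<in>K. Y1 k \<omega>) = distr P2 (PiM K (\<lambda>_. borel)) (\<lambda>\<omega>. \<lambda>k\<in>K. Y2 k \<omega>)"
proof -
  interpret P1: prob_space P1 by fact
  interpret P2: prob_space P2 by fact
  have key: "(LINT \<omega>|P1. (\<Prod>k\<in>S. indicator (A k) (Y1 k \<omega>)) * iexp (\<Sum>k\<in>K - S. c k * Y1 k \<omega>))
      = (LINT \<omega>|P2. (\<Prod>k\<in>S. indicator (A k) (Y2 k \<omega>)) * iexp (\<Sum>k\<in>K - S. c k * Y2 k \<omega>))"
    if "finite S" "S \<subseteq> K" "\<And>k. k \<in> K \<Longrightarrow> A k \<in> sets borel" for S A c
    using that(1,2)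
  proof (induction S arbitrary: c)
    case empty
    then show ?case using char by simp
  next
    case (insert j S)
    have j: "j \<in> K" using insert by auto
    have m[measurable]: "A k \<in> sets borel" if "k \<in> S" for k using that insert.prems \<open>\<And>k. k \<in> K \<Longrightarrow> A k \<in> sets borel\<close> by auto
    have [measurable]: "A j \<in> sets borel" using j that(3) by auto
    have Y: "Y1 k \<in> borel_measurable P1" "Y2 k \<in> borel_measurable P2" if "k \<in> S \<or> k \<in> K - S \<or> k \<in> K - insert j S \<or> k = j" for k
      using that insert.prems by auto
    have M1[measurable]: "(\<lambda>\<omega>. \<Sum>k\<in>K - insert j S. c k * Y1 k \<omega>) \<in> borel_measurable P1"
      by (intro borel_measurable_sum borel_measurable_times) (use Y in auto)
    have M2[measurable]: "(\<lambda>\<omega>. \<Sum>k\<in>K - insert j S. c k * Y2 k \<omega>) \<in> borel_measurable P2"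
      by (intro borel_measurable_sum borel_measurable_times) (use Y in auto)
    have M3[measurable]: "(\<lambda>\<omega>. \<Prod>k\<in>S. indicator (A k) (Y1 k \<omega>) :: complex) \<in> borel_measurable P1"
    proof (intro borel_measurable_prod)
      fix k assume k: "k \<in> S" then have [measurable]: "A k \<in> sets borel" "Y1 k \<in> borel_measurable P1" using m Y by auto
      show "(\<lambda>\<omega>. indicator (A k) (Y1 k \<omega>) :: complex) \<in> borel_measurable P1" by measurable
    qed
    have M4[measurable]: "(\<lambda>\<omega>. \<Prod>k\<in>S. indicator (A k) (Y2 k \<omega>) :: complex) \<in> borel_measurable P2"
    proof (intro borel_measurable_prod)
      fix k assume k: "k \<in> S" then have [measurable]: "A k \<in> sets borel" "Y2 k \<in> borel_measurable P2" using m Y by auto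
      show "(\<lambda>\<omega>. indicator (A k) (Y2 k \<omega>) :: complex) \<in> borel_measurable P2" by measurable
    qed
    have [measurable]: "Y1 j \<in> borel_measurable P1" "Y2 j \<in> borel_measurable P2" using Y by auto
    define g1 where "g1 \<omega> = (\<Prod>k\<in>S. indicator (A k) (Y1 k \<omega>)) * iexp (\<Sum>k\<in>K - insert j S. c k * Y1 k \<omega>)" for \<omega>
    define g2 where "g2 \<omega> = (\<Prod>k\<in>S. indicator (A k) (Y2 k \<omega>)) * iexp (\<Sum>k\<in>K - insert j S. c k * Y2 k \<omega>)" for \<omega>
    have prod1: "norm (\<Prod>k\<in>S. indicator (A k) (y k) :: complex) \<le> 1" for y :: "'i \<Rightarrow> real"
      unfolding prod_norm[symmetric] by (rule prod_le_1) (auto split: split_indicator)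
    have KS: "K - S = insert j (K - insert j S)" using insert j by auto
    have split: "(\<Sum>k\<in>K - S. (c(j := u)) k * y k) = u * y j + (\<Sum>k\<in>K - insert j S. c k * y k)" for u and y :: "'i \<Rightarrow> real"
      unfolding KS using \<open>finite K\<close> by (subst sum.insert) (auto intro!: sum.cong)
    have "(LINT \<omega>|P1. g1 \<omega> * indicator (A j) (Y1 j \<omega>)) = (LINT \<omega>|P2. g2 \<omega> * indicator (A j) (Y2 j \<omega>))"
    proof (rule weighted_law_eq[OF assms(1,2)])
      show "norm (g1 \<omega>) \<le> 1" for \<omega> using prod1[of "\<lambda>k. Y1 k \<omega>"] by (simp add: g1_def norm_mult)
      show "norm (g2 \<omega>) \<le> 1" for \<omega> using prod1[of "\<lambda>k. Y2 k \<omega>"] by (simp add: g2_def norm_mult)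
      have sj: "(\<Sum>k\<in>K. (if k = j then u else 0) * y k) = u * y j" for u and y :: "'i \<Rightarrow> real"
        using j \<open>finite K\<close> by (simp add: if_distrib[of "\<lambda>x. x * _"] sum.delta cong: if_cong)
      show "(LINT \<omega>|P1. iexp (u * Y1 j \<omega>)) = (LINT \<omega>|P2. iexp (u * Y2 j \<omega>))" for u
        using char[of "\<lambda>k. if k = j then u else 0"] unfolding sj .
      \<comment> \<open>The induction hypothesis for \<open>S\<close> still has the coefficient at
        \<open>j\<close> free; setting it to \<open>u\<close> gives the transform of
        \<open>Y1 j\<close> against the remaining product.\<close>
      show "(LINT \<omega>|P1. g1 \<omega> * iexp (u * Y1 j \<omega>)) = (LINT \<omega>|P2. g2 \<omega> * iexp (u * Y2 j \<omega>))" for u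
        using insert.IH[of "c(j := u)"] insert.prems unfolding split g1_def g2_def
        by (simp add: exp_add distrib_left mult_ac)
    qed (unfold g1_def g2_def, measurable)
    then show ?case using insert.hyps by (simp add: g1_def g2_def mult_ac)
  qed
  have em: "emeasure (distr P (PiM K (\<lambda>_. borel)) (\<lambda>\<omega>. \<lambda>k\<in>K. Y k \<omega>)) (Pi\<^sub>E K A)
      = ennreal (Re (LINT \<omega>|P. (\<Prod>k\<in>K. indicator (A k) (Y k \<omega>))))"
    if "prob_space P" and Y[measurable]: "\<And>k. k \<in> K \<Longrightarrow> Y k \<in> borel_measurable P" and A: "\<And>k. k \<in> K \<Longrightarrow> A k \<in> sets borel"
    for P :: "'c measure" and Y A
  proof -
    interpret prob_space P by fact
    have V[measurable]: "(\<lambda>\<omega>. \<lambda>k\<in>K. Y k \<omega>) \<in> measurable P (PiM K (\<lambda>_. borel))"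
      by (intro measurable_restrict) (use Y in auto)
    have B: "Pi\<^sub>E K A \<in> sets (PiM K (\<lambda>_. borel))"
      using \<open>finite K\<close> A by (intro sets_PiM_I_finite) auto
    have i: "(\<Prod>k\<in>K. indicator (A k) (Y k \<omega>) :: complex) = of_real (indicator ((\<lambda>\<omega>. \<lambda>k\<in>K. Y k \<omega>) -` Pi\<^sub>E K A \<inter> space P) \<omega>)" if "\<omega> \<in> space P" for \<omega>
      using \<open>finite K\<close> that by (auto simp: indicator_def prod_zero_iff PiE_iff extensional_def)
    have "(LINT \<omega>|P. (\<Prod>k\<in>K. indicator (A k) (Y k \<omega>) :: complex))
      = (LINT \<omega>|P. of_real (indicator ((\<lambda>\<omega>. \<lambda>k\<in>K. Y k \<omega>) -` Pi\<^sub>E K A \<inter> space P) \<omega>))"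
      by (rule Bochner_Integration.integral_cong) (use i in auto)
    also have "\<dots> = of_real (prob ((\<lambda>\<omega>. \<lambda>k\<in>K. Y k \<omega>) -` Pi\<^sub>E K A \<inter> space P))"
      using measurable_sets[OF V B] by simp
    finally show ?thesis
      using B by (simp add: emeasure_distr emeasure_eq_measure)
  qed
  show ?thesis
  proof (rule measure_eqI_PiM_finite[OF \<open>finite K\<close>])
    fix A assume A: "\<And>k. k \<in> K \<Longrightarrow> A k \<in> sets (borel :: real measure)"
    show "emeasure (distr P1 (PiM K (\<lambda>_. borel)) (\<lambda>\<omega>. \<lambda>k\<in>K. Y1 k \<omega>)) (Pi\<^sub>E K A)
      = emeasure (distr P2 (PiM K (\<lambda>_. borel)) (\<lambda>\<omega>. \<lambda>k\<in>K. Y2 k \<omega>)) (Pi\<^sub>E K A)"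
      using key[of K A "\<lambda>_. 0", OF \<open>finite K\<close> order.refl A] em[OF assms(1) assms(4) A] em[OF assms(2) assms(5) A]
      by simp
  next
    show "range (\<lambda>_::nat. Pi\<^sub>E K (\<lambda>_. UNIV :: real set)) \<subseteq> prod_algebra K (\<lambda>_. borel)"
      using \<open>finite K\<close> by (auto intro!: prod_algebraI_finite)
    have [measurable]: "(\<lambda>\<omega>. \<lambda>k\<in>K. Y1 k \<omega>) \<in> measurable P1 (PiM K (\<lambda>_. borel))"
      by (intro measurable_restrict) simp
    interpret D: prob_space "distr P1 (PiM K (\<lambda>_. borel)) (\<lambda>\<omega>. \<lambda>k\<in>K. Y1 k \<omega>)"
      by (rule P1.prob_space_distr) simp
    show "emeasure (distr P1 (PiM K (\<lambda>_. borel)) (\<lambda>\<omega>. \<lambda>k\<in>K. Y1 k \<omega>)) (Pi\<^sub>E K (\<lambda>_. UNIV)) \<noteq> \<infinity>" for i :: nat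
      by simp
  qed (auto simp: space_PiM)
qed

text \<open>Cholesky factorization by induction on the index set: the new index \<open>p\<close> is
  eliminated and the Schur complement \<open>r'\<close> is factored. A zero pivot
  \<open>r p p\<close> forces the whole column of \<open>p\<close> to vanish, which covers
  degenerate matrices.\<close>

lemma psd_factor:
  fixes r :: "'i \<Rightarrow> 'i \<Rightarrow> real"
  assumes "finite I" and "\<And>i j. i \<in> I \<Longrightarrow> j \<in> I \<Longrightarrow> r i j = r j i"
    and "\<And>c. (\<Sum>i\<in>I. \<Sum>j\<in>I. c i * c j * r i j) \<ge> 0"
  shows "\<exists>v. \<forall>i\<in>I. \<forall>j\<in>I. r i j = (\<Sum>k\<in>I. v i k * v j k)"
  using assms
proof (induction I arbitrary: r)
  case empty
  then show ?case by simp
next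
  case (insert p I)
  note sym = insert.prems(1) and psd = insert.prems(2)
  have expand: "(\<Sum>i\<in>insert p I. \<Sum>j\<in>insert p I. c i * c j * r i j)
      = c p * c p * r p p + 2 * c p * (\<Sum>i\<in>I. c i * r i p) + (\<Sum>i\<in>I. \<Sum>j\<in>I. c i * c j * r i j)" for c
  proof -
    have "(\<Sum>j\<in>I. c p * c j * r p j) = c p * (\<Sum>i\<in>I. c i * r i p)"
      using sym by (simp add: sum_distrib_left mult_ac)
    moreover have "(\<Sum>i\<in>I. c i * c p * r i p) = c p * (\<Sum>i\<in>I. c i * r i p)"
      by (simp add: sum_distrib_left mult_ac)
    ultimately show ?thesis using insert.hyps by (simp add: sum.distrib algebra_simps)
  qed
  have rpp: "r p p \<ge> 0"
  proof -
    have "(\<Sum>i\<in>I. (if i = p then 1 else 0) * r i p) = 0"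
      "(\<Sum>i\<in>I. \<Sum>j\<in>I. (if i = p then 1 else 0) * (if j = p then 1 else 0) * r i j) = 0"
      using insert.hyps by (auto intro!: sum.neutral)
    then show ?thesis using psd[of "\<lambda>i. if i = p then 1 else 0"] unfolding expand by simp
  qed
  define e where "e i = (if r p p = 0 then 0 else r i p / r p p)" for i
  have rip: "r i p = e i * r p p" if i: "i \<in> I" for i
  proof (cases "r p p = 0")
    case True
    \<comment> \<open>Test vector with \<open>x\<close> at \<open>p\<close>, 1 at \<open>i\<close>
      and 0 elsewhere; since the pivot is 0, the form is affine in \<open>x\<close>.\<close>
    have q: "2 * x * r i p + r i i \<ge> 0" for x
    proof -
      have ip: "i \<noteq> p" using i insert.hyps by auto
      have "(\<Sum>k\<in>I. ((\<lambda>k. if k = p then x else if k = i then 1 else 0) k) * r k p) = (\<Sum>k\<in>I. if k = i then r i p else 0)"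
        using insert.hyps by (intro sum.cong) auto
      also have "\<dots> = r i p" using i insert.hyps by simp
      finally have 1: "(\<Sum>k\<in>I. ((\<lambda>k. if k = p then x else if k = i then 1 else 0) k) * r k p) = r i p" .
      have "(\<Sum>k\<in>I. \<Sum>j\<in>I. ((\<lambda>k. if k = p then x else if k = i then 1 else 0) k) * ((\<lambda>k. if k = p then x else if k = i then 1 else 0) j) * r k j)
        = (\<Sum>k\<in>I. \<Sum>j\<in>I. if j = i then (if k = i then r i i else 0) else 0)"
        using insert.hyps by (intro sum.cong) auto
      also have "\<dots> = r i i" using i insert.hyps by (simp add: sum.delta)
      finally show ?thesis
        using psd[of "\<lambda>k. if k = p then x else if k = i then 1 else 0"] 1 True unfolding expand by simp
    qed
    have "r i p = 0"
    proof (rule ccontr)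
      assume "r i p \<noteq> 0"
      \<comment> \<open>For this \<open>x\<close> the form has the value -1.\<close>
      then show False using q[of "- (r i i + 1) / (2 * r i p)"] by (simp add: field_simps)
    qed
    then show ?thesis using True by simp
  qed (simp add: e_def)
  define r' where "r' i j = r i j - e i * e j * r p p" for i j
  have "\<exists>v. \<forall>i\<in>I. \<forall>j\<in>I. r' i j = (\<Sum>k\<in>I. v i k * v j k)"
  proof (rule insert.IH)
    show "r' i j = r' j i" if "i \<in> I" "j \<in> I" for i j
      using that sym by (simp add: r'_def mult_ac)
    show "0 \<le> (\<Sum>i\<in>I. \<Sum>j\<in>I. c i * c j * r' i j)" for c
    proof -
      \<comment> \<open>With the coefficients \<open>c\<close> on \<open>I\<close> fixed,
        \<open>- E\<close> is a minimizer of the form in the coefficient at \<open>p\<close>, and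
        the minimum is the form of the Schur complement.\<close>
      define E where "E = (\<Sum>i\<in>I. c i * e i)"
      have "(\<Sum>i\<in>I. \<Sum>j\<in>I. c i * c j * r' i j) = (\<Sum>i\<in>I. \<Sum>j\<in>I. c i * c j * r i j) - E * E * r p p"
        unfolding r'_def E_def sum_product
        by (simp add: sum_subtractf right_diff_distrib sum_distrib_left sum_distrib_right mult_ac)
      moreover have "(\<Sum>i\<in>I. c i * r i p) = E * r p p"
        unfolding E_def sum_distrib_right by (intro sum.cong) (auto simp: rip mult_ac)
      moreover have *: "(\<Sum>i\<in>I. (c(p := - E)) i * r i p) = (\<Sum>i\<in>I. c i * r i p)"
        using insert.hyps by (intro sum.cong) auto
      moreover have **: "(\<Sum>i\<in>I. \<Sum>j\<in>I. (c(p := - E)) i * (c(p := - E)) j * r i j) = (\<Sum>i\<in>I. \<Sum>j\<in>I. c i * c j * r i j)"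
        using insert.hyps by (intro sum.cong) auto
      ultimately show ?thesis using psd[of "c(p := - E)"] unfolding expand * ** by simp
    qed
  qed
  then obtain v where v: "\<And>i j. i \<in> I \<Longrightarrow> j \<in> I \<Longrightarrow> r' i j = (\<Sum>k\<in>I. v i k * v j k)" by blast
  define w where "w i k = (if k = p then (if i = p then sqrt (r p p) else e i * sqrt (r p p)) else if i = p then 0 else v i k)" for i k
  have sq: "sqrt (r p p) * sqrt (r p p) = r p p" using rpp by simp
  have "r i j = (\<Sum>k\<in>insert p I. w i k * w j k)" if "i \<in> insert p I" "j \<in> insert p I" for i j
  proof -
    have "(\<Sum>k\<in>insert p I. w i k * w j k) = w i p * w j p + (\<Sum>k\<in>I. w i k * w j k)"
      using insert.hyps by simp
    also have "(\<Sum>k\<in>I. w i k * w j k) = (if i = p \<or> j = p then 0 else r' i j)"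
    proof (cases "i = p \<or> j = p")
      case True
      then show ?thesis using insert.hyps by (auto simp: w_def intro!: sum.neutral)
    next
      case False
      then have "(\<Sum>k\<in>I. w i k * w j k) = (\<Sum>k\<in>I. v i k * v j k)"
        using insert.hyps by (intro sum.cong) (auto simp: w_def)
      then show ?thesis using v[of i j] that False by auto
    qed
    also have "w i p * w j p + (if i = p \<or> j = p then 0 else r' i j) = r i j"
      using that sym[of p j] rip[of i] rip[of j] sq insert.hyps
      by (auto simp: w_def r'_def algebra_simps)
    finally show ?thesis by simp
  qed
  then show ?case by blast
qed

text \<open>A factorization of \<open>r\<close> as \<open>v\<close> times its transpose maps
  independent standard normal coordinates to a vector with covariance \<open>r\<close>. This
  supplies the independent remainder on a space of its own.\<close>

lemma gaussian_vector_exists: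
  fixes r :: "'i \<Rightarrow> 'i \<Rightarrow> real"
  assumes "finite I" and "\<And>i j. i \<in> I \<Longrightarrow> j \<in> I \<Longrightarrow> r i j = r j i"
    and "\<And>c. (\<Sum>i\<in>I. \<Sum>j\<in>I. c i * c j * r i j) \<ge> 0"
  shows "\<exists>(P :: ('i \<Rightarrow> real) measure) R. prob_space P \<and>
    (\<forall>c. gauss_rv P (\<lambda>\<omega>. \<Sum>i\<in>I. c i * R i \<omega>) (\<Sum>i\<in>I. \<Sum>j\<in>I. c i * c j * r i j)) \<and> (\<forall>i\<in>I. R i \<in> borel_measurable P)"
proof -
  obtain v where v: "\<And>i j. i \<in> I \<Longrightarrow> j \<in> I \<Longrightarrow> r i j = (\<Sum>k\<in>I. v i k * v j k)"
    using psd_factor[OF assms] by blast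
  interpret N: real_distribution std_normal_distribution by (rule real_dist_normal_dist)
  interpret S: product_sigma_finite "\<lambda>_::'i. std_normal_distribution"
    by unfold_locales
  define P where "P = PiM I (\<lambda>_. std_normal_distribution)"
  interpret P: prob_space P unfolding P_def by (rule prob_space_PiM) unfold_locales
  define R where "R i \<omega> = (\<Sum>k\<in>I. v i k * \<omega> k)" for i and \<omega> :: "'i \<Rightarrow> real"
  have m[measurable]: "(\<lambda>\<omega>. \<omega> k) \<in> borel_measurable P" if "k \<in> I" for k
    using measurable_component_singleton[OF that, of "\<lambda>_. std_normal_distribution"] unfolding P_def by simp
  have R[measurable]: "R i \<in> borel_measurable P" for i unfolding R_def by measurable
  have "gauss_rv P (\<lambda>\<omega>. \<Sum>i\<in>I. c i * R i \<omega>) (\<Sum>i\<in>I. \<Sum>j\<in>I. c i * c j * r i j)" for c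
  proof (rule P.gauss_rv_charI)
    define d where "d k = (\<Sum>i\<in>I. c i * v i k)" for k
    have lin: "(\<Sum>i\<in>I. c i * R i \<omega>) = (\<Sum>k\<in>I. d k * \<omega> k)" for \<omega>
      unfolding R_def d_def sum_distrib_left sum_distrib_right
      by (subst sum.swap) (simp add: mult_ac)
    have var: "(\<Sum>i\<in>I. \<Sum>j\<in>I. c i * c j * r i j) = (\<Sum>k\<in>I. (d k)\<^sup>2)"
    proof -
      have "(\<Sum>i\<in>I. \<Sum>j\<in>I. c i * c j * r i j) = (\<Sum>i\<in>I. \<Sum>j\<in>I. \<Sum>k\<in>I. (c i * v i k) * (c j * v j k))"
        by (intro sum.cong refl) (simp add: v sum_distrib_left mult_ac)
      also have "\<dots> = (\<Sum>i\<in>I. \<Sum>k\<in>I. \<Sum>j\<in>I. (c i * v i k) * (c j * v j k))"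
        by (intro sum.cong refl sum.swap)
      also have "\<dots> = (\<Sum>k\<in>I. \<Sum>i\<in>I. \<Sum>j\<in>I. (c i * v i k) * (c j * v j k))"
        by (rule sum.swap)
      finally show ?thesis by (simp add: d_def power2_eq_square sum_product)
    qed
    show "(\<lambda>\<omega>. \<Sum>i\<in>I. c i * R i \<omega>) \<in> borel_measurable P" by measurable
    show "0 \<le> (\<Sum>i\<in>I. \<Sum>j\<in>I. c i * c j * r i j)" by fact
    fix u
    have "(LINT \<omega>|P. iexp (u * (\<Sum>i\<in>I. c i * R i \<omega>))) = (LINT \<omega>|P. (\<Prod>k\<in>I. iexp (u * d k * \<omega> k)))"
      unfolding lin using \<open>finite I\<close> by (simp add: exp_sum[symmetric] sum_distrib_left mult_ac)
    also have "\<dots> = (\<Prod>k\<in>I. char std_normal_distribution (u * d k))"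
      unfolding P_def char_def using \<open>finite I\<close>
      by (intro S.product_integral_prod N.integrable_iexp) auto
    also have "\<dots> = of_real (\<Prod>k\<in>I. exp (- (u\<^sup>2 * (d k)\<^sup>2) / 2))"
      by (simp add: char_std_normal_distribution power_mult_distrib)
    also have "\<dots> = of_real (exp (- (u\<^sup>2 * (\<Sum>i\<in>I. \<Sum>j\<in>I. c i * c j * r i j)) / 2))"
      unfolding var using \<open>finite I\<close> by (simp add: exp_sum[symmetric] sum_distrib_left sum_negf sum_divide_distrib)
    finally show "(LINT \<omega>|P. iexp (u * (\<Sum>i\<in>I. c i * R i \<omega>))) = \<dots>" .
  qed
  then show ?thesis using P.prob_space_axioms R by blast
qed

section \<open>Transfer of convergence in distribution\<close>

text \<open>\<open>X N\<close> and \<open>Y N\<close> live on different spaces, so only their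
  characteristic functions can be compared; Levy's continuity theorem is used in both
  directions.\<close>

lemma weak_conv_m_transfer:
  assumes "prob_space P" "prob_space Q" "real_distribution L"
    and [measurable]: "\<And>N. X N \<in> borel_measurable P" "\<And>N. Y N \<in> borel_measurable Q"
    and w: "weak_conv_m (\<lambda>N. distr Q borel (Y N)) L"
    and diff: "\<And>u. (\<lambda>N. (LINT \<omega>|P. iexp (u * X N \<omega>)) - (LINT \<omega>|Q. iexp (u * Y N \<omega>))) \<longlonglongrightarrow> 0"
  shows "weak_conv_m (\<lambda>N. distr P borel (X N)) L"
proof -
  interpret P: prob_space P by fact
  interpret Q: prob_space Q by fact
  have Y: "real_distribution (distr Q borel (Y N))" for N by (rule Q.real_distribution_distr) simp
  have X: "real_distribution (distr P borel (X N))" for N by (rule P.real_distribution_distr) simp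
  show ?thesis
  proof (rule levy_continuity[OF X assms(3)])
    fix u
    have cX: "char (distr P borel (X N)) u = (LINT \<omega>|P. iexp (u * X N \<omega>))" for N
      unfolding char_def by (subst integral_distr) auto
    have cY: "char (distr Q borel (Y N)) u = (LINT \<omega>|Q. iexp (u * Y N \<omega>))" for N
      unfolding char_def by (subst integral_distr) auto
    have "(\<lambda>N. char (distr Q borel (Y N)) u) \<longlonglongrightarrow> char L u"
      by (rule levy_continuity1[OF Y assms(3) w])
    from tendsto_add[OF diff[of u] this]
    show "(\<lambda>N. char (distr P borel (X N)) u) \<longlonglongrightarrow> char L u"
      by (simp add: cX cY)
  qed
qed

text \<open>Skorohod's representation replaces convergence in distribution by pointwise convergence
  of the normalized errors. Differentiability of \<open>g\<close> enters through the Caratheodory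
  quotient \<open>q\<close>, continuous at \<open>p\<close>, so that there is no remainder term to
  control.\<close>

lemma delta_method:
  assumes "prob_space P" and [measurable]: "\<And>N. V N \<in> borel_measurable P" "g \<in> borel_measurable borel"
    and w: "w \<ge> 0" and conv: "weak_conv_m (\<lambda>N. distr P borel (\<lambda>\<omega>. sqrt (real N) * (V N \<omega> - p))) (normal_law w)"
    and g: "(g has_real_derivative d) (at p)"
  shows "weak_conv_m (\<lambda>N. distr P borel (\<lambda>\<omega>. sqrt (real N) * (g (V N \<omega>) - g p))) (normal_law (d\<^sup>2 * w))"
proof -
  interpret P: prob_space P by fact
  have D: "real_distribution (distr P borel (\<lambda>\<omega>. sqrt (real N) * (V N \<omega> - p)))" for N
    by (rule P.real_distribution_distr) simp
  from Skorohod[OF D real_distribution_normal_law[OF w] conv]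
  obtain \<Omega> :: "real measure" and Y Z where "prob_space \<Omega>"
    and [measurable]: "\<And>n. Y n \<in> borel_measurable \<Omega>"
    and Y: "\<And>n. distr \<Omega> borel (Y n) = distr P borel (\<lambda>\<omega>. sqrt (real n) * (V n \<omega> - p))"
    and Z': "Z \<in> measurable \<Omega> lborel" and Z: "distr \<Omega> borel Z = normal_law w"
    and lim: "\<And>x. x \<in> space \<Omega> \<Longrightarrow> (\<lambda>n. Y n x) \<longlonglongrightarrow> Z x" by blast
  interpret O: prob_space \<Omega> by fact
  have [measurable]: "Z \<in> borel_measurable \<Omega>" using Z' by simp
  \<comment> \<open>Expresses the transformed statistic through the normalized error alone, so that
    its law can be computed on \<open>\<Omega>\<close>. For \<open>N = 0\<close> both sides are 0
    because \<open>sqrt 0 = 0\<close>.\<close>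
  define \<phi> where "\<phi> N y = sqrt (real N) * (g (p + y / sqrt (real N)) - g p)" for N y
  have [measurable]: "\<phi> N \<in> borel_measurable borel" for N unfolding \<phi>_def by measurable
  have law: "distr P borel (\<lambda>\<omega>. sqrt (real N) * (g (V N \<omega>) - g p)) = distr \<Omega> borel (\<lambda>x. \<phi> N (Y N x))" for N
  proof -
    have "sqrt (real N) * (g (V N \<omega>) - g p) = \<phi> N (sqrt (real N) * (V N \<omega> - p))" for \<omega>
      by (cases "N = 0") (auto simp: \<phi>_def)
    then have "distr P borel (\<lambda>\<omega>. sqrt (real N) * (g (V N \<omega>) - g p))
      = distr (distr P borel (\<lambda>\<omega>. sqrt (real N) * (V N \<omega> - p))) borel (\<phi> N)"
      by (subst distr_distr) (auto simp: o_def)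
    also have "\<dots> = distr \<Omega> borel (\<lambda>x. \<phi> N (Y N x))"
      unfolding Y[symmetric] by (subst distr_distr) (auto simp: o_def)
    finally show ?thesis .
  qed
  obtain q where q: "\<And>z. g z - g p = q z * (z - p)" and qc: "isCont q p" and qp: "q p = d"
    using g unfolding CARAT_DERIV by blast
  have lim': "(\<lambda>N. \<phi> N (Y N x)) \<longlonglongrightarrow> d * Z x" if x: "x \<in> space \<Omega>" for x
  proof -
    have inv: "(\<lambda>N. 1 / sqrt (real N)) \<longlonglongrightarrow> 0"
      by real_asymp
    have "(\<lambda>N. p + Y N x * (1 / sqrt (real N))) \<longlonglongrightarrow> p + Z x * 0"
      by (intro tendsto_intros lim x inv)
    then have "(\<lambda>N. p + Y N x / sqrt (real N)) \<longlonglongrightarrow> p" by simp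
    then have "(\<lambda>N. q (p + Y N x / sqrt (real N)) * Y N x) \<longlonglongrightarrow> d * Z x"
      using isCont_tendsto_compose[OF qc] lim[OF x] qp by (intro tendsto_mult) auto
    moreover have "\<forall>\<^sub>F N in sequentially. q (p + Y N x / sqrt (real N)) * Y N x = \<phi> N (Y N x)"
      using eventually_gt_at_top[of 0] by eventually_elim (simp add: \<phi>_def q)
    ultimately show ?thesis by (rule Lim_transform_eventually)
  qed
  have "gauss_rv \<Omega> Z w" using Z w by (simp add: gauss_rv_def)
  then have gd: "gauss_rv \<Omega> (\<lambda>x. d * Z x) (d\<^sup>2 * w)" by (rule gauss_rv_scale) fact
  show ?thesis unfolding law
  proof (rule levy_continuity)
    show "real_distribution (distr \<Omega> borel (\<lambda>x. \<phi> N (Y N x)))" for N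
      by (rule O.real_distribution_distr) simp
    show "real_distribution (normal_law (d\<^sup>2 * w))" using w by (intro real_distribution_normal_law) simp
    fix u
    have "(\<lambda>N. LINT x|\<Omega>. iexp (u * \<phi> N (Y N x))) \<longlonglongrightarrow> (LINT x|\<Omega>. iexp (u * (d * Z x)))"
      by (rule integral_dominated_convergence[where w="\<lambda>_. 1"])
        (auto intro!: AE_I2 tendsto_intros lim' simp del: of_real_mult)
    then show "(\<lambda>N. char (distr \<Omega> borel (\<lambda>x. \<phi> N (Y N x))) u) \<longlonglongrightarrow> char (normal_law (d\<^sup>2 * w)) u"
      using gauss_rv_char[OF gd, of u] w unfolding char_normal_law[OF gauss_rvD(2)[OF gd]]
      by (simp add: char_def integral_distr)
  qed
qed

section \<open>The Riesz kernel as a mixture of Gaussian convolutions\<close>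

lemma fst_snd_borel[measurable]:
  "fst \<in> borel_measurable (borel :: ('a::topological_space \<times> 'b::topological_space) measure)"
  "snd \<in> borel_measurable (borel :: ('a \<times> 'b) measure)"
  by (intro borel_measurable_continuous_onI continuous_intros)+

text \<open>The factor 2 is chosen such that integrating \<open>gk u p x * gk u p y\<close> over
  \<open>p\<close> leaves \<open>exp (- (x - y)\<^sup>2 * u)\<close>, up to the factor
  \<open>sqrt (pi / (4 * u))\<close>.\<close>

definition gk :: "real \<Rightarrow> real \<Rightarrow> real \<Rightarrow> real" where
  "gk u p x = exp (- (2 * u * (x - p)\<^sup>2))"

text \<open>The constant is chosen such that the integral of
  \<open>rw \<gamma> u * gk u p x * gk u p y\<close> over \<open>u\<close> and \<open>p\<close> is the Riesz kernel.\<close>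

definition rw :: "real \<Rightarrow> real \<Rightarrow> real" where
  "rw \<gamma> u = indicator {0<..} u * (2 * u powr (- 2 * \<gamma>) / (2 powr (4*\<gamma>) * pi * Gamma (2*\<gamma>)))"

lemma gk_measurable[measurable (raw)]:
  assumes [measurable]: "u \<in> borel_measurable M" "p \<in> borel_measurable M" "x \<in> borel_measurable M"
  shows "(\<lambda>\<omega>. gk (u \<omega>) (p \<omega>) (x \<omega>)) \<in> borel_measurable M"
  unfolding gk_def by measurable

lemma rw_measurable[measurable]: "rw \<gamma> \<in> borel_measurable borel"
  unfolding rw_def by measurable

lemma riesz_kernel_measurable[measurable]: "riesz_kernel \<gamma> \<in> borel_measurable borel"
  unfolding riesz_kernel_def by measurable

lemma gk_nonneg[simp]: "gk u p x \<ge> 0" by (simp add: gk_def)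

lemma rw_nonneg: "\<gamma> > 0 \<Longrightarrow> rw \<gamma> u \<ge> 0"
  using Gamma_real_pos[of "2 * \<gamma>"] by (simp add: rw_def less_imp_le)

lemma riesz_kernel_nonneg: "0 < \<gamma> \<Longrightarrow> \<gamma> < 1/4 \<Longrightarrow> riesz_kernel \<gamma> x \<ge> 0"
  using Gamma_real_pos[of "2 * \<gamma>"] Gamma_real_pos[of "1/2 - 2 * \<gamma>"] by (simp add: riesz_kernel_def less_imp_le)

lemma nn_integral_gamma_scaled:
  assumes a: "a > (0::real)" and c: "c > (0::real)"
  shows "(\<integral>\<^sup>+u. ennreal (indicator {0<..} u * u powr (a - 1) * exp (- (c * u))) \<partial>lborel) = ennreal (Gamma a * c powr (- a))"
proof -
  define I where "I = (\<integral>\<^sup>+u. ennreal (indicator {0<..} u * u powr (a - 1) * exp (- (c * u))) \<partial>lborel)"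
  have "ennreal (Gamma a) = (\<integral>\<^sup>+t. ennreal (indicator {0..} t * t powr (a - 1) / exp t) \<partial>lborel)"
    using Gamma_conv_nn_integral_real[OF a] .
  also have "\<dots> = ennreal c * (\<integral>\<^sup>+t. ennreal (indicator {0..} (c * t) * (c * t) powr (a - 1) / exp (c * t)) \<partial>lborel)"
    using c by (subst nn_integral_real_affine[where c=c and t=0]) auto
  also have "\<dots> = ennreal c * (\<integral>\<^sup>+t. ennreal (c powr (a - 1)) * ennreal (indicator {0<..} t * t powr (a - 1) * exp (- (c * t))) \<partial>lborel)"
  proof (intro arg_cong[where f="\<lambda>x. ennreal c * x"] nn_integral_cong)
    fix t :: real
    show "ennreal (indicator {0..} (c * t) * (c * t) powr (a - 1) / exp (c * t))
      = ennreal (c powr (a - 1)) * ennreal (indicator {0<..} t * t powr (a - 1) * exp (- (c * t)))"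
      using c by (subst ennreal_mult'[symmetric])
        (auto simp: indicator_def powr_mult exp_minus field_simps zero_le_mult_iff)
  qed
  also have "\<dots> = ennreal c * (ennreal (c powr (a - 1)) * I)"
    unfolding I_def by (subst nn_integral_cmult) auto
  also have "\<dots> = ennreal (c powr a) * I"
    using c by (simp add: mult.assoc[symmetric] ennreal_mult'[symmetric] powr_mult_base)
  finally have eq: "ennreal (c powr a) * I = ennreal (Gamma a)" by simp
  \<comment> \<open>Multiplying by \<open>c powr (- a)\<close> instead of dividing keeps the
    computation in the extended nonnegative reals.\<close>
  have "ennreal (c powr (- a)) * (ennreal (c powr a) * I) = I"
    using c by (simp add: mult.assoc[symmetric] ennreal_mult'[symmetric] powr_add[symmetric])
  then have "I = ennreal (c powr (- a)) * ennreal (Gamma a)" using eq by simp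
  then show ?thesis
    unfolding I_def[symmetric] using c by (simp add: ennreal_mult''[symmetric] mult.commute)
qed

lemma nn_integral_gk_gk:
  assumes u: "u > 0"
  shows "(\<integral>\<^sup>+p. ennreal (gk u p x * gk u p y) \<partial>lborel) = ennreal (sqrt (pi / (4 * u)) * exp (- (x - y)\<^sup>2 * u))"
proof -
  \<comment> \<open>After completing the square the coefficient of
    \<open>(p - (x + y) / 2)\<^sup>2\<close> is \<open>4 * u\<close>, which has to equal
    \<open>1 / (2 * \<tau>\<^sup>2)\<close>.\<close>
  define \<tau> where "\<tau> = 1 / sqrt (8 * u)"
  have \<tau>: "\<tau> > 0" "\<tau>\<^sup>2 = 1 / (8 * u)" using u by (auto simp: \<tau>_def power_divide)
  have alg: "2 * u * (x - p)\<^sup>2 + 2 * u * (y - p)\<^sup>2 = 4 * u * (p - (x + y) / 2)\<^sup>2 + (x - y)\<^sup>2 * u" for p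
    by (simp add: power2_eq_square field_simps)
  have eq: "gk u p x * gk u p y = (sqrt (pi / (4 * u)) * exp (- (x - y)\<^sup>2 * u)) * normal_density ((x + y) / 2) \<tau> p" for p
  proof -
    have "gk u p x * gk u p y = exp (- (2 * u * (x - p)\<^sup>2 + 2 * u * (y - p)\<^sup>2))"
      by (simp add: gk_def exp_add[symmetric])
    also have "\<dots> = exp (- (x - y)\<^sup>2 * u) * exp (- (4 * u * (p - (x + y) / 2)\<^sup>2))"
      unfolding alg by (simp add: exp_add[symmetric])
    also have "exp (- (4 * u * (p - (x + y) / 2)\<^sup>2)) = sqrt (pi / (4 * u)) * normal_density ((x + y) / 2) \<tau> p"
      using u unfolding normal_density_def \<tau>(2) by (simp add: field_simps)
    finally show ?thesis by simp
  qed
  interpret prob_space "density lborel (normal_density ((x + y) / 2) \<tau>)"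
    by (rule prob_space_normal_density) fact
  have "(\<integral>\<^sup>+p. ennreal (normal_density ((x + y) / 2) \<tau> p) \<partial>lborel) = 1"
    using emeasure_space_1 by (simp add: emeasure_density)
  then show ?thesis
    unfolding eq using u by (simp add: ennreal_mult' nn_integral_cmult)
qed

text \<open>The integral over \<open>p\<close> contributes
  \<open>u powr (- 1/2) * exp (- (x - y)\<^sup>2 * u)\<close> up to a constant. What remains is a
  Gamma integral in \<open>u\<close> of order \<open>1/2 - 2 * \<gamma>\<close>, positive because
  \<open>\<gamma> < 1/4\<close>, with rate \<open>(x - y)\<^sup>2\<close>; positivity of the rate
  excludes the diagonal.\<close>

lemma kernel_rep:
  assumes \<gamma>: "0 < \<gamma>" "\<gamma> < 1/4" and xy: "x \<noteq> y"
  shows "(\<integral>\<^sup>+w. ennreal (case w of (u, p) \<Rightarrow> rw \<gamma> u * (gk u p x * gk u p y)) \<partial>lborel) = ennreal (riesz_kernel \<gamma> (x - y))"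
proof -
  define C where "C = 1 / (2 powr (4*\<gamma>) * sqrt pi * Gamma (2*\<gamma>))"
  have C: "C \<ge> 0" using Gamma_real_pos[of "2 * \<gamma>"] \<gamma> by (simp add: C_def less_imp_le)
  have "(\<integral>\<^sup>+w. ennreal (case w of (u, p) \<Rightarrow> rw \<gamma> u * (gk u p x * gk u p y)) \<partial>lborel)
     = (\<integral>\<^sup>+u. \<integral>\<^sup>+p. ennreal (rw \<gamma> u * (gk u p x * gk u p y)) \<partial>lborel \<partial>lborel)"
    unfolding lborel_prod[symmetric] by (subst lborel.nn_integral_fst[symmetric]) auto
  also have "\<dots> = (\<integral>\<^sup>+u. ennreal (rw \<gamma> u) * (\<integral>\<^sup>+p. ennreal (gk u p x * gk u p y) \<partial>lborel) \<partial>lborel)"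
    using rw_nonneg[OF \<gamma>(1)] by (simp add: ennreal_mult' nn_integral_cmult)
  also have "\<dots> = (\<integral>\<^sup>+u. ennreal C * ennreal (indicator {0<..} u * u powr ((1/2 - 2*\<gamma>) - 1) * exp (- ((x - y)\<^sup>2 * u))) \<partial>lborel)"
  proof (intro nn_integral_cong)
    fix u :: real
    show "ennreal (rw \<gamma> u) * (\<integral>\<^sup>+p. ennreal (gk u p x * gk u p y) \<partial>lborel)
      = ennreal C * ennreal (indicator {0<..} u * u powr ((1/2 - 2*\<gamma>) - 1) * exp (- ((x - y)\<^sup>2 * u)))"
    proof (cases "u > 0")
      case True
      have sq: "sqrt (pi / (4 * u)) = sqrt pi / 2 * u powr (- 1/2)"
        using True by (simp add: real_sqrt_divide real_sqrt_mult powr_minus powr_half_sqrt field_simps)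
      have pw: "u powr ((1/2 - 2*\<gamma>) - 1) = u powr (- 2 * \<gamma>) * u powr (- 1/2)"
        unfolding powr_add[symmetric] by (rule arg_cong[where f="\<lambda>r. u powr r"]) simp
      \<comment> \<open>Writing \<open>pi\<close> as \<open>S * S\<close> leaves powers of a single
        number, so that the constants cancel by field arithmetic.\<close>
      obtain S where S: "S > 0" "sqrt pi = S" "pi = S * S"
        by (rule that[of "sqrt pi"]) simp_all
      have rw: "rw \<gamma> u = 2 * u powr (- 2 * \<gamma>) / (2 powr (4*\<gamma>) * (S * S) * Gamma (2*\<gamma>))"
        using True unfolding S(3)[symmetric] rw_def by simp
      have sq: "sqrt (pi / (4 * u)) = S / 2 * u powr (- 1/2)" using sq S(2) by simp
      have "rw \<gamma> u * (sqrt (pi / (4 * u)) * exp (- (x - y)\<^sup>2 * u))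
         = 2 * u powr (- 2 * \<gamma>) / (2 powr (4*\<gamma>) * (S * S) * Gamma (2*\<gamma>)) * (S / 2 * u powr (- 1/2) * exp (- (x - y)\<^sup>2 * u))"
        unfolding rw sq ..
      also have "\<dots> = 1 / (2 powr (4*\<gamma>) * S * Gamma (2*\<gamma>)) * ((u powr (- 2 * \<gamma>) * u powr (- 1/2)) * exp (- ((x - y)\<^sup>2 * u)))"
        using S(1) by simp
      also have "\<dots> = C * (indicator {0<..} u * u powr ((1/2 - 2*\<gamma>) - 1) * exp (- ((x - y)\<^sup>2 * u)))"
        using True unfolding C_def S(2) pw by simp
      finally have "rw \<gamma> u * (sqrt (pi / (4 * u)) * exp (- (x - y)\<^sup>2 * u)) = \<dots>" .
      then show ?thesis
        unfolding nn_integral_gk_gk[OF True]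
        using rw_nonneg[OF \<gamma>(1), of u] C True by (subst (1 2) ennreal_mult[symmetric]) auto
    qed (simp add: rw_def)
  qed
  also have "\<dots> = ennreal C * ennreal (Gamma (1/2 - 2*\<gamma>) * ((x - y)\<^sup>2) powr (- (1/2 - 2*\<gamma>)))"
    using \<gamma> xy by (subst nn_integral_cmult, simp, subst nn_integral_gamma_scaled) auto
  also have "((x - y)\<^sup>2) powr (- (1/2 - 2*\<gamma>)) = \<bar>x - y\<bar> powr (4*\<gamma> - 1)"
  proof -
    have eq: "(x - y)\<^sup>2 = \<bar>x - y\<bar> powr 2" using xy by (simp add: powr_numeral)
    show ?thesis unfolding eq powr_powr by (simp add: algebra_simps)
  qed
  also have "ennreal C * ennreal (Gamma (1/2 - 2*\<gamma>) * \<bar>x - y\<bar> powr (4*\<gamma> - 1)) = ennreal (riesz_kernel \<gamma> (x - y))"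
    using C by (simp add: ennreal_mult'[symmetric] C_def riesz_kernel_def)
  finally show ?thesis .
qed

lemma AE_fst_neq_snd: "AE z in (lborel :: (real \<times> real) measure). fst z \<noteq> snd z"
  unfolding lborel_prod[symmetric]
proof (rule lborel_pair.AE_pair_measure)
  show "{z \<in> space (lborel \<Otimes>\<^sub>M lborel). fst z \<noteq> snd z} \<in> sets (lborel \<Otimes>\<^sub>M (lborel :: real measure))"
    by measurable
  have "AE y in lborel. fst (x, y) \<noteq> snd (x, y)" for x :: real
    using AE_lborel_singleton[of x] by eventually_elim simp
  then show "AE x in lborel. AE y in (lborel :: real measure). fst (x, y) \<noteq> snd (x, y)" by simp
qed

text \<open>Tonelli moves the mixture outside, where the double integral factors into Gaussian
  averages. The diagonal, about which \<open>kernel_rep\<close> says nothing, is a null set.\<close>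

lemma nn_kform_rep:
  fixes a b :: "real \<Rightarrow> ennreal"
  assumes \<gamma>: "0 < \<gamma>" "\<gamma> < 1/4" and [measurable]: "a \<in> borel_measurable borel" "b \<in> borel_measurable borel"
  shows "(\<integral>\<^sup>+z. (case z of (x, y) \<Rightarrow> a x * b y * ennreal (riesz_kernel \<gamma> (x - y))) \<partial>lborel)
    = (\<integral>\<^sup>+w. (case w of (u, p) \<Rightarrow> ennreal (rw \<gamma> u) * ((\<integral>\<^sup>+x. a x * ennreal (gk u p x) \<partial>lborel) * (\<integral>\<^sup>+y. b y * ennreal (gk u p y) \<partial>lborel))) \<partial>lborel)"
proof -
  have "(\<integral>\<^sup>+z. (case z of (x, y) \<Rightarrow> a x * b y * ennreal (riesz_kernel \<gamma> (x - y))) \<partial>lborel)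
     = (\<integral>\<^sup>+z. (\<integral>\<^sup>+w. a (fst z) * b (snd z) * ennreal (rw \<gamma> (fst w) * (gk (fst w) (snd w) (fst z) * gk (fst w) (snd w) (snd z))) \<partial>lborel) \<partial>lborel)"
  proof (intro nn_integral_cong_AE, use AE_fst_neq_snd in eventually_elim)
    fix z :: "real \<times> real" assume "fst z \<noteq> snd z"
    from kernel_rep[OF \<gamma> this]
    show "(case z of (x, y) \<Rightarrow> a x * b y * ennreal (riesz_kernel \<gamma> (x - y)))
      = (\<integral>\<^sup>+w. a (fst z) * b (snd z) * ennreal (rw \<gamma> (fst w) * (gk (fst w) (snd w) (fst z) * gk (fst w) (snd w) (snd z))) \<partial>lborel)"
      by (subst nn_integral_cmult) (auto simp: split_beta)
  qed
  also have "\<dots> = (\<integral>\<^sup>+w. (\<integral>\<^sup>+z. a (fst z) * b (snd z) * ennreal (rw \<gamma> (fst w) * (gk (fst w) (snd w) (fst z) * gk (fst w) (snd w) (snd z))) \<partial>lborel) \<partial>lborel)"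
    by (rule lborel_pair.Fubini') simp
  also have "\<dots> = (\<integral>\<^sup>+w. (case w of (u, p) \<Rightarrow> ennreal (rw \<gamma> u) * ((\<integral>\<^sup>+x. a x * ennreal (gk u p x) \<partial>lborel) * (\<integral>\<^sup>+y. b y * ennreal (gk u p y) \<partial>lborel))) \<partial>lborel)"
  proof (intro nn_integral_cong)
    fix w :: "real \<times> real"
    obtain u p where w: "w = (u, p)" by force
    have "(\<integral>\<^sup>+z. a (fst z) * b (snd z) * ennreal (rw \<gamma> u * (gk u p (fst z) * gk u p (snd z))) \<partial>lborel)
      = (\<integral>\<^sup>+x. \<integral>\<^sup>+y. ennreal (rw \<gamma> u) * (a x * ennreal (gk u p x)) * (b y * ennreal (gk u p y)) \<partial>lborel \<partial>lborel)"
      unfolding lborel_prod[symmetric]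
      by (subst lborel.nn_integral_fst[symmetric])
        (auto simp: ennreal_mult rw_nonneg[OF \<gamma>(1)] mult_ac)
    also have "\<dots> = ennreal (rw \<gamma> u) * ((\<integral>\<^sup>+x. a x * ennreal (gk u p x) \<partial>lborel) * (\<integral>\<^sup>+y. b y * ennreal (gk u p y) \<partial>lborel))"
    proof -
      have "(\<integral>\<^sup>+y. ennreal (rw \<gamma> u) * (a x * ennreal (gk u p x)) * (b y * ennreal (gk u p y)) \<partial>lborel)
        = ennreal (rw \<gamma> u) * (a x * ennreal (gk u p x)) * (\<integral>\<^sup>+y. b y * ennreal (gk u p y) \<partial>lborel)" for x
        by (rule nn_integral_cmult) measurable
      moreover have "(\<integral>\<^sup>+x. ennreal (rw \<gamma> u) * (a x * ennreal (gk u p x)) * (\<integral>\<^sup>+y. b y * ennreal (gk u p y) \<partial>lborel) \<partial>lborel)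
        = (\<integral>\<^sup>+x. ennreal (rw \<gamma> u) * (a x * ennreal (gk u p x)) \<partial>lborel) * (\<integral>\<^sup>+y. b y * ennreal (gk u p y) \<partial>lborel)"
        by (rule nn_integral_multc) measurable
      moreover have "(\<integral>\<^sup>+x. ennreal (rw \<gamma> u) * (a x * ennreal (gk u p x)) \<partial>lborel) = ennreal (rw \<gamma> u) * (\<integral>\<^sup>+x. a x * ennreal (gk u p x) \<partial>lborel)"
        by (rule nn_integral_cmult) measurable
      ultimately show ?thesis by (simp add: mult.assoc)
    qed
    finally show "(\<integral>\<^sup>+z. a (fst z) * b (snd z) * ennreal (rw \<gamma> (fst w) * (gk (fst w) (snd w) (fst z) * gk (fst w) (snd w) (snd z))) \<partial>lborel)
      = (case w of (u, p) \<Rightarrow> ennreal (rw \<gamma> u) * ((\<integral>\<^sup>+x. a x * ennreal (gk u p x) \<partial>lborel) * (\<integral>\<^sup>+y. b y * ennreal (gk u p y) \<partial>lborel)))"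
      by (simp add: w)
  qed
  finally show ?thesis .
qed

text \<open>Under the positive weight of the mixture, the inequality
  \<open>s * t \<le> s * s + t * t\<close> is applied to the Gaussian averages of \<open>a\<close>
  and \<open>b\<close>. It makes mixed terms finite as soon as the two diagonal terms are.\<close>

lemma nn_kform_le:
  fixes a b :: "real \<Rightarrow> ennreal"
  assumes \<gamma>: "0 < \<gamma>" "\<gamma> < 1/4" and [measurable]: "a \<in> borel_measurable borel" "b \<in> borel_measurable borel"
  shows "(\<integral>\<^sup>+z. (case z of (x, y) \<Rightarrow> a x * b y * ennreal (riesz_kernel \<gamma> (x - y))) \<partial>lborel)
    \<le> (\<integral>\<^sup>+z. (case z of (x, y) \<Rightarrow> a x * a y * ennreal (riesz_kernel \<gamma> (x - y))) \<partial>lborel)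
     + (\<integral>\<^sup>+z. (case z of (x, y) \<Rightarrow> b x * b y * ennreal (riesz_kernel \<gamma> (x - y))) \<partial>lborel)"
proof -
  have le: "c * (s * t) \<le> c * (s * s) + c * (t * t)" for c s t :: ennreal
  proof (cases "s \<le> t")
    case True
    then have "c * (s * t) \<le> c * (t * t)" by (intro mult_left_mono mult_right_mono) auto
    then show ?thesis by (simp add: add_increasing)
  next
    case False
    then have "c * (s * t) \<le> c * (s * s)" by (intro mult_left_mono) auto
    then show ?thesis by (simp add: add_increasing2)
  qed
  show ?thesis
    unfolding nn_kform_rep[OF \<gamma> assms(3) assms(4)] nn_kform_rep[OF \<gamma> assms(3) assms(3)] nn_kform_rep[OF \<gamma> assms(4) assms(4)]
    by (subst nn_integral_add[symmetric]) (auto intro!: nn_integral_mono le simp: split_beta)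
qed

text \<open>Signed counterpart of \<open>nn_kform_rep\<close>, with Fubini licensed by the absolute
  integrability. The form becomes an integral of squares of Gaussian averages, hence nonnegative and
  accessible to \<open>plancherel\<close>.\<close>

lemma kform_square:
  fixes F :: "real \<Rightarrow> real"
  assumes \<gamma>: "0 < \<gamma>" "\<gamma> < 1/4" and [measurable]: "F \<in> borel_measurable borel"
    and i: "integrable lborel (\<lambda>(x, y). \<bar>F x\<bar> * \<bar>F y\<bar> * riesz_kernel \<gamma> (x - y))"
  shows "(LINT (x, y)|lborel. F x * F y * riesz_kernel \<gamma> (x - y)) \<ge> 0"
    and "ennreal (LINT (x, y)|lborel. F x * F y * riesz_kernel \<gamma> (x - y))
      = (\<integral>\<^sup>+w. ennreal (case w of (u, p) \<Rightarrow> rw \<gamma> u * (LINT x|lborel. F x * gk u p x)\<^sup>2) \<partial>lborel)"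
proof -
  define \<Phi> where "\<Phi> z w = (F (fst z) * F (snd z)) * (rw \<gamma> (fst w) * (gk (fst w) (snd w) (fst z) * gk (fst w) (snd w) (snd z)))"
    for z w :: "real \<times> real"
  have [measurable]: "(\<lambda>(z, w). \<Phi> z w) \<in> borel_measurable (borel \<Otimes>\<^sub>M borel)" unfolding \<Phi>_def by measurable
  have nnw: "(\<integral>\<^sup>+w. ennreal (rw \<gamma> (fst w) * (gk (fst w) (snd w) (fst z) * gk (fst w) (snd w) (snd z))) \<partial>lborel)
      = ennreal (riesz_kernel \<gamma> (fst z - snd z))" if "fst z \<noteq> snd z" for z
    using kernel_rep[OF \<gamma> that] by (simp add: split_beta)
  have K0: "riesz_kernel \<gamma> v \<ge> 0" for v by (rule riesz_kernel_nonneg) fact+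
  \<comment> \<open>For fixed \<open>z\<close> the integrand has a constant sign in
    \<open>w\<close>, so its absolute value integrates to the Riesz kernel and the remaining
    integral is the one assumed finite.\<close>
  have int\<Phi>: "integrable (lborel \<Otimes>\<^sub>M lborel) (\<lambda>(z, w). \<Phi> z w)"
  proof (rule integrableI_bounded)
    have "(\<integral>\<^sup>+q. ennreal (norm (case q of (z, w) \<Rightarrow> \<Phi> z w)) \<partial>(lborel \<Otimes>\<^sub>M lborel))
       = (\<integral>\<^sup>+z. \<integral>\<^sup>+w. ennreal \<bar>\<Phi> z w\<bar> \<partial>lborel \<partial>lborel)"
      by (subst lborel.nn_integral_fst[symmetric]) auto
    also have "\<dots> = (\<integral>\<^sup>+z. ennreal (case z of (x, y) \<Rightarrow> \<bar>F x\<bar> * \<bar>F y\<bar> * riesz_kernel \<gamma> (x - y)) \<partial>lborel)"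
    proof (intro nn_integral_cong_AE, use AE_fst_neq_snd in eventually_elim)
      fix z :: "real \<times> real" assume z: "fst z \<noteq> snd z"
      have "(\<integral>\<^sup>+w. ennreal \<bar>\<Phi> z w\<bar> \<partial>lborel)
        = (\<integral>\<^sup>+w. ennreal \<bar>F (fst z) * F (snd z)\<bar> * ennreal (rw \<gamma> (fst w) * (gk (fst w) (snd w) (fst z) * gk (fst w) (snd w) (snd z))) \<partial>lborel)"
        by (intro nn_integral_cong, subst ennreal_mult[symmetric])
          (auto simp: \<Phi>_def abs_mult rw_nonneg[OF \<gamma>(1)])
      also have "\<dots> = ennreal \<bar>F (fst z) * F (snd z)\<bar> * ennreal (riesz_kernel \<gamma> (fst z - snd z))"
        by (subst nn_integral_cmult) (auto simp: nnw[OF z])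
      also have "\<dots> = ennreal (case z of (x, y) \<Rightarrow> \<bar>F x\<bar> * \<bar>F y\<bar> * riesz_kernel \<gamma> (x - y))"
        using K0 by (subst ennreal_mult[symmetric]) (auto simp: split_beta abs_mult)
      finally show "(\<integral>\<^sup>+w. ennreal \<bar>\<Phi> z w\<bar> \<partial>lborel) = \<dots>" .
    qed
    also have "\<dots> = (\<integral>\<^sup>+z. ennreal (norm (case z of (x, y) \<Rightarrow> \<bar>F x\<bar> * \<bar>F y\<bar> * riesz_kernel \<gamma> (x - y))) \<partial>lborel)"
      using K0 by (intro nn_integral_cong) (auto simp: split_beta)
    also have "\<dots> < \<infinity>" using i by (simp add: integrable_iff_bounded)
    finally show "(\<integral>\<^sup>+q. ennreal (norm (case q of (z, w) \<Rightarrow> \<Phi> z w)) \<partial>(lborel \<Otimes>\<^sub>M lborel)) < \<infinity>" .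
  qed simp
  have 1: "(LINT (x, y)|lborel. F x * F y * riesz_kernel \<gamma> (x - y)) = (LINT z|lborel. LINT w|lborel. \<Phi> z w)"
  proof (intro integral_cong_AE, goal_cases)
    case 3
    show ?case
    proof (use AE_fst_neq_snd in eventually_elim)
      fix z :: "real \<times> real" assume z: "fst z \<noteq> snd z"
      have "(LINT w|lborel. rw \<gamma> (fst w) * (gk (fst w) (snd w) (fst z) * gk (fst w) (snd w) (snd z))) = riesz_kernel \<gamma> (fst z - snd z)"
        using nnw[OF z] K0 by (subst integral_eq_nn_integral) (auto simp: rw_nonneg[OF \<gamma>(1)])
      then show "(case z of (x, y) \<Rightarrow> F x * F y * riesz_kernel \<gamma> (x - y)) = (LINT w|lborel. \<Phi> z w)"
        by (simp add: \<Phi>_def split_beta)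
    qed
  qed measurable
  also have "\<dots> = (LINT w|lborel. LINT z|lborel. \<Phi> z w)"
    by (rule lborel_pair.Fubini_integral[symmetric, OF int\<Phi>])
  finally have 2: "(LINT (x, y)|lborel. F x * F y * riesz_kernel \<gamma> (x - y)) = (LINT w|lborel. LINT z|lborel. \<Phi> z w)" .
  have sq: "AE w in lborel. (LINT z|lborel. \<Phi> z w) = (case w of (u, p) \<Rightarrow> rw \<gamma> u * (LINT x|lborel. F x * gk u p x)\<^sup>2)"
  proof (use lborel_pair.AE_integrable_snd[OF int\<Phi>] in eventually_elim)
    fix w :: "real \<times> real" assume iw: "integrable lborel (\<lambda>z. \<Phi> z w)"
    have iw': "integrable (lborel \<Otimes>\<^sub>M lborel) (\<lambda>z. \<Phi> z w)" using iw by (simp add: lborel_prod)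
    have "(LINT z|lborel. \<Phi> z w) = (LINT x|lborel. LINT y|lborel. \<Phi> (x, y) w)"
      using lborel_pair.integral_fst'[OF iw'] by (simp add: lborel_prod)
    also have "\<dots> = (LINT x|lborel. LINT y|lborel. rw \<gamma> (fst w) * (F x * gk (fst w) (snd w) x) * (F y * gk (fst w) (snd w) y))"
      by (simp add: \<Phi>_def mult_ac)
    also have "\<dots> = rw \<gamma> (fst w) * (LINT x|lborel. F x * gk (fst w) (snd w) x) * (LINT x|lborel. F x * gk (fst w) (snd w) x)"
      by (simp only: integral_mult_right_zero integral_mult_left_zero)
    finally show "(LINT z|lborel. \<Phi> z w) = (case w of (u, p) \<Rightarrow> rw \<gamma> u * (LINT x|lborel. F x * gk u p x)\<^sup>2)"
      by (simp add: split_beta power2_eq_square mult.assoc)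
  qed
  have nn: "AE w in lborel. (LINT z|lborel. \<Phi> z w) \<ge> 0"
    using sq by eventually_elim (auto simp: split_beta rw_nonneg[OF \<gamma>(1)])
  show "(LINT (x, y)|lborel. F x * F y * riesz_kernel \<gamma> (x - y)) \<ge> 0"
    unfolding 2 by (rule integral_nonneg_AE[OF nn])
  have "ennreal (LINT w|lborel. LINT z|lborel. \<Phi> z w) = (\<integral>\<^sup>+w. ennreal (LINT z|lborel. \<Phi> z w) \<partial>lborel)"
    by (rule nn_integral_eq_integral[symmetric, OF lborel_pair.integrable_snd[OF int\<Phi>] nn])
  also have "\<dots> = (\<integral>\<^sup>+w. ennreal (case w of (u, p) \<Rightarrow> rw \<gamma> u * (LINT x|lborel. F x * gk u p x)\<^sup>2) \<partial>lborel)"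
    by (intro nn_integral_cong_AE, use sq in eventually_elim) simp
  finally show "ennreal (LINT (x, y)|lborel. F x * F y * riesz_kernel \<gamma> (x - y))
      = (\<integral>\<^sup>+w. ennreal (case w of (u, p) \<Rightarrow> rw \<gamma> u * (LINT x|lborel. F x * gk u p x)\<^sup>2) \<partial>lborel)"
    unfolding 2 .
qed

section \<open>The Hilbert seminorm of the noise\<close>

text \<open>Polarization of \<open>noise_norm2\<close>. It is handled as a bilinear form; cross
  terms are carried in both orders instead of being identified by symmetry.\<close>

definition nform :: "real \<Rightarrow> (real \<Rightarrow> real \<Rightarrow> real) \<Rightarrow> (real \<Rightarrow> real \<Rightarrow> real) \<Rightarrow> real" where
  "nform \<gamma> f g = (LINT (s, x, y)|lborel. indicator {0..} s * (f s x * g s y * riesz_kernel \<gamma> (x - y)))"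

lemma noise_norm2_eq_nform: "noise_norm2 \<gamma> f = nform \<gamma> f f"
  by (simp add: noise_norm2_def nform_def)

lemma borel_measurable_section:
  fixes f :: "real \<Rightarrow> real \<Rightarrow> real"
  assumes "(\<lambda>(s, x). f s x) \<in> borel_measurable borel"
  shows "f s \<in> borel_measurable borel"
proof -
  have "(\<lambda>x. (s, x)) \<in> borel_measurable borel"
    by (intro borel_measurable_continuous_onI continuous_intros)
  from measurable_compose[OF this assms] show ?thesis by simp
qed

lemma noise_integrand_measurable:
  fixes f g :: "real \<Rightarrow> real \<Rightarrow> real"
  assumes f: "(\<lambda>(s, x). f s x) \<in> borel_measurable borel" and g: "(\<lambda>(s, x). g s x) \<in> borel_measurable borel"
  shows "(\<lambda>(s, x, y). indicator {0..} s * (f s x * g s y * riesz_kernel \<gamma> (x - y))) \<in> borel_measurable borel"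
proof -
  have 1: "(\<lambda>q. (fst q, fst (snd q))) \<in> borel_measurable (borel :: (real \<times> real \<times> real) measure)"
    and 2: "(\<lambda>q. (fst q, snd (snd q))) \<in> borel_measurable (borel :: (real \<times> real \<times> real) measure)"
    by (intro borel_measurable_continuous_onI continuous_intros)+
  have [measurable]: "(\<lambda>q. f (fst q) (fst (snd q))) \<in> borel_measurable (borel :: (real \<times> real \<times> real) measure)"
    "(\<lambda>q. g (fst q) (snd (snd q))) \<in> borel_measurable (borel :: (real \<times> real \<times> real) measure)"
    using measurable_compose[OF 1 f] measurable_compose[OF 2 g] by simp_all
  show ?thesis unfolding split_beta by measurable
qed

lemma nn_integral_lborel_pair:
  fixes F :: "'a::euclidean_space \<times> 'b::euclidean_space \<Rightarrow> ennreal"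
  assumes "F \<in> borel_measurable borel"
  shows "(\<integral>\<^sup>+q. F q \<partial>lborel) = (\<integral>\<^sup>+s. \<integral>\<^sup>+z. F (s, z) \<partial>lborel \<partial>lborel)"
proof -
  have "F \<in> borel_measurable (lborel \<Otimes>\<^sub>M lborel)" using assms by (simp add: lborel_prod)
  from lborel.nn_integral_fst[OF this] show ?thesis by (simp add: lborel_prod)
qed

context
  fixes \<gamma> :: real
  assumes \<gamma>: "0 < \<gamma>" "\<gamma> < 1/4"
begin

text \<open>For each fixed time \<open>nn_kform_le\<close> bounds the mixed term by the two diagonal
  ones, which admissibility makes integrable in time.\<close>

lemma noise_admissible_integrable2:
  assumes f: "noise_admissible \<gamma> f" and g: "noise_admissible \<gamma> g"
  shows "integrable lborel (\<lambda>(s, x, y). indicator {0..} s * (\<bar>f s x\<bar> * \<bar>g s y\<bar> * riesz_kernel \<gamma> (x - y)))"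
proof (rule integrableI_bounded)
  have mf: "(\<lambda>(s, x). f s x) \<in> borel_measurable borel" and mg: "(\<lambda>(s, x). g s x) \<in> borel_measurable borel"
    using f g by (auto simp: noise_admissible_def)
  have mf': "(\<lambda>(s, x). \<bar>f s x\<bar>) \<in> borel_measurable borel" and mg': "(\<lambda>(s, x). \<bar>g s x\<bar>) \<in> borel_measurable borel"
    using borel_measurable_abs[OF mf] borel_measurable_abs[OF mg] by (simp_all add: split_beta)
  note sf[measurable] = borel_measurable_section[OF mf'] and sg[measurable] = borel_measurable_section[OF mg']
  show "(\<lambda>(s, x, y). indicator {0..} s * (\<bar>f s x\<bar> * \<bar>g s y\<bar> * riesz_kernel \<gamma> (x - y))) \<in> borel_measurable lborel"
    using noise_integrand_measurable[OF mf' mg'] by simp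
  note K0 = riesz_kernel_nonneg[OF \<gamma>]
  define k where "k a b s = (\<integral>\<^sup>+z. (case z of (x, y) \<Rightarrow> ennreal \<bar>a s x\<bar> * ennreal \<bar>b s y\<bar> * ennreal (riesz_kernel \<gamma> (x - y))) \<partial>lborel)"
    for a b :: "real \<Rightarrow> real \<Rightarrow> real" and s
  have eq: "(\<integral>\<^sup>+q. ennreal (norm (case q of (s, x, y) \<Rightarrow> indicator {0..} s * (\<bar>a s x\<bar> * \<bar>b s y\<bar> * riesz_kernel \<gamma> (x - y)))) \<partial>lborel)
     = (\<integral>\<^sup>+s. indicator {0..} s * k a b s \<partial>lborel)"
    and mk: "(\<lambda>s. indicator {0..} s * k a b s) \<in> borel_measurable lborel"
    if a: "(\<lambda>(s, x). \<bar>a s x\<bar>) \<in> borel_measurable borel" and b: "(\<lambda>(s, x). \<bar>b s x\<bar>) \<in> borel_measurable borel" for a b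
  proof -
    note [measurable] = noise_integrand_measurable[OF a b]
    have norm: "(\<lambda>q. ennreal (norm (case q of (s, x, y) \<Rightarrow> indicator {0..} s * (\<bar>a s x\<bar> * \<bar>b s y\<bar> * riesz_kernel \<gamma> (x - y))))) \<in> borel_measurable borel"
      by measurable
    have in1: "ennreal (norm (case (s, z) of (s, x, y) \<Rightarrow> indicator {0..} s * (\<bar>a s x\<bar> * \<bar>b s y\<bar> * riesz_kernel \<gamma> (x - y))))
      = indicator {0..} s * (case z of (x, y) \<Rightarrow> ennreal \<bar>a s x\<bar> * ennreal \<bar>b s y\<bar> * ennreal (riesz_kernel \<gamma> (x - y)))" for s z
      using K0 by (auto simp: split_beta ennreal_mult[symmetric] indicator_def)
    have in2: "(\<integral>\<^sup>+z. ennreal (norm (case (s, z) of (s, x, y) \<Rightarrow> indicator {0..} s * (\<bar>a s x\<bar> * \<bar>b s y\<bar> * riesz_kernel \<gamma> (x - y)))) \<partial>lborel)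
      = indicator {0..} s * k a b s" for s
      unfolding in1 k_def by (auto simp: indicator_def)
    show "(\<integral>\<^sup>+q. ennreal (norm (case q of (s, x, y) \<Rightarrow> indicator {0..} s * (\<bar>a s x\<bar> * \<bar>b s y\<bar> * riesz_kernel \<gamma> (x - y)))) \<partial>lborel)
     = (\<integral>\<^sup>+s. indicator {0..} s * k a b s \<partial>lborel)"
      unfolding nn_integral_lborel_pair[OF norm] in2 ..
    have "(\<lambda>q. ennreal (norm (case q of (s, x, y) \<Rightarrow> indicator {0..} s * (\<bar>a s x\<bar> * \<bar>b s y\<bar> * riesz_kernel \<gamma> (x - y))))) \<in> borel_measurable (lborel \<Otimes>\<^sub>M lborel)"
      using norm by (simp add: lborel_prod)
    from lborel.borel_measurable_nn_integral_fst[OF this]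
    show "(\<lambda>s. indicator {0..} s * k a b s) \<in> borel_measurable lborel"
      unfolding in2 .
  qed
  have "(\<integral>\<^sup>+s. indicator {0..} s * k f g s \<partial>lborel) \<le> (\<integral>\<^sup>+s. indicator {0..} s * k f f s + indicator {0..} s * k g g s \<partial>lborel)"
  proof (intro nn_integral_mono)
    fix s
    have "k f g s \<le> k f f s + k g g s"
      unfolding k_def by (rule nn_kform_le[OF \<gamma>]) measurable
    then show "indicator {0..} s * k f g s \<le> indicator {0..} s * k f f s + indicator {0..} s * k g g s"
      by (auto simp: indicator_def)
  qed
  also have "\<dots> = (\<integral>\<^sup>+s. indicator {0..} s * k f f s \<partial>lborel) + (\<integral>\<^sup>+s. indicator {0..} s * k g g s \<partial>lborel)"
    by (rule nn_integral_add[OF mk[OF mf' mf'] mk[OF mg' mg']])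
  also have "\<dots> < \<infinity>"
    using f g unfolding eq[OF mf' mf', symmetric] eq[OF mg' mg', symmetric]
    by (simp add: noise_admissible_def integrable_iff_bounded)
  finally show "(\<integral>\<^sup>+q. ennreal (norm (case q of (s, x, y) \<Rightarrow> indicator {0..} s * (\<bar>f s x\<bar> * \<bar>g s y\<bar> * riesz_kernel \<gamma> (x - y)))) \<partial>lborel) < \<infinity>"
    unfolding eq[OF mf' mg'] .
qed

lemma noise_admissible_integrable:
  assumes "noise_admissible \<gamma> f" "noise_admissible \<gamma> g"
  shows "integrable lborel (\<lambda>(s, x, y). indicator {0..} s * (f s x * g s y * riesz_kernel \<gamma> (x - y)))"
proof (rule Bochner_Integration.integrable_bound[OF noise_admissible_integrable2[OF assms]])
  show "(\<lambda>(s, x, y). indicator {0..} s * (f s x * g s y * riesz_kernel \<gamma> (x - y))) \<in> borel_measurable lborel"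
    using noise_integrand_measurable[of f g \<gamma>] assms by (simp add: noise_admissible_def)
qed (auto simp: abs_mult)

lemma noise_admissible_lincomb:
  assumes f: "noise_admissible \<gamma> f" and g: "noise_admissible \<gamma> g"
  shows "noise_admissible \<gamma> (\<lambda>s x. c * f s x + d * g s x)"
proof -
  have mf: "(\<lambda>q. f (fst q) (snd q)) \<in> borel_measurable borel" and mg: "(\<lambda>q. g (fst q) (snd q)) \<in> borel_measurable borel"
    using f g by (auto simp: noise_admissible_def case_prod_unfold)
  have m: "(\<lambda>(s, x). c * f s x + d * g s x) \<in> borel_measurable borel"
    using mf mg unfolding case_prod_unfold by measurable
  have m': "(\<lambda>(s, x). \<bar>c * f s x + d * g s x\<bar>) \<in> borel_measurable borel"
    using borel_measurable_abs[OF m] by (simp add: split_beta)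
  note K0 = riesz_kernel_nonneg[OF \<gamma>]
  have "integrable lborel (\<lambda>(s, x, y). indicator {0..} s * (\<bar>c * f s x + d * g s x\<bar> * \<bar>c * f s y + d * g s y\<bar> * riesz_kernel \<gamma> (x - y)))"
  proof (rule Bochner_Integration.integrable_bound)
    show "integrable lborel (\<lambda>q. \<bar>c\<bar> * \<bar>c\<bar> * (case q of (s, x, y) \<Rightarrow> indicator {0..} s * (\<bar>f s x\<bar> * \<bar>f s y\<bar> * riesz_kernel \<gamma> (x - y)))
        + \<bar>c\<bar> * \<bar>d\<bar> * (case q of (s, x, y) \<Rightarrow> indicator {0..} s * (\<bar>f s x\<bar> * \<bar>g s y\<bar> * riesz_kernel \<gamma> (x - y)))
        + \<bar>c\<bar> * \<bar>d\<bar> * (case q of (s, x, y) \<Rightarrow> indicator {0..} s * (\<bar>g s x\<bar> * \<bar>f s y\<bar> * riesz_kernel \<gamma> (x - y)))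
        + \<bar>d\<bar> * \<bar>d\<bar> * (case q of (s, x, y) \<Rightarrow> indicator {0..} s * (\<bar>g s x\<bar> * \<bar>g s y\<bar> * riesz_kernel \<gamma> (x - y))))"
      by (intro Bochner_Integration.integrable_add integrable_mult_right noise_admissible_integrable2 f g)
    show "(\<lambda>(s, x, y). indicator {0..} s * (\<bar>c * f s x + d * g s x\<bar> * \<bar>c * f s y + d * g s y\<bar> * riesz_kernel \<gamma> (x - y))) \<in> borel_measurable lborel"
      using noise_integrand_measurable[OF m' m'] by simp
    have "\<bar>c * f s x + d * g s x\<bar> * \<bar>c * f s y + d * g s y\<bar> * riesz_kernel \<gamma> (x - y)
       \<le> \<bar>c\<bar> * \<bar>c\<bar> * (\<bar>f s x\<bar> * \<bar>f s y\<bar> * riesz_kernel \<gamma> (x - y)) + \<bar>c\<bar> * \<bar>d\<bar> * (\<bar>f s x\<bar> * \<bar>g s y\<bar> * riesz_kernel \<gamma> (x - y))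
       + \<bar>c\<bar> * \<bar>d\<bar> * (\<bar>g s x\<bar> * \<bar>f s y\<bar> * riesz_kernel \<gamma> (x - y)) + \<bar>d\<bar> * \<bar>d\<bar> * (\<bar>g s x\<bar> * \<bar>g s y\<bar> * riesz_kernel \<gamma> (x - y))" (is "?l \<le> ?r") for s x y
    proof -
      have "?l \<le> (\<bar>c\<bar> * \<bar>f s x\<bar> + \<bar>d\<bar> * \<bar>g s x\<bar>) * (\<bar>c\<bar> * \<bar>f s y\<bar> + \<bar>d\<bar> * \<bar>g s y\<bar>) * riesz_kernel \<gamma> (x - y)"
        by (intro mult_right_mono mult_mono K0 order.trans[OF abs_triangle_ineq]) (auto simp: abs_mult)
      also have "\<dots> = ?r" by (simp add: algebra_simps del: abs_mult_self_eq)
      finally show ?thesis .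
    qed
    then show "AE q in lborel. norm (case q of (s, x, y) \<Rightarrow> indicator {0..} s * (\<bar>c * f s x + d * g s x\<bar> * \<bar>c * f s y + d * g s y\<bar> * riesz_kernel \<gamma> (x - y)))
       \<le> norm (\<bar>c\<bar> * \<bar>c\<bar> * (case q of (s, x, y) \<Rightarrow> indicator {0..} s * (\<bar>f s x\<bar> * \<bar>f s y\<bar> * riesz_kernel \<gamma> (x - y)))
        + \<bar>c\<bar> * \<bar>d\<bar> * (case q of (s, x, y) \<Rightarrow> indicator {0..} s * (\<bar>f s x\<bar> * \<bar>g s y\<bar> * riesz_kernel \<gamma> (x - y)))
        + \<bar>c\<bar> * \<bar>d\<bar> * (case q of (s, x, y) \<Rightarrow> indicator {0..} s * (\<bar>g s x\<bar> * \<bar>f s y\<bar> * riesz_kernel \<gamma> (x - y)))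
        + \<bar>d\<bar> * \<bar>d\<bar> * (case q of (s, x, y) \<Rightarrow> indicator {0..} s * (\<bar>g s x\<bar> * \<bar>g s y\<bar> * riesz_kernel \<gamma> (x - y))))"
      using K0 by (intro AE_I2) (auto simp: indicator_def split_beta)
  qed
  then show ?thesis using m by (simp add: noise_admissible_def)
qed

lemma nform_lincomb_left:
  assumes f: "noise_admissible \<gamma> f" and g: "noise_admissible \<gamma> g" and h: "noise_admissible \<gamma> h"
  shows "nform \<gamma> (\<lambda>s x. c * f s x + d * g s x) h = c * nform \<gamma> f h + d * nform \<gamma> g h"
proof -
  have "nform \<gamma> (\<lambda>s x. c * f s x + d * g s x) h
    = (LINT q|lborel. c * (case q of (s, x, y) \<Rightarrow> indicator {0..} s * (f s x * h s y * riesz_kernel \<gamma> (x - y)))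
       + d * (case q of (s, x, y) \<Rightarrow> indicator {0..} s * (g s x * h s y * riesz_kernel \<gamma> (x - y))))"
    unfolding nform_def by (intro Bochner_Integration.integral_cong) (auto simp: algebra_simps)
  then show ?thesis
    using noise_admissible_integrable[OF f h] noise_admissible_integrable[OF g h] by (simp add: nform_def)
qed

lemma nform_lincomb_right:
  assumes f: "noise_admissible \<gamma> f" and g: "noise_admissible \<gamma> g" and h: "noise_admissible \<gamma> h"
  shows "nform \<gamma> h (\<lambda>s x. c * f s x + d * g s x) = c * nform \<gamma> h f + d * nform \<gamma> h g"
proof -
  have "nform \<gamma> h (\<lambda>s x. c * f s x + d * g s x)
    = (LINT q|lborel. c * (case q of (s, x, y) \<Rightarrow> indicator {0..} s * (h s x * f s y * riesz_kernel \<gamma> (x - y)))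
       + d * (case q of (s, x, y) \<Rightarrow> indicator {0..} s * (h s x * g s y * riesz_kernel \<gamma> (x - y))))"
    unfolding nform_def by (intro Bochner_Integration.integral_cong) (auto simp: algebra_simps)
  then show ?thesis
    using noise_admissible_integrable[OF h f] noise_admissible_integrable[OF h g] by (simp add: nform_def)
qed

text \<open>By Fubini almost every time section is absolutely integrable, so that
  \<open>kform_square\<close> applies to it. Beyond nonnegativity this is the formula into which the
  Fourier representation of \<open>fund_sol\<close> is inserted later.\<close>

lemma noise_norm2_square:
  assumes f: "noise_admissible \<gamma> f"
  shows "noise_norm2 \<gamma> f \<ge> 0"
    and "ennreal (noise_norm2 \<gamma> f) = (\<integral>\<^sup>+s. indicator {0..} s *
      (\<integral>\<^sup>+w. ennreal (case w of (u, p) \<Rightarrow> rw \<gamma> u * (LINT x|lborel. f s x * gk u p x)\<^sup>2) \<partial>lborel) \<partial>lborel)"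
proof -
  have mf: "(\<lambda>(s, x). f s x) \<in> borel_measurable borel"
    using f by (auto simp: noise_admissible_def)
  note sf = borel_measurable_section[OF mf]
  define \<Psi> where "\<Psi> s z = indicator {0..} s * (case z of (x, y) \<Rightarrow> f s x * f s y * riesz_kernel \<gamma> (x - y))" for s :: real and z
  have i1: "integrable (lborel \<Otimes>\<^sub>M lborel) (\<lambda>(s, z). \<Psi> s z)"
    using noise_admissible_integrable[OF f f] by (simp add: lborel_prod \<Psi>_def case_prod_unfold)
  have i2: "integrable (lborel \<Otimes>\<^sub>M lborel) (\<lambda>(s, z). indicator {0..} s * (case z of (x, y) \<Rightarrow> \<bar>f s x\<bar> * \<bar>f s y\<bar> * riesz_kernel \<gamma> (x - y)))"
    using noise_admissible_integrable2[OF f f] by (simp add: lborel_prod case_prod_unfold)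
  have eq: "noise_norm2 \<gamma> f = (LINT s|lborel. LINT z|lborel. \<Psi> s z)"
    using lborel_pair.integral_fst[OF i1] by (simp add: noise_norm2_def lborel_prod \<Psi>_def case_prod_unfold)
  have sq: "AE s in lborel. 0 \<le> (LINT z|lborel. \<Psi> s z) \<and> ennreal (LINT z|lborel. \<Psi> s z) = indicator {0..} s *
      (\<integral>\<^sup>+w. ennreal (case w of (u, p) \<Rightarrow> rw \<gamma> u * (LINT x|lborel. f s x * gk u p x)\<^sup>2) \<partial>lborel)"
  proof (use lborel_pair.AE_integrable_fst[OF i2] in eventually_elim)
    fix s :: real assume "integrable lborel (\<lambda>z. indicator {0..} s * (case z of (x, y) \<Rightarrow> \<bar>f s x\<bar> * \<bar>f s y\<bar> * riesz_kernel \<gamma> (x - y)))"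
    then show "0 \<le> (LINT z|lborel. \<Psi> s z) \<and> ennreal (LINT z|lborel. \<Psi> s z) = indicator {0..} s *
      (\<integral>\<^sup>+w. ennreal (case w of (u, p) \<Rightarrow> rw \<gamma> u * (LINT x|lborel. f s x * gk u p x)\<^sup>2) \<partial>lborel)"
      using kform_square[OF \<gamma> sf, of s] by (cases "s \<ge> 0") (simp_all add: \<Psi>_def)
  qed
  show "noise_norm2 \<gamma> f \<ge> 0" unfolding eq
    by (rule integral_nonneg_AE) (use sq in eventually_elim, simp)
  have "ennreal (noise_norm2 \<gamma> f) = (\<integral>\<^sup>+s. ennreal (LINT z|lborel. \<Psi> s z) \<partial>lborel)"
    unfolding eq by (rule nn_integral_eq_integral[symmetric, OF lborel_pair.integrable_fst[OF i1]])
      (use sq in eventually_elim, simp)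
  also have "\<dots> = (\<integral>\<^sup>+s. indicator {0..} s *
      (\<integral>\<^sup>+w. ennreal (case w of (u, p) \<Rightarrow> rw \<gamma> u * (LINT x|lborel. f s x * gk u p x)\<^sup>2) \<partial>lborel) \<partial>lborel)"
    by (intro nn_integral_cong_AE, use sq in eventually_elim) simp
  finally show "ennreal (noise_norm2 \<gamma> f) = \<dots>" .
qed

lemma noise_norm2_lincomb:
  assumes f: "noise_admissible \<gamma> f" and g: "noise_admissible \<gamma> g"
  shows "noise_norm2 \<gamma> (\<lambda>s x. c * f s x + d * g s x)
    = c\<^sup>2 * noise_norm2 \<gamma> f + c * d * (nform \<gamma> f g + nform \<gamma> g f) + d\<^sup>2 * noise_norm2 \<gamma> g"
  unfolding noise_norm2_eq_nform
  by (simp add: nform_lincomb_left nform_lincomb_right noise_admissible_lincomb f g)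
    (simp add: power2_eq_square algebra_simps)

text \<open>Parallelogram argument: the value for \<open>(c, - d)\<close> is nonnegative, and adding
  it to the value for \<open>(c, d)\<close> cancels the cross terms.\<close>

lemma noise_norm2_lincomb_le:
  assumes f: "noise_admissible \<gamma> f" and g: "noise_admissible \<gamma> g"
  shows "noise_norm2 \<gamma> (\<lambda>s x. c * f s x + d * g s x) \<le> 2 * c\<^sup>2 * noise_norm2 \<gamma> f + 2 * d\<^sup>2 * noise_norm2 \<gamma> g"
  using noise_norm2_lincomb[OF f g, of c d] noise_norm2_lincomb[OF f g, of c "- d"]
    noise_norm2_square(1)[OF noise_admissible_lincomb[OF f g, of c "- d"]] by (simp add: algebra_simps)

lemma nform_Cauchy_Schwarz:
  assumes f: "noise_admissible \<gamma> f" and g: "noise_admissible \<gamma> g"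
  shows "(nform \<gamma> f g + nform \<gamma> g f)\<^sup>2 \<le> 4 * noise_norm2 \<gamma> f * noise_norm2 \<gamma> g"
proof -
  define b where "b = nform \<gamma> f g + nform \<gamma> g f"
  have q: "0 \<le> c\<^sup>2 * noise_norm2 \<gamma> f + c * d * b + d\<^sup>2 * noise_norm2 \<gamma> g" for c d
    using noise_norm2_square(1)[OF noise_admissible_lincomb[OF f g, of c d]]
    unfolding noise_norm2_lincomb[OF f g] b_def .
  have nf: "noise_norm2 \<gamma> f \<ge> 0" by (rule noise_norm2_square(1)[OF f])
  show ?thesis
  proof (cases "noise_norm2 \<gamma> f = 0")
    case False
    \<comment> \<open>With \<open>F\<close> and \<open>G\<close> the squared norms of
      \<open>f\<close> and \<open>g\<close>, the form is minimal for the ratio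
      \<open>c / d = - b / (2 * F)\<close>; the choice \<open>c = - b\<close>,
      \<open>d = 2 * F\<close> gives \<open>F * (4 * F * G - b\<^sup>2)\<close>.\<close>
    have "0 \<le> noise_norm2 \<gamma> f * (4 * noise_norm2 \<gamma> f * noise_norm2 \<gamma> g - b\<^sup>2)"
      using q[of "- b" "2 * noise_norm2 \<gamma> f"] by (simp add: power2_eq_square algebra_simps)
    then show ?thesis using nf False by (simp add: zero_le_mult_iff b_def)
  next
    case True
    have "b = 0"
    proof (rule ccontr)
      assume "b \<noteq> 0"
      \<comment> \<open>The term in \<open>c\<^sup>2\<close> vanishes, and this \<open>c\<close>
        gives the form the value -1.\<close>
      then show False using q[of "- (noise_norm2 \<gamma> g + 1) / b" 1] True by simp
    qed
    then show ?thesis using True by (simp add: b_def)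
  qed
qed

text \<open>With \<open>g n\<close> written as \<open>f\<close> minus the error, the cross term is
  controlled by Cauchy-Schwarz. This identifies the variance of a Wiener integral from those of its
  simple approximants.\<close>

lemma noise_norm2_tendsto:
  assumes f: "noise_admissible \<gamma> f" and g: "\<And>n. noise_admissible \<gamma> (g n)"
    and lim: "(\<lambda>n. noise_norm2 \<gamma> (\<lambda>s x. f s x - g n s x)) \<longlonglongrightarrow> 0"
  shows "(\<lambda>n. noise_norm2 \<gamma> (g n)) \<longlonglongrightarrow> noise_norm2 \<gamma> f"
proof -
  define d where "d n = (\<lambda>s x. f s x - g n s x)" for n
  have d: "noise_admissible \<gamma> (d n)" for n
    using noise_admissible_lincomb[OF f g, of 1 "- 1"] by (simp add: d_def)
  define b where "b n = nform \<gamma> f (d n) + nform \<gamma> (d n) f" for n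
  have eq: "noise_norm2 \<gamma> (g n) = noise_norm2 \<gamma> f - b n + noise_norm2 \<gamma> (d n)" for n
    using noise_norm2_lincomb[OF f d, of 1 "- 1" n] by (simp add: d_def b_def)
  have "b \<longlonglongrightarrow> 0"
  proof (rule Lim_null_comparison)
    show "(\<lambda>n. sqrt (4 * noise_norm2 \<gamma> f * noise_norm2 \<gamma> (d n))) \<longlonglongrightarrow> 0"
      using tendsto_real_sqrt[OF tendsto_mult_left[OF lim, of "4 * noise_norm2 \<gamma> f"]] by (simp add: d_def)
    show "\<forall>\<^sub>F n in sequentially. norm (b n) \<le> sqrt (4 * noise_norm2 \<gamma> f * noise_norm2 \<gamma> (d n))"
      using nform_Cauchy_Schwarz[OF f d] by (intro always_eventually allI) (simp add: real_le_rsqrt b_def)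
  qed
  then have "(\<lambda>n. noise_norm2 \<gamma> f - b n + noise_norm2 \<gamma> (d n)) \<longlonglongrightarrow> noise_norm2 \<gamma> f - 0 + 0"
    using lim by (intro tendsto_intros) (auto simp: d_def)
  then show ?thesis by (simp add: eq)
qed

end

section \<open>The Wiener integral\<close>

text \<open>The exponent \<open>4 * \<gamma> - 1\<close> is larger than -1, so the singularity at 0
  is integrable; this is what makes indicators of bounded sets admissible.\<close>

lemma riesz_kernel_integrable_interval:
  assumes \<gamma>: "0 < \<gamma>" "\<gamma> < 1/4" and R: "R \<ge> 0"
  shows "(\<integral>\<^sup>+v. ennreal (indicator {-R..R} v * riesz_kernel \<gamma> v) \<partial>lborel) < \<infinity>"
proof -
  define C where "C = Gamma (1/2 - 2*\<gamma>) / (2 powr (4*\<gamma>) * sqrt pi * Gamma (2*\<gamma>))"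
  have K: "riesz_kernel \<gamma> v = C * \<bar>v\<bar> powr (4*\<gamma> - 1)" for v by (simp add: riesz_kernel_def C_def)
  note K0 = riesz_kernel_nonneg[OF \<gamma>]
  have "((\<lambda>v. v powr (4*\<gamma> - 1)) has_integral (R powr (4*\<gamma> - 1 + 1) / (4*\<gamma> - 1 + 1))) {0..R}"
    using \<gamma> R by (intro has_integral_powr_from_0) auto
  then have "((\<lambda>v. C * v powr (4*\<gamma> - 1)) has_integral C * (R powr (4*\<gamma> - 1 + 1) / (4*\<gamma> - 1 + 1))) {0..R}"
    by (rule has_integral_mult_right)
  then have "((\<lambda>v. riesz_kernel \<gamma> v) has_integral C * (R powr (4*\<gamma> - 1 + 1) / (4*\<gamma> - 1 + 1))) {0..R}"
    by (rule has_integral_cong[THEN iffD1, rotated]) (simp add: K)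
  then have "((\<lambda>v. indicator {0..R} v * riesz_kernel \<gamma> v) has_integral C * (R powr (4*\<gamma> - 1 + 1) / (4*\<gamma> - 1 + 1))) UNIV"
    unfolding has_integral_restrict_UNIV[of "{0..R}", symmetric]
    by (rule has_integral_cong[THEN iffD1, rotated]) (simp add: indicator_def)
  then have fin: "(\<integral>\<^sup>+v. ennreal (indicator {0..R} v * riesz_kernel \<gamma> v) \<partial>lborel) < \<infinity>"
    by (subst nn_integral_has_integral_lborel) (auto simp: K0)
  have "(\<integral>\<^sup>+v. ennreal (indicator {-R..R} v * riesz_kernel \<gamma> v) \<partial>lborel)
    \<le> (\<integral>\<^sup>+v. ennreal (indicator {0..R} v * riesz_kernel \<gamma> v) + ennreal (indicator {0..R} (-v) * riesz_kernel \<gamma> (- v)) \<partial>lborel)"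
    by (intro nn_integral_mono) (auto simp: K indicator_def)
  also have "\<dots> = (\<integral>\<^sup>+v. ennreal (indicator {0..R} v * riesz_kernel \<gamma> v) \<partial>lborel) + (\<integral>\<^sup>+v. ennreal (indicator {0..R} (-v) * riesz_kernel \<gamma> (- v)) \<partial>lborel)"
    by (rule nn_integral_add) measurable
  also have "(\<integral>\<^sup>+v. ennreal (indicator {0..R} (-v) * riesz_kernel \<gamma> (- v)) \<partial>lborel) = (\<integral>\<^sup>+v. ennreal (indicator {0..R} v * riesz_kernel \<gamma> v) \<partial>lborel)"
    by (subst (2) nn_integral_real_affine[where c="-1" and t=0]) auto
  finally show ?thesis using fin by (simp add: order_le_less_trans)
qed

text \<open>For fixed \<open>x\<close> the inner integral is, after a translation, at most the
  integral of the kernel over one bounded interval containing all differences; the outer variable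
  ranges over a set of finite measure.\<close>

lemma riesz_kernel_integrable_cell:
  assumes \<gamma>: "0 < \<gamma>" "\<gamma> < 1/4" and AB: "A \<in> bounded_borel" "B \<in> bounded_borel"
  shows "integrable lborel (\<lambda>(x, y). indicator A x * indicator B y * riesz_kernel \<gamma> (x - y))"
proof (rule integrableI_bounded)
  have [measurable]: "A \<in> sets borel" "B \<in> sets borel" using AB by (auto simp: bounded_borel_def)
  show "(\<lambda>(x, y). indicator A x * indicator B y * riesz_kernel \<gamma> (x - y)) \<in> borel_measurable lborel"
    unfolding case_prod_unfold by measurable
  note K0 = riesz_kernel_nonneg[OF \<gamma>]
  obtain R1 where R1: "\<And>x. x \<in> A \<Longrightarrow> \<bar>x\<bar> \<le> R1" using AB by (auto simp: bounded_borel_def bounded_iff)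
  obtain R2 where R2: "\<And>x. x \<in> B \<Longrightarrow> \<bar>x\<bar> \<le> R2" using AB by (auto simp: bounded_borel_def bounded_iff)
  define R where "R = \<bar>R1\<bar> + \<bar>R2\<bar>"
  have R: "x - y \<in> {-R..R}" if "x \<in> A" "y \<in> B" for x y
    using R1[OF that(1)] R2[OF that(2)] by (auto simp: R_def)
  define I where "I = (\<integral>\<^sup>+v. ennreal (indicator {-R..R} v * riesz_kernel \<gamma> v) \<partial>lborel)"
  have I: "I < \<infinity>" unfolding I_def by (rule riesz_kernel_integrable_interval[OF \<gamma>]) (simp add: R_def)
  have "(\<integral>\<^sup>+q. ennreal (norm (case q of (x, y) \<Rightarrow> indicator A x * indicator B y * riesz_kernel \<gamma> (x - y))) \<partial>lborel)
    = (\<integral>\<^sup>+x. \<integral>\<^sup>+y. ennreal (indicator A x * indicator B y * riesz_kernel \<gamma> (x - y)) \<partial>lborel \<partial>lborel)"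
    by (subst nn_integral_lborel_pair) (auto simp: case_prod_unfold K0)
  also have "\<dots> \<le> (\<integral>\<^sup>+x. indicator A x * I \<partial>lborel)"
  proof (intro nn_integral_mono)
    fix x :: real
    have "(\<integral>\<^sup>+y. ennreal (indicator A x * indicator B y * riesz_kernel \<gamma> (x - y)) \<partial>lborel)
      \<le> (\<integral>\<^sup>+y. indicator A x * ennreal (indicator {-R..R} (x - y) * riesz_kernel \<gamma> (x - y)) \<partial>lborel)"
      using R K0 by (intro nn_integral_mono) (auto simp: indicator_def)
    also have "\<dots> = indicator A x * (\<integral>\<^sup>+y. ennreal (indicator {-R..R} (x - y) * riesz_kernel \<gamma> (x - y)) \<partial>lborel)"
      by (rule nn_integral_cmult) measurable
    also have "(\<integral>\<^sup>+y. ennreal (indicator {-R..R} (x - y) * riesz_kernel \<gamma> (x - y)) \<partial>lborel) = I"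
      unfolding I_def by (subst nn_integral_real_affine[where c="-1" and t=x and f="\<lambda>v. ennreal (indicator {-R..R} v * riesz_kernel \<gamma> v)"]) auto
    finally show "(\<integral>\<^sup>+y. ennreal (indicator A x * indicator B y * riesz_kernel \<gamma> (x - y)) \<partial>lborel) \<le> indicator A x * I" .
  qed
  also have "\<dots> = emeasure lborel A * I" by (subst nn_integral_multc) auto
  also have "\<dots> < \<infinity>"
    using I emeasure_bounded_finite[of A] AB by (auto simp: bounded_borel_def ennreal_mult_less_top)
  finally show "(\<integral>\<^sup>+q. ennreal (norm (case q of (x, y) \<Rightarrow> indicator A x * indicator B y * riesz_kernel \<gamma> (x - y))) \<partial>lborel) < \<infinity>" .
qed

lemma (in pair_sigma_finite) integrable_product_mult:
  fixes f :: "'a \<Rightarrow> 'c::{real_normed_field, banach, second_countable_topology}"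
  assumes f: "integrable M1 f" and g: "integrable M2 g"
  shows "integrable (M1 \<Otimes>\<^sub>M M2) (\<lambda>(x, y). f x * g y)"
    and "(LINT (x, y)|(M1 \<Otimes>\<^sub>M M2). f x * g y) = (LINT x|M1. f x) * (LINT y|M2. g y)"
proof -
  have [measurable]: "f \<in> borel_measurable M1" "g \<in> borel_measurable M2" using f g by auto
  show i: "integrable (M1 \<Otimes>\<^sub>M M2) (\<lambda>(x, y). f x * g y)"
  proof (rule Fubini_integrable)
    show "integrable M1 (\<lambda>x. LINT y|M2. norm (case (x, y) of (x, y) \<Rightarrow> f x * g y))"
      using f by (simp add: norm_mult)
    show "AE x in M1. integrable M2 (\<lambda>y. case (x, y) of (x, y) \<Rightarrow> f x * g y)"
      using g by simp
  qed measurable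
  show "(LINT (x, y)|(M1 \<Otimes>\<^sub>M M2). f x * g y) = (LINT x|M1. f x) * (LINT y|M2. g y)"
    using integral_fst[OF i] by simp
qed

lemma integrable_lborel_product:
  fixes f :: "real \<Rightarrow> real" and g :: "real \<times> real \<Rightarrow> real"
  assumes f: "integrable lborel f" and g: "integrable lborel g"
  shows "integrable lborel (\<lambda>(s, z). f s * g z)" and "(LINT (s, z)|lborel. f s * g z) = (LINT s|lborel. f s) * (LINT z|lborel. g z)"
  using lborel_pair.integrable_product_mult[OF f g] by (simp_all add: lborel_prod)

section \<open>The isometry on cells and simple functions\<close>

definition cell :: "real \<Rightarrow> real \<Rightarrow> real set \<Rightarrow> real \<Rightarrow> real \<Rightarrow> real" where
  "cell s u A r z = indicator {s<..u} r * indicator A z"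

text \<open>Time and space separate. The combination of minima is the length of the intersection of
  the two time intervals; it is kept in this form because the covariance of the increments of
  \<open>W\<close> in time produces exactly these four terms.\<close>

lemma cell_form:
  assumes \<gamma>: "0 < \<gamma>" "\<gamma> < 1/4" and AB: "A \<in> bounded_borel" "B \<in> bounded_borel"
    and s: "0 \<le> s" "s \<le> u" "0 \<le> s'" "s' \<le> u'"
  shows "integrable lborel (\<lambda>(r, x, y). indicator {0..} r * (cell s u A r x * cell s' u' B r y * riesz_kernel \<gamma> (x - y)))"
    and "nform \<gamma> (cell s u A) (cell s' u' B)
      = (min u u' - min u s' - min s u' + min s s') * (LINT x:A|lborel. (LINT y:B|lborel. riesz_kernel \<gamma> (x - y)))"
proof -
  note k = riesz_kernel_integrable_cell[OF \<gamma> AB]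
  have eq: "(case q of (r, x, y) \<Rightarrow> indicator {0..} r * (cell s u A r x * cell s' u' B r y * riesz_kernel \<gamma> (x - y)))
    = (case q of (r, z) \<Rightarrow> indicator {max s s'<..min u u'} r * (case z of (x, y) \<Rightarrow> indicator A x * indicator B y * riesz_kernel \<gamma> (x - y)))" for q
    using s by (auto simp: cell_def indicator_def split: prod.split)
  have i: "integrable lborel (\<lambda>r. indicator {max s s'<..min u u'} r :: real)"
  proof (rule integrable_real_indicator)
    have "bounded {max s s'<..min u u'}"
      by (rule bounded_subset[OF bounded_closed_interval[of "max s s'" "min u u'"]]) (simp add: subset_iff)
    then show "emeasure lborel {max s s'<..min u u'} < \<infinity>" by (rule emeasure_bounded_finite)
  qed simp
  show "integrable lborel (\<lambda>(r, x, y). indicator {0..} r * (cell s u A r x * cell s' u' B r y * riesz_kernel \<gamma> (x - y)))"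
    unfolding eq using integrable_lborel_product(1)[OF i k] by simp
  have "(LINT r|lborel. indicator {max s s'<..min u u'} r :: real) = (if max s s' \<le> min u u' then min u u' - max s s' else 0)"
  proof (cases "max s s' \<le> min u u'")
    case False
    then have "min u u' \<le> max s s'" by linarith
    then have empty: "{max s s'<..min u u'} = {}" by (rule greaterThanAtMost_empty)
    show ?thesis unfolding empty using False by (simp only: if_False) simp
  qed simp
  also have "\<dots> = min u u' - min u s' - min s u' + min s s'"
    using s by (auto simp: min_def max_def)
  finally have m: "(LINT r|lborel. indicator {max s s'<..min u u'} r :: real) = min u u' - min u s' - min s u' + min s s'" .
  have k': "integrable (lborel \<Otimes>\<^sub>M lborel) (\<lambda>(x, y). indicator A x * indicator B y * riesz_kernel \<gamma> (x - y))"
    using k by (simp add: lborel_prod)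
  have "(LINT (x, y)|lborel. indicator A x * indicator B y * riesz_kernel \<gamma> (x - y)) = (LINT x:A|lborel. (LINT y:B|lborel. riesz_kernel \<gamma> (x - y)))"
    using lborel_pair.integral_fst[OF k'] by (simp add: lborel_prod set_lebesgue_integral_def mult.assoc)
  then show "nform \<gamma> (cell s u A) (cell s' u' B)
      = (min u u' - min u s' - min s u' + min s s') * (LINT x:A|lborel. (LINT y:B|lborel. riesz_kernel \<gamma> (x - y)))"
    unfolding nform_def eq using integrable_lborel_product(2)[OF i k] m by simp
qed

lemma cell_admissible:
  assumes \<gamma>: "0 < \<gamma>" "\<gamma> < 1/4" and A: "A \<in> bounded_borel" and s: "0 \<le> s" "s \<le> u"
  shows "noise_admissible \<gamma> (cell s u A)"
proof -
  have [measurable]: "A \<in> sets borel" using A by (simp add: bounded_borel_def)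
  have "(\<lambda>(r, x). cell s u A r x) \<in> borel_measurable borel"
    unfolding cell_def case_prod_unfold by measurable
  moreover have abs: "\<bar>cell s u A r x\<bar> = cell s u A r x" for r x by (simp add: cell_def abs_mult)
  ultimately show ?thesis
    using cell_form(1)[OF \<gamma> A A s s] by (simp add: noise_admissible_def abs)
qed

lemma simple_eval_Nil: "simple_eval [] = (\<lambda>r z. 0)"
  by (simp add: simple_eval_def fun_eq_iff)

lemma simple_eval_Cons: "simple_eval ((c, s, u, A) # \<phi>) = (\<lambda>r z. c * cell s u A r z + 1 * simple_eval \<phi> r z)"
  by (simp add: simple_eval_def cell_def fun_eq_iff)

lemma simple_integral_Cons: "simple_integral W ((c, s, u, A) # \<phi>) \<omega> = c * (W u A \<omega> - W s A \<omega>) + simple_integral W \<phi> \<omega>"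
  by (simp add: simple_integral_def)

lemma noise_admissible_zero: "noise_admissible \<gamma> (\<lambda>r z. 0)"
  by (simp add: noise_admissible_def case_prod_unfold)

lemma simple_eval_admissible:
  assumes \<gamma>: "0 < \<gamma>" "\<gamma> < 1/4" and "is_simple \<phi>"
  shows "noise_admissible \<gamma> (simple_eval \<phi>)"
  using assms(3)
proof (induction \<phi>)
  case Nil
  then show ?case by (simp add: simple_eval_Nil noise_admissible_zero)
next
  case (Cons e \<phi>)
  obtain c s u A where e: "e = (c, s, u, A)" by (cases e)
  show ?case unfolding e simple_eval_Cons
    using Cons by (intro noise_admissible_lincomb[OF \<gamma>] cell_admissible[OF \<gamma>]) (auto simp: is_simple_def e)
qed

text \<open>The list of a simple function may name the same pair of time and set repeatedly, whereas
  \<open>centered_gaussian_family\<close> speaks of finite sets of indices; \<open>add\<close>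
  merges equal indices while the sum is built up.\<close>

lemma simple_integral_gaussian:
  assumes "prob_space P" and W: "riesz_noise P \<gamma> W" and \<phi>: "is_simple \<phi>"
  shows "\<exists>v. gauss_rv P (simple_integral W \<phi>) v"
proof -
  let ?I = "{0..} \<times> bounded_borel" and ?Y = "\<lambda>(t, A). W t A"
  have add: "\<exists>S c. finite S \<and> S \<subseteq> ?I \<and> (\<forall>\<omega>. Z \<omega> + d * ?Y j \<omega> = (\<Sum>i\<in>S. c i * ?Y i \<omega>))"
    if "\<exists>S c. finite S \<and> S \<subseteq> ?I \<and> (\<forall>\<omega>. Z \<omega> = (\<Sum>i\<in>S. c i * ?Y i \<omega>))" "j \<in> ?I" for Z d j
  proof -
    obtain S c where S: "finite S" "S \<subseteq> ?I" "\<And>\<omega>. Z \<omega> = (\<Sum>i\<in>S. c i * ?Y i \<omega>)" using \<open>\<exists>S c. _ S c\<close> by blast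
    define c' where "c' i = (if i \<in> S then c i else 0) + (if i = j then d else 0)" for i
    have "(\<Sum>i\<in>insert j S. c' i * ?Y i \<omega>) = Z \<omega> + d * ?Y j \<omega>" for \<omega>
    proof -
      have "(\<Sum>i\<in>insert j S. c' i * ?Y i \<omega>)
        = (\<Sum>i\<in>insert j S. if i \<in> S then c i * ?Y i \<omega> else 0) + (\<Sum>i\<in>insert j S. if i = j then d * ?Y i \<omega> else 0)"
        unfolding sum.distrib[symmetric] by (intro sum.cong) (auto simp: c'_def distrib_right)
      also have "(\<Sum>i\<in>insert j S. if i \<in> S then c i * ?Y i \<omega> else 0) = (\<Sum>i\<in>S. c i * ?Y i \<omega>)"
        using S(1) by (intro sum.mono_neutral_cong_right) auto
      also have "(\<Sum>i\<in>insert j S. if i = j then d * ?Y i \<omega> else 0) = d * ?Y j \<omega>"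
        using S(1) by (subst sum.delta) auto
      finally show ?thesis using S(3) by simp
    qed
    then show ?thesis using S \<open>j \<in> ?I\<close> by (intro exI[of _ "insert j S"] exI[of _ c']) auto
  qed
  have "\<exists>S c. finite S \<and> S \<subseteq> ?I \<and> (\<forall>\<omega>. simple_integral W \<phi> \<omega> = (\<Sum>i\<in>S. c i * ?Y i \<omega>))"
    using \<phi>
  proof (induction \<phi>)
    case Nil
    then show ?case by (intro exI[of _ "{}"]) (simp add: simple_integral_def)
  next
    case (Cons e \<phi>)
    obtain c s u A where e: "e = (c, s, u, A)" by (cases e)
    have su: "0 \<le> s" "s \<le> u" "A \<in> bounded_borel" and \<phi>: "is_simple \<phi>" using Cons.prems by (auto simp: e is_simple_def)
    from add[OF add[OF Cons.IH[OF \<phi>], of "(u, A)" c], of "(s, A)" "- c"] su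
    show ?case by (simp add: e simple_integral_Cons algebra_simps)
  qed
  then obtain S c where S: "finite S" "S \<subseteq> ?I" "\<And>\<omega>. simple_integral W \<phi> \<omega> = (\<Sum>i\<in>S. c i * ?Y i \<omega>)" by blast
  have eq: "simple_integral W \<phi> = (\<lambda>\<omega>. \<Sum>i\<in>S. c i * ?Y i \<omega>)" using S(3) by blast
  from W have "centered_gaussian_family P ?I ?Y" by (simp add: riesz_noise_def)
  then have "(\<lambda>\<omega>. \<Sum>i\<in>S. c i * ?Y i \<omega>) \<in> borel_measurable P \<and>
        (\<exists>v\<ge>0. distr P borel (\<lambda>\<omega>. \<Sum>i\<in>S. c i * ?Y i \<omega>) = normal_law v)"
    unfolding centered_gaussian_family_def using S(1,2) by blast
  then show ?thesis unfolding eq gauss_rv_def by blast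
qed

lemma integrable_mult_L2:
  fixes X Y :: "'a \<Rightarrow> real"
  assumes [measurable]: "X \<in> borel_measurable P" "Y \<in> borel_measurable P"
    and "integrable P (\<lambda>\<omega>. (X \<omega>)\<^sup>2)" "integrable P (\<lambda>\<omega>. (Y \<omega>)\<^sup>2)"
  shows "integrable P (\<lambda>\<omega>. X \<omega> * Y \<omega>)"
proof (rule Bochner_Integration.integrable_bound)
  show "integrable P (\<lambda>\<omega>. (X \<omega>)\<^sup>2 + (Y \<omega>)\<^sup>2)" using assms by simp
  have "\<bar>a * b\<bar> \<le> a\<^sup>2 + b\<^sup>2" for a b :: real
    using zero_le_power2[of "a - b"] zero_le_power2[of "a + b"] zero_le_power2[of a] zero_le_power2[of b]
    unfolding power2_sum power2_diff by (auto simp: abs_le_iff)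
  then show "AE \<omega> in P. norm (X \<omega> * Y \<omega>) \<le> norm ((X \<omega>)\<^sup>2 + (Y \<omega>)\<^sup>2)" by simp
qed simp

lemma cell_isometry:
  assumes \<gamma>: "0 < \<gamma>" "\<gamma> < 1/4" and P: "prob_space P" and W: "riesz_noise P \<gamma> W"
    and AB: "A \<in> bounded_borel" "B \<in> bounded_borel" and s: "0 \<le> s" "s \<le> u" "0 \<le> s'" "s' \<le> u'"
  shows "(LINT \<omega>|P. (W u A \<omega> - W s A \<omega>) * (W u' B \<omega> - W s' B \<omega>)) = nform \<gamma> (cell s u A) (cell s' u' B)"
proof -
  have cov: "(LINT \<omega>|P. W t A \<omega> * W r B \<omega>) = min t r * (LINT x:A|lborel. (LINT y:B|lborel. riesz_kernel \<gamma> (x - y)))"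
    if "t \<ge> 0" "r \<ge> 0" for t r
    using W AB that by (auto simp: riesz_noise_def)
  have L2: "W t C \<in> borel_measurable P" "integrable P (\<lambda>\<omega>. (W t C \<omega>)\<^sup>2)" if "t \<ge> 0" "C \<in> bounded_borel" for t C
  proof -
    from W have "centered_gaussian_family P ({0..} \<times> bounded_borel) (\<lambda>(t, A). W t A)" by (simp add: riesz_noise_def)
    from this[unfolded centered_gaussian_family_def, rule_format, of "{(t, C)}" "\<lambda>_. 1"] that
    have "\<exists>v. gauss_rv P (W t C) v" by (auto simp: gauss_rv_def)
    then show "W t C \<in> borel_measurable P" "integrable P (\<lambda>\<omega>. (W t C \<omega>)\<^sup>2)"
      using gauss_rvD(1) gauss_rv_square(1) by blast+
  qed
  have i: "integrable P (\<lambda>\<omega>. W t A \<omega> * W r B \<omega>)" if "t \<ge> 0" "r \<ge> 0" for t r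
    by (rule integrable_mult_L2) (use L2 AB that in auto)
  have "(LINT \<omega>|P. (W u A \<omega> - W s A \<omega>) * (W u' B \<omega> - W s' B \<omega>))
    = (LINT \<omega>|P. W u A \<omega> * W u' B \<omega> - W u A \<omega> * W s' B \<omega> - (W s A \<omega> * W u' B \<omega> - W s A \<omega> * W s' B \<omega>))"
    by (simp add: algebra_simps)
  also have "\<dots> = (LINT \<omega>|P. W u A \<omega> * W u' B \<omega>) - (LINT \<omega>|P. W u A \<omega> * W s' B \<omega>)
     - ((LINT \<omega>|P. W s A \<omega> * W u' B \<omega>) - (LINT \<omega>|P. W s A \<omega> * W s' B \<omega>))"
    using s by (simp add: i)
  also have "\<dots> = nform \<gamma> (cell s u A) (cell s' u' B)"
    unfolding cell_form(2)[OF \<gamma> AB s] using s by (simp add: cov left_diff_distrib distrib_right)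
  finally show ?thesis .
qed

text \<open>Both sides are bilinear, so the isometry for two cells is enough. The inner induction
  \<open>one\<close> runs over the right factor against a single cell, the outer one over the left
  factor.\<close>

lemma simple_isometry:
  assumes \<gamma>: "0 < \<gamma>" "\<gamma> < 1/4" and P: "prob_space P" and W: "riesz_noise P \<gamma> W"
    and \<phi>: "is_simple \<phi>" and \<psi>: "is_simple \<psi>"
  shows "(LINT \<omega>|P. simple_integral W \<phi> \<omega> * simple_integral W \<psi> \<omega>) = nform \<gamma> (simple_eval \<phi>) (simple_eval \<psi>)"
proof -
  have L2: "simple_integral W \<phi> \<in> borel_measurable P" "integrable P (\<lambda>\<omega>. (simple_integral W \<phi> \<omega>)\<^sup>2)" if "is_simple \<phi>" for \<phi>
    using simple_integral_gaussian[OF P W that] gauss_rvD(1) gauss_rv_square(1) by blast+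
  have i: "integrable P (\<lambda>\<omega>. simple_integral W \<phi> \<omega> * simple_integral W \<psi> \<omega>)" if "is_simple \<phi>" "is_simple \<psi>" for \<phi> \<psi>
    by (rule integrable_mult_L2) (use L2 that in auto)
  have single: "simple_integral W [(1, s, u, A)] = (\<lambda>\<omega>. W u A \<omega> - W s A \<omega>)" "simple_eval [(1, s, u, A)] = cell s u A" for s u A
    by (auto simp: simple_integral_def simple_eval_def cell_def fun_eq_iff)
  have nf0: "nform \<gamma> f (\<lambda>r z. 0) = 0" "nform \<gamma> (\<lambda>r z. 0) f = 0" for f by (simp_all add: nform_def case_prod_unfold)
  have one: "(LINT \<omega>|P. (W u A \<omega> - W s A \<omega>) * simple_integral W \<psi> \<omega>) = nform \<gamma> (cell s u A) (simple_eval \<psi>)"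
    if \<psi>: "is_simple \<psi>" and A: "0 \<le> s" "s \<le> u" "A \<in> bounded_borel" for s u A \<psi>
    using \<psi>
  proof (induction \<psi>)
    case Nil
    then show ?case by (simp add: simple_integral_def simple_eval_Nil nf0)
  next
    case (Cons e \<psi>)
    obtain d s' u' B where e: "e = (d, s', u', B)" by (cases e)
    have su: "0 \<le> s'" "s' \<le> u'" "B \<in> bounded_borel" and \<psi>: "is_simple \<psi>" using Cons.prems by (auto simp: e is_simple_def)
    have i1: "integrable P (\<lambda>\<omega>. (W u A \<omega> - W s A \<omega>) * (W u' B \<omega> - W s' B \<omega>))"
      using i[of "[(1, s, u, A)]" "[(1, s', u', B)]"] su A by (simp add: single is_simple_def)
    have i2: "integrable P (\<lambda>\<omega>. (W u A \<omega> - W s A \<omega>) * simple_integral W \<psi> \<omega>)"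
      using i[of "[(1, s, u, A)]" \<psi>] \<psi> A by (simp add: single) (simp add: is_simple_def)
    have "(LINT \<omega>|P. (W u A \<omega> - W s A \<omega>) * simple_integral W (e # \<psi>) \<omega>)
      = (LINT \<omega>|P. d * ((W u A \<omega> - W s A \<omega>) * (W u' B \<omega> - W s' B \<omega>)) + (W u A \<omega> - W s A \<omega>) * simple_integral W \<psi> \<omega>)"
      by (simp add: e simple_integral_Cons algebra_simps)
    also have "\<dots> = d * nform \<gamma> (cell s u A) (cell s' u' B) + nform \<gamma> (cell s u A) (simple_eval \<psi>)"
      using i1 i2 by (simp add: cell_isometry[OF \<gamma> P W A(3) su(3) A(1,2) su(1,2)] Cons.IH[OF \<psi>])
    also have "\<dots> = nform \<gamma> (cell s u A) (simple_eval (e # \<psi>))"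
      unfolding e simple_eval_Cons
      by (subst nform_lincomb_right[OF \<gamma> cell_admissible[OF \<gamma> su(3,1,2)] simple_eval_admissible[OF \<gamma> \<psi>] cell_admissible[OF \<gamma> A(3,1,2)]]) simp
    finally show ?case .
  qed
  show ?thesis using \<phi>
  proof (induction \<phi>)
    case Nil
    then show ?case by (simp add: simple_integral_def simple_eval_Nil nf0)
  next
    case (Cons e \<phi>)
    obtain c s u A where e: "e = (c, s, u, A)" by (cases e)
    have su: "0 \<le> s" "s \<le> u" "A \<in> bounded_borel" and \<phi>: "is_simple \<phi>" using Cons.prems by (auto simp: e is_simple_def)
    have i1: "integrable P (\<lambda>\<omega>. (W u A \<omega> - W s A \<omega>) * simple_integral W \<psi> \<omega>)"
      using i[of "[(1, s, u, A)]" \<psi>] \<psi> su by (simp add: single) (simp add: is_simple_def)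
    have "(LINT \<omega>|P. simple_integral W (e # \<phi>) \<omega> * simple_integral W \<psi> \<omega>)
      = (LINT \<omega>|P. c * ((W u A \<omega> - W s A \<omega>) * simple_integral W \<psi> \<omega>) + simple_integral W \<phi> \<omega> * simple_integral W \<psi> \<omega>)"
      by (simp add: e simple_integral_Cons algebra_simps)
    also have "\<dots> = c * nform \<gamma> (cell s u A) (simple_eval \<psi>) + nform \<gamma> (simple_eval \<phi>) (simple_eval \<psi>)"
      using i1 i[OF \<phi> \<psi>] by (simp add: one[OF \<psi> su] Cons.IH[OF \<phi>])
    also have "\<dots> = nform \<gamma> (simple_eval (e # \<phi>)) (simple_eval \<psi>)"
      unfolding e simple_eval_Cons
      by (subst nform_lincomb_left[OF \<gamma> cell_admissible[OF \<gamma> su(3,1,2)] simple_eval_admissible[OF \<gamma> \<phi>] simple_eval_admissible[OF \<gamma> \<psi>]]) simp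
    finally show ?case .
  qed
qed

lemma simple_integral_gauss_rv:
  assumes \<gamma>: "0 < \<gamma>" "\<gamma> < 1/4" and P: "prob_space P" and W: "riesz_noise P \<gamma> W" and \<phi>: "is_simple \<phi>"
  shows "gauss_rv P (simple_integral W \<phi>) (noise_norm2 \<gamma> (simple_eval \<phi>))"
proof -
  obtain v where v: "gauss_rv P (simple_integral W \<phi>) v" using simple_integral_gaussian[OF P W \<phi>] by blast
  from gauss_rv_square(2)[OF this] have "v = noise_norm2 \<gamma> (simple_eval \<phi>)"
    using simple_isometry[OF \<gamma> P W \<phi> \<phi>] by (simp add: noise_norm2_eq_nform power2_eq_square)
  then show ?thesis using v by simp
qed

text \<open>Mean-square limits of centered Gaussian variables are Gaussian, and the variances of the
  approximants converge by \<open>noise_norm2_tendsto\<close>.\<close>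

lemma wiener_integral_gauss_rv:
  assumes \<gamma>: "0 < \<gamma>" "\<gamma> < 1/4" and P: "prob_space P" and W: "riesz_noise P \<gamma> W"
    and I: "is_wiener_integral P \<gamma> W f I"
  shows "gauss_rv P I (noise_norm2 \<gamma> f)"
proof -
  interpret prob_space P by fact
  from I obtain \<phi> where \<phi>: "\<And>n. is_simple (\<phi> n)"
      "(\<lambda>n. noise_norm2 \<gamma> (\<lambda>s z. f s z - simple_eval (\<phi> n) s z)) \<longlonglongrightarrow> 0"
      "(\<lambda>n. LINT \<omega>|P. (I \<omega> - simple_integral W (\<phi> n) \<omega>)\<^sup>2) \<longlonglongrightarrow> 0"
    and f: "noise_admissible \<gamma> f" and "I \<in> borel_measurable P" "integrable P (\<lambda>\<omega>. (I \<omega>)\<^sup>2)"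
    unfolding is_wiener_integral_def by blast
  then show ?thesis
    by (intro gauss_rv_limit_L2[OF simple_integral_gauss_rv[OF \<gamma> P W \<phi>(1)] noise_norm2_tendsto[OF \<gamma> f simple_eval_admissible[OF \<gamma> \<phi>(1)] \<phi>(2)]])
qed

section \<open>Linearity of the Wiener integral\<close>

lemma simple_eval_append: "simple_eval (\<phi> @ \<psi>) r z = simple_eval \<phi> r z + simple_eval \<psi> r z"
  by (simp add: simple_eval_def)

lemma simple_eval_scale: "simple_eval (map (\<lambda>(d, e). (c * d, e)) \<phi>) r z = c * simple_eval \<phi> r z"
  by (induction \<phi>) (auto simp: simple_eval_def algebra_simps)

lemma simple_integral_append: "simple_integral W (\<phi> @ \<psi>) \<omega> = simple_integral W \<phi> \<omega> + simple_integral W \<psi> \<omega>"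
  by (simp add: simple_integral_def)

lemma simple_integral_scale: "simple_integral W (map (\<lambda>(d, e). (c * d, e)) \<phi>) \<omega> = c * simple_integral W \<phi> \<omega>"
  by (induction \<phi>) (auto simp: simple_integral_def algebra_simps)

text \<open>Concatenating the two scaled lists approximates the combination both in the seminorm and
  in mean square. Through it a finite combination of values of the solution is a multiple of a
  single Wiener integral.\<close>

lemma wiener_integral_lincomb:
  assumes \<gamma>: "0 < \<gamma>" "\<gamma> < 1/4" and P: "prob_space P" and W: "riesz_noise P \<gamma> W"
    and I: "is_wiener_integral P \<gamma> W f I" and J: "is_wiener_integral P \<gamma> W g J"
  shows "is_wiener_integral P \<gamma> W (\<lambda>s z. c * f s z + d * g s z) (\<lambda>\<omega>. c * I \<omega> + d * J \<omega>)"
proof -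
  interpret prob_space P by fact
  from I obtain \<phi> where \<phi>: "\<And>n. is_simple (\<phi> n)"
      "(\<lambda>n. noise_norm2 \<gamma> (\<lambda>s z. f s z - simple_eval (\<phi> n) s z)) \<longlonglongrightarrow> 0"
      "(\<lambda>n. LINT \<omega>|P. (I \<omega> - simple_integral W (\<phi> n) \<omega>)\<^sup>2) \<longlonglongrightarrow> 0"
    and f: "noise_admissible \<gamma> f" and [measurable]: "I \<in> borel_measurable P" and I2: "integrable P (\<lambda>\<omega>. (I \<omega>)\<^sup>2)"
    unfolding is_wiener_integral_def by blast
  from J obtain \<psi> where \<psi>: "\<And>n. is_simple (\<psi> n)"
      "(\<lambda>n. noise_norm2 \<gamma> (\<lambda>s z. g s z - simple_eval (\<psi> n) s z)) \<longlonglongrightarrow> 0"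
      "(\<lambda>n. LINT \<omega>|P. (J \<omega> - simple_integral W (\<psi> n) \<omega>)\<^sup>2) \<longlonglongrightarrow> 0"
    and g: "noise_admissible \<gamma> g" and [measurable]: "J \<in> borel_measurable P" and J2: "integrable P (\<lambda>\<omega>. (J \<omega>)\<^sup>2)"
    unfolding is_wiener_integral_def by blast
  define \<eta> where "\<eta> n = map (\<lambda>(e, x). (c * e, x)) (\<phi> n) @ map (\<lambda>(e, x). (d * e, x)) (\<psi> n)" for n
  have ev: "simple_eval (\<eta> n) r z = c * simple_eval (\<phi> n) r z + d * simple_eval (\<psi> n) r z" for n r z
    by (simp add: \<eta>_def simple_eval_append simple_eval_scale)
  have si: "simple_integral W (\<eta> n) \<omega> = c * simple_integral W (\<phi> n) \<omega> + d * simple_integral W (\<psi> n) \<omega>" for n \<omega>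
    by (simp add: \<eta>_def simple_integral_append simple_integral_scale)
  have sq: "(c * a + d * b)\<^sup>2 \<le> 2 * c\<^sup>2 * a\<^sup>2 + 2 * d\<^sup>2 * b\<^sup>2" for a b :: real
    using zero_le_power2[of "c * a - d * b"] unfolding power2_sum power2_diff power_mult_distrib by (simp add: algebra_simps)
  have sub: "noise_admissible \<gamma> (\<lambda>s z. f s z - simple_eval (\<phi> n) s z)" "noise_admissible \<gamma> (\<lambda>s z. g s z - simple_eval (\<psi> n) s z)" for n
    using noise_admissible_lincomb[OF \<gamma> f simple_eval_admissible[OF \<gamma> \<phi>(1)], of 1 "- 1"]
      noise_admissible_lincomb[OF \<gamma> g simple_eval_admissible[OF \<gamma> \<psi>(1)], of 1 "- 1"] by simp_all
  have L2: "simple_integral W \<phi> \<in> borel_measurable P" "integrable P (\<lambda>\<omega>. (simple_integral W \<phi> \<omega>)\<^sup>2)" if "is_simple \<phi>" for \<phi>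
    using simple_integral_gaussian[OF P W that] gauss_rvD(1) gauss_rv_square(1) by blast+
  have d2: "integrable P (\<lambda>\<omega>. (X \<omega> - Y \<omega>)\<^sup>2)" if [measurable]: "X \<in> borel_measurable P" "Y \<in> borel_measurable P"
    and "integrable P (\<lambda>\<omega>. (X \<omega>)\<^sup>2)" "integrable P (\<lambda>\<omega>. (Y \<omega>)\<^sup>2)" for X Y :: "'a \<Rightarrow> real"
    unfolding power2_diff using that integrable_mult_L2[OF that] by (simp add: mult.assoc)
  have iI: "integrable P (\<lambda>\<omega>. (I \<omega> - simple_integral W (\<phi> n) \<omega>)\<^sup>2)" for n
    by (intro d2 I2) (use L2[OF \<phi>(1)] in auto)
  have iJ: "integrable P (\<lambda>\<omega>. (J \<omega> - simple_integral W (\<psi> n) \<omega>)\<^sup>2)" for n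
    by (intro d2 J2) (use L2[OF \<psi>(1)] in auto)
  note [measurable] = L2(1)[OF \<phi>(1)] L2(1)[OF \<psi>(1)]
  show ?thesis unfolding is_wiener_integral_def
  proof (intro conjI exI[of _ \<eta>] allI)
    show "noise_admissible \<gamma> (\<lambda>s z. c * f s z + d * g s z)" by (rule noise_admissible_lincomb[OF \<gamma> f g])
    show "(\<lambda>\<omega>. c * I \<omega> + d * J \<omega>) \<in> borel_measurable P" by measurable
    show "integrable P (\<lambda>\<omega>. (c * I \<omega> + d * J \<omega>)\<^sup>2)"
    proof (rule Bochner_Integration.integrable_bound)
      show "integrable P (\<lambda>\<omega>. 2 * c\<^sup>2 * (I \<omega>)\<^sup>2 + 2 * d\<^sup>2 * (J \<omega>)\<^sup>2)" using I2 J2 by simp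
      show "AE \<omega> in P. norm ((c * I \<omega> + d * J \<omega>)\<^sup>2) \<le> norm (2 * c\<^sup>2 * (I \<omega>)\<^sup>2 + 2 * d\<^sup>2 * (J \<omega>)\<^sup>2)" using sq by simp
    qed simp
    show "is_simple (\<eta> n)" for n using \<phi>(1)[of n] \<psi>(1)[of n] by (auto simp: is_simple_def \<eta>_def)
    show "(\<lambda>n. noise_norm2 \<gamma> (\<lambda>s z. c * f s z + d * g s z - simple_eval (\<eta> n) s z)) \<longlonglongrightarrow> 0"
    proof (rule tendsto_sandwich[OF always_eventually always_eventually tendsto_const])
      have eq: "(\<lambda>s z. c * f s z + d * g s z - simple_eval (\<eta> n) s z)
         = (\<lambda>s z. c * (f s z - simple_eval (\<phi> n) s z) + d * (g s z - simple_eval (\<psi> n) s z))" for n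
        by (simp add: ev algebra_simps)
      show "\<forall>n. 0 \<le> noise_norm2 \<gamma> (\<lambda>s z. c * f s z + d * g s z - simple_eval (\<eta> n) s z)"
        unfolding eq by (intro allI noise_norm2_square(1)[OF \<gamma>] noise_admissible_lincomb[OF \<gamma>] sub)
      show "\<forall>n. noise_norm2 \<gamma> (\<lambda>s z. c * f s z + d * g s z - simple_eval (\<eta> n) s z)
        \<le> 2 * c\<^sup>2 * noise_norm2 \<gamma> (\<lambda>s z. f s z - simple_eval (\<phi> n) s z) + 2 * d\<^sup>2 * noise_norm2 \<gamma> (\<lambda>s z. g s z - simple_eval (\<psi> n) s z)"
        unfolding eq by (intro allI noise_norm2_lincomb_le[OF \<gamma>] sub)
      have "(\<lambda>n. 2 * c\<^sup>2 * noise_norm2 \<gamma> (\<lambda>s z. f s z - simple_eval (\<phi> n) s z) + 2 * d\<^sup>2 * noise_norm2 \<gamma> (\<lambda>s z. g s z - simple_eval (\<psi> n) s z)) \<longlonglongrightarrow> 2 * c\<^sup>2 * 0 + 2 * d\<^sup>2 * 0"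
        by (intro tendsto_intros \<phi> \<psi>)
      then show "(\<lambda>n. 2 * c\<^sup>2 * noise_norm2 \<gamma> (\<lambda>s z. f s z - simple_eval (\<phi> n) s z) + 2 * d\<^sup>2 * noise_norm2 \<gamma> (\<lambda>s z. g s z - simple_eval (\<psi> n) s z)) \<longlonglongrightarrow> 0" by simp
    qed
    show "(\<lambda>n. LINT \<omega>|P. (c * I \<omega> + d * J \<omega> - simple_integral W (\<eta> n) \<omega>)\<^sup>2) \<longlonglongrightarrow> 0"
    proof (rule tendsto_sandwich[OF always_eventually always_eventually tendsto_const])
      show "\<forall>n. 0 \<le> (LINT \<omega>|P. (c * I \<omega> + d * J \<omega> - simple_integral W (\<eta> n) \<omega>)\<^sup>2)" by simp
      show "\<forall>n. (LINT \<omega>|P. (c * I \<omega> + d * J \<omega> - simple_integral W (\<eta> n) \<omega>)\<^sup>2)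
        \<le> 2 * c\<^sup>2 * (LINT \<omega>|P. (I \<omega> - simple_integral W (\<phi> n) \<omega>)\<^sup>2) + 2 * d\<^sup>2 * (LINT \<omega>|P. (J \<omega> - simple_integral W (\<psi> n) \<omega>)\<^sup>2)"
      proof
        fix n
        have eq: "c * I \<omega> + d * J \<omega> - simple_integral W (\<eta> n) \<omega>
          = c * (I \<omega> - simple_integral W (\<phi> n) \<omega>) + d * (J \<omega> - simple_integral W (\<psi> n) \<omega>)" for \<omega>
          by (simp add: si algebra_simps)
        have "(LINT \<omega>|P. (c * I \<omega> + d * J \<omega> - simple_integral W (\<eta> n) \<omega>)\<^sup>2)
          \<le> (LINT \<omega>|P. 2 * c\<^sup>2 * (I \<omega> - simple_integral W (\<phi> n) \<omega>)\<^sup>2 + 2 * d\<^sup>2 * (J \<omega> - simple_integral W (\<psi> n) \<omega>)\<^sup>2)"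
          unfolding eq using iI iJ sq by (intro integral_mono') auto
        then show "(LINT \<omega>|P. (c * I \<omega> + d * J \<omega> - simple_integral W (\<eta> n) \<omega>)\<^sup>2)
        \<le> 2 * c\<^sup>2 * (LINT \<omega>|P. (I \<omega> - simple_integral W (\<phi> n) \<omega>)\<^sup>2) + 2 * d\<^sup>2 * (LINT \<omega>|P. (J \<omega> - simple_integral W (\<psi> n) \<omega>)\<^sup>2)"
          using iI iJ by simp
      qed
      have "(\<lambda>n. 2 * c\<^sup>2 * (LINT \<omega>|P. (I \<omega> - simple_integral W (\<phi> n) \<omega>)\<^sup>2) + 2 * d\<^sup>2 * (LINT \<omega>|P. (J \<omega> - simple_integral W (\<psi> n) \<omega>)\<^sup>2)) \<longlonglongrightarrow> 2 * c\<^sup>2 * 0 + 2 * d\<^sup>2 * 0"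
        by (intro tendsto_intros \<phi> \<psi>)
      then show "(\<lambda>n. 2 * c\<^sup>2 * (LINT \<omega>|P. (I \<omega> - simple_integral W (\<phi> n) \<omega>)\<^sup>2) + 2 * d\<^sup>2 * (LINT \<omega>|P. (J \<omega> - simple_integral W (\<psi> n) \<omega>)\<^sup>2)) \<longlonglongrightarrow> 0" by simp
    qed
  qed
qed

lemma wiener_integral_sum:
  assumes \<gamma>: "0 < \<gamma>" "\<gamma> < 1/4" and P: "prob_space P" and W: "riesz_noise P \<gamma> W"
    and "finite S" and I: "\<And>i. i \<in> S \<Longrightarrow> is_wiener_integral P \<gamma> W (f i) (I i)"
  shows "is_wiener_integral P \<gamma> W (\<lambda>s z. \<Sum>i\<in>S. c i * f i s z) (\<lambda>\<omega>. \<Sum>i\<in>S. c i * I i \<omega>)"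
  using assms(5,6)
proof (induction S)
  case empty
  have "noise_norm2 \<gamma> (\<lambda>s z. 0) = 0" by (simp add: noise_norm2_def case_prod_unfold)
  then show ?case
    by (auto simp: is_wiener_integral_def noise_admissible_zero simple_eval_Nil simple_integral_def is_simple_def
        intro!: exI[of _ "\<lambda>_. []"])
next
  case (insert j S)
  have "is_wiener_integral P \<gamma> W (\<lambda>s z. c j * f j s z + 1 * (\<Sum>i\<in>S. c i * f i s z)) (\<lambda>\<omega>. c j * I j \<omega> + 1 * (\<Sum>i\<in>S. c i * I i \<omega>))"
    by (rule wiener_integral_lincomb[OF \<gamma> P W]) (use insert in auto)
  then show ?case using insert.hyps by simp
qed

section \<open>Fourier analysis\<close>

lemma integrable_lborel_if_has_integral:
  fixes f :: "real \<Rightarrow> real"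
  assumes [measurable]: "f \<in> borel_measurable borel" "S \<in> sets borel" and f: "\<And>x. 0 \<le> f x" and i: "(f has_integral I) S"
  shows "integrable lborel (\<lambda>x. indicator S x * f x)"
proof (rule integrableI_nonneg)
  have "((\<lambda>x. if x \<in> S then f x else 0) has_integral I) UNIV"
    using i by (simp only: has_integral_restrict_UNIV)
  moreover have "(\<lambda>x. if x \<in> S then f x else 0) = (\<lambda>x. indicator S x * f x)"
    by (auto simp: indicator_def)
  ultimately have "((\<lambda>x. indicator S x * f x) has_integral I) UNIV" by metis
  then show "(\<integral>\<^sup>+x. ennreal (indicator S x * f x) \<partial>lborel) < \<infinity>"
    by (subst nn_integral_has_integral_lborel) (auto simp: f)
qed (use f in auto)

text \<open>Serves as majorant for the spectral integrals, with one power governing the origin and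
  another governing infinity.\<close>

lemma integrable_powr_two_sided:
  assumes "a > (-1::real)" "b < (-1::real)"
  shows "integrable lborel (\<lambda>x::real. if \<bar>x\<bar> \<le> 1 then \<bar>x\<bar> powr a else \<bar>x\<bar> powr b)"
proof -
  have 1: "integrable lborel (\<lambda>x::real. indicator {0..1} x * x powr a)"
    by (rule integrable_lborel_if_has_integral[OF _ _ _ has_integral_powr_from_0[of a 1]]) (use assms in auto)
  have 2: "integrable lborel (\<lambda>x::real. indicator {1..} x * x powr b)"
    by (rule integrable_lborel_if_has_integral[OF _ _ _ has_integral_powr_to_inf[of b 1]]) (use assms in auto)
  define g where "g x = indicator {0..1} x * x powr a + indicator {1..} x * x powr b" for x :: real
  have g: "integrable lborel g" using 1 2 by (simp add: g_def[abs_def])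
  have "integrable lborel (\<lambda>x. g (0 + (-1) * x))" by (rule lborel_integrable_real_affine[OF g]) simp
  then have "integrable lborel (\<lambda>x. g x + g (- x))" using g by simp
  then show ?thesis
    by (rule Bochner_Integration.integrable_bound) (auto simp: g_def indicator_def)
qed

text \<open>A single term of the exponential series suffices: \<open>exp y\<close> is at least
  \<open>y ^ k / fact k\<close>, and \<open>k\<close> is taken so large that
  \<open>\<alpha> * k \<ge> b\<close>.\<close>

lemma exp_minus_le_powr:
  assumes "\<alpha> > (0::real)" "\<tau> > 0"
  shows "\<exists>C\<ge>0. \<forall>x\<ge>1. exp (- (\<tau> * x powr \<alpha>)) \<le> C * x powr (- b)"
proof -
  obtain k :: nat where k: "real k \<ge> b / \<alpha>" using real_arch_simple by blast
  have "exp (- (\<tau> * x powr \<alpha>)) \<le> fact k / \<tau> ^ k * x powr (- b)" if x: "x \<ge> 1" for x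
  proof -
    define y where "y = \<tau> * x powr \<alpha>"
    have y: "y > 0" using assms x by (simp add: y_def)
    have "y ^ k / fact k \<le> exp y"
    proof -
      have "y ^ k / fact k = (\<Sum>n\<in>{k}. y ^ n /\<^sub>R fact n)" by (simp add: field_simps)
      also have "\<dots> \<le> (\<Sum>n. y ^ n /\<^sub>R fact n)" using y by (intro sum_le_suminf summable_exp_generic) auto
      finally show ?thesis by (simp add: exp_def)
    qed
    then have "exp (- y) \<le> fact k / y ^ k"
      using y by (simp add: exp_minus field_simps)
    also have "y ^ k = \<tau> ^ k * x powr (\<alpha> * real k)"
      using x by (simp add: y_def power_mult_distrib powr_powr[symmetric] powr_realpow)
    also have "fact k / (\<tau> ^ k * x powr (\<alpha> * real k)) = fact k / \<tau> ^ k * x powr (- (\<alpha> * real k))"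
      using x by (simp add: powr_minus field_simps)
    also have "\<dots> \<le> fact k / \<tau> ^ k * x powr (- b)"
      using x k assms by (intro mult_left_mono powr_mono) (auto simp: field_simps)
    finally show ?thesis by (simp add: y_def)
  qed
  then show ?thesis using assms by (intro exI[of _ "fact k / \<tau> ^ k"]) auto
qed

lemma integrable_powr_exp:
  assumes "\<alpha> > (0::real)" "\<tau> > 0" "\<beta> > (-1::real)"
  shows "integrable lborel (\<lambda>x::real. \<bar>x\<bar> powr \<beta> * exp (- (\<tau> * \<bar>x\<bar> powr \<alpha>)))"
proof -
  \<comment> \<open>Decay of order \<open>\<beta> + 2\<close> leaves
    \<open>\<bar>x\<bar> powr (- 2)\<close> at infinity after multiplication by
    \<open>\<bar>x\<bar> powr \<beta>\<close>.\<close>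
  obtain C where C: "C \<ge> 0" "\<And>x. x \<ge> 1 \<Longrightarrow> exp (- (\<tau> * x powr \<alpha>)) \<le> C * x powr (- (\<beta> + 2))"
    using exp_minus_le_powr[OF assms(1,2)] by blast
  show ?thesis
  proof (rule Bochner_Integration.integrable_bound)
    show "integrable lborel (\<lambda>x::real. (1 + C) * (if \<bar>x\<bar> \<le> 1 then \<bar>x\<bar> powr \<beta> else \<bar>x\<bar> powr (- 2)))"
      using assms by (intro integrable_mult_right integrable_powr_two_sided) auto
    have "\<bar>x\<bar> powr \<beta> * exp (- (\<tau> * \<bar>x\<bar> powr \<alpha>)) \<le> (1 + C) * (if \<bar>x\<bar> \<le> 1 then \<bar>x\<bar> powr \<beta> else \<bar>x\<bar> powr (- 2))" for x
    proof (cases "\<bar>x\<bar> \<le> 1")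
      case True
      have "\<bar>x\<bar> powr \<beta> * exp (- (\<tau> * \<bar>x\<bar> powr \<alpha>)) \<le> \<bar>x\<bar> powr \<beta> * 1"
        using assms by (intro mult_left_mono) auto
      also have "\<dots> \<le> (1 + C) * \<bar>x\<bar> powr \<beta>" using C(1) by (simp add: distrib_right)
      finally show ?thesis using True by simp
    next
      case False
      have "\<bar>x\<bar> powr \<beta> * exp (- (\<tau> * \<bar>x\<bar> powr \<alpha>)) \<le> \<bar>x\<bar> powr \<beta> * (C * \<bar>x\<bar> powr (- (\<beta> + 2)))"
        using C(2)[of "\<bar>x\<bar>"] False by (intro mult_left_mono) auto
      also have "\<dots> = C * (\<bar>x\<bar> powr \<beta> * \<bar>x\<bar> powr (- (\<beta> + 2)))" by simp
      also have "\<bar>x\<bar> powr \<beta> * \<bar>x\<bar> powr (- (\<beta> + 2)) = \<bar>x\<bar> powr (- 2)" by (simp add: powr_add[symmetric])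
      also have "C * \<dots> \<le> (1 + C) * \<bar>x\<bar> powr (- 2)" by (simp add: distrib_right)
      finally show ?thesis using False by simp
    qed
    then show "AE x in lborel. norm (\<bar>x\<bar> powr \<beta> * exp (- (\<tau> * \<bar>x\<bar> powr \<alpha>))) \<le> norm ((1 + C) * (if \<bar>x\<bar> \<le> 1 then \<bar>x\<bar> powr \<beta> else \<bar>x\<bar> powr (- 2)))"
      using C(1) by (intro AE_I2) (simp add: abs_mult)
  qed measurable
qed

lemma integrable_exp_minus_powr:
  assumes "\<alpha> > (0::real)" "\<tau> > 0"
  shows "integrable lborel (\<lambda>x::real. exp (- (\<tau> * \<bar>x\<bar> powr \<alpha>)))"
proof -
  have "integrable lborel (\<lambda>x::real. \<bar>x\<bar> powr 0 * exp (- (\<tau> * \<bar>x\<bar> powr \<alpha>)))"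
    by (rule integrable_powr_exp) (use assms in auto)
  then show ?thesis
  proof (rule integrable_cong_AE[THEN iffD1, rotated -1])
    show "AE x in lborel. \<bar>x\<bar> powr 0 * exp (- (\<tau> * \<bar>x\<bar> powr \<alpha>)) = exp (- (\<tau> * \<bar>x\<bar> powr \<alpha>))"
      using AE_lborel_singleton[of 0] by eventually_elim simp
  qed measurable
qed

lemma integrable_exp_minus_square: "c > 0 \<Longrightarrow> integrable lborel (\<lambda>x::real. exp (- (c * x\<^sup>2)))"
  using integrable_exp_minus_powr[of 2 c] by (simp add: powr_numeral)

text \<open>Substitution \<open>v = 1 / u\<close> in the Gamma integral. The change of variables is
  carried out for absolutely integrable functions on a set, hence the passage from nonnegative
  integrals to gauge integrals and back.\<close>

lemma nn_integral_inverse_gamma: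
  assumes a: "a > (0::real)" and c: "c > (0::real)"
  shows "(\<integral>\<^sup>+u. ennreal (indicator {0<..} u * u powr (- a - 1) * exp (- (c / u))) \<partial>lborel) = ennreal (Gamma a * c powr (- a))"
proof -
  define f where "f u = u powr (- a - 1) * exp (- (c / u))" for u :: real
  define h where "h v = v powr (a - 1) * exp (- (c * v))" for v :: real
  define V where "V = Gamma a * c powr (- a)"
  have V: "V \<ge> 0" using Gamma_real_pos[OF a] by (simp add: V_def)
  have nnh: "(\<integral>\<^sup>+v. ennreal (indicator {0<..} v * h v) \<partial>lborel) = ennreal V"
    using nn_integral_gamma_scaled[OF a c] by (simp add: h_def V_def mult.assoc)
  have [measurable]: "h \<in> borel_measurable borel" "f \<in> borel_measurable borel" unfolding h_def f_def by measurable
  have ih: "integrable lborel (\<lambda>v. indicator {0<..} v * h v)"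
    by (rule integrableI_nonneg) (auto simp: nnh, auto simp: h_def)
  have Vh: "(LINT v|lborel. indicator {0<..} v * h v) = V"
    using nnh V by (subst integral_eq_nn_integral) (auto simp: h_def)
  have h: "h absolutely_integrable_on {0<..}" "integral {0<..} h = V"
  proof -
    have "integrable lebesgue (\<lambda>v. indicator {0<..} v *\<^sub>R h v)"
      using ih by (simp add: integrable_completion)
    then show ai: "h absolutely_integrable_on {0<..}" by (simp add: set_integrable_def)
    have "(LINT v:{0<..}|lebesgue. h v) = integral {0<..} h"
      by (rule set_lebesgue_integral_eq_integral(2)[OF ai])
    moreover have "(LINT v:{0<..}|lebesgue. h v) = V"
      using Vh by (simp add: set_lebesgue_integral_def integral_completion)
    ultimately show "integral {0<..} h = V" by simp
  qed
  have img: "(\<lambda>v::real. 1 / v) ` {0<..} = {0<..}"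
    by (auto intro!: image_eqI[where x="1 / _"])
  have "(\<lambda>x. \<bar>- (1 / x\<^sup>2)\<bar> * f (1 / x)) absolutely_integrable_on {0<..} \<and>
        integral {0<..} (\<lambda>x. \<bar>- (1 / x\<^sup>2)\<bar> * f (1 / x)) = V
    \<longleftrightarrow> f absolutely_integrable_on ((\<lambda>v. 1 / v) ` {0<..}) \<and> integral ((\<lambda>v. 1 / v) ` {0<..}) f = V"
  proof (rule has_absolute_integral_change_of_variables_1')
    show "((\<lambda>v. 1 / v) has_real_derivative - (1 / x\<^sup>2)) (at x within {0<..})" if "x \<in> {0<..}" for x :: real
      using that by (auto intro!: derivative_eq_intros simp: power2_eq_square)
    show "inj_on (\<lambda>v::real. 1 / v) {0<..}" by (auto simp: inj_on_def)
  qed simp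
  moreover have sub: "\<bar>- (1 / x\<^sup>2)\<bar> * f (1 / x) = h x" if "x \<in> {0<..}" for x
  proof -
    have x: "x > 0" using that by simp
    have "(1 / x) powr (- a - 1) = x powr (- (- a - 1))"
      unfolding powr_minus_divide using x by (simp add: powr_divide)
    then have "(1 / x) powr (- a - 1) = x powr (a + 1)" by (simp add: add.commute)
    moreover have "1 / x\<^sup>2 = x powr (- 2)" using x by (simp add: powr_minus powr_numeral divide_inverse)
    ultimately have "\<bar>- (1 / x\<^sup>2)\<bar> * f (1 / x) = (x powr (- 2) * x powr (a + 1)) * exp (- (c * x))"
      using x by (simp add: f_def)
    then show ?thesis by (simp add: powr_add[symmetric] h_def)
  qed
  moreover have "(\<lambda>x. \<bar>- (1 / x\<^sup>2)\<bar> * f (1 / x)) absolutely_integrable_on {0<..}"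
    using h(1) by (rule set_integrable_cong[THEN iffD1, rotated -1]) (use sub in auto)
  moreover have "integral {0<..} (\<lambda>x. \<bar>- (1 / x\<^sup>2)\<bar> * f (1 / x)) = V"
    using h(2) by (subst Henstock_Kurzweil_Integration.integral_cong[OF sub]) auto
  ultimately have f: "f absolutely_integrable_on {0<..}" "integral {0<..} f = V"
    unfolding img by auto
  then have "(f has_integral V) {0<..}"
    by (auto simp: has_integral_integrable_integral dest: set_lebesgue_integral_eq_integral(1))
  then have "((\<lambda>u. if u \<in> {0<..} then f u else 0) has_integral V) UNIV"
    by (simp only: has_integral_restrict_UNIV)
  moreover have "(\<lambda>u. if u \<in> {0<..} then f u else 0) = (\<lambda>u. indicator {0<..} u * f u)"
    by (auto simp: indicator_def)
  ultimately have "((\<lambda>u. indicator {0<..} u * f u) has_integral V) UNIV" by metis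
  then have "(\<integral>\<^sup>+u. ennreal (indicator {0<..} u * f u) \<partial>lborel) = ennreal V"
    by (intro nn_integral_has_integral_lborel) (auto simp: f_def)
  then show ?thesis by (simp add: f_def V_def mult.assoc)
qed

section \<open>Fourier transforms of Gaussians, and Plancherel\<close>

lemma normal_density_fourier:
  assumes \<sigma>: "\<sigma> > 0"
  shows "(LINT x|lborel. of_real (normal_density m \<sigma> x) * iexp (t * x)) = iexp (t * m) * of_real (exp (- (\<sigma> * t)\<^sup>2 / 2))"
proof -
  have "(LINT x|lborel. of_real (normal_density m \<sigma> x) * iexp (t * x))
    = \<bar>\<sigma>\<bar> *\<^sub>R (LINT x|lborel. of_real (normal_density m \<sigma> (m + \<sigma> * x)) * iexp (t * (m + \<sigma> * x)))"
    using \<sigma> by (intro lborel_integral_real_affine) simp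
  also have "\<dots> = (LINT x|lborel. iexp (t * m) * (std_normal_density x *\<^sub>R iexp ((\<sigma> * t) * x)))"
  proof -
    have nd: "normal_density m \<sigma> (m + \<sigma> * x) = std_normal_density x / \<sigma>" for x
      using \<sigma> by (simp add: normal_density_def real_sqrt_mult power_mult_distrib field_simps)
    have "\<bar>\<sigma>\<bar> *\<^sub>R (of_real (normal_density m \<sigma> (m + \<sigma> * x)) * iexp (t * (m + \<sigma> * x)))
       = iexp (t * m) * (std_normal_density x *\<^sub>R iexp ((\<sigma> * t) * x))" for x
      unfolding nd using \<sigma> by (simp add: scaleR_conv_of_real exp_add[symmetric] algebra_simps)
    then show ?thesis unfolding integral_scaleR_right[symmetric] by simp
  qed
  also have "\<dots> = iexp (t * m) * (LINT x|lborel. std_normal_density x *\<^sub>R iexp ((\<sigma> * t) * x))"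
    by (rule integral_mult_right_zero)
  also have "(LINT x|lborel. std_normal_density x *\<^sub>R iexp ((\<sigma> * t) * x)) = char std_normal_distribution (\<sigma> * t)"
    unfolding char_def by (subst integral_density) auto
  also have "char std_normal_distribution (\<sigma> * t) = of_real (exp (- (\<sigma> * t)\<^sup>2 / 2))"
    by (simp add: char_std_normal_distribution)
  finally show ?thesis .
qed

lemma gk_fourier:
  assumes u: "u > 0"
  shows "(LINT x|lborel. of_real (gk u p x) * iexp (t * x)) = of_real (sqrt (pi / (2 * u))) * (iexp (t * p) * of_real (exp (- t\<^sup>2 / (8 * u))))"
proof -
  \<comment> \<open>Read off from \<open>2 * u = 1 / (2 * \<sigma>\<^sup>2)\<close>.\<close>
  define \<sigma> where "\<sigma> = 1 / sqrt (4 * u)"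
  have \<sigma>: "\<sigma> > 0" "\<sigma>\<^sup>2 = 1 / (4 * u)" using u by (auto simp: \<sigma>_def power_divide)
  have gk: "gk u p x = sqrt (pi / (2 * u)) * normal_density p \<sigma> x" for x
    using u unfolding gk_def normal_density_def \<sigma>(2) by (simp add: field_simps)
  have "(LINT x|lborel. of_real (gk u p x) * iexp (t * x)) = of_real (sqrt (pi / (2 * u))) * (LINT x|lborel. of_real (normal_density p \<sigma> x) * iexp (t * x))"
    unfolding gk by (simp add: mult.assoc)
  also have "\<dots> = of_real (sqrt (pi / (2 * u))) * (iexp (t * p) * of_real (exp (- (\<sigma> * t)\<^sup>2 / 2)))"
    unfolding normal_density_fourier[OF \<sigma>(1)] ..
  also have "- (\<sigma> * t)\<^sup>2 / 2 = - t\<^sup>2 / (8 * u)" by (simp add: power_mult_distrib \<sigma>(2))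
  finally show ?thesis .
qed

lemma integrable_gk: "u > 0 \<Longrightarrow> integrable lborel (gk u p)"
proof -
  assume u: "u > 0"
  have "integrable lborel (\<lambda>x. exp (- (2 * u * (- p + 1 * x)\<^sup>2)))"
    by (rule lborel_integrable_real_affine[of "\<lambda>x. exp (- (2 * u * x\<^sup>2))" 1 "- p"]) (use integrable_exp_minus_square[of "2 * u"] u in auto)
  then show ?thesis by (simp add: gk_def[abs_def])
qed

text \<open>The left-hand side is regularized by the Gaussian factors \<open>\<psi> n\<close>, whose Fourier transforms form an
  approximate identity; no inversion formula is needed.\<close>

lemma plancherel:
  fixes A :: "real \<Rightarrow> complex"
  assumes cont: "continuous_on UNIV A" and bd: "\<And>x. norm (A x) \<le> B" and int: "integrable lborel A"
  shows "(\<integral>\<^sup>+p. ennreal ((norm (LINT \<xi>|lborel. A \<xi> * iexp (- (p * \<xi>))))\<^sup>2) \<partial>lborel) = ennreal (2 * pi) * (\<integral>\<^sup>+\<xi>. ennreal ((norm (A \<xi>))\<^sup>2) \<partial>lborel)"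
proof -
  have mA[measurable]: "A \<in> borel_measurable borel" using int by simp
  have [measurable]: "cnj \<in> borel_measurable borel"
    by (intro borel_measurable_continuous_onI continuous_intros)
  have B: "B \<ge> 0" using bd[of 0] norm_ge_zero order_trans by blast
  define Ah where "Ah p = (LINT \<xi>|lborel. A \<xi> * iexp (- (p * \<xi>)))" for p
  have Ahm[measurable]: "Ah \<in> borel_measurable borel"
    unfolding Ah_def by measurable
  define L where "L = (LINT \<xi>|lborel. norm (A \<xi>))"
  have Ahb: "norm (Ah p) \<le> L" for p
    unfolding Ah_def L_def by (rule order.trans[OF integral_norm_bound]) (simp add: norm_mult)
  have L: "L \<ge> 0" by (simp add: L_def)
  define \<psi> where "\<psi> n p = exp (- (p\<^sup>2 / (2 * (real (Suc n))\<^sup>2)))" for n p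
  have [measurable]: "\<psi> n \<in> borel_measurable borel" for n unfolding \<psi>_def by measurable
  have i\<psi>: "integrable lborel (\<psi> n)" for n
    using integrable_exp_minus_square[of "1 / (2 * (real (Suc n))\<^sup>2)"] by (simp add: \<psi>_def[abs_def])
  have \<psi>nd: "\<psi> n p = (real (Suc n) * sqrt (2 * pi)) * normal_density 0 (real (Suc n)) p" for n p
    by (simp add: \<psi>_def normal_density_def real_sqrt_mult)
  have \<psi>f: "(LINT p|lborel. of_real (\<psi> n p) * iexp (t * p)) = of_real (real (Suc n) * sqrt (2 * pi) * exp (- (real (Suc n) * t)\<^sup>2 / 2))" for n t
    unfolding \<psi>nd using normal_density_fourier[of "real (Suc n)" 0 t] by (simp add: mult.assoc del: of_nat_Suc)
  define Q where "Q n = (LINT p|lborel. (norm (Ah p))\<^sup>2 * \<psi> n p)" for n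
  have iQ: "integrable lborel (\<lambda>p. (norm (Ah p))\<^sup>2 * \<psi> n p)" for n
  proof (rule Bochner_Integration.integrable_bound)
    show "integrable lborel (\<lambda>p. L\<^sup>2 * \<psi> n p)" using i\<psi> by simp
    show "AE p in lborel. norm ((norm (Ah p))\<^sup>2 * \<psi> n p) \<le> norm (L\<^sup>2 * \<psi> n p)"
      using power_mono[OF Ahb norm_ge_zero, of _ 2] by (auto simp: abs_mult \<psi>_def)
  qed measurable
  \<comment> \<open>Gaussian average of \<open>A\<close> around \<open>\<eta>\<close> at scale
    \<open>1 / (n + 1)\<close>, as it arises from the transform of \<open>\<psi> n\<close> after
    rescaling; it tends to \<open>sqrt (2 * pi) * A \<eta>\<close>.\<close>
  define G where "G n \<eta> = (LINT v|lborel. A (\<eta> + v / real (Suc n)) * of_real (exp (- v\<^sup>2 / 2)))" for n \<eta>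
  have inner: "(LINT p|lborel. Ah p * iexp (p * \<eta>) * of_real (\<psi> n p)) = of_real (sqrt (2 * pi)) * G n \<eta>" for n \<eta>
  proof -
    define N where "N = real (Suc n)"
    have N: "N > 0" by (simp add: N_def)
    have iF: "integrable (lborel \<Otimes>\<^sub>M lborel) (\<lambda>(p, \<xi>). A \<xi> * iexp (- (p * \<xi>)) * iexp (p * \<eta>) * of_real (\<psi> n p))"
    proof (rule lborel_pair.Fubini_integrable)
      show "integrable lborel (\<lambda>p. LINT \<xi>|lborel. norm (case (p, \<xi>) of (p, \<xi>) \<Rightarrow> A \<xi> * iexp (- (p * \<xi>)) * iexp (p * \<eta>) * of_real (\<psi> n p)))"
        using i\<psi>[of n] by (simp add: norm_mult \<psi>_def[abs_def])
      show "AE p in lborel. integrable lborel (\<lambda>\<xi>. case (p, \<xi>) of (p, \<xi>) \<Rightarrow> A \<xi> * iexp (- (p * \<xi>)) * iexp (p * \<eta>) * of_real (\<psi> n p))"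
      proof (intro AE_I2)
        fix p
        have "integrable lborel (\<lambda>\<xi>. norm (A \<xi>) * \<psi> n p)" using int by simp
        then show "integrable lborel (\<lambda>\<xi>. case (p, \<xi>) of (p, \<xi>) \<Rightarrow> A \<xi> * iexp (- (p * \<xi>)) * iexp (p * \<eta>) * of_real (\<psi> n p))"
          by (rule Bochner_Integration.integrable_bound) (auto simp: norm_mult)
      qed
    qed measurable
    have "(LINT p|lborel. Ah p * iexp (p * \<eta>) * of_real (\<psi> n p))
      = (LINT p|lborel. LINT \<xi>|lborel. A \<xi> * iexp (- (p * \<xi>)) * iexp (p * \<eta>) * of_real (\<psi> n p))"
      by (simp only: Ah_def integral_mult_left_zero)
    also have "\<dots> = (LINT \<xi>|lborel. LINT p|lborel. A \<xi> * iexp (- (p * \<xi>)) * iexp (p * \<eta>) * of_real (\<psi> n p))"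
      by (rule lborel_pair.Fubini_integral[symmetric, OF iF])
    also have "\<dots> = (LINT \<xi>|lborel. A \<xi> * of_real (N * sqrt (2 * pi) * exp (- (N * (\<eta> - \<xi>))\<^sup>2 / 2)))"
    proof (rule Bochner_Integration.integral_cong[OF refl])
      fix \<xi>
      have "A \<xi> * iexp (- (p * \<xi>)) * iexp (p * \<eta>) * of_real (\<psi> n p) = A \<xi> * (of_real (\<psi> n p) * iexp ((\<eta> - \<xi>) * p))" for p
        by (simp add: mult.assoc exp_add[symmetric]) (simp add: algebra_simps)
      then have "(LINT p|lborel. A \<xi> * iexp (- (p * \<xi>)) * iexp (p * \<eta>) * of_real (\<psi> n p)) = A \<xi> * (LINT p|lborel. of_real (\<psi> n p) * iexp ((\<eta> - \<xi>) * p))"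
        by (simp only: integral_mult_right_zero)
      then show "(LINT p|lborel. A \<xi> * iexp (- (p * \<xi>)) * iexp (p * \<eta>) * of_real (\<psi> n p)) = A \<xi> * of_real (N * sqrt (2 * pi) * exp (- (N * (\<eta> - \<xi>))\<^sup>2 / 2))"
        unfolding \<psi>f N_def .
    qed
    also have "\<dots> = \<bar>1 / N\<bar> *\<^sub>R (LINT v|lborel. A (\<eta> + 1 / N * v) * of_real (N * sqrt (2 * pi) * exp (- (N * (\<eta> - (\<eta> + 1 / N * v)))\<^sup>2 / 2)))"
      using N by (intro lborel_integral_real_affine) simp
    also have "\<dots> = (LINT v|lborel. of_real (sqrt (2 * pi)) * (A (\<eta> + v / N) * of_real (exp (- v\<^sup>2 / 2))))"
      unfolding integral_scaleR_right[symmetric] using N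
      by (intro Bochner_Integration.integral_cong) (auto simp: scaleR_conv_of_real power_mult_distrib power_divide field_simps)
    also have "\<dots> = of_real (sqrt (2 * pi)) * G n \<eta>"
      unfolding G_def N_def by (rule integral_mult_right_zero)
    finally show ?thesis .
  qed
  \<comment> \<open>Only one of the two factors \<open>Ah p\<close> and \<open>cnj (Ah p)\<close> is
    expanded; the integral over \<open>p\<close> that is left has been computed in
    \<open>inner\<close>.\<close>
  have Qeq: "of_real (Q n) = (LINT \<eta>|lborel. cnj (A \<eta>) * (of_real (sqrt (2 * pi)) * G n \<eta>))" for n
  proof -
    have iF: "integrable (lborel \<Otimes>\<^sub>M lborel) (\<lambda>(p, \<eta>). cnj (A \<eta>) * (Ah p * iexp (p * \<eta>) * of_real (\<psi> n p)))"
    proof (rule lborel_pair.Fubini_integrable)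
      have "integrable lborel (\<lambda>p. norm (Ah p) * \<psi> n p)"
      proof (rule Bochner_Integration.integrable_bound)
        show "integrable lborel (\<lambda>p. L * \<psi> n p)" using i\<psi> by simp
        show "AE p in lborel. norm (norm (Ah p) * \<psi> n p) \<le> norm (L * \<psi> n p)"
          using Ahb L by (auto simp: abs_mult \<psi>_def)
      qed measurable
      then have "integrable lborel (\<lambda>p. L * (norm (Ah p) * \<psi> n p))" by simp
      then show "integrable lborel (\<lambda>p. LINT \<eta>|lborel. norm (case (p, \<eta>) of (p, \<eta>) \<Rightarrow> cnj (A \<eta>) * (Ah p * iexp (p * \<eta>) * of_real (\<psi> n p))))"
        by (simp add: norm_mult L_def \<psi>_def[abs_def])
      show "AE p in lborel. integrable lborel (\<lambda>\<eta>. case (p, \<eta>) of (p, \<eta>) \<Rightarrow> cnj (A \<eta>) * (Ah p * iexp (p * \<eta>) * of_real (\<psi> n p)))"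
      proof (intro AE_I2)
        fix p
        have "integrable lborel (\<lambda>\<eta>. norm (A \<eta>) * norm (Ah p * of_real (\<psi> n p)))" using int by simp
        then show "integrable lborel (\<lambda>\<eta>. case (p, \<eta>) of (p, \<eta>) \<Rightarrow> cnj (A \<eta>) * (Ah p * iexp (p * \<eta>) * of_real (\<psi> n p)))"
          by (rule Bochner_Integration.integrable_bound) (auto simp: norm_mult)
      qed
    qed measurable
    have cnjAh: "cnj (Ah p) = (LINT \<eta>|lborel. cnj (A \<eta>) * iexp (p * \<eta>))" for p
      unfolding Ah_def by (simp add: Bochner_Integration.integral_cnj[symmetric] exp_cnj del: Bochner_Integration.integral_cnj)
    have "complex_of_real (Q n) = (LINT p|lborel. of_real ((norm (Ah p))\<^sup>2 * \<psi> n p))"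
      by (simp only: Q_def integral_complex_of_real)
    also have "\<dots> = (LINT p|lborel. cnj (Ah p) * (Ah p * of_real (\<psi> n p)))"
      by (rule Bochner_Integration.integral_cong[OF refl]) (simp only: of_real_mult complex_norm_square mult_ac)
    also have "\<dots> = (LINT p|lborel. LINT \<eta>|lborel. cnj (A \<eta>) * iexp (p * \<eta>) * (Ah p * of_real (\<psi> n p)))"
      by (simp only: cnjAh integral_mult_left_zero)
    also have "\<dots> = (LINT p|lborel. LINT \<eta>|lborel. cnj (A \<eta>) * (Ah p * iexp (p * \<eta>) * of_real (\<psi> n p)))"
      by (simp add: mult_ac)
    also have "\<dots> = (LINT \<eta>|lborel. LINT p|lborel. cnj (A \<eta>) * (Ah p * iexp (p * \<eta>) * of_real (\<psi> n p)))"
      by (rule lborel_pair.Fubini_integral[symmetric, OF iF])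
    also have "\<dots> = (LINT \<eta>|lborel. cnj (A \<eta>) * (of_real (sqrt (2 * pi)) * G n \<eta>))"
      unfolding integral_mult_right_zero inner ..
    finally show ?thesis .
  qed
  have nd: "exp (- v\<^sup>2 / 2) = sqrt (2 * pi) * std_normal_density v" for v :: real
    by (simp add: normal_density_def)
  have ie: "integrable lborel (\<lambda>v::real. exp (- v\<^sup>2 / 2))"
    using integrable_exp_minus_square[of "1/2"] by simp
  have e1: "(LINT v|lborel. exp (- v\<^sup>2 / 2)) = sqrt (2 * pi)"
    using normal_density_fourier[of 1 0 0] unfolding nd by (simp flip: of_real_eq_iff)
  have Glim: "(\<lambda>n. G n \<eta>) \<longlonglongrightarrow> A \<eta> * of_real (sqrt (2 * pi))" for \<eta>
  proof -
    have "(\<lambda>n. G n \<eta>) \<longlonglongrightarrow> (LINT v|lborel. A \<eta> * of_real (exp (- v\<^sup>2 / 2)))"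
      unfolding G_def
    proof (rule integral_dominated_convergence[where w="\<lambda>v. B * exp (- v\<^sup>2 / 2)"])
      show "AE v in lborel. (\<lambda>n. A (\<eta> + v / real (Suc n)) * of_real (exp (- v\<^sup>2 / 2))) \<longlonglongrightarrow> A \<eta> * of_real (exp (- v\<^sup>2 / 2))"
      proof (intro AE_I2 tendsto_intros)
        fix v :: real
        have "(\<lambda>n. \<eta> + v / real (Suc n)) \<longlonglongrightarrow> \<eta> + 0"
          by (intro tendsto_intros LIMSEQ_Suc[OF lim_const_over_n])
        then show "(\<lambda>n. A (\<eta> + v / real (Suc n))) \<longlonglongrightarrow> A \<eta>"
          using cont by (intro continuous_on_tendsto_compose[OF cont]) auto
      qed
      show "integrable lborel (\<lambda>v. B * exp (- v\<^sup>2 / 2))" using ie by simp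
    qed (use bd in \<open>auto simp: norm_mult\<close>)
    then show ?thesis using e1 by simp
  qed
  have Gb: "norm (G n \<eta>) \<le> B * sqrt (2 * pi)" for n \<eta>
  proof -
    have "norm (G n \<eta>) \<le> (LINT v|lborel. B * exp (- v\<^sup>2 / 2))"
      unfolding G_def using ie bd by (intro order.trans[OF integral_norm_bound] integral_mono')
        (auto simp: norm_mult B)
    then show ?thesis using e1 by simp
  qed
  have Gm[measurable]: "G n \<in> borel_measurable borel" for n unfolding G_def by measurable
  define R where "R = (LINT \<eta>|lborel. (norm (A \<eta>))\<^sup>2)"
  have "(\<lambda>n. LINT \<eta>|lborel. cnj (A \<eta>) * (of_real (sqrt (2 * pi)) * G n \<eta>)) \<longlonglongrightarrow> (LINT \<eta>|lborel. cnj (A \<eta>) * (of_real (sqrt (2 * pi)) * (A \<eta> * of_real (sqrt (2 * pi)))))"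
  proof (rule integral_dominated_convergence[where w="\<lambda>\<eta>. norm (A \<eta>) * (sqrt (2 * pi) * (B * sqrt (2 * pi)))"])
    show "AE \<eta> in lborel. norm (cnj (A \<eta>) * (of_real (sqrt (2 * pi)) * G n \<eta>)) \<le> norm (A \<eta>) * (sqrt (2 * pi) * (B * sqrt (2 * pi)))" for n
      using Gb by (intro AE_I2) (auto simp: norm_mult intro!: mult_left_mono)
  qed (use int in \<open>auto intro!: AE_I2 tendsto_intros Glim\<close>)
  moreover have "(LINT \<eta>|lborel. cnj (A \<eta>) * (of_real (sqrt (2 * pi)) * (A \<eta> * of_real (sqrt (2 * pi))))) = of_real (2 * pi * R)"
  proof -
    have sq: "complex_of_real (sqrt (2 * pi)) * of_real (sqrt (2 * pi)) = of_real (2 * pi)"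
      by (subst of_real_mult[symmetric]) simp
    have "cnj (A \<eta>) * (of_real (sqrt (2 * pi)) * (A \<eta> * of_real (sqrt (2 * pi)))) = of_real (2 * pi * (norm (A \<eta>))\<^sup>2)" for \<eta>
    proof -
      have "cnj (A \<eta>) * (of_real (sqrt (2 * pi)) * (A \<eta> * of_real (sqrt (2 * pi))))
        = (complex_of_real (sqrt (2 * pi)) * of_real (sqrt (2 * pi))) * (A \<eta> * cnj (A \<eta>))" by (simp only: mult_ac)
      also have "\<dots> = of_real (2 * pi * (norm (A \<eta>))\<^sup>2)"
        unfolding sq complex_norm_square[symmetric] by simp
      finally show ?thesis .
    qed
    then show ?thesis by (simp only: integral_complex_of_real integral_mult_right_zero R_def)
  qed
  ultimately have "(\<lambda>n. complex_of_real (Q n)) \<longlonglongrightarrow> of_real (2 * pi * R)" unfolding Qeq by simp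
  then have Qlim: "Q \<longlonglongrightarrow> 2 * pi * R" by (simp only: tendsto_of_real_iff)
  have iR: "integrable lborel (\<lambda>\<eta>. (norm (A \<eta>))\<^sup>2)"
  proof (rule Bochner_Integration.integrable_bound)
    show "integrable lborel (\<lambda>\<eta>. B * norm (A \<eta>))" using int by simp
    show "AE \<eta> in lborel. norm ((norm (A \<eta>))\<^sup>2) \<le> norm (B * norm (A \<eta>))"
      using bd B by (intro AE_I2) (auto simp: power2_eq_square intro!: mult_right_mono)
  qed measurable
  have R: "(\<integral>\<^sup>+\<xi>. ennreal ((norm (A \<xi>))\<^sup>2) \<partial>lborel) = ennreal R"
    unfolding R_def using iR by (intro nn_integral_eq_integral) auto
  have "(\<lambda>n. \<integral>\<^sup>+p. ennreal ((norm (Ah p))\<^sup>2 * \<psi> n p) \<partial>lborel) \<longlonglongrightarrow> (\<integral>\<^sup>+p. ennreal ((norm (Ah p))\<^sup>2) \<partial>lborel)"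
  \<comment> \<open>\<open>\<psi> n\<close> increases to 1. Monotone convergence is used because
    square integrability of \<open>Ah\<close> is not known beforehand; it comes out as part of the
    result.\<close>
  proof (rule nn_integral_LIMSEQ)
    show "incseq (\<lambda>n p. ennreal ((norm (Ah p))\<^sup>2 * \<psi> n p))"
    proof (intro incseq_SucI le_funI ennreal_leI mult_left_mono)
      show "\<psi> n p \<le> \<psi> (Suc n) p" for n p
        unfolding \<psi>_def by (auto intro!: divide_left_mono mult_left_mono power_mono)
    qed simp
    show "(\<lambda>n. ennreal ((norm (Ah p))\<^sup>2 * \<psi> n p)) \<longlonglongrightarrow> ennreal ((norm (Ah p))\<^sup>2)" for p
    proof -
      have "(\<lambda>n. \<psi> n p) \<longlonglongrightarrow> 1" unfolding \<psi>_def by real_asymp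
      then have "(\<lambda>n. (norm (Ah p))\<^sup>2 * \<psi> n p) \<longlonglongrightarrow> (norm (Ah p))\<^sup>2 * 1" by (intro tendsto_intros)
      then show ?thesis by (intro tendsto_ennrealI) simp
    qed
  qed measurable
  moreover have "(\<integral>\<^sup>+p. ennreal ((norm (Ah p))\<^sup>2 * \<psi> n p) \<partial>lborel) = ennreal (Q n)" for n
    unfolding Q_def by (rule nn_integral_eq_integral[OF iQ]) (simp add: \<psi>_def)
  moreover have "(\<lambda>n. ennreal (Q n)) \<longlonglongrightarrow> ennreal (2 * pi * R)" by (intro tendsto_ennrealI Qlim)
  ultimately have "(\<integral>\<^sup>+p. ennreal ((norm (Ah p))\<^sup>2) \<partial>lborel) = ennreal (2 * pi * R)"
    using LIMSEQ_unique by fastforce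
  then show ?thesis unfolding R Ah_def by (simp add: ennreal_mult')
qed

section \<open>Spectral representation of the solution\<close>

text \<open>Fourier symbol of the functional \<open>\<Sum>i\<in>S. c i * f (x i)\<close>; its
  squared modulus weights the spectral density in the variance.\<close>

definition esum :: "'i set \<Rightarrow> ('i \<Rightarrow> real) \<Rightarrow> ('i \<Rightarrow> real) \<Rightarrow> real \<Rightarrow> complex" where
  "esum S c x \<xi> = (\<Sum>i\<in>S. of_real (c i) * iexp (x i * \<xi>))"

text \<open>Spectral density of the solution at time \<open>t\<close> for noise level 1: the first
  factor belongs to the noise, and the second is the integral of \<open>exp (- (2 * \<theta> * (t -
  s) * \<bar>\<xi>\<bar> powr \<alpha>))\<close> over \<open>s\<close> in
  \<open>{0..t}\<close>.\<close>

definition sol_spec :: "real \<Rightarrow> real \<Rightarrow> real \<Rightarrow> real \<Rightarrow> real \<Rightarrow> real" where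
  "sol_spec \<alpha> \<gamma> \<theta> t \<xi> = \<bar>\<xi>\<bar> powr (- 4 * \<gamma>) / (2 * pi) * ((1 - exp (- (2 * \<theta> * t * \<bar>\<xi>\<bar> powr \<alpha>))) / (2 * \<theta> * \<bar>\<xi>\<bar> powr \<alpha>))"

lemma esum_continuous: "continuous_on UNIV (esum S c x)"
  unfolding esum_def by (intro continuous_intros)

lemma esum_measurable[measurable]: "esum S c x \<in> borel_measurable borel"
  by (intro borel_measurable_continuous_onI esum_continuous)

lemma norm_esum_le: "norm (esum S c x \<xi>) \<le> (\<Sum>i\<in>S. \<bar>c i\<bar>)"
  unfolding esum_def by (rule order.trans[OF norm_sum]) (auto simp: norm_mult intro!: sum_mono)

text \<open>Reflecting \<open>\<xi>\<close> turns the integral into its conjugate, so it is real and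
  taking \<open>Re\<close> in \<open>fund_sol\<close> loses nothing.\<close>

lemma fund_sol_complex:
  assumes "\<alpha> > 0" "\<tau> > 0"
  shows "complex_of_real (fund_sol \<alpha> \<tau> y) = of_real (1 / (2*pi)) * (LINT \<xi>|lborel. iexp (y * \<xi>) * of_real (exp (- (\<tau> * \<bar>\<xi>\<bar> powr \<alpha>))))"
proof -
  define J where "J = (LINT \<xi>|lborel. iexp (y * \<xi>) * of_real (exp (- (\<tau> * \<bar>\<xi>\<bar> powr \<alpha>))))"
  have "exp (\<i> * of_real (y * \<xi>) - of_real (\<tau> * \<bar>\<xi>\<bar> powr \<alpha>)) = iexp (y * \<xi>) * of_real (exp (- (\<tau> * \<bar>\<xi>\<bar> powr \<alpha>)))" for \<xi>
    by (simp only: diff_conv_add_uminus exp_add of_real_minus[symmetric] exp_of_real)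
  then have J: "(LINT \<xi>|lborel. exp (\<i> * of_real (y * \<xi>) - of_real (\<tau> * \<bar>\<xi>\<bar> powr \<alpha>))) = J"
    by (simp only: J_def)
  have "cnj J = (LINT \<xi>|lborel. iexp (- (y * \<xi>)) * of_real (exp (- (\<tau> * \<bar>\<xi>\<bar> powr \<alpha>))))"
    unfolding J_def by (simp add: Bochner_Integration.integral_cnj[symmetric] exp_cnj del: Bochner_Integration.integral_cnj)
  also have "\<dots> = \<bar>-1\<bar> *\<^sub>R (LINT \<xi>|lborel. iexp (- (y * (0 + (-1) * \<xi>))) * of_real (exp (- (\<tau> * \<bar>0 + (-1) * \<xi>\<bar> powr \<alpha>))))"
    by (rule lborel_integral_real_affine) simp
  also have "\<dots> = J" by (simp add: J_def)
  finally have "Im J = 0" by (simp add: complex_eq_iff)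
  then have "J = of_real (Re J)" by (simp add: complex_eq_iff)
  then show ?thesis
    unfolding fund_sol_def J J_def[symmetric] by (metis of_real_mult)
qed

lemma fund_sol_measurable[measurable]: "fund_sol \<alpha> \<tau> \<in> borel_measurable borel"
  unfolding fund_sol_def by measurable

text \<open>Fubini rests on the integrability of the exponential in \<open>\<xi>\<close> and of
  \<open>gk\<close> in \<open>z\<close>; \<open>fund_sol\<close> itself is never integrated in
  space. The outcome is the Fourier transform of a continuous integrable function, the form that
  \<open>plancherel\<close> expects.\<close>

lemma gk_transform:
  assumes \<alpha>: "\<alpha> > 0" and \<tau>: "\<tau> > 0" and u: "u > 0" and S: "finite S"
  shows "complex_of_real (LINT z|lborel. (\<Sum>i\<in>S. c i * fund_sol \<alpha> \<tau> (x i - z)) * gk u p z)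
    = of_real (sqrt (pi / (2 * u)) / (2 * pi)) *
      (LINT \<xi>|lborel. (esum S c x \<xi> * of_real (exp (- (\<tau> * \<bar>\<xi>\<bar> powr \<alpha>)) * exp (- \<xi>\<^sup>2 / (8 * u)))) * iexp (- (p * \<xi>)))"
proof -
  define E where "E \<xi> = exp (- (\<tau> * \<bar>\<xi>\<bar> powr \<alpha>))" for \<xi>
  have [measurable]: "E \<in> borel_measurable borel" unfolding E_def by measurable
  have iE: "integrable lborel E" unfolding E_def by (rule integrable_exp_minus_powr) fact+
  have E0: "E \<xi> \<ge> 0" for \<xi> by (simp add: E_def)
  define B where "B = (\<Sum>i\<in>S. \<bar>c i\<bar>)"
  have F: "complex_of_real (\<Sum>i\<in>S. c i * fund_sol \<alpha> \<tau> (x i - z)) = of_real (1 / (2 * pi)) * (LINT \<xi>|lborel. esum S c x \<xi> * of_real (E \<xi>) * iexp (- (z * \<xi>)))" for z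
  proof -
    have i: "integrable lborel (\<lambda>\<xi>. iexp ((x i - z) * \<xi>) * of_real (E \<xi>))" for i
      by (rule Bochner_Integration.integrable_bound[OF iE]) (auto simp: norm_mult)
    have "complex_of_real (\<Sum>i\<in>S. c i * fund_sol \<alpha> \<tau> (x i - z))
      = (\<Sum>i\<in>S. of_real (1 / (2 * pi)) * (of_real (c i) * (LINT \<xi>|lborel. iexp ((x i - z) * \<xi>) * of_real (E \<xi>))))"
      by (simp only: of_real_sum of_real_mult fund_sol_complex[OF \<alpha> \<tau>] E_def mult_ac)
    also have "\<dots> = of_real (1 / (2 * pi)) * (\<Sum>i\<in>S. of_real (c i) * (LINT \<xi>|lborel. iexp ((x i - z) * \<xi>) * of_real (E \<xi>)))"
      by (rule sum_distrib_left[symmetric])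
    also have "(\<Sum>i\<in>S. of_real (c i) * (LINT \<xi>|lborel. iexp ((x i - z) * \<xi>) * of_real (E \<xi>)))
      = (\<Sum>i\<in>S. (LINT \<xi>|lborel. of_real (c i) * (iexp ((x i - z) * \<xi>) * of_real (E \<xi>))))"
      by (simp only: integral_mult_right_zero)
    also have "\<dots> = (LINT \<xi>|lborel. (\<Sum>i\<in>S. of_real (c i) * (iexp ((x i - z) * \<xi>) * of_real (E \<xi>))))"
      by (rule Bochner_Integration.integral_sum[symmetric]) (intro integrable_mult_right i)
    also have "\<dots> = (LINT \<xi>|lborel. esum S c x \<xi> * of_real (E \<xi>) * iexp (- (z * \<xi>)))"
    proof (rule Bochner_Integration.integral_cong[OF refl])
      fix \<xi>
      have "iexp ((x i - z) * \<xi>) = iexp (x i * \<xi>) * iexp (- (z * \<xi>))" for i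
        by (simp add: exp_add[symmetric] algebra_simps)
      then show "(\<Sum>i\<in>S. of_real (c i) * (iexp ((x i - z) * \<xi>) * of_real (E \<xi>))) = esum S c x \<xi> * of_real (E \<xi>) * iexp (- (z * \<xi>))"
        by (simp only: esum_def sum_distrib_left sum_distrib_right mult_ac)
    qed
    finally show ?thesis .
  qed
  have ig: "integrable lborel (gk u p)" by (rule integrable_gk[OF u])
  have iF: "integrable (lborel \<Otimes>\<^sub>M lborel) (\<lambda>(z, \<xi>). esum S c x \<xi> * of_real (E \<xi>) * iexp (- (z * \<xi>)) * of_real (gk u p z))"
  proof (rule lborel_pair.Fubini_integrable)
    have iBE: "integrable lborel (\<lambda>\<xi>. norm (esum S c x \<xi>) * E \<xi>)"
    proof (rule Bochner_Integration.integrable_bound)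
      show "integrable lborel (\<lambda>\<xi>. B * E \<xi>)" using iE by simp
      show "AE \<xi> in lborel. norm (norm (esum S c x \<xi>) * E \<xi>) \<le> norm (B * E \<xi>)"
        using norm_esum_le[of S c x] E0 by (auto simp: abs_mult B_def sum_nonneg intro!: mult_right_mono)
    qed measurable
    show "integrable lborel (\<lambda>z. LINT \<xi>|lborel. norm (case (z, \<xi>) of (z, \<xi>) \<Rightarrow> esum S c x \<xi> * of_real (E \<xi>) * iexp (- (z * \<xi>)) * of_real (gk u p z)))"
      using ig E0 by (simp add: norm_mult)
    show "AE z in lborel. integrable lborel (\<lambda>\<xi>. case (z, \<xi>) of (z, \<xi>) \<Rightarrow> esum S c x \<xi> * of_real (E \<xi>) * iexp (- (z * \<xi>)) * of_real (gk u p z))"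
    proof (intro AE_I2)
      fix z
      have "integrable lborel (\<lambda>\<xi>. norm (esum S c x \<xi>) * E \<xi> * gk u p z)" using iBE by simp
      then show "integrable lborel (\<lambda>\<xi>. case (z, \<xi>) of (z, \<xi>) \<Rightarrow> esum S c x \<xi> * of_real (E \<xi>) * iexp (- (z * \<xi>)) * of_real (gk u p z))"
        by (rule Bochner_Integration.integrable_bound) (auto simp: norm_mult E0)
    qed
  qed measurable
  have "complex_of_real (LINT z|lborel. (\<Sum>i\<in>S. c i * fund_sol \<alpha> \<tau> (x i - z)) * gk u p z)
    = (LINT z|lborel. of_real (1 / (2 * pi)) * (LINT \<xi>|lborel. esum S c x \<xi> * of_real (E \<xi>) * iexp (- (z * \<xi>)) * of_real (gk u p z)))"
    by (simp only: integral_complex_of_real[symmetric] of_real_mult F mult.assoc[of "complex_of_real (1 / (2 * pi))"] integral_mult_left_zero)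
  also have "\<dots> = of_real (1 / (2 * pi)) * (LINT z|lborel. LINT \<xi>|lborel. esum S c x \<xi> * of_real (E \<xi>) * iexp (- (z * \<xi>)) * of_real (gk u p z))"
    by (rule integral_mult_right_zero)
  also have "(LINT z|lborel. LINT \<xi>|lborel. esum S c x \<xi> * of_real (E \<xi>) * iexp (- (z * \<xi>)) * of_real (gk u p z))
    = (LINT \<xi>|lborel. LINT z|lborel. esum S c x \<xi> * of_real (E \<xi>) * iexp (- (z * \<xi>)) * of_real (gk u p z))"
    by (rule lborel_pair.Fubini_integral[symmetric, OF iF])
  also have "\<dots> = (LINT \<xi>|lborel. of_real (sqrt (pi / (2 * u))) * ((esum S c x \<xi> * of_real (E \<xi> * exp (- \<xi>\<^sup>2 / (8 * u)))) * iexp (- (p * \<xi>))))"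
  proof (rule Bochner_Integration.integral_cong[OF refl])
    fix \<xi>
    have "esum S c x \<xi> * of_real (E \<xi>) * iexp (- (z * \<xi>)) * of_real (gk u p z) = (esum S c x \<xi> * of_real (E \<xi>)) * (of_real (gk u p z) * iexp ((- \<xi>) * z))" for z
      by (simp add: mult_ac)
    then have "(LINT z|lborel. esum S c x \<xi> * of_real (E \<xi>) * iexp (- (z * \<xi>)) * of_real (gk u p z))
      = (esum S c x \<xi> * of_real (E \<xi>)) * (LINT z|lborel. of_real (gk u p z) * iexp ((- \<xi>) * z))"
      by (simp only: integral_mult_right_zero)
    also have "\<dots> = of_real (sqrt (pi / (2 * u))) * ((esum S c x \<xi> * of_real (E \<xi> * exp (- \<xi>\<^sup>2 / (8 * u)))) * iexp (- (p * \<xi>)))"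
      unfolding gk_fourier[OF u] by (simp add: mult_ac)
    finally show "(LINT z|lborel. esum S c x \<xi> * of_real (E \<xi>) * iexp (- (z * \<xi>)) * of_real (gk u p z)) = \<dots>" .
  qed
  also have "\<dots> = of_real (sqrt (pi / (2 * u))) * (LINT \<xi>|lborel. (esum S c x \<xi> * of_real (E \<xi> * exp (- \<xi>\<^sup>2 / (8 * u)))) * iexp (- (p * \<xi>)))"
    by (rule integral_mult_right_zero)
  finally show ?thesis unfolding E_def by simp
qed

lemma gk_transform_norm:
  assumes \<alpha>: "\<alpha> > 0" and \<tau>: "\<tau> > 0" and u: "u > 0" and S: "finite S"
  shows "(\<integral>\<^sup>+p. ennreal ((LINT z|lborel. (\<Sum>i\<in>S. c i * fund_sol \<alpha> \<tau> (x i - z)) * gk u p z)\<^sup>2) \<partial>lborel)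
    = (\<integral>\<^sup>+\<xi>. ennreal (1 / (4 * u) * exp (- (\<xi>\<^sup>2 / 4 / u)) * ((norm (esum S c x \<xi>))\<^sup>2 * exp (- (2 * \<tau> * \<bar>\<xi>\<bar> powr \<alpha>)))) \<partial>lborel)"
proof -
  define A where "A \<xi> = esum S c x \<xi> * of_real (exp (- (\<tau> * \<bar>\<xi>\<bar> powr \<alpha>)) * exp (- \<xi>\<^sup>2 / (8 * u)))" for \<xi>
  have [measurable]: "A \<in> borel_measurable borel" unfolding A_def by measurable
  define B where "B = (\<Sum>i\<in>S. \<bar>c i\<bar>)"
  have B: "B \<ge> 0" by (simp add: B_def sum_nonneg)
  \<comment> \<open>The Gaussian factor alone provides integrability; the exponential of the
    solution is estimated by 1.\<close>
  have nA: "norm (A \<xi>) \<le> B * exp (- \<xi>\<^sup>2 / (8 * u))" for \<xi>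
  proof -
    have "norm (A \<xi>) = norm (esum S c x \<xi>) * exp (- (\<tau> * \<bar>\<xi>\<bar> powr \<alpha>)) * exp (- \<xi>\<^sup>2 / (8 * u))"
      by (simp add: A_def norm_mult)
    also have "\<dots> \<le> B * 1 * exp (- \<xi>\<^sup>2 / (8 * u))"
      using norm_esum_le[of S c x \<xi>] \<tau> by (intro mult_right_mono mult_mono) (auto simp: B_def sum_nonneg)
    finally show ?thesis by simp
  qed
  have "(\<integral>\<^sup>+p. ennreal ((norm (LINT \<xi>|lborel. A \<xi> * iexp (- (p * \<xi>))))\<^sup>2) \<partial>lborel) = ennreal (2 * pi) * (\<integral>\<^sup>+\<xi>. ennreal ((norm (A \<xi>))\<^sup>2) \<partial>lborel)"
  proof (rule plancherel)
    show "continuous_on UNIV A"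
      unfolding A_def using \<alpha> u by (intro continuous_intros esum_continuous continuous_on_powr') auto
    show "norm (A \<xi>) \<le> B" for \<xi>
    proof (rule order.trans[OF nA])
      show "B * exp (- \<xi>\<^sup>2 / (8 * u)) \<le> B" using B u by (intro mult_left_le) auto
    qed
    have "integrable lborel (\<lambda>\<xi>. B * exp (- (1 / (8 * u) * \<xi>\<^sup>2)))"
      using u by (intro integrable_mult_right integrable_exp_minus_square) auto
    then show "integrable lborel A"
      by (rule Bochner_Integration.integrable_bound) (use nA B in \<open>auto simp: abs_mult\<close>)
  qed
  note pl = this
  \<comment> \<open>The constant of \<open>gk_transform\<close>; its square times the
    \<open>2 * pi\<close> of Plancherel is \<open>1 / (4 * u)\<close>.\<close>
  define k where "k = sqrt (pi / (2 * u)) / (2 * pi)"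
  have k2: "k\<^sup>2 * (2 * pi) = 1 / (4 * u)" using u by (simp add: k_def power_divide power2_eq_square field_simps)
  have "(LINT z|lborel. (\<Sum>i\<in>S. c i * fund_sol \<alpha> \<tau> (x i - z)) * gk u p z)\<^sup>2 = k\<^sup>2 * (norm (LINT \<xi>|lborel. A \<xi> * iexp (- (p * \<xi>))))\<^sup>2" for p
  proof -
    have "(LINT z|lborel. (\<Sum>i\<in>S. c i * fund_sol \<alpha> \<tau> (x i - z)) * gk u p z)\<^sup>2
       = (norm (complex_of_real (LINT z|lborel. (\<Sum>i\<in>S. c i * fund_sol \<alpha> \<tau> (x i - z)) * gk u p z)))\<^sup>2"
      by (simp only: norm_of_real power2_abs)
    also have "\<dots> = k\<^sup>2 * (norm (LINT \<xi>|lborel. A \<xi> * iexp (- (p * \<xi>))))\<^sup>2"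
      unfolding gk_transform[OF assms] A_def[symmetric] k_def[symmetric]
      by (simp only: norm_mult norm_of_real power_mult_distrib power2_abs)
    finally show ?thesis .
  qed
  then have "(\<integral>\<^sup>+p. ennreal ((LINT z|lborel. (\<Sum>i\<in>S. c i * fund_sol \<alpha> \<tau> (x i - z)) * gk u p z)\<^sup>2) \<partial>lborel)
    = (\<integral>\<^sup>+p. ennreal (k\<^sup>2) * ennreal ((norm (LINT \<xi>|lborel. A \<xi> * iexp (- (p * \<xi>))))\<^sup>2) \<partial>lborel)"
    by (simp add: ennreal_mult)
  also have "\<dots> = ennreal (k\<^sup>2) * (ennreal (2 * pi) * (\<integral>\<^sup>+\<xi>. ennreal ((norm (A \<xi>))\<^sup>2) \<partial>lborel))"
    unfolding pl[symmetric] by (rule nn_integral_cmult) measurable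
  also have "\<dots> = ennreal (k\<^sup>2 * (2 * pi)) * (\<integral>\<^sup>+\<xi>. ennreal ((norm (A \<xi>))\<^sup>2) \<partial>lborel)"
    by (simp add: ennreal_mult mult.assoc)
  also have "\<dots> = (\<integral>\<^sup>+\<xi>. ennreal (1 / (4 * u)) * ennreal ((norm (A \<xi>))\<^sup>2) \<partial>lborel)"
    unfolding k2 by (rule nn_integral_cmult[symmetric]) measurable
  also have "\<dots> = (\<integral>\<^sup>+\<xi>. ennreal (1 / (4 * u) * exp (- (\<xi>\<^sup>2 / 4 / u)) * ((norm (esum S c x \<xi>))\<^sup>2 * exp (- (2 * \<tau> * \<bar>\<xi>\<bar> powr \<alpha>)))) \<partial>lborel)"
  proof (rule nn_integral_cong)
    fix \<xi> :: real
    have "(exp (- \<xi>\<^sup>2 / (8 * u)))\<^sup>2 = exp (- (\<xi>\<^sup>2 / 4 / u))" using u by (simp add: exp_double[symmetric] field_simps)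
    moreover have "(exp (- (\<tau> * \<bar>\<xi>\<bar> powr \<alpha>)))\<^sup>2 = exp (- (2 * \<tau> * \<bar>\<xi>\<bar> powr \<alpha>))" by (simp add: exp_double[symmetric])
    ultimately have "(norm (A \<xi>))\<^sup>2 = exp (- (\<xi>\<^sup>2 / 4 / u)) * ((norm (esum S c x \<xi>))\<^sup>2 * exp (- (2 * \<tau> * \<bar>\<xi>\<bar> powr \<alpha>)))"
      by (simp add: A_def norm_mult power_mult_distrib)
    then show "ennreal (1 / (4 * u)) * ennreal ((norm (A \<xi>))\<^sup>2) = ennreal (1 / (4 * u) * exp (- (\<xi>\<^sup>2 / 4 / u)) * ((norm (esum S c x \<xi>))\<^sup>2 * exp (- (2 * \<tau> * \<bar>\<xi>\<bar> powr \<alpha>))))"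
      using u by (simp add: ennreal_mult[symmetric] mult.assoc)
  qed
  finally show ?thesis .
qed

text \<open>Here the Fourier transform of the Riesz kernel emerges, without being taken of the
  kernel itself: summing the Gaussian widths is an inverse Gamma integral of order
  \<open>2 * \<gamma>\<close> with parameter \<open>\<xi>\<^sup>2 / 4\<close>.\<close>

lemma rw_integral:
  assumes \<gamma>: "\<gamma> > 0" and \<xi>: "\<xi> \<noteq> 0"
  shows "(\<integral>\<^sup>+u. ennreal (rw \<gamma> u * (1 / (4 * u) * exp (- (\<xi>\<^sup>2 / 4 / u)))) \<partial>lborel) = ennreal (\<bar>\<xi>\<bar> powr (- 4 * \<gamma>) / (2 * pi))"
proof -
  define K where "K = 1 / (2 * (2 powr (4*\<gamma>) * pi * Gamma (2*\<gamma>)))"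
  have G: "Gamma (2 * \<gamma>) > 0" using \<gamma> by (intro Gamma_real_pos) simp
  have K: "K \<ge> 0" using G by (simp add: K_def)
  have "rw \<gamma> u * (1 / (4 * u) * exp (- (\<xi>\<^sup>2 / 4 / u))) = K * (indicator {0<..} u * u powr (- (2 * \<gamma>) - 1) * exp (- (\<xi>\<^sup>2 / 4 / u)))" for u
  proof (cases "u > 0")
    case True
    have "u powr (- (2 * \<gamma>) - 1) = u powr (- 2 * \<gamma>) / u" using True by (simp add: powr_diff)
    then show ?thesis using True by (simp add: rw_def K_def)
  qed (simp add: rw_def)
  then have "(\<integral>\<^sup>+u. ennreal (rw \<gamma> u * (1 / (4 * u) * exp (- (\<xi>\<^sup>2 / 4 / u)))) \<partial>lborel)
    = (\<integral>\<^sup>+u. ennreal K * ennreal (indicator {0<..} u * u powr (- (2 * \<gamma>) - 1) * exp (- (\<xi>\<^sup>2 / 4 / u))) \<partial>lborel)"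
    using K by (simp add: ennreal_mult'[symmetric])
  also have "\<dots> = ennreal K * ennreal (Gamma (2 * \<gamma>) * (\<xi>\<^sup>2 / 4) powr (- (2 * \<gamma>)))"
    using \<gamma> \<xi> by (subst nn_integral_cmult, simp, subst nn_integral_inverse_gamma) auto
  also have "\<dots> = ennreal (K * (Gamma (2 * \<gamma>) * (\<xi>\<^sup>2 / 4) powr (- (2 * \<gamma>))))"
    using K by (simp add: ennreal_mult')
  also have "(\<xi>\<^sup>2 / 4) powr (- (2 * \<gamma>)) = 2 powr (4 * \<gamma>) * \<bar>\<xi>\<bar> powr (- 4 * \<gamma>)"
  proof -
    have e: "\<xi>\<^sup>2 / 4 = (\<bar>\<xi>\<bar> / 2) powr 2" using \<xi> by (simp add: powr_numeral power_divide)
    have "(\<xi>\<^sup>2 / 4) powr (- (2 * \<gamma>)) = (\<bar>\<xi>\<bar> / 2) powr (- 4 * \<gamma>)"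
      unfolding e powr_powr by simp
    also have "\<dots> = 2 powr (4 * \<gamma>) * \<bar>\<xi>\<bar> powr (- 4 * \<gamma>)"
      using powr_minus_divide[of 2 "4 * \<gamma>"] by (simp add: powr_divide)
    finally show ?thesis .
  qed
  also have "K * (Gamma (2 * \<gamma>) * (2 powr (4 * \<gamma>) * \<bar>\<xi>\<bar> powr (- 4 * \<gamma>))) = \<bar>\<xi>\<bar> powr (- 4 * \<gamma>) / (2 * pi)"
    using G by (simp add: K_def)
  finally show ?thesis .
qed

text \<open>Plancherel in \<open>p\<close> for each \<open>u\<close>, then Tonelli and the integral
  over \<open>u\<close>, all at one fixed positive time.\<close>

lemma fund_sol_spectral:
  assumes \<gamma>: "0 < \<gamma>" "\<gamma> < 1/4" and \<alpha>: "\<alpha> > 0" and \<tau>: "\<tau> > 0" and S: "finite S"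
  shows "(\<integral>\<^sup>+w. ennreal (case w of (u, p) \<Rightarrow> rw \<gamma> u * (LINT z|lborel. (\<Sum>i\<in>S. c i * fund_sol \<alpha> \<tau> (x i - z)) * gk u p z)\<^sup>2) \<partial>lborel)
    = (\<integral>\<^sup>+\<xi>. ennreal (\<bar>\<xi>\<bar> powr (- 4 * \<gamma>) / (2 * pi) * ((norm (esum S c x \<xi>))\<^sup>2 * exp (- (2 * \<tau> * \<bar>\<xi>\<bar> powr \<alpha>)))) \<partial>lborel)"
proof -
  define T where "T \<xi> = (norm (esum S c x \<xi>))\<^sup>2 * exp (- (2 * \<tau> * \<bar>\<xi>\<bar> powr \<alpha>))" for \<xi>
  have [measurable]: "T \<in> borel_measurable borel" unfolding T_def by measurable
  have T0: "T \<xi> \<ge> 0" for \<xi> by (simp add: T_def)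
  note rw0 = rw_nonneg[OF \<gamma>(1)]
  have "(\<integral>\<^sup>+w. ennreal (case w of (u, p) \<Rightarrow> rw \<gamma> u * (LINT z|lborel. (\<Sum>i\<in>S. c i * fund_sol \<alpha> \<tau> (x i - z)) * gk u p z)\<^sup>2) \<partial>lborel)
    = (\<integral>\<^sup>+u. \<integral>\<^sup>+p. ennreal (rw \<gamma> u * (LINT z|lborel. (\<Sum>i\<in>S. c i * fund_sol \<alpha> \<tau> (x i - z)) * gk u p z)\<^sup>2) \<partial>lborel \<partial>lborel)"
    by (subst nn_integral_lborel_pair) (simp_all add: case_prod_unfold)
  also have "\<dots> = (\<integral>\<^sup>+u. \<integral>\<^sup>+\<xi>. ennreal (rw \<gamma> u * (1 / (4 * u) * exp (- (\<xi>\<^sup>2 / 4 / u)))) * ennreal (T \<xi>) \<partial>lborel \<partial>lborel)"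
  proof (rule nn_integral_cong)
    fix u :: real
    show "(\<integral>\<^sup>+p. ennreal (rw \<gamma> u * (LINT z|lborel. (\<Sum>i\<in>S. c i * fund_sol \<alpha> \<tau> (x i - z)) * gk u p z)\<^sup>2) \<partial>lborel)
      = (\<integral>\<^sup>+\<xi>. ennreal (rw \<gamma> u * (1 / (4 * u) * exp (- (\<xi>\<^sup>2 / 4 / u)))) * ennreal (T \<xi>) \<partial>lborel)"
    proof (cases "u > 0")
      case True
      have "(\<integral>\<^sup>+p. ennreal (rw \<gamma> u * (LINT z|lborel. (\<Sum>i\<in>S. c i * fund_sol \<alpha> \<tau> (x i - z)) * gk u p z)\<^sup>2) \<partial>lborel)
        = ennreal (rw \<gamma> u) * (\<integral>\<^sup>+p. ennreal ((LINT z|lborel. (\<Sum>i\<in>S. c i * fund_sol \<alpha> \<tau> (x i - z)) * gk u p z)\<^sup>2) \<partial>lborel)"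
        using rw0 by (simp add: ennreal_mult nn_integral_cmult)
      also have "\<dots> = (\<integral>\<^sup>+\<xi>. ennreal (rw \<gamma> u) * ennreal (1 / (4 * u) * exp (- (\<xi>\<^sup>2 / 4 / u)) * T \<xi>) \<partial>lborel)"
        unfolding gk_transform_norm[OF \<alpha> \<tau> True S] T_def[symmetric] by (rule nn_integral_cmult[symmetric]) measurable
      also have "\<dots> = (\<integral>\<^sup>+\<xi>. ennreal (rw \<gamma> u * (1 / (4 * u) * exp (- (\<xi>\<^sup>2 / 4 / u)))) * ennreal (T \<xi>) \<partial>lborel)"
        using True by (intro nn_integral_cong) (simp add: ennreal_mult[symmetric] rw0 T0 mult.assoc)
      finally show ?thesis .
    qed (simp add: rw_def)
  qed
  also have "\<dots> = (\<integral>\<^sup>+\<xi>. \<integral>\<^sup>+u. ennreal (rw \<gamma> u * (1 / (4 * u) * exp (- (\<xi>\<^sup>2 / 4 / u)))) * ennreal (T \<xi>) \<partial>lborel \<partial>lborel)"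
    by (rule lborel_pair.Fubini') measurable
  also have "\<dots> = (\<integral>\<^sup>+\<xi>. ennreal (\<bar>\<xi>\<bar> powr (- 4 * \<gamma>) / (2 * pi) * T \<xi>) \<partial>lborel)"
  proof (intro nn_integral_cong_AE, use AE_lborel_singleton[of 0] in eventually_elim)
    fix \<xi> :: real assume \<xi>: "\<xi> \<noteq> 0"
    have "(\<integral>\<^sup>+u. ennreal (rw \<gamma> u * (1 / (4 * u) * exp (- (\<xi>\<^sup>2 / 4 / u)))) * ennreal (T \<xi>) \<partial>lborel)
      = (\<integral>\<^sup>+u. ennreal (rw \<gamma> u * (1 / (4 * u) * exp (- (\<xi>\<^sup>2 / 4 / u)))) \<partial>lborel) * ennreal (T \<xi>)"
      by (rule nn_integral_multc) measurable
    also have "\<dots> = ennreal (\<bar>\<xi>\<bar> powr (- 4 * \<gamma>) / (2 * pi) * T \<xi>)"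
      unfolding rw_integral[OF \<gamma>(1) \<xi>] by (rule ennreal_mult[symmetric]) (simp_all add: T0)
    finally show "(\<integral>\<^sup>+u. ennreal (rw \<gamma> u * (1 / (4 * u) * exp (- (\<xi>\<^sup>2 / 4 / u)))) * ennreal (T \<xi>) \<partial>lborel)
      = ennreal (\<bar>\<xi>\<bar> powr (- 4 * \<gamma>) / (2 * pi) * T \<xi>)" .
  qed
  finally show ?thesis unfolding T_def .
qed

lemma nn_integral_exp_decay:
  fixes t k :: real
  assumes t: "t \<ge> 0" and k: "k > 0"
  shows "(\<integral>\<^sup>+s. ennreal (indicator {0..t} s * exp (- (k * (t - s)))) \<partial>lborel) = ennreal ((1 - exp (- (k * t))) / k)"
proof -
  have "(\<integral>\<^sup>+s. ennreal (exp (- (k * (t - s)))) * indicator {0..t} s \<partial>lborel) = ennreal (exp (- (k * (t - t))) / k - exp (- (k * (t - 0))) / k)"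
    by (rule nn_integral_FTC_Icc[where F="\<lambda>s. exp (- (k * (t - s))) / k"])
      (use t k in \<open>auto intro!: derivative_eq_intros simp: field_simps\<close>)
  also have "exp (- (k * (t - t))) / k - exp (- (k * (t - 0))) / k = (1 - exp (- (k * t))) / k"
    by (simp add: diff_divide_distrib)
  finally show ?thesis
    by (simp add: ennreal_mult'' ennreal_indicator mult.commute)
qed

lemma noise_norm2_solution:
  assumes \<gamma>: "0 < \<gamma>" "\<gamma> < 1/4" and \<alpha>: "\<alpha> > 0" and \<theta>: "\<theta> > 0" and t: "t > 0" and S: "finite S"
    and adm: "noise_admissible \<gamma> (\<lambda>s z. \<Sum>i\<in>S. c i * (indicator {0..t} s * fund_sol \<alpha> (\<theta> * (t - s)) (x i - z)))"
  shows "ennreal (noise_norm2 \<gamma> (\<lambda>s z. \<Sum>i\<in>S. c i * (indicator {0..t} s * fund_sol \<alpha> (\<theta> * (t - s)) (x i - z))))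
    = (\<integral>\<^sup>+\<xi>. ennreal ((norm (esum S c x \<xi>))\<^sup>2 * sol_spec \<alpha> \<gamma> \<theta> t \<xi>) \<partial>lborel)"
proof -
  define T where "T \<xi> = \<bar>\<xi>\<bar> powr (- 4 * \<gamma>) / (2 * pi) * (norm (esum S c x \<xi>))\<^sup>2" for \<xi>
  have [measurable]: "T \<in> borel_measurable borel" unfolding T_def by measurable
  have T0: "T \<xi> \<ge> 0" for \<xi> by (simp add: T_def)
  have "ennreal (noise_norm2 \<gamma> (\<lambda>s z. \<Sum>i\<in>S. c i * (indicator {0..t} s * fund_sol \<alpha> (\<theta> * (t - s)) (x i - z))))
    = (\<integral>\<^sup>+s. indicator {0..} s * (\<integral>\<^sup>+w. ennreal (case w of (u, p) \<Rightarrow> rw \<gamma> u *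
       (LINT z|lborel. (\<Sum>i\<in>S. c i * (indicator {0..t} s * fund_sol \<alpha> (\<theta> * (t - s)) (x i - z))) * gk u p z)\<^sup>2) \<partial>lborel) \<partial>lborel)"
    by (rule noise_norm2_square(2)[OF \<gamma> adm])
  also have "\<dots> = (\<integral>\<^sup>+s. \<integral>\<^sup>+\<xi>. ennreal (indicator {0..t} s * exp (- ((2 * \<theta> * \<bar>\<xi>\<bar> powr \<alpha>) * (t - s)))) * ennreal (T \<xi>) \<partial>lborel \<partial>lborel)"
  \<comment> \<open>At \<open>s = t\<close> the time argument of \<open>fund_sol\<close> is 0, where
    \<open>fund_sol_spectral\<close> does not apply; this is a single point.\<close>
  proof (intro nn_integral_cong_AE, use AE_lborel_singleton[of t] in eventually_elim)
    fix s :: real assume s: "s \<noteq> t"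
    show "indicator {0..} s * (\<integral>\<^sup>+w. ennreal (case w of (u, p) \<Rightarrow> rw \<gamma> u *
       (LINT z|lborel. (\<Sum>i\<in>S. c i * (indicator {0..t} s * fund_sol \<alpha> (\<theta> * (t - s)) (x i - z))) * gk u p z)\<^sup>2) \<partial>lborel)
      = (\<integral>\<^sup>+\<xi>. ennreal (indicator {0..t} s * exp (- ((2 * \<theta> * \<bar>\<xi>\<bar> powr \<alpha>) * (t - s)))) * ennreal (T \<xi>) \<partial>lborel)"
    proof (cases "0 \<le> s \<and> s < t")
      case True
      then have "\<theta> * (t - s) > 0" using \<theta> by simp
      from fund_sol_spectral[OF \<gamma> \<alpha> this S, of c x] True
      have "indicator {0..} s * (\<integral>\<^sup>+w. ennreal (case w of (u, p) \<Rightarrow> rw \<gamma> u *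
         (LINT z|lborel. (\<Sum>i\<in>S. c i * (indicator {0..t} s * fund_sol \<alpha> (\<theta> * (t - s)) (x i - z))) * gk u p z)\<^sup>2) \<partial>lborel)
        = (\<integral>\<^sup>+\<xi>. ennreal (\<bar>\<xi>\<bar> powr (- 4 * \<gamma>) / (2 * pi) * ((norm (esum S c x \<xi>))\<^sup>2 * exp (- (2 * (\<theta> * (t - s)) * \<bar>\<xi>\<bar> powr \<alpha>)))) \<partial>lborel)"
        by (simp add: mult.assoc)
      also have "\<dots> = (\<integral>\<^sup>+\<xi>. ennreal (indicator {0..t} s * exp (- ((2 * \<theta> * \<bar>\<xi>\<bar> powr \<alpha>) * (t - s)))) * ennreal (T \<xi>) \<partial>lborel)"
        using True by (intro nn_integral_cong, subst ennreal_mult[symmetric]) (auto simp: T0 T_def mult_ac)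
      finally show ?thesis .
    next
      case False
      with s have "indicator {0..t} s = (0::real)" by (auto simp: indicator_def)
      then show ?thesis by (simp add: case_prod_unfold)
    qed
  qed
  also have "\<dots> = (\<integral>\<^sup>+\<xi>. \<integral>\<^sup>+s. ennreal (indicator {0..t} s * exp (- ((2 * \<theta> * \<bar>\<xi>\<bar> powr \<alpha>) * (t - s)))) * ennreal (T \<xi>) \<partial>lborel \<partial>lborel)"
    by (rule lborel_pair.Fubini') measurable
  also have "\<dots> = (\<integral>\<^sup>+\<xi>. ennreal ((norm (esum S c x \<xi>))\<^sup>2 * sol_spec \<alpha> \<gamma> \<theta> t \<xi>) \<partial>lborel)"
  proof (intro nn_integral_cong_AE, use AE_lborel_singleton[of 0] in eventually_elim)
    fix \<xi> :: real assume \<xi>: "\<xi> \<noteq> 0"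
    have k: "2 * \<theta> * \<bar>\<xi>\<bar> powr \<alpha> > 0" using \<theta> \<xi> by simp
    have "(\<integral>\<^sup>+s. ennreal (indicator {0..t} s * exp (- ((2 * \<theta> * \<bar>\<xi>\<bar> powr \<alpha>) * (t - s)))) * ennreal (T \<xi>) \<partial>lborel)
      = (\<integral>\<^sup>+s. ennreal (indicator {0..t} s * exp (- ((2 * \<theta> * \<bar>\<xi>\<bar> powr \<alpha>) * (t - s)))) \<partial>lborel) * ennreal (T \<xi>)"
      by (rule nn_integral_multc) measurable
    also have "\<dots> = ennreal ((1 - exp (- ((2 * \<theta> * \<bar>\<xi>\<bar> powr \<alpha>) * t))) / (2 * \<theta> * \<bar>\<xi>\<bar> powr \<alpha>)) * ennreal (T \<xi>)"
      using t k by (subst nn_integral_exp_decay) auto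
    also have "\<dots> = ennreal ((norm (esum S c x \<xi>))\<^sup>2 * sol_spec \<alpha> \<gamma> \<theta> t \<xi>)"
      using k T0 by (subst ennreal_mult''[symmetric]) (auto simp: sol_spec_def T_def mult_ac)
    finally show "(\<integral>\<^sup>+s. ennreal (indicator {0..t} s * exp (- ((2 * \<theta> * \<bar>\<xi>\<bar> powr \<alpha>) * (t - s)))) * ennreal (T \<xi>) \<partial>lborel)
       = ennreal ((norm (esum S c x \<xi>))\<^sup>2 * sol_spec \<alpha> \<gamma> \<theta> t \<xi>)" .
  qed
  finally show ?thesis .
qed

text \<open>Finiteness of the spectral integral is inherited from admissibility, which is part of
  being a Wiener integral; hence the formulation with a real \<open>v\<close> and
  \<open>ennreal v\<close>.\<close>

lemma mild_solution_gaussian: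
  assumes \<gamma>: "0 < \<gamma>" "\<gamma> < 1/4" and \<alpha>: "\<alpha> > 0" and \<theta>: "\<theta> > 0" and t: "t > 0"
    and P: "prob_space P" and W: "riesz_noise P \<gamma> W" and X: "mild_solution P \<alpha> \<theta> \<sigma> \<gamma> W X" and S: "finite S"
  shows "\<exists>v. gauss_rv P (\<lambda>\<omega>. \<Sum>i\<in>S. c i * X t (x i) \<omega>) (\<sigma>\<^sup>2 * v) \<and> v \<ge> 0
    \<and> ennreal v = (\<integral>\<^sup>+\<xi>. ennreal ((norm (esum S c x \<xi>))\<^sup>2 * sol_spec \<alpha> \<gamma> \<theta> t \<xi>) \<partial>lborel)"
proof -
  let ?f = "\<lambda>y s z. indicator {0..t} s * fund_sol \<alpha> (\<theta> * (t - s)) (y - z)"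
  have "\<forall>y. \<exists>I. is_wiener_integral P \<gamma> W (?f y) I \<and> (\<forall>\<omega>\<in>space P. X t y \<omega> = \<sigma> * I \<omega>)"
    using X t by (simp add: mild_solution_def)
  from choice[OF this] obtain I where I: "\<And>y. is_wiener_integral P \<gamma> W (?f y) (I y)" "\<And>y \<omega>. \<omega> \<in> space P \<Longrightarrow> X t y \<omega> = \<sigma> * I y \<omega>"
    by blast
  define v where "v = noise_norm2 \<gamma> (\<lambda>s z. \<Sum>i\<in>S. c i * ?f (x i) s z)"
  have w: "is_wiener_integral P \<gamma> W (\<lambda>s z. \<Sum>i\<in>S. c i * ?f (x i) s z) (\<lambda>\<omega>. \<Sum>i\<in>S. c i * I (x i) \<omega>)"
    by (rule wiener_integral_sum[OF \<gamma> P W S I(1)])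
  then have adm: "noise_admissible \<gamma> (\<lambda>s z. \<Sum>i\<in>S. c i * ?f (x i) s z)" by (simp add: is_wiener_integral_def)
  have g: "gauss_rv P (\<lambda>\<omega>. \<sigma> * (\<Sum>i\<in>S. c i * I (x i) \<omega>)) (\<sigma>\<^sup>2 * v)"
    unfolding v_def by (rule gauss_rv_scale[OF wiener_integral_gauss_rv[OF \<gamma> P W w] P])
  have eq: "\<sigma> * (\<Sum>i\<in>S. c i * I (x i) \<omega>) = (\<Sum>i\<in>S. c i * X t (x i) \<omega>)" if "\<omega> \<in> space P" for \<omega>
    using that by (simp add: sum_distrib_left I(2) mult_ac)
  have "gauss_rv P (\<lambda>\<omega>. \<Sum>i\<in>S. c i * X t (x i) \<omega>) (\<sigma>\<^sup>2 * v)"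
    using g unfolding gauss_rv_def
    by (simp add: measurable_cong[OF eq] distr_cong[OF refl refl eq])
  then show ?thesis
    using noise_norm2_square(1)[OF \<gamma> adm] noise_norm2_solution[OF \<gamma> \<alpha> \<theta> t S adm] by (auto simp: v_def)
qed

section \<open>Spectral representation of the integrated fractional Brownian motion\<close>

text \<open>Linear combinations are indexed by lists of pairs of a coefficient and a point, so that a Riemann
  sum of combinations is again a combination, whatever coincidences there are between the points.\<close>

definition lsum :: "(real \<Rightarrow> 'v::real_vector) \<Rightarrow> (real \<times> real) list \<Rightarrow> 'v" where
  "lsum f l = (\<Sum>(c, x)\<leftarrow>l. c *\<^sub>R f x)"

definition lcoef :: "(real \<times> real) list \<Rightarrow> real \<Rightarrow> real" where
  "lcoef l y = (\<Sum>(c, x)\<leftarrow>l. if x = y then c else 0)"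

lemma lsum_simps[simp]: "lsum f [] = 0" "lsum f ((c, x) # l) = c *\<^sub>R f x + lsum f l"
  by (simp_all add: lsum_def)

lemma lsum_append: "lsum f (l @ l') = lsum f l + lsum f l'"
  by (simp add: lsum_def)

lemma lsum_affine: "lsum f (map (\<lambda>(c, x). (a * c, x + d)) l) = a *\<^sub>R lsum (\<lambda>x. f (x + d)) l"
  by (induction l) (auto simp: scaleR_add_right)

lemma lsum_diff: "lsum (\<lambda>x. f x - g x) l = lsum f l - lsum g l"
  by (induction l) (auto simp: scaleR_diff_right)

lemma lsum_sum: "lsum (\<lambda>x. \<Sum>k\<in>S. a *\<^sub>R f k x) l = (\<Sum>k\<in>S. a *\<^sub>R lsum (f k) l)"
  by (induction l) (auto simp: sum.distrib scaleR_add_right scaleR_sum_right mult.commute)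

lemma lsum_concat: "lsum f (concat (map g [0..<n])) = (\<Sum>k<n. lsum f (g k))"
  by (induction n) (auto simp: lsum_append)

text \<open>Coinciding points are merged, which links the lists to
  \<open>centered_gaussian_family\<close> and to the other statements about sums over finite
  sets.\<close>

lemma lsum_eq_sum:
  assumes "finite S" "snd ` set l \<subseteq> S"
  shows "lsum f l = (\<Sum>y\<in>S. lcoef l y *\<^sub>R f y)"
  using assms(2)
proof (induction l)
  case Nil
  then show ?case by (simp add: lcoef_def)
next
  case (Cons e l)
  obtain c x where e: "e = (c, x)" by (cases e)
  have "(\<Sum>y\<in>S. lcoef (e # l) y *\<^sub>R f y) = (\<Sum>y\<in>S. (if x = y then c *\<^sub>R f y else 0) + lcoef l y *\<^sub>R f y)"
    by (intro sum.cong) (auto simp: e lcoef_def scaleR_add_left)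
  also have "\<dots> = c *\<^sub>R f x + lsum f l"
    using Cons \<open>finite S\<close> by (simp add: sum.distrib e)
  finally show ?case by (simp add: e)
qed

lemma lsum_tendsto:
  fixes f :: "real \<Rightarrow> 'v::real_normed_vector"
  assumes "\<And>x. (\<lambda>n. g n x) \<longlonglongrightarrow> f x"
  shows "(\<lambda>n. lsum (g n) l) \<longlonglongrightarrow> lsum f l"
  by (induction l) (auto intro!: tendsto_intros assms)

lemma lsum_measurable[measurable (raw)]:
  fixes f :: "'a \<Rightarrow> real \<Rightarrow> 'v::{second_countable_topology, real_normed_vector}"
  assumes "\<And>x. (\<lambda>\<omega>. f \<omega> x) \<in> borel_measurable M"
  shows "(\<lambda>\<omega>. lsum (f \<omega>) l) \<in> borel_measurable M"
proof (induction l)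
  case (Cons e l)
  obtain c x where e: "e = (c, x)" by (cases e)
  show ?case unfolding e lsum_simps
    using Cons assms by (intro borel_measurable_add borel_measurable_scaleR) auto
qed simp

lemma norm_lsum_le:
  fixes f :: "real \<Rightarrow> 'v::real_normed_vector"
  assumes "\<And>x. norm (f x) \<le> B"
  shows "norm (lsum f l) \<le> (\<Sum>(c, x)\<leftarrow>l. \<bar>c\<bar>) * B"
proof (induction l)
  case (Cons e l)
  obtain c x where e: "e = (c, x)" by (cases e)
  have "norm (lsum f (e # l)) \<le> norm (c *\<^sub>R f x) + norm (lsum f l)" unfolding e lsum_simps by (rule norm_triangle_ineq)
  also have "\<dots> \<le> \<bar>c\<bar> * B + (\<Sum>(c, x)\<leftarrow>l. \<bar>c\<bar>) * B" using Cons assms by (intro add_mono) (auto intro!: mult_left_mono)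
  finally show ?case by (simp add: e distrib_right)
qed simp

text \<open>A Gaussian isometry taking \<open>Y x\<close> to \<open>e x\<close> in
  \<open>L^2\<close> with weight \<open>\<rho>\<close>, recorded through the laws of all finite
  combinations. Differences and Riemann sums act on both sides alike.\<close>

definition spec_gauss :: "'b measure \<Rightarrow> (real \<Rightarrow> 'b \<Rightarrow> real) \<Rightarrow> (real \<Rightarrow> real \<Rightarrow> complex) \<Rightarrow> (real \<Rightarrow> real) \<Rightarrow> bool" where
  "spec_gauss Q Y e \<rho> \<longleftrightarrow> (\<forall>l. gauss_rv Q (\<lambda>\<omega>. lsum (\<lambda>x. Y x \<omega>) l) (LINT \<xi>|lborel. (norm (lsum (\<lambda>x. e x \<xi>) l))\<^sup>2 * \<rho> \<xi>))"

text \<open>A combination of differences is a combination of values: the list is doubled, with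
  shifted points in one half and opposite signs in the other.\<close>

lemma spec_gauss_diff:
  assumes "spec_gauss Q Y e \<rho>"
  shows "spec_gauss Q (\<lambda>x \<omega>. Y (x + h) \<omega> - Y x \<omega>) (\<lambda>x \<xi>. e (x + h) \<xi> - e x \<xi>) \<rho>"
  unfolding spec_gauss_def
proof
  fix l :: "(real \<times> real) list"
  define l' where "l' = map (\<lambda>(c, x). (1 * c, x + h)) l @ map (\<lambda>(c, x). ((- 1) * c, x + 0)) l"
  have eq: "lsum f l' = lsum (\<lambda>x. f (x + h) - f x) l" for f :: "real \<Rightarrow> 'v::real_vector"
    by (simp only: l'_def lsum_append lsum_affine lsum_diff) simp
  show "gauss_rv Q (\<lambda>\<omega>. lsum (\<lambda>x. Y (x + h) \<omega> - Y x \<omega>) l) (LINT \<xi>|lborel. (norm (lsum (\<lambda>x. e (x + h) \<xi> - e x \<xi>) l))\<^sup>2 * \<rho> \<xi>)"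
    using assms[unfolded spec_gauss_def, rule_format, of l'] unfolding eq .
qed

text \<open>The mean value inequality bounds the error on each subinterval by its length times the
  oscillation of \<open>f\<close>. Vector values allow one lemma for the real paths and the complex
  spectral functions.\<close>

lemma riemann_sum_tendsto:
  fixes F f :: "real \<Rightarrow> 'v::real_normed_vector"
  assumes F: "\<And>y. (F has_vector_derivative f y) (at y)" and f: "continuous_on UNIV f" and h: "h > 0"
  shows "(\<lambda>n. \<Sum>k<n. (h / real n) *\<^sub>R f (x + real k * (h / real n))) \<longlonglongrightarrow> F (x + h) - F x"
proof (rule LIMSEQ_I)
  fix \<epsilon> :: real assume \<epsilon>: "\<epsilon> > 0"
  \<comment> \<open>The \<open>n\<close> steps of length \<open>d\<close> contribute at most
    \<open>n * d * e = h * e = \<epsilon> / 2\<close>.\<close>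
  define e where "e = \<epsilon> / (2 * h)"
  have e: "e > 0" using \<epsilon> h by (simp add: e_def)
  have "uniformly_continuous_on {x..x + h} f"
    using f by (intro compact_uniformly_continuous continuous_on_subset[OF f]) auto
  then obtain \<delta> where \<delta>: "\<delta> > 0" "\<And>y z. y \<in> {x..x+h} \<Longrightarrow> z \<in> {x..x+h} \<Longrightarrow> dist z y < \<delta> \<Longrightarrow> dist (f z) (f y) < e"
    unfolding uniformly_continuous_on_def using e by meson
  obtain N :: nat where N: "real N > h / \<delta>" using reals_Archimedean2 by blast
  show "\<exists>no. \<forall>n\<ge>no. norm ((\<Sum>k<n. (h / real n) *\<^sub>R f (x + real k * (h / real n))) - (F (x + h) - F x)) < \<epsilon>"
  proof (intro exI allI impI)
    fix n assume n: "n \<ge> Suc N"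
    then have n0: "n > 0" by simp
    define d where "d = h / real n"
    have d: "d > 0" "real n * d = h" using h n0 by (auto simp: d_def)
    have "h / \<delta> < real n" using N n by linarith
    then have dd: "d < \<delta>" using \<delta>(1) n0 by (simp add: d_def field_simps)
    define X where "X k = x + real k * d" for k
    have step: "norm (F (X (Suc k)) - F (X k) - d *\<^sub>R f (X k)) \<le> d * e" if k: "k < n" for k
    proof -
      have Xk: "X (Suc k) = X k + d" by (simp add: X_def algebra_simps)
      have "real (Suc k) * d \<le> real n * d" using k d by (intro mult_right_mono) auto
      then have top: "X k + d \<le> x + h" using d by (simp add: X_def distrib_right)
      have bot: "x \<le> X k" using d by (simp add: X_def)
      have "norm (F (X k + d) - F (X k) - ((X k + d) - X k) *\<^sub>R f (X k)) \<le> norm ((X k + d) - X k) * e"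
      proof (rule vector_differentiable_bound_linearization)
        show "closed_segment (X k) (X k + d) \<subseteq> {X k..X k + d}" using d by (simp add: closed_segment_eq_real_ivl)
        show "(F has_vector_derivative f y) (at y within {X k..X k + d})" for y
          using F has_vector_derivative_at_within by blast
        show "norm (f y - f (X k)) \<le> e" if "y \<in> {X k..X k + d}" for y
        proof -
          have "dist (f y) (f (X k)) < e"
            using that bot top d dd by (intro \<delta>(2)) (auto simp: dist_real_def)
          then show ?thesis by (simp add: dist_norm)
        qed
        show "X k \<in> {X k..X k + d}" using d by simp
      qed
      then show ?thesis using d by (simp add: Xk)
    qed
    have "F (x + h) - F x = (\<Sum>k<n. F (X (Suc k)) - F (X k))"
      by (subst sum_lessThan_telescope) (simp add: X_def d(2))
    then have "norm ((\<Sum>k<n. d *\<^sub>R f (X k)) - (F (x + h) - F x)) = norm (\<Sum>k<n. F (X (Suc k)) - F (X k) - d *\<^sub>R f (X k))"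
      by (simp add: sum_subtractf norm_minus_commute)
    also have "\<dots> \<le> (\<Sum>k<n. d * e)"
      by (rule order.trans[OF norm_sum]) (intro sum_mono step, simp)
    also have "\<dots> = \<epsilon> / 2" using d h by (simp add: e_def mult.assoc[symmetric])
    also have "\<dots> < \<epsilon>" using \<epsilon> by simp
    finally show "norm ((\<Sum>k<n. (h / real n) *\<^sub>R f (x + real k * (h / real n))) - (F (x + h) - F x)) < \<epsilon>"
      by (simp add: X_def d_def)
  qed
qed

text \<open>Integration over an interval of length \<open>h\<close> is approximated on both sides by
  the same combination of points. The paths converge pointwise and the variances by dominated
  convergence with majorant \<open>g\<close>. The spectral functions may be singular at
  \<open>\<xi> = 0\<close>, which is a null set.\<close>

lemma spec_gauss_integrate:
  assumes Q: "prob_space Q" and Y: "spec_gauss Q Y e \<rho>" and h: "h > 0"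
    and F: "\<And>\<omega> y. \<omega> \<in> space Q \<Longrightarrow> ((\<lambda>x. F x \<omega>) has_vector_derivative Y y \<omega>) (at y)"
    and Yc: "\<And>\<omega>. \<omega> \<in> space Q \<Longrightarrow> continuous_on UNIV (\<lambda>x. Y x \<omega>)"
    and E: "\<And>\<xi> y. \<xi> \<noteq> 0 \<Longrightarrow> ((\<lambda>x. E x \<xi>) has_vector_derivative e y \<xi>) (at y)"
    and ec: "\<And>\<xi>. \<xi> \<noteq> 0 \<Longrightarrow> continuous_on UNIV (\<lambda>x. e x \<xi>)"
    and [measurable]: "\<And>x. e x \<in> borel_measurable borel" "\<And>x. E x \<in> borel_measurable borel" "\<rho> \<in> borel_measurable borel"
    and \<rho>: "\<And>\<xi>. \<rho> \<xi> \<ge> 0" and bd: "\<And>x \<xi>. norm (e x \<xi>) \<le> g \<xi>" and int: "integrable lborel (\<lambda>\<xi>. (g \<xi>)\<^sup>2 * \<rho> \<xi>)"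
  shows "spec_gauss Q (\<lambda>x \<omega>. F (x + h) \<omega> - F x \<omega>) (\<lambda>x \<xi>. E (x + h) \<xi> - E x \<xi>) \<rho>"
  unfolding spec_gauss_def
proof
  fix l :: "(real \<times> real) list"
  interpret prob_space Q by fact
  have [measurable]: "(\<lambda>\<omega>. e x \<omega>) \<in> borel_measurable borel" for x by measurable
  define r where "r n = concat (map (\<lambda>k. map (\<lambda>(c, x). ((h / real n) * c, x + real k * (h / real n))) l) [0..<n])" for n :: nat
  have r: "lsum f (r n) = lsum (\<lambda>x. \<Sum>k<n. (h / real n) *\<^sub>R f (x + real k * (h / real n))) l" for f :: "real \<Rightarrow> 'v::real_vector" and n
    unfolding r_def lsum_concat lsum_affine lsum_sum ..
  have gY: "gauss_rv Q (\<lambda>\<omega>. lsum (\<lambda>x. Y x \<omega>) (r n)) (LINT \<xi>|lborel. (norm (lsum (\<lambda>x. e x \<xi>) (r n)))\<^sup>2 * \<rho> \<xi>)" for n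
    using Y by (simp add: spec_gauss_def)
  define C where "C = (\<Sum>(c, x)\<leftarrow>l. \<bar>c\<bar>)"
  have C: "C \<ge> 0" unfolding C_def by (induction l) auto
  show "gauss_rv Q (\<lambda>\<omega>. lsum (\<lambda>x. F (x + h) \<omega> - F x \<omega>) l) (LINT \<xi>|lborel. (norm (lsum (\<lambda>x. E (x + h) \<xi> - E x \<xi>) l))\<^sup>2 * \<rho> \<xi>)"
  proof (rule gauss_rv_limit_pointwise[OF gY])
    show "(\<lambda>n. lsum (\<lambda>x. Y x \<omega>) (r n)) \<longlonglongrightarrow> lsum (\<lambda>x. F (x + h) \<omega> - F x \<omega>) l" if "\<omega> \<in> space Q" for \<omega>
      unfolding r by (intro lsum_tendsto riemann_sum_tendsto F Yc that h)
    show "(\<lambda>n. LINT \<xi>|lborel. (norm (lsum (\<lambda>x. e x \<xi>) (r n)))\<^sup>2 * \<rho> \<xi>) \<longlonglongrightarrow> (LINT \<xi>|lborel. (norm (lsum (\<lambda>x. E (x + h) \<xi> - E x \<xi>) l))\<^sup>2 * \<rho> \<xi>)"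
    proof (rule integral_dominated_convergence[where w="\<lambda>\<xi>. (C * h)\<^sup>2 * ((g \<xi>)\<^sup>2 * \<rho> \<xi>)"])
      show "(\<lambda>\<xi>. (norm (lsum (\<lambda>x. E (x + h) \<xi> - E x \<xi>) l))\<^sup>2 * \<rho> \<xi>) \<in> borel_measurable lborel" by measurable
      show "(\<lambda>\<xi>. (norm (lsum (\<lambda>x. e x \<xi>) (r n)))\<^sup>2 * \<rho> \<xi>) \<in> borel_measurable lborel" for n by measurable
      show "integrable lborel (\<lambda>\<xi>. (C * h)\<^sup>2 * ((g \<xi>)\<^sup>2 * \<rho> \<xi>))" using int by simp
      show "AE \<xi> in lborel. (\<lambda>n. (norm (lsum (\<lambda>x. e x \<xi>) (r n)))\<^sup>2 * \<rho> \<xi>) \<longlonglongrightarrow> (norm (lsum (\<lambda>x. E (x + h) \<xi> - E x \<xi>) l))\<^sup>2 * \<rho> \<xi>"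
        using AE_lborel_singleton[of 0]
      proof eventually_elim
        fix \<xi> :: real assume "\<xi> \<noteq> 0"
        then show "(\<lambda>n. (norm (lsum (\<lambda>x. e x \<xi>) (r n)))\<^sup>2 * \<rho> \<xi>) \<longlonglongrightarrow> (norm (lsum (\<lambda>x. E (x + h) \<xi> - E x \<xi>) l))\<^sup>2 * \<rho> \<xi>"
          unfolding r by (intro tendsto_intros lsum_tendsto riemann_sum_tendsto E ec h)
      qed
      show "AE \<xi> in lborel. norm ((norm (lsum (\<lambda>x. e x \<xi>) (r n)))\<^sup>2 * \<rho> \<xi>) \<le> (C * h)\<^sup>2 * ((g \<xi>)\<^sup>2 * \<rho> \<xi>)" for n
      proof (intro AE_I2)
        fix \<xi> :: real
        have g0: "0 \<le> g \<xi>" using bd[of 0 \<xi>] norm_ge_zero order_trans by blast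
        have "norm (lsum (\<lambda>x. e x \<xi>) (r n)) \<le> C * (h * g \<xi>)"
          unfolding r C_def
        proof (rule norm_lsum_le)
          fix x
          have "norm (\<Sum>k<n. (h / real n) *\<^sub>R e (x + real k * (h / real n)) \<xi>) \<le> (\<Sum>k<n. (h / real n) * g \<xi>)"
            using h bd by (intro order.trans[OF norm_sum] sum_mono) (auto intro!: mult_left_mono divide_right_mono)
          also have "\<dots> \<le> h * g \<xi>" using h g0 by (cases "n = 0") auto
          finally show "norm (\<Sum>k<n. (h / real n) *\<^sub>R e (x + real k * (h / real n)) \<xi>) \<le> h * g \<xi>" .
        qed
        then have "(norm (lsum (\<lambda>x. e x \<xi>) (r n)))\<^sup>2 \<le> (C * (h * g \<xi>))\<^sup>2" by (intro power_mono) auto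
        then have "(norm (lsum (\<lambda>x. e x \<xi>) (r n)))\<^sup>2 * \<rho> \<xi> \<le> (C * (h * g \<xi>))\<^sup>2 * \<rho> \<xi>" using \<rho> by (intro mult_right_mono)
        then show "norm ((norm (lsum (\<lambda>x. e x \<xi>) (r n)))\<^sup>2 * \<rho> \<xi>) \<le> (C * h)\<^sup>2 * ((g \<xi>)\<^sup>2 * \<rho> \<xi>)"
          using \<rho> by (simp add: power_mult_distrib mult_ac)
      qed
    qed
  qed
qed

section \<open>The spectral density of fractional Brownian motion\<close>

lemma one_minus_cos_le: "1 - cos (x::real) \<le> x\<^sup>2 / 2"
proof -
  have "1 - cos x = 2 * (sin (x / 2))\<^sup>2" using cos_double_sin[of "x / 2"] by simp
  also have "(sin (x / 2))\<^sup>2 \<le> (x / 2)\<^sup>2" by (rule abs_le_square_iff[THEN iffD1, OF abs_sin_x_le_abs_x])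
  finally show ?thesis by (simp add: power_divide)
qed

text \<open>Normalizing constant of the spectral density of fractional Brownian motion; for the
  parameters of the theorem it is \<open>2 * pi\<close> times the square of
  \<open>c_const\<close>.\<close>

definition cos_const :: "real \<Rightarrow> real" where
  "cos_const H = (LINT \<xi>|lborel. (1 - cos \<xi>) * \<bar>\<xi>\<bar> powr (- 2 * H - 1))"

text \<open>Near 0 the bound \<open>1 - cos \<xi> \<le> \<xi>\<^sup>2 / 2\<close> gives convergence
  for \<open>H < 1\<close>, and at infinity the bound 2 gives it for \<open>0 < H\<close>. The power
  of \<open>t\<close> comes from rescaling \<open>\<xi>\<close>. Positivity holds because the
  integrand is positive on the open unit interval.\<close>

lemma cos_const:
  assumes H: "0 < H" "H < 1"
  shows "integrable lborel (\<lambda>\<xi>. (1 - cos (t * \<xi>)) * \<bar>\<xi>\<bar> powr (- 2 * H - 1))"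
    and "(LINT \<xi>|lborel. (1 - cos (t * \<xi>)) * \<bar>\<xi>\<bar> powr (- 2 * H - 1)) = \<bar>t\<bar> powr (2 * H) * cos_const H"
    and "cos_const H > 0"
proof -
  define g where "g \<xi> = (1 - cos \<xi>) * \<bar>\<xi>\<bar> powr (- 2 * H - 1)" for \<xi> :: real
  have [measurable]: "g \<in> borel_measurable borel" unfolding g_def by measurable
  have g0: "g \<xi> \<ge> 0" for \<xi> by (simp add: g_def)
  have ig: "integrable lborel g"
  proof (rule Bochner_Integration.integrable_bound)
    show "integrable lborel (\<lambda>\<xi>::real. 2 * (if \<bar>\<xi>\<bar> \<le> 1 then \<bar>\<xi>\<bar> powr (1 - 2 * H) else \<bar>\<xi>\<bar> powr (- 2 * H - 1)))"
      using H by (intro integrable_mult_right integrable_powr_two_sided) auto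
    have "g \<xi> \<le> 2 * (if \<bar>\<xi>\<bar> \<le> 1 then \<bar>\<xi>\<bar> powr (1 - 2 * H) else \<bar>\<xi>\<bar> powr (- 2 * H - 1))" for \<xi>
    proof (cases "\<bar>\<xi>\<bar> \<le> 1")
      case True
      have "g \<xi> \<le> (\<xi>\<^sup>2 / 2) * \<bar>\<xi>\<bar> powr (- 2 * H - 1)"
        unfolding g_def by (intro mult_right_mono one_minus_cos_le) auto
      also have "\<dots> = \<bar>\<xi>\<bar> powr (1 - 2 * H) / 2"
      proof (cases "\<xi> = 0")
        case False
        then have "\<xi>\<^sup>2 = \<bar>\<xi>\<bar> powr 2" by (simp add: powr_numeral)
        then have "(\<xi>\<^sup>2 / 2) * \<bar>\<xi>\<bar> powr (- 2 * H - 1) = (\<bar>\<xi>\<bar> powr 2 * \<bar>\<xi>\<bar> powr (- 2 * H - 1)) / 2" by simp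
        also have "\<bar>\<xi>\<bar> powr 2 * \<bar>\<xi>\<bar> powr (- 2 * H - 1) = \<bar>\<xi>\<bar> powr (1 - 2 * H)"
          unfolding powr_add[symmetric] by (rule arg_cong[where f="\<lambda>a. \<bar>\<xi>\<bar> powr a"]) simp
        finally show ?thesis .
      qed simp
      also have "\<dots> \<le> 2 * \<bar>\<xi>\<bar> powr (1 - 2 * H)" by simp
      finally show ?thesis using True by simp
    next
      case False
      have "g \<xi> \<le> 2 * \<bar>\<xi>\<bar> powr (- 2 * H - 1)"
        unfolding g_def using cos_ge_minus_one[of \<xi>] by (intro mult_right_mono) auto
      then show ?thesis using False by simp
    qed
    then show "AE \<xi> in lborel. norm (g \<xi>) \<le> norm (2 * (if \<bar>\<xi>\<bar> \<le> 1 then \<bar>\<xi>\<bar> powr (1 - 2 * H) else \<bar>\<xi>\<bar> powr (- 2 * H - 1)))"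
      using g0 by (intro AE_I2) simp
  qed measurable
  have G: "cos_const H = (LINT \<xi>|lborel. g \<xi>)" by (simp add: cos_const_def g_def)
  show "cos_const H > 0"
  proof (rule ccontr)
    assume "\<not> cos_const H > 0"
    moreover have "cos_const H \<ge> 0" unfolding G by (simp add: g0)
    ultimately have "(LINT \<xi>|lborel. g \<xi>) = 0" using G by simp
    then have "AE \<xi> in lborel. g \<xi> = 0" using integral_nonneg_eq_0_iff_AE[OF ig] g0 by simp
    then have "AE \<xi> in lborel. \<xi> \<notin> {0<..<1::real}"
    proof eventually_elim
      fix \<xi> :: real assume z: "g \<xi> = 0"
      show "\<xi> \<notin> {0<..<1}"
      proof
        assume x: "\<xi> \<in> {0<..<1}"
        then have "cos \<xi> < cos 0" using pi_gt3 by (intro cos_monotone_0_pi) auto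
        then show False using z x by (simp add: g_def)
      qed
    qed
    then have "{0<..<1::real} \<in> null_sets lborel" by (subst AE_iff_null_sets) auto
    then show False by (simp add: null_sets_def)
  qed
  show "integrable lborel (\<lambda>\<xi>. (1 - cos (t * \<xi>)) * \<bar>\<xi>\<bar> powr (- 2 * H - 1))"
    and "(LINT \<xi>|lborel. (1 - cos (t * \<xi>)) * \<bar>\<xi>\<bar> powr (- 2 * H - 1)) = \<bar>t\<bar> powr (2 * H) * cos_const H"
  proof -
    have "integrable lborel (\<lambda>\<xi>. (1 - cos (t * \<xi>)) * \<bar>\<xi>\<bar> powr (- 2 * H - 1)) \<and>
      (LINT \<xi>|lborel. (1 - cos (t * \<xi>)) * \<bar>\<xi>\<bar> powr (- 2 * H - 1)) = \<bar>t\<bar> powr (2 * H) * cos_const H"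
    proof (cases "t = 0")
      case False
      have gt: "g (0 + t * \<xi>) = \<bar>t\<bar> powr (- 2 * H - 1) * ((1 - cos (t * \<xi>)) * \<bar>\<xi>\<bar> powr (- 2 * H - 1))" for \<xi>
        by (simp add: g_def abs_mult powr_mult mult_ac)
      define k where "k = \<bar>t\<bar> powr (- 2 * H - 1)"
      have k: "k > 0" using False by (simp add: k_def)
      have kk: "\<bar>t\<bar> * k * \<bar>t\<bar> powr (2 * H) = 1"
      proof -
        have "\<bar>t\<bar> * k * \<bar>t\<bar> powr (2 * H) = \<bar>t\<bar> powr 1 * \<bar>t\<bar> powr (- 2 * H - 1) * \<bar>t\<bar> powr (2 * H)"
          using False by (simp add: k_def)
        also have "\<dots> = \<bar>t\<bar> powr 0" unfolding powr_add[symmetric] by simp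
        finally show ?thesis using False by simp
      qed
      have "integrable lborel (\<lambda>\<xi>. g (0 + t * \<xi>))" by (rule lborel_integrable_real_affine[OF ig False])
      then have i: "integrable lborel (\<lambda>\<xi>. (1 - cos (t * \<xi>)) * \<bar>\<xi>\<bar> powr (- 2 * H - 1))"
        unfolding gt k_def[symmetric] using k by simp
      have "cos_const H = \<bar>t\<bar> *\<^sub>R (LINT \<xi>|lborel. g (0 + t * \<xi>))"
        unfolding G by (rule lborel_integral_real_affine[OF False])
      also have "\<dots> = \<bar>t\<bar> * k * (LINT \<xi>|lborel. (1 - cos (t * \<xi>)) * \<bar>\<xi>\<bar> powr (- 2 * H - 1))"
        unfolding gt k_def[symmetric] by simp
      finally have "\<bar>t\<bar> powr (2 * H) * cos_const H = (\<bar>t\<bar> * k * \<bar>t\<bar> powr (2 * H)) * (LINT \<xi>|lborel. (1 - cos (t * \<xi>)) * \<bar>\<xi>\<bar> powr (- 2 * H - 1))"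
        by simp
      then show ?thesis unfolding kk using i by simp
    qed simp
    then show "integrable lborel (\<lambda>\<xi>. (1 - cos (t * \<xi>)) * \<bar>\<xi>\<bar> powr (- 2 * H - 1))"
      and "(LINT \<xi>|lborel. (1 - cos (t * \<xi>)) * \<bar>\<xi>\<bar> powr (- 2 * H - 1)) = \<bar>t\<bar> powr (2 * H) * cos_const H" by auto
  qed
qed

text \<open>Normalized such that the squared modulus of \<open>iexp (t * \<xi>) - 1\<close>, which
  is \<open>2 * (1 - cos (t * \<xi>))\<close>, integrates against it to
  \<open>\<bar>t\<bar> powr (2 * H)\<close>.\<close>

definition fbm_spec :: "real \<Rightarrow> real \<Rightarrow> real" where
  "fbm_spec H \<xi> = \<bar>\<xi>\<bar> powr (- 2 * H - 1) / (2 * cos_const H)"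

lemma fbm_spec_measurable[measurable]: "fbm_spec H \<in> borel_measurable borel"
  unfolding fbm_spec_def by measurable

lemma fbm_spec_nonneg: "0 < H \<Longrightarrow> H < 1 \<Longrightarrow> fbm_spec H \<xi> \<ge> 0"
  using cos_const(3)[of H] by (simp add: fbm_spec_def)

text \<open>The product of the spectral function at \<open>y\<close> with the conjugate of the one
  at \<open>z\<close> has real part \<open>(1 - cos (y * \<xi>)) + (1 - cos (z * \<xi>)) - (1 - cos
  ((y - z) * \<xi>))\<close>, and \<open>cos_const\<close> integrates each term to the matching
  summand of the covariance.\<close>

lemma fbm_spec_gauss:
  assumes Q: "prob_space Q" and B: "fractional_bm Q H B" and H: "0 < H" "H < 1"
  shows "spec_gauss Q B (\<lambda>x \<xi>. iexp (x * \<xi>) - 1) (fbm_spec H)"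
  unfolding spec_gauss_def
proof
  fix l :: "(real \<times> real) list"
  define S where "S = snd ` set l"
  have S: "finite S" "snd ` set l \<subseteq> S" by (auto simp: S_def)
  define d where "d = lcoef l"
  have fam: "centered_gaussian_family Q UNIV B" using B by (simp add: fractional_bm_def)
  have cov: "(LINT \<omega>|Q. B t \<omega> * B r \<omega>) = 1/2 * (\<bar>t\<bar> powr (2*H) + \<bar>r\<bar> powr (2*H) - \<bar>t - r\<bar> powr (2*H))" for t r
    using B by (simp add: fractional_bm_def)
  obtain v where v: "gauss_rv Q (\<lambda>\<omega>. \<Sum>y\<in>S. d y * B y \<omega>) v"
    using fam S unfolding centered_gaussian_family_def gauss_rv_def by blast
  have L2: "B t \<in> borel_measurable Q" "integrable Q (\<lambda>\<omega>. (B t \<omega>)\<^sup>2)" for t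
  proof -
    from fam[unfolded centered_gaussian_family_def, rule_format, of "{t}" "\<lambda>_. 1"]
    have "\<exists>v. gauss_rv Q (B t) v" by (auto simp: gauss_rv_def)
    then show "B t \<in> borel_measurable Q" "integrable Q (\<lambda>\<omega>. (B t \<omega>)\<^sup>2)"
      using gauss_rvD(1) gauss_rv_square(1) by blast+
  qed
  have iB: "integrable Q (\<lambda>\<omega>. B t \<omega> * B r \<omega>)" for t r
    by (rule integrable_mult_L2) (use L2 in auto)
  have "v = (LINT \<omega>|Q. (\<Sum>y\<in>S. d y * B y \<omega>)\<^sup>2)" using gauss_rv_square(2)[OF v] by simp
  also have "\<dots> = (LINT \<omega>|Q. (\<Sum>y\<in>S. \<Sum>z\<in>S. (d y * d z) * (B y \<omega> * B z \<omega>)))"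
    by (simp add: power2_eq_square sum_product mult_ac)
  also have "\<dots> = (\<Sum>y\<in>S. \<Sum>z\<in>S. (d y * d z) * (1/2 * (\<bar>y\<bar> powr (2*H) + \<bar>z\<bar> powr (2*H) - \<bar>y - z\<bar> powr (2*H))))"
    using iB by (simp add: cov)
  finally have v1: "v = (\<Sum>y\<in>S. \<Sum>z\<in>S. (d y * d z) * (1/2 * (\<bar>y\<bar> powr (2*H) + \<bar>z\<bar> powr (2*H) - \<bar>y - z\<bar> powr (2*H))))" .
  define q where "q t \<xi> = (1 - cos (t * \<xi>)) * \<bar>\<xi>\<bar> powr (- 2 * H - 1)" for t \<xi> :: real
  have q: "integrable lborel (q t)" "(LINT \<xi>|lborel. q t \<xi>) = \<bar>t\<bar> powr (2 * H) * cos_const H" for t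
    using cos_const(1,2)[OF H, of t] by (simp_all add: q_def[abs_def])
  note k = cos_const(3)[OF H]
  have nsq: "(norm (lsum (\<lambda>x. iexp (x * \<xi>) - 1) l))\<^sup>2 * fbm_spec H \<xi>
    = (\<Sum>y\<in>S. \<Sum>z\<in>S. (d y * d z) * (1 / (2 * cos_const H) * (q y \<xi> + q z \<xi> - q (y - z) \<xi>)))" for \<xi>
  proof -
    have l: "lsum (\<lambda>x. iexp (x * \<xi>) - 1) l = (\<Sum>y\<in>S. d y *\<^sub>R (iexp (y * \<xi>) - 1))"
      unfolding d_def by (rule lsum_eq_sum[OF S])
    have R: "Re (\<Sum>y\<in>S. d y *\<^sub>R (iexp (y * \<xi>) - 1)) = (\<Sum>y\<in>S. d y * (cos (y * \<xi>) - 1))"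
      and I: "Im (\<Sum>y\<in>S. d y *\<^sub>R (iexp (y * \<xi>) - 1)) = (\<Sum>y\<in>S. d y * sin (y * \<xi>))"
      by (simp_all add: Re_exp Im_exp)
    have "(norm (lsum (\<lambda>x. iexp (x * \<xi>) - 1) l))\<^sup>2
      = (\<Sum>y\<in>S. \<Sum>z\<in>S. (d y * (cos (y * \<xi>) - 1)) * (d z * (cos (z * \<xi>) - 1)) + (d y * sin (y * \<xi>)) * (d z * sin (z * \<xi>)))"
      unfolding l cmod_power2 R I by (simp only: power2_eq_square sum_product sum.distrib)
    also have "\<dots> = (\<Sum>y\<in>S. \<Sum>z\<in>S. (d y * d z) * ((1 - cos (y * \<xi>)) + (1 - cos (z * \<xi>)) - (1 - cos ((y - z) * \<xi>))))"
      by (intro sum.cong refl) (simp add: left_diff_distrib cos_diff algebra_simps)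
    finally show ?thesis
      unfolding fbm_spec_def q_def by (simp only: sum_distrib_right) (intro sum.cong refl, simp add: algebra_simps add_divide_distrib diff_divide_distrib)
  qed
  have "(LINT \<xi>|lborel. (norm (lsum (\<lambda>x. iexp (x * \<xi>) - 1) l))\<^sup>2 * fbm_spec H \<xi>)
    = (\<Sum>y\<in>S. \<Sum>z\<in>S. (d y * d z) * (1 / (2 * cos_const H) * (\<bar>y\<bar> powr (2*H) * cos_const H + \<bar>z\<bar> powr (2*H) * cos_const H - \<bar>y - z\<bar> powr (2*H) * cos_const H)))"
    unfolding nsq using q by (simp del: times_divide_eq_left)
  also have "\<dots> = v"
    unfolding v1 using k by (intro sum.cong refl) (simp add: field_simps)
  finally have "(LINT \<xi>|lborel. (norm (lsum (\<lambda>x. iexp (x * \<xi>) - 1) l))\<^sup>2 * fbm_spec H \<xi>) = v" .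
  moreover have "lsum (\<lambda>x. B x \<omega>) l = (\<Sum>y\<in>S. d y * B y \<omega>)" for \<omega>
    unfolding d_def by (simp add: lsum_eq_sum[OF S])
  ultimately show "gauss_rv Q (\<lambda>\<omega>. lsum (\<lambda>x. B x \<omega>) l) (LINT \<xi>|lborel. (norm (lsum (\<lambda>x. iexp (x * \<xi>) - 1) l))\<^sup>2 * fbm_spec H \<xi>)"
    using v by simp
qed

section \<open>Differences of iterated primitives\<close>

lemma int_op_has_vector_derivative:
  fixes f :: "real \<Rightarrow> real"
  assumes f: "continuous_on UNIV f"
  shows "(int_op f has_vector_derivative f x) (at x)"
proof -
  \<comment> \<open>An interval around 0 and \<open>x\<close> with \<open>x\<close> in its interior,
    so that the derivative within it is the full derivative.\<close>
  define R where "R = \<bar>x\<bar> + 1"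
  have "((\<lambda>u. LBINT y=0..u. f y) has_vector_derivative f x) (at x within {-R..R})"
    by (rule interval_integral_FTC2[of "-R" 0 R, simplified zero_ereal_def[symmetric]])
      (auto simp: R_def intro: continuous_on_subset[OF f])
  moreover have "at x within {-R..R} = at x" by (rule at_within_Icc_at) (auto simp: R_def)
  ultimately show ?thesis by (simp add: int_op_def[abs_def] zero_ereal_def)
qed

lemma continuous_on_fwd_diff: "continuous_on UNIV f \<Longrightarrow> continuous_on UNIV (fwd_diff h f)"
  unfolding fwd_diff_def[abs_def]
  by (intro continuous_on_diff continuous_on_compose2[of UNIV f _ "\<lambda>x. x + h"] continuous_on_add continuous_on_id continuous_on_const subset_UNIV)

lemma continuous_on_fwd_diff_pow: "continuous_on UNIV f \<Longrightarrow> continuous_on UNIV ((fwd_diff h ^^ M) f)"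
  by (induction M) (auto intro: continuous_on_fwd_diff)

lemma int_op_continuous: "continuous_on UNIV f \<Longrightarrow> continuous_on UNIV (int_op f)"
  by (rule continuous_at_imp_continuous_on) (auto intro: has_vector_derivative_continuous int_op_has_vector_derivative)

lemma fwd_diff_pow_has_vector_derivative:
  assumes "\<And>x. (F has_vector_derivative f x) (at x)"
  shows "((fwd_diff h ^^ M) F has_vector_derivative (fwd_diff h ^^ M) f x) (at x)"
proof (induction M arbitrary: x)
  case (Suc M)
  have "((\<lambda>x. x + h) has_vector_derivative 1) (at x)"
    unfolding has_real_derivative_iff_has_vector_derivative[symmetric] by (auto intro!: derivative_eq_intros)
  from vector_diff_chain_at[OF this Suc[of "x + h"]]
  have "((\<lambda>x. (fwd_diff h ^^ M) F (x + h)) has_vector_derivative (fwd_diff h ^^ M) f (x + h)) (at x)"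
    by (simp add: o_def)
  from has_vector_derivative_diff[OF this Suc[of x]]
  show ?case by (simp add: fwd_diff_def[abs_def])
qed (use assms in simp)

lemma norm_iexp_minus_one_le: "norm (iexp x - 1) \<le> \<bar>x\<bar>" "norm (iexp x - 1) \<le> 2"
proof -
  show "norm (iexp x - 1) \<le> \<bar>x\<bar>" using norm_iexp_diff_le[of x 0] by simp
  have "norm (iexp x - 1) \<le> norm (iexp x) + norm (1::complex)" by (rule norm_triangle_ineq4)
  then show "norm (iexp x - 1) \<le> 2" by simp
qed

text \<open>Near 0 the numerator is at most \<open>(h * \<bar>\<xi>\<bar>) ^ M\<close>, and
  \<open>M \<ge> m + 1\<close> leaves one power of \<open>\<bar>\<xi>\<bar>\<close> to offset the
  singularity of the density. Away from 0 the numerator is at most \<open>2 ^ M\<close> and the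
  density decays. \<open>C\<close> adds the constants of the two regimes.\<close>

lemma fbm_spec_integrable:
  assumes H: "0 < H" "H < 1" and M: "M \<ge> m + 1" and h: "h > 0"
  shows "integrable lborel (\<lambda>\<xi>. (norm (iexp (h * \<xi>) - 1) ^ M / \<bar>\<xi>\<bar> ^ m)\<^sup>2 * fbm_spec H \<xi>)"
proof (rule Bochner_Integration.integrable_bound)
  define C where "C = (h ^ (2 * M) + 2 ^ (2 * M)) / (2 * cos_const H)"
  note k = cos_const(3)[OF H]
  have C: "C \<ge> 0" using h k by (simp add: C_def)
  show "integrable lborel (\<lambda>\<xi>::real. C * (if \<bar>\<xi>\<bar> \<le> 1 then \<bar>\<xi>\<bar> powr (1 - 2 * H) else \<bar>\<xi>\<bar> powr (- 2 * H - 1)))"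
    using H by (intro integrable_mult_right integrable_powr_two_sided) auto
  have le: "(norm (iexp (h * \<xi>) - 1) ^ M / \<bar>\<xi>\<bar> ^ m)\<^sup>2 * fbm_spec H \<xi> \<le> C * (if \<bar>\<xi>\<bar> \<le> 1 then \<bar>\<xi>\<bar> powr (1 - 2 * H) else \<bar>\<xi>\<bar> powr (- 2 * H - 1))"
    if \<xi>: "\<xi> \<noteq> 0" for \<xi>
  proof (cases "\<bar>\<xi>\<bar> \<le> 1")
    case True
    have "norm (iexp (h * \<xi>) - 1) ^ M / \<bar>\<xi>\<bar> ^ m \<le> \<bar>h * \<xi>\<bar> ^ M / \<bar>\<xi>\<bar> ^ m"
      by (intro divide_right_mono power_mono norm_iexp_minus_one_le) auto
    also have "\<dots> = h ^ M * \<bar>\<xi>\<bar> ^ (M - m)"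
      using \<xi> M h by (simp add: abs_mult power_mult_distrib power_diff)
    also have "\<dots> \<le> h ^ M * \<bar>\<xi>\<bar> ^ 1"
      using M True h by (intro mult_left_mono power_decreasing) auto
    finally have "(norm (iexp (h * \<xi>) - 1) ^ M / \<bar>\<xi>\<bar> ^ m)\<^sup>2 \<le> (h ^ M * \<bar>\<xi>\<bar>)\<^sup>2"
      by (intro power_mono) auto
    also have "\<dots> = h ^ (2 * M) * \<bar>\<xi>\<bar> powr 2" using \<xi> by (simp add: power_mult_distrib power_mult[symmetric] powr_numeral mult.commute)
    finally have "(norm (iexp (h * \<xi>) - 1) ^ M / \<bar>\<xi>\<bar> ^ m)\<^sup>2 * fbm_spec H \<xi> \<le> h ^ (2 * M) * \<bar>\<xi>\<bar> powr 2 * fbm_spec H \<xi>"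
      using fbm_spec_nonneg[OF H] by (intro mult_right_mono) auto
    also have "\<dots> = h ^ (2 * M) / (2 * cos_const H) * (\<bar>\<xi>\<bar> powr 2 * \<bar>\<xi>\<bar> powr (- 2 * H - 1))"
      by (simp add: fbm_spec_def)
    also have "\<bar>\<xi>\<bar> powr 2 * \<bar>\<xi>\<bar> powr (- 2 * H - 1) = \<bar>\<xi>\<bar> powr (1 - 2 * H)"
      unfolding powr_add[symmetric] by (rule arg_cong[where f="\<lambda>a. \<bar>\<xi>\<bar> powr a"]) simp
    also have "h ^ (2 * M) / (2 * cos_const H) * \<bar>\<xi>\<bar> powr (1 - 2 * H) \<le> C * \<bar>\<xi>\<bar> powr (1 - 2 * H)"
      using k h unfolding C_def by (intro mult_right_mono divide_right_mono) auto
    finally show ?thesis using True by simp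
  next
    case False
    have "norm (iexp (h * \<xi>) - 1) ^ M / \<bar>\<xi>\<bar> ^ m \<le> 2 ^ M / 1"
      using False by (intro frac_le power_mono norm_iexp_minus_one_le one_le_power) auto
    then have "(norm (iexp (h * \<xi>) - 1) ^ M / \<bar>\<xi>\<bar> ^ m)\<^sup>2 \<le> (2 ^ M / 1)\<^sup>2"
      by (intro power_mono) auto
    also have "\<dots> = 2 ^ (2 * M)" by (simp add: power_mult[symmetric] mult.commute)
    finally have "(norm (iexp (h * \<xi>) - 1) ^ M / \<bar>\<xi>\<bar> ^ m)\<^sup>2 * fbm_spec H \<xi> \<le> 2 ^ (2 * M) * fbm_spec H \<xi>"
      using fbm_spec_nonneg[OF H] by (intro mult_right_mono) auto
    also have "\<dots> = 2 ^ (2 * M) / (2 * cos_const H) * \<bar>\<xi>\<bar> powr (- 2 * H - 1)" by (simp add: fbm_spec_def)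
    also have "\<dots> \<le> C * \<bar>\<xi>\<bar> powr (- 2 * H - 1)"
      using k h unfolding C_def by (intro mult_right_mono divide_right_mono) auto
    finally show ?thesis using False by simp
  qed
  show "AE \<xi> in lborel. norm ((norm (iexp (h * \<xi>) - 1) ^ M / \<bar>\<xi>\<bar> ^ m)\<^sup>2 * fbm_spec H \<xi>)
    \<le> norm (C * (if \<bar>\<xi>\<bar> \<le> 1 then \<bar>\<xi>\<bar> powr (1 - 2 * H) else \<bar>\<xi>\<bar> powr (- 2 * H - 1)))"
    using AE_lborel_singleton[of 0]
  proof eventually_elim
    fix \<xi> :: real assume "\<xi> \<noteq> 0"
    from le[OF this] show "norm ((norm (iexp (h * \<xi>) - 1) ^ M / \<bar>\<xi>\<bar> ^ m)\<^sup>2 * fbm_spec H \<xi>)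
    \<le> norm (C * (if \<bar>\<xi>\<bar> \<le> 1 then \<bar>\<xi>\<bar> powr (1 - 2 * H) else \<bar>\<xi>\<bar> powr (- 2 * H - 1)))"
      using fbm_spec_nonneg[OF H] C by (simp add: abs_mult)
  qed
qed measurable

text \<open>The order \<open>m\<close> is raised by \<open>\<Delta>\<^sub>h\<^sup>M\<^sup>+\<^sup>1 J f x = \<integral> \<Delta>\<^sub>h\<^sup>M f\<close>, integrated over \<open>[x, x + h]\<close>. Working with differences
  only avoids the polynomial terms in the spectral representation of \<open>J\<^sup>m B\<close> itself.\<close>

lemma fbm_diff_spec_gauss:
  assumes Q: "prob_space Q" and B: "fractional_bm Q H B" and H: "0 < H" "H < 1" and h: "h > 0"
  shows "M \<ge> m + 1 \<Longrightarrow> spec_gauss Q (\<lambda>x \<omega>. (fwd_diff h ^^ M) (int_fbm m B \<omega>) x)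
    (\<lambda>x \<xi>. (iexp (h * \<xi>) - 1) ^ M / (\<i> * of_real \<xi>) ^ m * iexp (x * \<xi>)) (fbm_spec H)"
proof (induction m arbitrary: M)
  case 0
  have shift: "iexp ((x + h) * \<xi>) = iexp (h * \<xi>) * iexp (x * \<xi>)" for x \<xi>
    by (simp add: exp_add[symmetric] algebra_simps)
  have "M \<ge> 1 \<Longrightarrow> spec_gauss Q (\<lambda>x \<omega>. (fwd_diff h ^^ M) (\<lambda>t. B t \<omega>) x)
    (\<lambda>x \<xi>. (iexp (h * \<xi>) - 1) ^ M * iexp (x * \<xi>)) (fbm_spec H)" for M
  proof (induction M rule: nat_induct_at_least)
    \<comment> \<open>The first difference cancels the constant -1 in the spectral function of
      \<open>B\<close>.\<close>
    case base
    have "(\<lambda>x \<xi>. (iexp ((x + h) * \<xi>) - 1) - (iexp (x * \<xi>) - 1)) = (\<lambda>x \<xi>. (iexp (h * \<xi>) - 1) ^ 1 * iexp (x * \<xi>))"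
      unfolding shift by (simp add: algebra_simps)
    then show ?case
      using spec_gauss_diff[OF fbm_spec_gauss[OF Q B H], of h] by (simp add: fwd_diff_def[abs_def])
  next
    case (Suc M)
    have "(\<lambda>x \<xi>. (iexp (h * \<xi>) - 1) ^ M * iexp ((x + h) * \<xi>) - (iexp (h * \<xi>) - 1) ^ M * iexp (x * \<xi>)) = (\<lambda>x \<xi>. (iexp (h * \<xi>) - 1) ^ Suc M * iexp (x * \<xi>))"
      unfolding shift by (simp add: algebra_simps)
    then show ?case
      using spec_gauss_diff[OF Suc.IH, of h] by (simp add: fwd_diff_def[abs_def])
  qed
  from this[of M] 0 show ?case by (simp add: int_fbm_def)
next
  case (Suc m)
  \<comment> \<open>One difference is spent on the integration, so the induction hypothesis is used
    with \<open>N = M - 1\<close> differences.\<close>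
  then obtain N where M: "M = Suc N" and N: "N \<ge> m + 1" by (cases M) auto
  have cont: "continuous_on UNIV (int_fbm m B \<omega>)" if "\<omega> \<in> space Q" for \<omega> and m
  proof (induction m)
    case 0
    show ?case using B that by (simp add: int_fbm_def fractional_bm_def)
  next
    case (Suc m)
    then show ?case by (simp add: int_fbm_def int_op_continuous)
  qed
  define e where "e x \<xi> = (iexp (h * \<xi>) - 1) ^ N / (\<i> * of_real \<xi>) ^ m * iexp (x * \<xi>)" for x \<xi>
  define E where "E x \<xi> = (iexp (h * \<xi>) - 1) ^ N / (\<i> * of_real \<xi>) ^ Suc m * iexp (x * \<xi>)" for x \<xi>
  define F where "F x \<omega> = (fwd_diff h ^^ N) (int_fbm (Suc m) B \<omega>) x" for x \<omega>
  have shift: "iexp ((x + h) * \<xi>) = iexp (h * \<xi>) * iexp (x * \<xi>)" for x \<xi>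
    by (simp add: exp_add[symmetric] algebra_simps)
  have "spec_gauss Q (\<lambda>x \<omega>. F (x + h) \<omega> - F x \<omega>) (\<lambda>x \<xi>. E (x + h) \<xi> - E x \<xi>) (fbm_spec H)"
  proof (rule spec_gauss_integrate[OF Q Suc.IH[OF N] h, folded e_def])
    show "((\<lambda>x. F x \<omega>) has_vector_derivative (fwd_diff h ^^ N) (int_fbm m B \<omega>) y) (at y)" if "\<omega> \<in> space Q" for \<omega> y
    proof -
      have "int_fbm (Suc m) B \<omega> = int_op (int_fbm m B \<omega>)" by (simp add: int_fbm_def)
      then show ?thesis
        unfolding F_def using fwd_diff_pow_has_vector_derivative[OF int_op_has_vector_derivative[OF cont[OF that]]] by simp
    qed
    show "continuous_on UNIV (\<lambda>x. (fwd_diff h ^^ N) (int_fbm m B \<omega>) x)" if "\<omega> \<in> space Q" for \<omega>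
      using continuous_on_fwd_diff_pow[OF cont[OF that]] by simp
    show "((\<lambda>x. E x \<xi>) has_vector_derivative e y \<xi>) (at y)" if "\<xi> \<noteq> 0" for \<xi> y
    proof -
      have "((\<lambda>x. iexp (x * \<xi>)) has_vector_derivative \<xi> *\<^sub>R (\<i> * iexp (y * \<xi>))) (at y)"
      proof -
        have "((\<lambda>x. x * \<xi>) has_vector_derivative \<xi>) (at y)"
          unfolding has_real_derivative_iff_has_vector_derivative[symmetric] by (auto intro!: derivative_eq_intros)
        from vector_diff_chain_at[OF this has_vector_derivative_iexp]
        show ?thesis by (simp only: o_def)
      qed
      from has_vector_derivative_mult_right[OF this, of "(iexp (h * \<xi>) - 1) ^ N / (\<i> * of_real \<xi>) ^ Suc m"]
      have "((\<lambda>x. E x \<xi>) has_vector_derivative (iexp (h * \<xi>) - 1) ^ N / (\<i> * of_real \<xi>) ^ Suc m * (\<xi> *\<^sub>R (\<i> * iexp (y * \<xi>)))) (at y)"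
        by (simp add: E_def)
      moreover have "(iexp (h * \<xi>) - 1) ^ N / (\<i> * of_real \<xi>) ^ Suc m * (\<xi> *\<^sub>R (\<i> * iexp (y * \<xi>))) = e y \<xi>"
        using that by (simp add: e_def scaleR_conv_of_real field_simps)
      ultimately show ?thesis by simp
    qed
    show "continuous_on UNIV (\<lambda>x. e x \<xi>)" for \<xi> unfolding e_def by (intro continuous_intros)
    show "e x \<in> borel_measurable borel" "E x \<in> borel_measurable borel" for x
      unfolding e_def E_def by measurable
    show "norm (e x \<xi>) \<le> norm (iexp (h * \<xi>) - 1) ^ N / \<bar>\<xi>\<bar> ^ m" for x \<xi>
      by (simp add: e_def norm_mult norm_divide norm_power)
    show "integrable lborel (\<lambda>\<xi>. (norm (iexp (h * \<xi>) - 1) ^ N / \<bar>\<xi>\<bar> ^ m)\<^sup>2 * fbm_spec H \<xi>)"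
      by (rule fbm_spec_integrable[OF H N h])
  qed (use fbm_spec_nonneg[OF H] in auto)
  moreover have "F (x + h) \<omega> - F x \<omega> = (fwd_diff h ^^ M) (int_fbm (Suc m) B \<omega>) x" for x \<omega>
    by (simp add: F_def M fwd_diff_def)
  moreover have "E (x + h) \<xi> - E x \<xi> = (iexp (h * \<xi>) - 1) ^ M / (\<i> * of_real \<xi>) ^ Suc m * iexp (x * \<xi>)" for x \<xi>
  proof -
    have "E (x + h) \<xi> - E x \<xi> = (iexp (h * \<xi>) - 1) ^ N * (iexp (h * \<xi>) - 1) / (\<i> * of_real \<xi>) ^ Suc m * iexp (x * \<xi>)"
      unfolding E_def shift by (simp only: right_diff_distrib left_diff_distrib diff_divide_distrib) (simp add: mult_ac)
    then show ?thesis by (simp add: M mult.commute)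
  qed
  ultimately show ?case by simp
qed

text \<open>The factor \<open>G\<close>, the symbol of the difference operator, is the same at all
  points and comes out of the sum. \<open>S\<close> is enumerated without repetition, while the
  points \<open>x i\<close> may coincide.\<close>

lemma spec_gauss_sum:
  assumes Y: "spec_gauss Q Y (\<lambda>x \<xi>. G \<xi> * iexp (x * \<xi>)) \<rho>" and S: "finite S"
  shows "gauss_rv Q (\<lambda>\<omega>. \<Sum>i\<in>S. c i * Y (x i) \<omega>)
    (LINT \<xi>|lborel. (norm (esum S c x \<xi>))\<^sup>2 * ((norm (G \<xi>))\<^sup>2 * \<rho> \<xi>))"
proof -
  obtain ks where ks: "set ks = S" "distinct ks" using finite_distinct_list[OF S] by blast
  define l where "l = map (\<lambda>i. (c i, x i)) ks"
  have l: "lsum f l = (\<Sum>i\<in>S. c i *\<^sub>R f (x i))" for f :: "real \<Rightarrow> 'v::real_vector"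
    unfolding l_def lsum_def ks(1)[symmetric] by (simp add: sum.distinct_set_conv_list[OF ks(2)] o_def)
  have "lsum (\<lambda>x. G \<xi> * iexp (x * \<xi>)) l = esum S c x \<xi> * G \<xi>" for \<xi>
    unfolding l esum_def sum_distrib_right by (intro sum.cong refl) (simp only: scaleR_conv_of_real mult_ac)
  then have eq: "(norm (lsum (\<lambda>x. G \<xi> * iexp (x * \<xi>)) l))\<^sup>2 * \<rho> \<xi> = (norm (esum S c x \<xi>))\<^sup>2 * ((norm (G \<xi>))\<^sup>2 * \<rho> \<xi>)" for \<xi>
    by (simp only: norm_mult power_mult_distrib mult.assoc)
  from Y[unfolded spec_gauss_def, rule_format, of l]
  show ?thesis unfolding eq by (simp add: l)
qed

lemma fbm_diff_gaussian:
  assumes Q: "prob_space Q" and B: "fractional_bm Q H B" and H: "0 < H" "H < 1" and h: "h > 0"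
    and M: "M \<ge> m + 1" and S: "finite S"
  shows "gauss_rv Q (\<lambda>\<omega>. \<Sum>i\<in>S. c i * (fwd_diff h ^^ M) (int_fbm m B \<omega>) (x i))
    (LINT \<xi>|lborel. (norm (esum S c x \<xi>))\<^sup>2 * ((norm (iexp (h * \<xi>) - 1) ^ M / \<bar>\<xi>\<bar> ^ m)\<^sup>2 * fbm_spec H \<xi>))"
  using spec_gauss_sum[OF fbm_diff_spec_gauss[OF Q B H h M] S, of c x]
  by (simp add: norm_divide norm_power norm_mult)

section \<open>Comparison of the power variations\<close>

lemma power_diff_abs_le:
  fixes u v b :: real
  assumes "0 \<le> u" "u \<le> b" "0 \<le> v" "v \<le> b"
  shows "\<bar>u ^ Suc k - v ^ Suc k\<bar> \<le> real (Suc k) * b ^ k * \<bar>u - v\<bar>"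
proof (induction k)
  case (Suc k)
  have b: "b \<ge> 0" using assms by simp
  have "u ^ Suc (Suc k) - v ^ Suc (Suc k) = u * (u ^ Suc k - v ^ Suc k) + (u - v) * v ^ Suc k"
    by (simp add: algebra_simps)
  also have "\<bar>\<dots>\<bar> \<le> u * \<bar>u ^ Suc k - v ^ Suc k\<bar> + \<bar>u - v\<bar> * v ^ Suc k"
    using assms by (intro order.trans[OF abs_triangle_ineq]) (simp add: abs_mult)
  also have "\<dots> \<le> b * (real (Suc k) * b ^ k * \<bar>u - v\<bar>) + \<bar>u - v\<bar> * b ^ Suc k"
    using assms b by (intro add_mono mult_mono Suc.IH mult_left_mono power_mono) auto
  also have "\<dots> = real (Suc (Suc k)) * b ^ Suc k * \<bar>u - v\<bar>" by (simp add: algebra_simps)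
  finally show ?case .
qed simp

text \<open>The factor \<open>2 ^ k\<close> comes from \<open>\<bar>x\<bar> + \<bar>r\<bar> \<le> 2
  * max \<bar>x\<bar> \<bar>r\<bar>\<close>. The term linear in \<open>r\<close> carries the rate,
  since \<open>r\<close> will be small compared with \<open>x\<close>.\<close>

lemma abs_power_perturb:
  fixes x r :: real
  shows "\<bar>\<bar>x\<bar> ^ Suc k - \<bar>x + r\<bar> ^ Suc k\<bar> \<le> real (Suc k) * 2 ^ k * (\<bar>r\<bar> * \<bar>x\<bar> ^ k + \<bar>r\<bar> ^ Suc k)"
proof -
  define b where "b = \<bar>x\<bar> + \<bar>r\<bar>"
  have "\<bar>\<bar>x\<bar> ^ Suc k - \<bar>x + r\<bar> ^ Suc k\<bar> \<le> real (Suc k) * b ^ k * \<bar>\<bar>x\<bar> - \<bar>x + r\<bar>\<bar>"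
    by (rule power_diff_abs_le) (auto simp: b_def)
  also have "\<dots> \<le> real (Suc k) * (2 ^ k * (\<bar>x\<bar> ^ k + \<bar>r\<bar> ^ k)) * \<bar>r\<bar>"
  proof (intro mult_mono mult_left_mono)
    have "b \<le> 2 * max \<bar>x\<bar> \<bar>r\<bar>" by (simp add: b_def max_def)
    then have "b ^ k \<le> (2 * max \<bar>x\<bar> \<bar>r\<bar>) ^ k" by (intro power_mono) (auto simp: b_def)
    also have "\<dots> \<le> 2 ^ k * (\<bar>x\<bar> ^ k + \<bar>r\<bar> ^ k)" by (simp add: power_mult_distrib max_def)
    finally show "b ^ k \<le> 2 ^ k * (\<bar>x\<bar> ^ k + \<bar>r\<bar> ^ k)" .
  qed (auto simp: b_def)
  also have "\<dots> = real (Suc k) * 2 ^ k * (\<bar>r\<bar> * \<bar>x\<bar> ^ k + \<bar>r\<bar> ^ Suc k)" by (simp add: algebra_simps)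
  finally show ?thesis .
qed

text \<open>\<open>Y\<close> has the law of \<open>X + R\<close> with \<open>R\<close> independent of \<open>X\<close> and of covariance \<open>r\<close>.\<close>

lemma power_sum_law_compare:
  fixes X :: "'i \<Rightarrow> 'a \<Rightarrow> real" and Y :: "'i \<Rightarrow> 'b \<Rightarrow> real"
  assumes P: "prob_space P" and Q: "prob_space Q" and K: "finite K"
    and X: "\<And>c. gauss_rv P (\<lambda>\<omega>. \<Sum>k\<in>K. c k * X k \<omega>) (VX c)"
    and Y: "\<And>c. gauss_rv Q (\<lambda>\<omega>. \<Sum>k\<in>K. c k * Y k \<omega>) (VX c + (\<Sum>k\<in>K. \<Sum>l\<in>K. c k * c l * r k l))"
    and sym: "\<And>k l. k \<in> K \<Longrightarrow> l \<in> K \<Longrightarrow> r k l = r l k"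
    and psd: "\<And>c. (\<Sum>k\<in>K. \<Sum>l\<in>K. c k * c l * r k l) \<ge> 0"
    and VX: "\<And>k. k \<in> K \<Longrightarrow> VX (\<lambda>l. if l = k then 1 else 0) \<le> \<rho>\<^sup>2" and r: "\<And>k. k \<in> K \<Longrightarrow> r k k \<le> \<delta>\<^sup>2"
    and \<rho>: "\<rho> \<ge> 0" and \<delta>: "\<delta> \<ge> 0" and A: "A \<ge> 0"
  shows "norm ((LINT \<omega>|P. iexp (u * (A * (\<Sum>k\<in>K. \<bar>X k \<omega>\<bar> ^ Suc q) - C))) - (LINT \<omega>|Q. iexp (u * (A * (\<Sum>k\<in>K. \<bar>Y k \<omega>\<bar> ^ Suc q) - C))))
    \<le> \<bar>u\<bar> * (A * (real (card K) * (real (Suc q) * 2 ^ q * (\<delta> * abs_normal_moment 1 * (\<rho> ^ q * abs_normal_moment q) + \<delta> ^ Suc q * abs_normal_moment (Suc q)))))"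
proof -
  interpret P: prob_space P by fact
  interpret Q: prob_space Q by fact
  obtain P' :: "('i \<Rightarrow> real) measure" and R where P': "prob_space P'"
    and R: "\<And>c. gauss_rv P' (\<lambda>\<omega>. \<Sum>i\<in>K. c i * R i \<omega>) (\<Sum>i\<in>K. \<Sum>j\<in>K. c i * c j * r i j)"
    using gaussian_vector_exists[OF K sym psd] by blast
  interpret P': prob_space P' by fact
  interpret PP: pair_prob_space P P' ..
  have delta: "(\<Sum>l\<in>K. (if l = k then 1 else 0) * f l) = f k" if "k \<in> K" for k and f :: "'i \<Rightarrow> real"
    using that K by (simp add: if_distrib[of "\<lambda>x. x * _"] cong: if_cong)
  have Xk: "gauss_rv P (X k) (VX (\<lambda>l. if l = k then 1 else 0))" if k: "k \<in> K" for k
    using X[of "\<lambda>l. if l = k then 1 else 0"] unfolding delta[OF k] .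
  have Rk: "gauss_rv P' (R k) (r k k)" if k: "k \<in> K" for k
  proof -
    have "(\<Sum>i\<in>K. \<Sum>j\<in>K. (if i = k then 1 else 0) * (if j = k then 1 else 0) * r i j)
      = (\<Sum>i\<in>K. (if i = k then 1 else 0) * (\<Sum>j\<in>K. (if j = k then 1 else 0) * r i j))"
      by (simp only: sum_distrib_left mult.assoc)
    also have "\<dots> = r k k" unfolding delta[OF k] ..
    finally show ?thesis using R[of "\<lambda>l. if l = k then 1 else 0"] unfolding delta[OF k] by simp
  qed
  have Yk: "Y k \<in> borel_measurable Q" if k: "k \<in> K" for k
    using gauss_rvD(1)[OF Y[of "\<lambda>l. if l = k then 1 else 0"]] unfolding delta[OF k] .
  note mX[measurable] = gauss_rvD(1)[OF Xk] and mR[measurable] = gauss_rvD(1)[OF Rk] and mY[measurable] = Yk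
  \<comment> \<open>The product space makes \<open>X\<close> and \<open>R\<close>
    independent.\<close>
  define T where "T k w = X k (fst w) + R k (snd w)" for k w
  have mT[measurable]: "T k \<in> borel_measurable (P \<Otimes>\<^sub>M P')" if "k \<in> K" for k
    unfolding T_def using mX[OF that] mR[OF that] by measurable
  have law: "distr (P \<Otimes>\<^sub>M P') (PiM K (\<lambda>_. borel)) (\<lambda>\<omega>. \<lambda>k\<in>K. T k \<omega>) = distr Q (PiM K (\<lambda>_. borel)) (\<lambda>\<omega>. \<lambda>k\<in>K. Y k \<omega>)"
  proof (rule joint_law_eq[OF PP.prob_space_axioms Q K mT mY])
    fix c
    define v where "v = (\<Sum>i\<in>K. \<Sum>j\<in>K. c i * c j * r i j)"
    have i1: "integrable P (\<lambda>\<omega>. iexp (\<Sum>k\<in>K. c k * X k \<omega>))"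
      using gauss_rvD(1)[OF X[of c]] by (intro P.integrable_iexp) auto
    have i2: "integrable P' (\<lambda>\<omega>. iexp (\<Sum>k\<in>K. c k * R k \<omega>))"
      using gauss_rvD(1)[OF R[of c]] by (intro P'.integrable_iexp) auto
    have "(LINT w|(P \<Otimes>\<^sub>M P'). iexp (\<Sum>k\<in>K. c k * T k w))
      = (LINT (x, y)|(P \<Otimes>\<^sub>M P'). iexp (\<Sum>k\<in>K. c k * X k x) * iexp (\<Sum>k\<in>K. c k * R k y))"
      by (simp add: T_def case_prod_unfold distrib_left sum.distrib exp_add)
    also have "\<dots> = (LINT \<omega>|P. iexp (\<Sum>k\<in>K. c k * X k \<omega>)) * (LINT \<omega>|P'. iexp (\<Sum>k\<in>K. c k * R k \<omega>))"
      by (rule PP.integrable_product_mult(2)[OF i1 i2])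
    also have "\<dots> = of_real (exp (- VX c / 2)) * of_real (exp (- v / 2))"
      using gauss_rv_char[OF X[of c], of 1] gauss_rv_char[OF R[of c], of 1] by (simp add: v_def)
    also have "\<dots> = of_real (exp (- (VX c + v) / 2))"
      by (simp only: of_real_mult[symmetric] exp_add[symmetric]) (simp add: add_divide_distrib)
    also have "\<dots> = (LINT \<omega>|Q. iexp (\<Sum>k\<in>K. c k * Y k \<omega>))"
      using gauss_rv_char[OF Y[of c], of 1] by (simp add: v_def)
    finally show "(LINT w|(P \<Otimes>\<^sub>M P'). iexp (\<Sum>k\<in>K. c k * T k w)) = (LINT \<omega>|Q. iexp (\<Sum>k\<in>K. c k * Y k \<omega>))" .
  qed
  define \<Phi> where "\<Phi> y = A * (\<Sum>k\<in>K. \<bar>y k\<bar> ^ Suc q) - C" for y :: "'i \<Rightarrow> real"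
  have [measurable]: "\<Phi> \<in> borel_measurable (PiM K (\<lambda>_. borel))" unfolding \<Phi>_def by measurable
  have "(LINT y|distr (P \<Otimes>\<^sub>M P') (PiM K (\<lambda>_. borel)) (\<lambda>\<omega>. \<lambda>k\<in>K. T k \<omega>). iexp (u * \<Phi> y))
    = (LINT y|distr Q (PiM K (\<lambda>_. borel)) (\<lambda>\<omega>. \<lambda>k\<in>K. Y k \<omega>). iexp (u * \<Phi> y))"
    unfolding law ..
  then have TY: "(LINT w|(P \<Otimes>\<^sub>M P'). iexp (u * (A * (\<Sum>k\<in>K. \<bar>T k w\<bar> ^ Suc q) - C)))
    = (LINT \<omega>|Q. iexp (u * (A * (\<Sum>k\<in>K. \<bar>Y k \<omega>\<bar> ^ Suc q) - C)))"
    by (subst (asm) (1 2) integral_distr) (auto simp: \<Phi>_def intro!: measurable_restrict)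
  define G where "G \<omega> = A * (\<Sum>k\<in>K. \<bar>X k \<omega>\<bar> ^ Suc q) - C" for \<omega>
  have mG[measurable]: "G \<in> borel_measurable P" unfolding G_def by measurable
  have iG: "integrable P (\<lambda>\<omega>. iexp (u * G \<omega>))" by (intro P.integrable_iexp) auto
  have XX: "(LINT w|(P \<Otimes>\<^sub>M P'). iexp (u * G (fst w))) = (LINT \<omega>|P. iexp (u * G \<omega>))"
    using PP.integrable_product_mult(2)[OF iG, of "\<lambda>_. 1"] by (simp add: case_prod_unfold P'.prob_space)
  define D where "D w = (\<Sum>k\<in>K. \<bar>X k (fst w)\<bar> ^ Suc q) - (\<Sum>k\<in>K. \<bar>T k w\<bar> ^ Suc q)" for w
  define b where "b k w = real (Suc q) * 2 ^ q * (\<bar>X k (fst w)\<bar> ^ q * \<bar>R k (snd w)\<bar> + \<bar>R k (snd w)\<bar> ^ Suc q)" for k w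
  have Db: "\<bar>D w\<bar> \<le> (\<Sum>k\<in>K. b k w)" for w
    unfolding D_def sum_subtractf[symmetric] b_def T_def
    by (rule order.trans[OF sum_abs]) (intro sum_mono order.trans[OF abs_power_perturb], simp add: mult_ac)
  \<comment> \<open>Independence splits the mixed moment; each factor is a Gaussian absolute moment
    with standard deviation at most \<open>\<rho>\<close> or \<open>\<delta>\<close>.\<close>
  have ib: "integrable (P \<Otimes>\<^sub>M P') (b k)"
    and bb: "(LINT w|(P \<Otimes>\<^sub>M P'). b k w) \<le> real (Suc q) * 2 ^ q * (\<delta> * abs_normal_moment 1 * (\<rho> ^ q * abs_normal_moment q) + \<delta> ^ Suc q * abs_normal_moment (Suc q))"
    if k: "k \<in> K" for k
  proof -
    define v where "v = VX (\<lambda>l. if l = k then 1 else 0)"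
    have v: "sqrt v \<le> \<rho>" using VX[OF k] \<rho> by (simp add: v_def real_le_lsqrt gauss_rvD(2)[OF Xk[OF k]])
    have v0: "v \<ge> 0" using gauss_rvD(2)[OF Xk[OF k]] by (simp add: v_def)
    have r0: "r k k \<ge> 0" by (rule gauss_rvD(2)[OF Rk[OF k]])
    have rk: "sqrt (r k k) \<le> \<delta>" using r[OF k] \<delta> r0 by (simp add: real_le_lsqrt)
    note mom = abs_normal_moment_pos[THEN less_imp_le]
    have iX: "integrable P (\<lambda>\<omega>. \<bar>X k \<omega>\<bar> ^ q)" "(LINT \<omega>|P. \<bar>X k \<omega>\<bar> ^ q) = sqrt v ^ q * abs_normal_moment q"
      using gauss_rv_abs_power[OF Xk[OF k]] by (simp_all add: v_def)
    have iR: "integrable P' (\<lambda>\<omega>. \<bar>R k \<omega>\<bar>)" "(LINT \<omega>|P'. \<bar>R k \<omega>\<bar>) = sqrt (r k k) * abs_normal_moment 1"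
      using gauss_rv_abs_power[OF Rk[OF k], of 1] by simp_all
    have iRq: "integrable P' (\<lambda>\<omega>. \<bar>R k \<omega>\<bar> ^ Suc q)" "(LINT \<omega>|P'. \<bar>R k \<omega>\<bar> ^ Suc q) = sqrt (r k k) ^ Suc q * abs_normal_moment (Suc q)"
      using gauss_rv_abs_power[OF Rk[OF k], of "Suc q"] by blast+
    have p1: "integrable (P \<Otimes>\<^sub>M P') (\<lambda>w. \<bar>X k (fst w)\<bar> ^ q * \<bar>R k (snd w)\<bar>)"
      "(LINT w|(P \<Otimes>\<^sub>M P'). \<bar>X k (fst w)\<bar> ^ q * \<bar>R k (snd w)\<bar>) = sqrt v ^ q * abs_normal_moment q * (sqrt (r k k) * abs_normal_moment 1)"
      using PP.integrable_product_mult[OF iX(1) iR(1)] iX(2) iR(2) by (simp_all add: case_prod_unfold)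
    have p2: "integrable (P \<Otimes>\<^sub>M P') (\<lambda>w. \<bar>R k (snd w)\<bar> ^ Suc q)"
      "(LINT w|(P \<Otimes>\<^sub>M P'). \<bar>R k (snd w)\<bar> ^ Suc q) = sqrt (r k k) ^ Suc q * abs_normal_moment (Suc q)"
      using PP.integrable_product_mult[OF P.integrable_const[of 1] iRq(1)] iRq(2)
      by (simp_all add: case_prod_unfold P.prob_space del: power_Suc)
    show "integrable (P \<Otimes>\<^sub>M P') (b k)"
      unfolding b_def[abs_def] by (intro integrable_mult_right Bochner_Integration.integrable_add p1 p2)
    have "(LINT w|(P \<Otimes>\<^sub>M P'). b k w) = real (Suc q) * 2 ^ q * (sqrt v ^ q * abs_normal_moment q * (sqrt (r k k) * abs_normal_moment 1) + sqrt (r k k) ^ Suc q * abs_normal_moment (Suc q))"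
      unfolding b_def by (simp only: integral_mult_right_zero Bochner_Integration.integral_add[OF p1(1) p2(1)] p1(2) p2(2))
    also have "\<dots> \<le> real (Suc q) * 2 ^ q * (\<rho> ^ q * abs_normal_moment q * (\<delta> * abs_normal_moment 1) + \<delta> ^ Suc q * abs_normal_moment (Suc q))"
      using v rk \<rho> \<delta> r0 v0 by (intro mult_left_mono add_mono mult_mono power_mono mult_nonneg_nonneg mom zero_le_power) auto
    finally show "(LINT w|(P \<Otimes>\<^sub>M P'). b k w) \<le> real (Suc q) * 2 ^ q * (\<delta> * abs_normal_moment 1 * (\<rho> ^ q * abs_normal_moment q) + \<delta> ^ Suc q * abs_normal_moment (Suc q))"
      by (simp add: mult_ac)
  qed
  define Z where "Z w = A * (\<Sum>k\<in>K. \<bar>T k w\<bar> ^ Suc q) - C" for w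
  have mZ[measurable]: "Z \<in> borel_measurable (P \<Otimes>\<^sub>M P')" unfolding Z_def by measurable
  have GZ: "G (fst w) - Z w = A * D w" for w by (simp add: G_def Z_def D_def right_diff_distrib)
  have sb: "integrable (P \<Otimes>\<^sub>M P') (\<lambda>w. A * (\<Sum>k\<in>K. b k w))" using ib by (intro integrable_mult_right Bochner_Integration.integrable_sum) auto
  have mD: "D \<in> borel_measurable (P \<Otimes>\<^sub>M P')" unfolding D_def by measurable
  have iD: "integrable (P \<Otimes>\<^sub>M P') (\<lambda>w. A * D w)"
  proof (rule Bochner_Integration.integrable_bound[OF sb])
    show "AE w in P \<Otimes>\<^sub>M P'. norm (A * D w) \<le> norm (A * (\<Sum>k\<in>K. b k w))"
      using Db A by (intro AE_I2) (auto simp: abs_mult intro!: mult_left_mono order.trans[OF Db abs_ge_self])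
  qed (use mD in measurable)
  have 1: "norm ((LINT w|(P \<Otimes>\<^sub>M P'). iexp (u * G (fst w))) - (LINT w|(P \<Otimes>\<^sub>M P'). iexp (u * Z w))) \<le> \<bar>u\<bar> * (LINT w|(P \<Otimes>\<^sub>M P'). \<bar>G (fst w) - Z w\<bar>)"
    by (rule PP.integral_iexp_diff_le) (use iD in \<open>simp_all add: GZ\<close>)
  have "(LINT w|(P \<Otimes>\<^sub>M P'). \<bar>G (fst w) - Z w\<bar>) \<le> (LINT w|(P \<Otimes>\<^sub>M P'). A * (\<Sum>k\<in>K. b k w))"
    unfolding GZ using sb Db A by (intro integral_mono') (auto simp: abs_mult intro!: mult_left_mono mult_nonneg_nonneg order.trans[OF abs_ge_zero Db])
  also have "\<dots> = A * (\<Sum>k\<in>K. LINT w|(P \<Otimes>\<^sub>M P'). b k w)"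
    using ib by simp
  also have "\<dots> \<le> A * (\<Sum>k\<in>K. real (Suc q) * 2 ^ q * (\<delta> * abs_normal_moment 1 * (\<rho> ^ q * abs_normal_moment q) + \<delta> ^ Suc q * abs_normal_moment (Suc q)))"
    using A bb by (intro mult_left_mono sum_mono) auto
  finally have "(LINT w|(P \<Otimes>\<^sub>M P'). \<bar>G (fst w) - Z w\<bar>) \<le> \<dots>" .
  from order.trans[OF 1 mult_left_mono[OF this abs_ge_zero]]
  show ?thesis unfolding XX unfolding G_def Z_def TY sum_constant .
qed

section \<open>Spectral form of the differences of the solution\<close>

lemma sol_spec_gauss:
  assumes \<gamma>: "0 < \<gamma>" "\<gamma> < 1/4" and \<alpha>: "\<alpha> > 0" and \<theta>: "\<theta> > 0" and t: "t > 0"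
    and P: "prob_space P" and W: "riesz_noise P \<gamma> W" and X: "mild_solution P \<alpha> \<theta> \<sigma> \<gamma> W X"
  shows "spec_gauss P (X t) (\<lambda>x \<xi>. iexp (x * \<xi>)) (\<lambda>\<xi>. \<sigma>\<^sup>2 * sol_spec \<alpha> \<gamma> \<theta> t \<xi>)"
  unfolding spec_gauss_def
proof
  fix l :: "(real \<times> real) list"
  define S where "S = snd ` set l"
  have S: "finite S" "snd ` set l \<subseteq> S" by (auto simp: S_def)
  obtain v where v: "gauss_rv P (\<lambda>\<omega>. \<Sum>y\<in>S. lcoef l y * X t y \<omega>) (\<sigma>\<^sup>2 * v)" "v \<ge> 0"
    "ennreal v = (\<integral>\<^sup>+\<xi>. ennreal ((norm (esum S (lcoef l) (\<lambda>y. y) \<xi>))\<^sup>2 * sol_spec \<alpha> \<gamma> \<theta> t \<xi>) \<partial>lborel)"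
    using mild_solution_gaussian[OF \<gamma> \<alpha> \<theta> t P W X S(1), of "lcoef l" "\<lambda>y. y"] by blast
  have e: "lsum (\<lambda>x. iexp (x * \<xi>)) l = esum S (lcoef l) (\<lambda>y. y) \<xi>" for \<xi>
    unfolding esum_def lsum_eq_sum[OF S] by (simp add: scaleR_conv_of_real)
  have nn: "sol_spec \<alpha> \<gamma> \<theta> t \<xi> \<ge> 0" for \<xi> using \<theta> t by (simp add: sol_spec_def)
  have [measurable]: "sol_spec \<alpha> \<gamma> \<theta> t \<in> borel_measurable borel" unfolding sol_spec_def by measurable
  have "(LINT \<xi>|lborel. (norm (esum S (lcoef l) (\<lambda>y. y) \<xi>))\<^sup>2 * sol_spec \<alpha> \<gamma> \<theta> t \<xi>) = v"
    using v(2,3) nn by (subst integral_eq_nn_integral) (auto simp: v(3)[symmetric])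
  then have "(LINT \<xi>|lborel. (norm (lsum (\<lambda>x. iexp (x * \<xi>)) l))\<^sup>2 * (\<sigma>\<^sup>2 * sol_spec \<alpha> \<gamma> \<theta> t \<xi>)) = \<sigma>\<^sup>2 * v"
    unfolding e by (simp only: mult.left_commute[of _ "\<sigma>\<^sup>2"] integral_mult_right_zero)
  then show "gauss_rv P (\<lambda>\<omega>. lsum (\<lambda>x. X t x \<omega>) l) (LINT \<xi>|lborel. (norm (lsum (\<lambda>x. iexp (x * \<xi>)) l))\<^sup>2 * (\<sigma>\<^sup>2 * sol_spec \<alpha> \<gamma> \<theta> t \<xi>))"
    using v(1) by (simp add: lsum_eq_sum[OF S])
qed

lemma spec_gauss_fwd_diff:
  assumes "spec_gauss P Y (\<lambda>x \<xi>. iexp (x * \<xi>)) \<rho>"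
  shows "spec_gauss P (\<lambda>x \<omega>. (fwd_diff h ^^ M) (\<lambda>x. Y x \<omega>) x) (\<lambda>x \<xi>. (iexp (h * \<xi>) - 1) ^ M * iexp (x * \<xi>)) \<rho>"
proof (induction M)
  case (Suc M)
  have "iexp ((x + h) * \<xi>) = iexp (h * \<xi>) * iexp (x * \<xi>)" for x \<xi>
    by (simp add: exp_add[symmetric] algebra_simps)
  then have "(\<lambda>x \<xi>. (iexp (h * \<xi>) - 1) ^ M * iexp ((x + h) * \<xi>) - (iexp (h * \<xi>) - 1) ^ M * iexp (x * \<xi>)) = (\<lambda>x \<xi>. (iexp (h * \<xi>) - 1) ^ Suc M * iexp (x * \<xi>))"
    by (simp add: algebra_simps)
  then show ?case
    using spec_gauss_diff[OF Suc.IH, of h] by (simp add: fwd_diff_def[abs_def])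
qed (use assms in simp)

lemma norm_esum_square:
  "(norm (esum S c x \<xi>))\<^sup>2 = (\<Sum>k\<in>S. \<Sum>l\<in>S. c k * c l * cos ((x k - x l) * \<xi>))"
proof -
  have R: "Re (esum S c x \<xi>) = (\<Sum>k\<in>S. c k * cos (x k * \<xi>))" and I: "Im (esum S c x \<xi>) = (\<Sum>k\<in>S. c k * sin (x k * \<xi>))"
    by (simp_all add: esum_def Re_exp Im_exp)
  show ?thesis
    unfolding cmod_power2 R I unfolding power2_eq_square sum_product sum.distrib[symmetric]
    by (intro sum.cong refl) (simp add: left_diff_distrib cos_diff algebra_simps)
qed

text \<open>Rewrites the quadratic form of an integrable density as that of a stationary covariance
  matrix. For the density of the remainder this matrix is the \<open>r\<close> of
  \<open>power_sum_law_compare\<close>.\<close>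

lemma esum_form:
  assumes f: "integrable lborel f"
  shows "integrable lborel (\<lambda>\<xi>. (norm (esum S c x \<xi>))\<^sup>2 * f \<xi>)"
    and "(LINT \<xi>|lborel. (norm (esum S c x \<xi>))\<^sup>2 * f \<xi>) = (\<Sum>k\<in>S. \<Sum>l\<in>S. c k * c l * (LINT \<xi>|lborel. cos ((x k - x l) * \<xi>) * f \<xi>))"
proof -
  have [measurable]: "f \<in> borel_measurable borel" using f by simp
  have i: "integrable lborel (\<lambda>\<xi>. cos (y * \<xi>) * f \<xi>)" for y
    by (rule Bochner_Integration.integrable_bound[OF f]) (auto simp: abs_mult intro!: mult_left_le_one_le)
  have eq: "(norm (esum S c x \<xi>))\<^sup>2 * f \<xi> = (\<Sum>k\<in>S. \<Sum>l\<in>S. c k * c l * (cos ((x k - x l) * \<xi>) * f \<xi>))" for \<xi>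
    unfolding norm_esum_square by (simp only: sum_distrib_right mult.assoc)
  show "integrable lborel (\<lambda>\<xi>. (norm (esum S c x \<xi>))\<^sup>2 * f \<xi>)"
    unfolding eq by (intro Bochner_Integration.integrable_sum integrable_mult_right i)
  show "(LINT \<xi>|lborel. (norm (esum S c x \<xi>))\<^sup>2 * f \<xi>) = (\<Sum>k\<in>S. \<Sum>l\<in>S. c k * c l * (LINT \<xi>|lborel. cos ((x k - x l) * \<xi>) * f \<xi>))"
    unfolding eq using i by simp
qed

text \<open>The constant in front of \<open>h ^ (2 * M)\<close> in the bound for the variance of one
  remainder difference: the symbol of the differences is at most
  \<open>(h * \<bar>\<xi>\<bar>) ^ (2 * M)\<close> in squared modulus, and the power of
  \<open>\<xi>\<close> is integrated against the density of the remainder.\<close>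

definition rem_const :: "real \<Rightarrow> real \<Rightarrow> real \<Rightarrow> real \<Rightarrow> real \<Rightarrow> nat \<Rightarrow> real" where
  "rem_const \<alpha> \<theta> \<sigma> s t M = \<sigma>\<^sup>2 / (4 * pi * \<theta>) * (LINT \<xi>|lborel. \<bar>\<xi>\<bar> powr (2 * real M - 2 * s - 1) * exp (- (2 * \<theta> * t * \<bar>\<xi>\<bar> powr \<alpha>)))"

text \<open>The relation between \<open>m\<close>, \<open>H\<close>, \<open>\<gamma>\<close> and
  \<open>\<alpha>\<close> turns the exponent in \<open>c_const\<close> into
  \<open>- 2 * H - 1\<close>.\<close>

lemma c_const_cos_const:
  assumes "real m + H = 2*\<gamma> + \<alpha>/2 - 1/2" and H: "0 < H" "H < 1"
  shows "(c_const \<alpha> \<gamma> m)\<^sup>2 = cos_const H / (2 * pi)" "c_const \<alpha> \<gamma> m > 0"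
proof -
  have ex: "2 * real m - 4 * \<gamma> - \<alpha> = - 2 * H - 1" using assms(1) by (simp add: field_simps)
  have c: "c_const \<alpha> \<gamma> m = sqrt (cos_const H / (2 * pi))"
    unfolding c_const_def ex cos_const_def by simp
  show "(c_const \<alpha> \<gamma> m)\<^sup>2 = cos_const H / (2 * pi)" "c_const \<alpha> \<gamma> m > 0"
    unfolding c using cos_const(3)[OF H] by simp_all
qed

text \<open>After division by \<open>h powr s\<close>, \<open>eps\<close> bounds the standard
  deviation of one remainder difference and \<open>lam * sqrt \<mu>\<close> that of one difference
  of the solution. The centering \<open>C\<close> is arbitrary and the same on both sides; the power
  is written \<open>Suc q\<close> to be at least 1.\<close>

lemma variation_char_bound:
  fixes B :: "real \<Rightarrow> 'b \<Rightarrow> real"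
  assumes \<alpha>: "\<alpha> > 0" and \<theta>: "\<theta> > 0" and \<sigma>: "\<sigma> > 0" and \<gamma>: "0 < \<gamma>" "\<gamma> < 1/4"
    and P: "prob_space P" and W: "riesz_noise P \<gamma> W" and X: "mild_solution P \<alpha> \<theta> \<sigma> \<gamma> W X"
    and s: "s = 2*\<gamma> + \<alpha>/2 - 1/2" and H: "0 < H" "H < 1" and mH: "real m + H = s"
    and M: "M \<ge> m + 1" and t: "t > 0" and ab: "a < b"
    and Q: "prob_space Q" and B: "fractional_bm Q H B" and mu: "is_mu_const Q B m M s \<mu>"
    and N: "N \<ge> 1" and lam: "lam = c_const \<alpha> \<gamma> m * \<sigma> / sqrt \<theta>"
    and eps: "eps = sqrt (rem_const \<alpha> \<theta> \<sigma> s t M) * ((b - a) / real N) powr (real M - s)"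
  shows "norm ((LINT \<omega>|P. iexp (u * (sqrt (real N) * (power_variation a b (Suc q) M s N (\<lambda>x. X t x \<omega>) - C))))
      - (LINT \<omega>|Q. iexp (u * (sqrt (real N) * (lam ^ Suc q * power_variation a b (Suc q) M s N (int_fbm m B \<omega>) - C)))))
    \<le> \<bar>u\<bar> * (sqrt (real N) * (real (Suc q) * 2 ^ q * (eps * abs_normal_moment 1 * ((lam * sqrt \<mu>) ^ q * abs_normal_moment q) + eps ^ Suc q * abs_normal_moment (Suc q))))"
proof -
  define h where "h = (b - a) / real N"
  have h: "h > 0" using ab N by (simp add: h_def)
  define K where "K = {0..N - M}"
  have K: "finite K" by (simp add: K_def)
  define x where "x k = a + real k * h" for k
  define g where "g \<xi> = norm (iexp (h * \<xi>) - 1) ^ M" for \<xi>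
  have [measurable]: "g \<in> borel_measurable borel" unfolding g_def by measurable
  \<comment> \<open>\<open>L\<close> belongs to \<open>lam\<close> times the \<open>m\<close>-fold
    integral of \<open>B\<close>, \<open>Sp\<close> to the solution and \<open>R\<close> to the
    remainder; \<open>F1\<close> and \<open>F2\<close> record this away from 0.\<close>
  define L where "L \<xi> = \<sigma>\<^sup>2 / (4 * pi * \<theta>) * \<bar>\<xi>\<bar> powr (- 2 * s - 1)" for \<xi>
  define R where "R \<xi> = L \<xi> * exp (- (2 * \<theta> * t * \<bar>\<xi>\<bar> powr \<alpha>))" for \<xi>
  define Sp where "Sp \<xi> = \<sigma>\<^sup>2 * sol_spec \<alpha> \<gamma> \<theta> t \<xi>" for \<xi>
  have [measurable]: "L \<in> borel_measurable borel" "R \<in> borel_measurable borel" "Sp \<in> borel_measurable borel"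
    unfolding L_def R_def Sp_def sol_spec_def by measurable
  have pos: "L \<xi> \<ge> 0" "R \<xi> \<ge> 0" "Sp \<xi> \<ge> 0" for \<xi>
    using \<theta> t by (simp_all add: R_def L_def Sp_def sol_spec_def)
  note cc = c_const_cos_const[OF mH[unfolded s] H]
  have lam0: "lam > 0" using cc(2) \<sigma> \<theta> by (simp add: lam)
  have mu0: "\<mu> > 0" using mu by (simp add: is_mu_const_def)
  have lam2: "lam\<^sup>2 = cos_const H / (2 * pi) * \<sigma>\<^sup>2 / \<theta>"
    using \<theta> by (simp add: lam power_divide power_mult_distrib cc(1))
  have F1: "lam\<^sup>2 * ((g \<xi> / \<bar>\<xi>\<bar> ^ m)\<^sup>2 * fbm_spec H \<xi>) = (g \<xi>)\<^sup>2 * L \<xi>" if \<xi>: "\<xi> \<noteq> 0" for \<xi>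
  proof -
    have sq: "(\<bar>\<xi>\<bar> ^ m)\<^sup>2 = \<bar>\<xi>\<bar> powr (2 * real m)"
      using powr_realpow[of "\<bar>\<xi>\<bar>" "2 * m"] \<xi> by (simp add: power_even_eq)
    have ex: "- 2 * H - 1 - 2 * real m = - 2 * s - 1" using mH by simp
    have e: "\<bar>\<xi>\<bar> powr (- 2 * H - 1) / (\<bar>\<xi>\<bar> ^ m)\<^sup>2 = \<bar>\<xi>\<bar> powr (- 2 * s - 1)"
      unfolding sq powr_diff[symmetric] ex ..
    have "lam\<^sup>2 * ((g \<xi> / \<bar>\<xi>\<bar> ^ m)\<^sup>2 * fbm_spec H \<xi>)
      = (g \<xi>)\<^sup>2 * (lam\<^sup>2 / (2 * cos_const H) * (\<bar>\<xi>\<bar> powr (- 2 * H - 1) / (\<bar>\<xi>\<bar> ^ m)\<^sup>2))"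
      by (simp add: fbm_spec_def power_divide mult_ac)
    also have "lam\<^sup>2 / (2 * cos_const H) = \<sigma>\<^sup>2 / (4 * pi * \<theta>)"
      using cos_const(3)[OF H] \<theta> by (simp add: lam2 field_simps)
    finally show ?thesis unfolding e L_def .
  qed
  have F2: "L \<xi> = Sp \<xi> + R \<xi>" if \<xi>: "\<xi> \<noteq> 0" for \<xi>
  proof -
    have ex: "- 4 * \<gamma> - \<alpha> = - 2 * s - 1" using s by (simp add: field_simps)
    have e: "\<bar>\<xi>\<bar> powr (- 4 * \<gamma>) / \<bar>\<xi>\<bar> powr \<alpha> = \<bar>\<xi>\<bar> powr (- 2 * s - 1)"
      unfolding powr_diff[symmetric] ex ..
    have "Sp \<xi> = \<sigma>\<^sup>2 / (4 * pi * \<theta>) * (\<bar>\<xi>\<bar> powr (- 4 * \<gamma>) / \<bar>\<xi>\<bar> powr \<alpha>) * (1 - exp (- (2 * \<theta> * t * \<bar>\<xi>\<bar> powr \<alpha>)))"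
      by (simp add: Sp_def sol_spec_def)
    then show ?thesis unfolding e R_def L_def by (simp only: right_diff_distrib mult_1_right diff_add_cancel)
  qed
  note iB = fbm_spec_integrable[OF H M h, folded g_def]
  have AE1: "AE \<xi> in lborel. lam\<^sup>2 * ((g \<xi> / \<bar>\<xi>\<bar> ^ m)\<^sup>2 * fbm_spec H \<xi>) = (g \<xi>)\<^sup>2 * L \<xi>"
    using AE_lborel_singleton[of 0] by eventually_elim (rule F1)
  have AE2: "AE \<xi> in lborel. L \<xi> = Sp \<xi> + R \<xi>"
    using AE_lborel_singleton[of 0] by eventually_elim (rule F2)
  \<comment> \<open>The symbol \<open>g\<close> of the differences makes the density integrable;
    \<open>Sp\<close> and \<open>R\<close>, both nonnegative with sum \<open>L\<close>, are then
    dominated.\<close>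
  have iL: "integrable lborel (\<lambda>\<xi>. (g \<xi>)\<^sup>2 * L \<xi>)"
    using integrable_mult_right[OF iB, of "lam\<^sup>2"] by (rule integrable_cong_AE_imp) (use AE1 in auto)
  have iR: "integrable lborel (\<lambda>\<xi>. (g \<xi>)\<^sup>2 * R \<xi>)"
  proof (rule Bochner_Integration.integrable_bound[OF iL])
    show "AE \<xi> in lborel. norm ((g \<xi>)\<^sup>2 * R \<xi>) \<le> norm ((g \<xi>)\<^sup>2 * L \<xi>)"
      using AE2 by eventually_elim (use pos in \<open>auto intro!: mult_left_mono\<close>)
  qed measurable
  have iS: "integrable lborel (\<lambda>\<xi>. (g \<xi>)\<^sup>2 * Sp \<xi>)"
  proof (rule Bochner_Integration.integrable_bound[OF iL])
    show "AE \<xi> in lborel. norm ((g \<xi>)\<^sup>2 * Sp \<xi>) \<le> norm ((g \<xi>)\<^sup>2 * L \<xi>)"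
      using AE2 by eventually_elim (use pos in \<open>auto intro!: mult_left_mono\<close>)
  qed measurable
  define DX where "DX k \<omega> = (fwd_diff h ^^ M) (\<lambda>x. X t x \<omega>) (x k)" for k \<omega>
  define DB where "DB k \<omega> = (fwd_diff h ^^ M) (int_fbm m B \<omega>) (x k)" for k \<omega>
  define VX where "VX c = (LINT \<xi>|lborel. (norm (esum K c x \<xi>))\<^sup>2 * ((g \<xi>)\<^sup>2 * Sp \<xi>))" for c
  define VB where "VB c = (LINT \<xi>|lborel. (norm (esum K c x \<xi>))\<^sup>2 * ((g \<xi> / \<bar>\<xi>\<bar> ^ m)\<^sup>2 * fbm_spec H \<xi>))" for c
  define r where "r k l = (LINT \<xi>|lborel. cos ((x k - x l) * \<xi>) * ((g \<xi>)\<^sup>2 * R \<xi>))" for k l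
  have gX: "gauss_rv P (\<lambda>\<omega>. \<Sum>k\<in>K. c k * DX k \<omega>) (VX c)" for c
    using spec_gauss_sum[OF spec_gauss_fwd_diff[OF sol_spec_gauss[OF \<gamma> \<alpha> \<theta> t P W X], where h=h and M=M] K, of c x]
    by (simp add: DX_def VX_def g_def Sp_def norm_power)
  have gB: "gauss_rv Q (\<lambda>\<omega>. \<Sum>k\<in>K. c k * DB k \<omega>) (VB c)" for c
    using fbm_diff_gaussian[OF Q B H h M K, of c x] by (simp add: DB_def VB_def g_def)
  have rform: "(\<Sum>k\<in>K. \<Sum>l\<in>K. c k * c l * r k l) = (LINT \<xi>|lborel. (norm (esum K c x \<xi>))\<^sup>2 * ((g \<xi>)\<^sup>2 * R \<xi>))" for c
    unfolding r_def by (rule esum_form(2)[OF iR, symmetric])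
  have psd: "(\<Sum>k\<in>K. \<Sum>l\<in>K. c k * c l * r k l) \<ge> 0" for c
    unfolding rform using pos by simp
  have VV: "lam\<^sup>2 * VB c = VX c + (\<Sum>k\<in>K. \<Sum>l\<in>K. c k * c l * r k l)" for c
  proof -
    have "lam\<^sup>2 * VB c = (LINT \<xi>|lborel. lam\<^sup>2 * ((norm (esum K c x \<xi>))\<^sup>2 * ((g \<xi> / \<bar>\<xi>\<bar> ^ m)\<^sup>2 * fbm_spec H \<xi>)))"
      unfolding VB_def by (rule integral_mult_right_zero[symmetric])
    also have "\<dots> = (LINT \<xi>|lborel. (norm (esum K c x \<xi>))\<^sup>2 * ((g \<xi>)\<^sup>2 * Sp \<xi>) + (norm (esum K c x \<xi>))\<^sup>2 * ((g \<xi>)\<^sup>2 * R \<xi>))"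
    proof (rule integral_cong_AE)
      show "AE \<xi> in lborel. lam\<^sup>2 * ((norm (esum K c x \<xi>))\<^sup>2 * ((g \<xi> / \<bar>\<xi>\<bar> ^ m)\<^sup>2 * fbm_spec H \<xi>))
        = (norm (esum K c x \<xi>))\<^sup>2 * ((g \<xi>)\<^sup>2 * Sp \<xi>) + (norm (esum K c x \<xi>))\<^sup>2 * ((g \<xi>)\<^sup>2 * R \<xi>)"
        using AE1 AE2
      proof eventually_elim
        fix \<xi> assume 1: "lam\<^sup>2 * ((g \<xi> / \<bar>\<xi>\<bar> ^ m)\<^sup>2 * fbm_spec H \<xi>) = (g \<xi>)\<^sup>2 * L \<xi>" and 2: "L \<xi> = Sp \<xi> + R \<xi>"
        show "lam\<^sup>2 * ((norm (esum K c x \<xi>))\<^sup>2 * ((g \<xi> / \<bar>\<xi>\<bar> ^ m)\<^sup>2 * fbm_spec H \<xi>))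
          = (norm (esum K c x \<xi>))\<^sup>2 * ((g \<xi>)\<^sup>2 * Sp \<xi>) + (norm (esum K c x \<xi>))\<^sup>2 * ((g \<xi>)\<^sup>2 * R \<xi>)"
        proof -
          have "lam\<^sup>2 * ((norm (esum K c x \<xi>))\<^sup>2 * ((g \<xi> / \<bar>\<xi>\<bar> ^ m)\<^sup>2 * fbm_spec H \<xi>))
            = (norm (esum K c x \<xi>))\<^sup>2 * (lam\<^sup>2 * ((g \<xi> / \<bar>\<xi>\<bar> ^ m)\<^sup>2 * fbm_spec H \<xi>))"
            by (rule mult.left_commute)
          then show ?thesis unfolding 1 2 by (simp only: distrib_left)
        qed
      qed
    qed measurable
    also have "\<dots> = VX c + (\<Sum>k\<in>K. \<Sum>l\<in>K. c k * c l * r k l)"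
      unfolding rform VX_def by (rule Bochner_Integration.integral_add[OF esum_form(1)[OF iS] esum_form(1)[OF iR]])
    finally show ?thesis .
  qed
  have gY: "gauss_rv Q (\<lambda>\<omega>. \<Sum>k\<in>K. c k * (lam * DB k \<omega>)) (VX c + (\<Sum>k\<in>K. \<Sum>l\<in>K. c k * c l * r k l))" for c
    using gauss_rv_scale[OF gB[of c] Q, of lam] unfolding VV by (simp add: sum_distrib_left mult_ac)
  define \<rho> where "\<rho> = lam * sqrt \<mu> * h powr s"
  have \<rho>0: "\<rho> \<ge> 0" using lam0 mu0 by (simp add: \<rho>_def)
  \<comment> \<open>The remainder has nonnegative variance, so a difference of the solution has at
    most the variance of the rescaled fractional Brownian one, which \<open>\<mu>\<close> gives
    exactly.\<close>
  have VXk: "VX (\<lambda>l. if l = k then 1 else 0) \<le> \<rho>\<^sup>2" if k: "k \<in> K" for k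
  proof -
    have "(\<Sum>l\<in>K. (if l = k then 1 else 0) * DB l \<omega>) = DB k \<omega>" for \<omega>
      using k K by (simp add: if_distrib[of "\<lambda>x. x * _"] cong: if_cong)
    then have "VB (\<lambda>l. if l = k then 1 else 0) = (LINT \<omega>|Q. (DB k \<omega>)\<^sup>2)"
      using gauss_rv_square(2)[OF gB[of "\<lambda>l. if l = k then 1 else 0"]] by simp
    also have "\<dots> = \<mu> * h powr (2 * s)"
      using mu h by (simp add: is_mu_const_def DB_def)
    finally have "lam\<^sup>2 * VB (\<lambda>l. if l = k then 1 else 0) = \<rho>\<^sup>2"
      using h mu0 by (simp add: \<rho>_def power_mult_distrib powr_power mult.commute)
    then show ?thesis using VV[of "\<lambda>l. if l = k then 1 else 0"] psd[of "\<lambda>l. if l = k then 1 else 0"] by simp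
  qed
  define CR where "CR = rem_const \<alpha> \<theta> \<sigma> s t M"
  have CR0: "CR \<ge> 0" using \<theta> by (simp add: CR_def rem_const_def)
  define \<delta> where "\<delta> = sqrt CR * h ^ M"
  have \<delta>0: "\<delta> \<ge> 0" using h CR0 by (simp add: \<delta>_def)
  have rk: "r k k \<le> \<delta>\<^sup>2" for k
  proof -
    define f where "f \<xi> = \<bar>\<xi>\<bar> powr (2 * real M - 2 * s - 1) * exp (- (2 * \<theta> * t * \<bar>\<xi>\<bar> powr \<alpha>))" for \<xi>
    have e: "2 * real M - 2 * s - 1 > -1" using M mH H by simp
    have if': "integrable lborel f"
      unfolding f_def using integrable_powr_exp[OF \<alpha> _ e, of "2 * \<theta> * t"] \<theta> t by simp
    have "r k k = (LINT \<xi>|lborel. (g \<xi>)\<^sup>2 * R \<xi>)" by (simp add: r_def)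
    also have "\<dots> \<le> (LINT \<xi>|lborel. h ^ (2 * M) * (\<sigma>\<^sup>2 / (4 * pi * \<theta>)) * f \<xi>)"
    proof (rule integral_mono_AE[OF iR])
      show "integrable lborel (\<lambda>\<xi>. h ^ (2 * M) * (\<sigma>\<^sup>2 / (4 * pi * \<theta>)) * f \<xi>)" using if' by simp
      show "AE \<xi> in lborel. (g \<xi>)\<^sup>2 * R \<xi> \<le> h ^ (2 * M) * (\<sigma>\<^sup>2 / (4 * pi * \<theta>)) * f \<xi>"
        using AE_lborel_singleton[of 0]
      proof eventually_elim
        fix \<xi> :: real assume \<xi>: "\<xi> \<noteq> 0"
        have "g \<xi> \<le> \<bar>h * \<xi>\<bar> ^ M" unfolding g_def by (intro power_mono norm_iexp_minus_one_le) auto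
        then have "(g \<xi>)\<^sup>2 \<le> (\<bar>h * \<xi>\<bar> ^ M)\<^sup>2" by (intro power_mono) (auto simp: g_def)
        also have "\<dots> = h ^ (2 * M) * \<bar>\<xi>\<bar> ^ (2 * M)"
          using h by (simp add: abs_mult power_mult_distrib power_mult[symmetric] mult.commute)
        also have "\<bar>\<xi>\<bar> ^ (2 * M) = \<bar>\<xi>\<bar> powr (2 * real M)" using powr_realpow[of "\<bar>\<xi>\<bar>" "2 * M"] \<xi> by simp
        finally have "(g \<xi>)\<^sup>2 * R \<xi> \<le> h ^ (2 * M) * \<bar>\<xi>\<bar> powr (2 * real M) * R \<xi>"
          using pos by (intro mult_right_mono)
        also have "\<dots> = h ^ (2 * M) * (\<sigma>\<^sup>2 / (4 * pi * \<theta>)) * ((\<bar>\<xi>\<bar> powr (2 * real M) * \<bar>\<xi>\<bar> powr (- 2 * s - 1)) * exp (- (2 * \<theta> * t * \<bar>\<xi>\<bar> powr \<alpha>)))"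
          by (simp add: R_def L_def)
        also have "\<bar>\<xi>\<bar> powr (2 * real M) * \<bar>\<xi>\<bar> powr (- 2 * s - 1) = \<bar>\<xi>\<bar> powr (2 * real M - 2 * s - 1)"
          unfolding powr_add[symmetric] by (rule arg_cong[where f="\<lambda>a. \<bar>\<xi>\<bar> powr a"]) simp
        finally show "(g \<xi>)\<^sup>2 * R \<xi> \<le> h ^ (2 * M) * (\<sigma>\<^sup>2 / (4 * pi * \<theta>)) * f \<xi>" by (simp add: f_def)
      qed
    qed
    also have "\<dots> = h ^ (2 * M) * CR"
      by (simp add: CR_def rem_const_def f_def[symmetric])
    also have "\<dots> = \<delta>\<^sup>2" using CR0 by (simp add: \<delta>_def power_mult_distrib power_mult[symmetric] mult.commute)
    finally show ?thesis .
  qed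
  define hs where "hs = h powr s"
  have hs: "hs > 0" using h by (simp add: hs_def)
  define A where "A = sqrt (real N) * (h / (b - a) * (1 / hs) ^ Suc q)"
  have A0: "A \<ge> 0" using h ab hs by (simp add: A_def)
  have pv: "power_variation a b (Suc q) M s N f = h / (b - a) * (1 / hs) ^ Suc q * (\<Sum>k\<in>K. \<bar>(fwd_diff h ^^ M) f (x k)\<bar> ^ Suc q)" for f
  proof -
    have d: "\<bar>d / hs\<bar> ^ Suc q = (1 / hs) ^ Suc q * \<bar>d\<bar> ^ Suc q" for d
      using hs by (simp add: abs_divide power_divide del: power_Suc)
    have "power_variation a b (Suc q) M s N f = 1 / (b - a) * (\<Sum>k\<in>K. h * ((1 / hs) ^ Suc q * \<bar>(fwd_diff h ^^ M) f (x k)\<bar> ^ Suc q))"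
      by (simp only: power_variation_def Let_def h_def[symmetric] hs_def[symmetric] K_def x_def d)
    then show ?thesis by (simp add: sum_distrib_left mult_ac del: power_Suc)
  qed
  have PX: "sqrt (real N) * (power_variation a b (Suc q) M s N (\<lambda>x. X t x \<omega>) - C) = A * (\<Sum>k\<in>K. \<bar>DX k \<omega>\<bar> ^ Suc q) - sqrt (real N) * C" for \<omega>
    unfolding pv A_def DX_def by (simp add: right_diff_distrib mult.assoc del: power_Suc)
  have PB: "sqrt (real N) * (lam ^ Suc q * power_variation a b (Suc q) M s N (int_fbm m B \<omega>) - C) = A * (\<Sum>k\<in>K. \<bar>lam * DB k \<omega>\<bar> ^ Suc q) - sqrt (real N) * C" for \<omega>
  proof -
    have d: "\<bar>lam * d\<bar> ^ Suc q = lam ^ Suc q * \<bar>d\<bar> ^ Suc q" for d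
      using lam0 by (simp add: abs_mult power_mult_distrib del: power_Suc)
    show ?thesis
      unfolding pv A_def DB_def d by (simp add: right_diff_distrib sum_distrib_left mult_ac del: power_Suc)
  qed
  have sym: "r k l = r l k" for k l
  proof -
    have "cos ((x k - x l) * \<xi>) = cos ((x l - x k) * \<xi>)" for \<xi>
      using cos_minus[of "(x l - x k) * \<xi>"] by (simp add: algebra_simps)
    then show ?thesis unfolding r_def by simp
  qed
  \<comment> \<open>Jointly homogeneous of degree \<open>Suc q\<close> in its two arguments, so that
    the normalization \<open>(1 / hs) ^ Suc q\<close> can be absorbed into them.\<close>
  define mom where "mom d \<rho> = real (Suc q) * 2 ^ q * (d * abs_normal_moment 1 * (\<rho> ^ q * abs_normal_moment q) + d ^ Suc q * abs_normal_moment (Suc q))" for d \<rho>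
  have 1: "norm ((LINT \<omega>|P. iexp (u * (A * (\<Sum>k\<in>K. \<bar>DX k \<omega>\<bar> ^ Suc q) - sqrt (real N) * C))) - (LINT \<omega>|Q. iexp (u * (A * (\<Sum>k\<in>K. \<bar>lam * DB k \<omega>\<bar> ^ Suc q) - sqrt (real N) * C))))
    \<le> \<bar>u\<bar> * (A * (real (card K) * mom \<delta> \<rho>))"
    unfolding mom_def by (rule power_sum_law_compare[OF P Q K gX gY sym psd VXk rk \<rho>0 \<delta>0 A0])
  have "A * (real (card K) * mom \<delta> \<rho>) \<le> sqrt (real N) * mom eps (lam * sqrt \<mu>)"
  proof -
    have eps': "eps = \<delta> / hs"
    proof -
      have "h powr (real M - s) = h ^ M / hs" using h by (simp add: hs_def powr_diff powr_realpow)
      then show ?thesis by (simp add: eps \<delta>_def CR_def h_def)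
    qed
    have \<rho>': "\<rho> = (lam * sqrt \<mu>) * hs" by (simp add: \<rho>_def hs_def)
    have "(1 / hs) ^ Suc q * mom \<delta> \<rho> = mom eps (lam * sqrt \<mu>)"
    proof -
      have 1: "(1 / hs) ^ Suc q * (\<delta> * \<rho> ^ q) = eps * (lam * sqrt \<mu>) ^ q"
        unfolding eps' \<rho>' power_mult_distrib using hs by (simp add: power_divide)
      have 2: "(1 / hs) ^ Suc q * \<delta> ^ Suc q = eps ^ Suc q"
        unfolding eps' power_mult_distrib[symmetric] by simp
      have "(1 / hs) ^ Suc q * mom \<delta> \<rho> = real (Suc q) * 2 ^ q * (((1 / hs) ^ Suc q * (\<delta> * \<rho> ^ q)) * abs_normal_moment 1 * abs_normal_moment q + ((1 / hs) ^ Suc q * \<delta> ^ Suc q) * abs_normal_moment (Suc q))"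
        unfolding mom_def by (simp only: distrib_left mult_ac)
      also have "\<dots> = mom eps (lam * sqrt \<mu>)" unfolding 1 2 mom_def by (simp only: mult_ac)
      finally show ?thesis .
    qed
    then have "A * (real (card K) * mom \<delta> \<rho>) = sqrt (real N) * ((h / (b - a) * real (card K)) * mom eps (lam * sqrt \<mu>))"
      unfolding A_def by (simp add: mult_ac del: power_Suc)
    also have "\<dots> \<le> sqrt (real N) * (1 * mom eps (lam * sqrt \<mu>))"
    proof (intro mult_left_mono mult_right_mono)
      \<comment> \<open>For \<open>M \<le> N\<close> there are \<open>N - M + 1\<close> differences,
        at most \<open>N\<close> because \<open>M \<ge> 1\<close>; for \<open>N < M\<close>
        truncated subtraction leaves one, and \<open>N \<ge> 1\<close>.\<close>
      have "card K \<le> N" using M N by (simp add: K_def)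
      moreover have "h / (b - a) = 1 / real N" using ab by (simp add: h_def)
      ultimately show "h / (b - a) * real (card K) \<le> 1" using N by simp
      have "eps \<ge> 0" using \<delta>0 hs by (simp add: eps')
      then show "0 \<le> mom eps (lam * sqrt \<mu>)"
        unfolding mom_def using lam0 mu0 abs_normal_moment_pos[THEN less_imp_le]
        by (intro mult_nonneg_nonneg add_nonneg_nonneg) auto
    qed simp
    finally show ?thesis by simp
  qed
  from order.trans[OF 1 mult_left_mono[OF this abs_ge_zero]]
  show ?thesis unfolding PX PB unfolding mom_def .
qed

text \<open>\<open>is_sigma_const\<close> concerns the process at scale 1. Rescaling by
  \<open>lam\<close> multiplies its power variation by \<open>lam ^ Suc q\<close>, which is a linear
  instance of the delta method. The transfer to the solution then needs \<open>eps\<close> and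
  \<open>sqrt N * eps\<close> to tend to 0.\<close>

lemma variation_weak_conv:
  fixes B :: "real \<Rightarrow> 'b \<Rightarrow> real"
  assumes \<alpha>: "\<alpha> > 0" and \<theta>: "\<theta> > 0" and \<sigma>: "\<sigma> > 0" and \<gamma>: "0 < \<gamma>" "\<gamma> < 1/4"
    and P: "prob_space P" and W: "riesz_noise P \<gamma> W" and X: "mild_solution P \<alpha> \<theta> \<sigma> \<gamma> W X"
    and s: "s = 2*\<gamma> + \<alpha>/2 - 1/2" and H: "0 < H" "H < 1" and mH: "real m + H = s"
    and M: "M = m + 1 \<and> H < 1/2 \<or> M \<ge> m + 2" and t: "t > 0" and ab: "a < b"
    and Q: "prob_space Q" and B: "fractional_bm Q H B" and mu: "is_mu_const Q B m M s \<mu>"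
    and kap: "is_sigma_const Q B a b m (Suc q) M s \<mu> \<kappa>" and lam: "lam = c_const \<alpha> \<gamma> m * \<sigma> / sqrt \<theta>"
  shows "\<And>N. (\<lambda>\<omega>. power_variation a b (Suc q) M s N (\<lambda>x. X t x \<omega>)) \<in> borel_measurable P"
    and "weak_conv_m (\<lambda>N. distr P borel (\<lambda>\<omega>. sqrt (real N) * (power_variation a b (Suc q) M s N (\<lambda>x. X t x \<omega>)
       - lam ^ Suc q * (abs_normal_moment (Suc q) * \<mu> powr (real (Suc q) / 2)))))
      (normal_law ((lam ^ Suc q)\<^sup>2 * (\<kappa>\<^sup>2 * \<mu> ^ Suc q)))"
proof -
  have M1: "M \<ge> m + 1" using M by auto
  \<comment> \<open>\<open>M - s\<close> equals \<open>1 - H\<close> with \<open>H < 1/2\<close> in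
    the first case and is at least \<open>2 - H\<close> in the second.\<close>
  have e: "real M - s > 1 / 2" using M mH H by auto
  have mu0: "\<mu> > 0" using mu by (simp add: is_mu_const_def)
  have mX: "X t x \<in> borel_measurable P" for x
    using gauss_rvD(1)[OF sol_spec_gauss[OF \<gamma> \<alpha> \<theta> t P W X, unfolded spec_gauss_def, rule_format, of "[(1, x)]"]] by simp
  have mD: "(\<lambda>\<omega>. (fwd_diff h ^^ M) (\<lambda>x. X t x \<omega>) x) \<in> borel_measurable P" for h x
    by (induction M arbitrary: x) (auto simp: fwd_diff_def intro: mX)
  show mV: "(\<lambda>\<omega>. power_variation a b (Suc q) M s N (\<lambda>x. X t x \<omega>)) \<in> borel_measurable P" for N
    unfolding power_variation_def Let_def using mD by measurable
  have mB: "(\<lambda>\<omega>. power_variation a b (Suc q) M s N (int_fbm m B \<omega>)) \<in> borel_measurable Q" for N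
  \<comment> \<open>For \<open>N = 0\<close> the step is \<open>(b - a) / 0 = 0\<close> and the
    variation is 0, while the spectral results need a positive step.\<close>
  proof (cases "N = 0")
    case True
    then show ?thesis by (simp add: power_variation_def)
  next
    case False
    then have h: "(b - a) / real N > 0" using ab by simp
    have [measurable]: "(\<lambda>\<omega>. (fwd_diff ((b - a) / real N) ^^ M) (int_fbm m B \<omega>) x) \<in> borel_measurable Q" for x
      using gauss_rvD(1)[OF fbm_diff_gaussian[OF Q B H h M1, of "{()}" "\<lambda>_. 1" "\<lambda>_. x"]] by simp
    show ?thesis unfolding power_variation_def Let_def by measurable
  qed
  define p where "p = abs_normal_moment (Suc q) * \<mu> powr (real (Suc q) / 2)"
  have conv: "weak_conv_m (\<lambda>N. distr Q borel (\<lambda>\<omega>. sqrt (real N) * (power_variation a b (Suc q) M s N (int_fbm m B \<omega>) - p))) (normal_law (\<kappa>\<^sup>2 * \<mu> ^ Suc q))"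
    using kap by (simp add: is_sigma_const_def p_def)
  have der: "((\<lambda>y. lam ^ Suc q * y) has_real_derivative lam ^ Suc q) (at p)"
    by (auto intro!: derivative_eq_intros)
  have convB: "weak_conv_m (\<lambda>N. distr Q borel (\<lambda>\<omega>. sqrt (real N) * (lam ^ Suc q * power_variation a b (Suc q) M s N (int_fbm m B \<omega>) - lam ^ Suc q * p)))
     (normal_law ((lam ^ Suc q)\<^sup>2 * (\<kappa>\<^sup>2 * \<mu> ^ Suc q)))"
    by (rule delta_method[OF Q mB _ _ conv der]) (use mu0 in auto)
  have "weak_conv_m (\<lambda>N. distr P borel (\<lambda>\<omega>. sqrt (real N) * (power_variation a b (Suc q) M s N (\<lambda>x. X t x \<omega>) - lam ^ Suc q * p)))
    (normal_law ((lam ^ Suc q)\<^sup>2 * (\<kappa>\<^sup>2 * \<mu> ^ Suc q)))"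
  proof (rule weak_conv_m_transfer[OF P Q _ _ _ convB])
    show "real_distribution (normal_law ((lam ^ Suc q)\<^sup>2 * (\<kappa>\<^sup>2 * \<mu> ^ Suc q)))"
      by (rule real_distribution_normal_law) (use mu0 in auto)
    show "(\<lambda>\<omega>. sqrt (real N) * (power_variation a b (Suc q) M s N (\<lambda>x. X t x \<omega>) - lam ^ Suc q * p)) \<in> borel_measurable P" for N
      using mV[of N] by measurable
    show "(\<lambda>\<omega>. sqrt (real N) * (lam ^ Suc q * power_variation a b (Suc q) M s N (int_fbm m B \<omega>) - lam ^ Suc q * p)) \<in> borel_measurable Q" for N
      using mB[of N] by measurable
    fix u
    define eps where "eps N = sqrt (rem_const \<alpha> \<theta> \<sigma> s t M) * ((b - a) / real N) powr (real M - s)" for N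
    define c1 where "c1 = abs_normal_moment 1 * ((lam * sqrt \<mu>) ^ q * abs_normal_moment q)"
    define c2 where "c2 = abs_normal_moment (Suc q)"
    have powr0: "(\<lambda>N. real N powr d) \<longlonglongrightarrow> 0" if "d < 0" for d
      by (rule tendsto_neg_powr[OF that filterlim_real_sequentially])
    have epsN: "eps N = sqrt (rem_const \<alpha> \<theta> \<sigma> s t M) * (b - a) powr (real M - s) * real N powr (- (real M - s))" for N
      using ab unfolding powr_minus_divide by (simp add: eps_def powr_divide)
    have l1: "eps \<longlonglongrightarrow> 0"
      unfolding epsN using tendsto_mult_left[OF powr0[of "- (real M - s)"], of "sqrt (rem_const \<alpha> \<theta> \<sigma> s t M) * (b - a) powr (real M - s)"] e by simp
    have l2: "(\<lambda>N. sqrt (real N) * eps N) \<longlonglongrightarrow> 0"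
    proof -
      have "sqrt (real N) * eps N = sqrt (rem_const \<alpha> \<theta> \<sigma> s t M) * (b - a) powr (real M - s) * real N powr (1 / 2 - (real M - s))" for N
      proof -
        have "sqrt (real N) * real N powr (- (real M - s)) = real N powr (1 / 2) * real N powr (- (real M - s))"
          by (simp add: powr_half_sqrt)
        also have "\<dots> = real N powr (1 / 2 - (real M - s))" unfolding powr_add[symmetric] by (rule arg_cong[where f="\<lambda>d. real N powr d"]) simp
        finally show ?thesis unfolding epsN by (simp add: mult_ac)
      qed
      then show ?thesis
        using tendsto_mult_left[OF powr0[of "1 / 2 - (real M - s)"], of "sqrt (rem_const \<alpha> \<theta> \<sigma> s t M) * (b - a) powr (real M - s)"] e by simp
    qed
    have "(\<lambda>N. \<bar>u\<bar> * (real (Suc q) * 2 ^ q * ((sqrt (real N) * eps N) * c1 + (sqrt (real N) * eps N) * eps N ^ q * c2))) \<longlonglongrightarrow> \<bar>u\<bar> * (real (Suc q) * 2 ^ q * (0 * c1 + 0 * 0 ^ q * c2))"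
      by (intro tendsto_intros l1 l2)
    then have lim: "(\<lambda>N. \<bar>u\<bar> * (sqrt (real N) * (real (Suc q) * 2 ^ q * (eps N * abs_normal_moment 1 * ((lam * sqrt \<mu>) ^ q * abs_normal_moment q) + eps N ^ Suc q * abs_normal_moment (Suc q))))) \<longlonglongrightarrow> 0"
      by (simp add: c1_def c2_def algebra_simps)
    show "(\<lambda>N. (LINT \<omega>|P. iexp (u * (sqrt (real N) * (power_variation a b (Suc q) M s N (\<lambda>x. X t x \<omega>) - lam ^ Suc q * p))))
      - (LINT \<omega>|Q. iexp (u * (sqrt (real N) * (lam ^ Suc q * power_variation a b (Suc q) M s N (int_fbm m B \<omega>) - lam ^ Suc q * p))))) \<longlonglongrightarrow> 0"
    proof (rule Lim_null_comparison[OF _ lim], use eventually_ge_at_top[of 1] in eventually_elim)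
      fix N :: nat assume N: "N \<ge> 1"
      show "norm ((LINT \<omega>|P. iexp (u * (sqrt (real N) * (power_variation a b (Suc q) M s N (\<lambda>x. X t x \<omega>) - lam ^ Suc q * p))))
      - (LINT \<omega>|Q. iexp (u * (sqrt (real N) * (lam ^ Suc q * power_variation a b (Suc q) M s N (int_fbm m B \<omega>) - lam ^ Suc q * p)))))
      \<le> \<bar>u\<bar> * (sqrt (real N) * (real (Suc q) * 2 ^ q * (eps N * abs_normal_moment 1 * ((lam * sqrt \<mu>) ^ q * abs_normal_moment q) + eps N ^ Suc q * abs_normal_moment (Suc q))))"
        by (rule variation_char_bound[OF \<alpha> \<theta> \<sigma> \<gamma> P W X s H mH M1 t ab Q B mu N lam eps_def])
    qed
  qed
  then show "weak_conv_m (\<lambda>N. distr P borel (\<lambda>\<omega>. sqrt (real N) * (power_variation a b (Suc q) M s N (\<lambda>x. X t x \<omega>)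
       - lam ^ Suc q * (abs_normal_moment (Suc q) * \<mu> powr (real (Suc q) / 2)))))
      (normal_law ((lam ^ Suc q)\<^sup>2 * (\<kappa>\<^sup>2 * \<mu> ^ Suc q)))"
    unfolding p_def .
qed

section \<open>The limit theorem and the two estimators\<close>

theorem theorem6p3:
  fixes P :: "'a measure" and W :: "real \<Rightarrow> real set \<Rightarrow> 'a \<Rightarrow> real"
    and X :: "real \<Rightarrow> real \<Rightarrow> 'a \<Rightarrow> real"
    and Q :: "'b measure" and B :: "real \<Rightarrow> 'b \<Rightarrow> real"
    and \<alpha> \<theta> \<sigma> \<gamma> H s t a b \<mu> \<kappa> :: real and m M q :: nat
  assumes "\<alpha> > 0" "\<theta> > 0" "\<sigma> > 0" and "0 < \<gamma>" "\<gamma> < 1/4"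
    and "prob_space P" and "riesz_noise P \<gamma> W" and "mild_solution P \<alpha> \<theta> \<sigma> \<gamma> W X"
    and "s = 2*\<gamma> + \<alpha>/2 - 1/2" and "0 < H" "H < 1" and "real m + H = s"
    and "q \<ge> 1" and "(M = m + 1 \<and> H < 1/2) \<or> M \<ge> m + 2"
    and "t > 0" and "a < b"
    and "prob_space Q" and "fractional_bm Q H B"
    and "is_mu_const Q B m M s \<mu>" and "is_sigma_const Q B a b m q M s \<mu> \<kappa>"
  shows "weak_conv_m
           (\<lambda>N. distr P borel (\<lambda>\<omega>. sqrt (real N) *
              (power_variation a b q M s N (\<lambda>x. X t x \<omega>)
                 - c_const \<alpha> \<gamma> m ^ q * abs_normal_moment q * \<mu> powr (real q / 2)
                     * (\<sigma> / sqrt \<theta>) ^ q)))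
           (normal_law (c_const \<alpha> \<gamma> m ^ (2*q) * \<kappa>\<^sup>2 * \<mu> ^ q * (\<sigma> / sqrt \<theta>) ^ (2*q)))
       \<and> asymptotically_normal P
           (\<lambda>N \<omega>. inverse (c_const \<alpha> \<gamma> m) * abs_normal_moment q powr (- 1 / real q)
              * \<mu> powr (- 1/2) * sqrt \<theta>
              * power_variation a b q M s N (\<lambda>x. X t x \<omega>) powr (1 / real q))
           \<sigma>
       \<and> asymptotically_normal P
           (\<lambda>N \<omega>. (c_const \<alpha> \<gamma> m)\<^sup>2 * abs_normal_moment q powr (2 / real q) * \<mu> * \<sigma>\<^sup>2
              * power_variation a b q M s N (\<lambda>x. X t x \<omega>) powr (- 2 / real q))
           \<theta>"
proof -
  define c where "c = c_const \<alpha> \<gamma> m"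
  have c: "c > 0"
    using c_const_cos_const(2)[of m H \<gamma> \<alpha>] assms(9-12) by (simp add: c_def)
  define lam where "lam = c * \<sigma> / sqrt \<theta>"
  have lam: "lam > 0" using c assms(2,3) by (simp add: lam_def)
  have mu: "\<mu> > 0" using assms(19) by (simp add: is_mu_const_def)
  have kap: "\<kappa> > 0" using assms(20) by (simp add: is_sigma_const_def)
  obtain k where k: "q = Suc k" using assms(13) by (cases q) auto
  define \<tau> where "\<tau> = abs_normal_moment q"
  have \<tau>: "\<tau> > 0" by (simp add: \<tau>_def abs_normal_moment_pos)
  define p where "p = lam ^ q * (\<tau> * \<mu> powr (real q / 2))"
  have p: "p > 0" using lam \<tau> mu by (simp add: p_def)
  define w where "w = (lam ^ q)\<^sup>2 * (\<kappa>\<^sup>2 * \<mu> ^ q)"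
  have w: "w > 0" using lam kap mu by (simp add: w_def)
  define V where "V N \<omega> = power_variation a b q M s N (\<lambda>x. X t x \<omega>)" for N \<omega>
  note vw = variation_weak_conv[OF assms(1-12,14-19) assms(20)[unfolded k] lam_def[unfolded c_def], folded k]
  have mV: "V N \<in> borel_measurable P" for N
    using vw(1)[of N] by (simp add: V_def[abs_def])
  have conv: "weak_conv_m (\<lambda>N. distr P borel (\<lambda>\<omega>. sqrt (real N) * (V N \<omega> - p))) (normal_law w)"
    using vw(2) by (simp add: V_def p_def \<tau>_def w_def)
  have pe: "p = c ^ q * \<tau> * \<mu> powr (real q / 2) * (\<sigma> / sqrt \<theta>) ^ q"
    by (simp add: p_def lam_def power_mult_distrib power_divide)
  have we: "w = c ^ (2*q) * \<kappa>\<^sup>2 * \<mu> ^ q * (\<sigma> / sqrt \<theta>) ^ (2*q)"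
    by (simp add: w_def lam_def power_mult_distrib power_divide power_mult[symmetric] mult.commute[of q 2])
  have q0: "real q > 0" using k by simp
  \<comment> \<open>The constants of the two estimators come from solving this expression, with
    \<open>lam = c * \<sigma> / sqrt \<theta>\<close>, once for \<open>\<sigma>\<close> and once for
    \<open>\<theta>\<close>.\<close>
  have proot: "p powr (1 / real q) = lam * \<tau> powr (1 / real q) * \<mu> powr (1 / 2)"
  proof -
    have "p powr (1 / real q) = (lam powr real q) powr (1 / real q) * (\<tau> powr (1 / real q) * (\<mu> powr (real q / 2)) powr (1 / real q))"
      using lam \<tau> mu by (simp add: p_def powr_mult powr_realpow)
    also have "\<dots> = lam * (\<tau> powr (1 / real q) * \<mu> powr (1 / 2))"
      using q0 lam unfolding powr_powr by simp
    finally show ?thesis by simp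
  qed
  \<comment> \<open>Both estimators are of the form \<open>A * V powr e\<close> and equal the
    parameter when \<open>V\<close> is replaced by \<open>p\<close>. The derivative at
    \<open>p\<close> is nonzero, which keeps the limit variance positive.\<close>
  have normal: "asymptotically_normal P (\<lambda>N \<omega>. A * V N \<omega> powr e) r"
    if A: "A \<noteq> 0" and e: "e \<noteq> 0" and r: "A * p powr e = r" for A e r
  proof -
    define d where "d = A * (e * p powr (e - 1))"
    \<comment> \<open>Differentiability is required at \<open>p > 0\<close> only; where the
      variation vanishes the estimator has the value given by \<open>0 powr e = 0\<close>.\<close>
    have "((\<lambda>y. A * y powr e) has_real_derivative d) (at p)"
      using p unfolding d_def by (auto intro!: derivative_eq_intros)
    from delta_method[OF assms(6) mV _ less_imp_le[OF w] conv this]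
    have "weak_conv_m (\<lambda>N. distr P borel (\<lambda>\<omega>. sqrt (real N) * (A * V N \<omega> powr e - r))) (normal_law (d\<^sup>2 * w))"
      by (simp add: r)
    moreover have "d\<^sup>2 * w > 0" using w A e p by (simp add: d_def)
    ultimately show ?thesis unfolding asymptotically_normal_def by blast
  qed
  have "asymptotically_normal P (\<lambda>N \<omega>. (inverse c * \<tau> powr (- 1 / real q) * \<mu> powr (- 1/2) * sqrt \<theta>) * V N \<omega> powr (1 / real q)) \<sigma>"
  proof (rule normal)
    have "\<tau> powr (- 1 / real q) * \<tau> powr (1 / real q) = 1" "\<mu> powr (- 1/2) * \<mu> powr (1 / 2) = 1"
      using \<tau> mu by (simp_all add: powr_add[symmetric])
    moreover have "inverse c * sqrt \<theta> * lam = \<sigma>" using c assms(2) by (simp add: lam_def)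
    moreover have "inverse c * \<tau> powr (- 1 / real q) * \<mu> powr (- 1/2) * sqrt \<theta> * p powr (1 / real q)
      = (inverse c * sqrt \<theta> * lam) * (\<tau> powr (- 1 / real q) * \<tau> powr (1 / real q)) * (\<mu> powr (- 1/2) * \<mu> powr (1 / 2))"
      unfolding proot by (simp only: mult_ac)
    ultimately show "inverse c * \<tau> powr (- 1 / real q) * \<mu> powr (- 1/2) * sqrt \<theta> * p powr (1 / real q) = \<sigma>" by simp
  qed (use c \<tau> mu assms(2) q0 in auto)
  moreover have "asymptotically_normal P (\<lambda>N \<omega>. (c\<^sup>2 * \<tau> powr (2 / real q) * \<mu> * \<sigma>\<^sup>2) * V N \<omega> powr (- 2 / real q)) \<theta>"
  proof (rule normal)
    have "p powr (- 2 / real q) = (p powr (1 / real q)) powr (- 2)" by (simp add: powr_powr)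
    also have "\<dots> = inverse ((p powr (1 / real q))\<^sup>2)"
      using p by (simp add: powr_minus powr_numeral)
    also have "(p powr (1 / real q))\<^sup>2 = lam\<^sup>2 * \<tau> powr (2 / real q) * \<mu>"
      unfolding proot power_mult_distrib using \<tau> mu by (simp add: powr_power)
    also have "lam\<^sup>2 = c\<^sup>2 * \<sigma>\<^sup>2 / \<theta>" using assms(2) by (simp add: lam_def power_mult_distrib power_divide)
    finally have "p powr (- 2 / real q) = inverse (c\<^sup>2 * \<sigma>\<^sup>2 / \<theta> * \<tau> powr (2 / real q) * \<mu>)" .
    then show "c\<^sup>2 * \<tau> powr (2 / real q) * \<mu> * \<sigma>\<^sup>2 * p powr (- 2 / real q) = \<theta>"
      using c \<tau> mu assms(2,3) by simp
  qed (use c \<tau> mu assms(3) q0 in auto)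
  ultimately show ?thesis
    using conv unfolding pe we V_def c_def \<tau>_def by blast
qed

end
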